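(* Let $f\colon N^n\to\mathbb{S}^{n+1}$ be an immersion. Suppose that $N$ is complete with respect to the Riemannian metric induced by $f$, and that $\operatorname{length}(J(f))<\frac{\pi}{2}$. Then: (a) $N$ is diffeomorphic to $\mathbb{S}^n$. (b) If $J(f)$ does not contain $0 \pmod \pi$, then $f$ is an embedding. (c) If $J(f)$ does not contain $\frac{\pi}{2} \pmod \pi$, then the dual $f^\star$ of $f$ is an embedding. In particular, (a)--(c) hold if $N$ is closed and $J(f)$ is disjoint from $J(f)+\frac{\pi}{2}$.
   Context: Throughout, $n\ge 2$ is an integer, manifolds are connected, oriented and smooth ($C^\infty$), and maps between manifolds are smooth. $\mathbb{S}^{n+1}\subset\mathbb{R}^{n+2}$ carries the round metric of curvature $1$, and a frame $(u_1,\dots,u_{n+1})$ in $T\mathbb{S}^{n+1}_p$ is positively oriented iff $(u_1,\dots,u_{n+1},p)$ is positively oriented in $\mathbb{R}^{n+2}$. Gauss map and dual: the Gauss map $\nu=\nu_f$ of an immersion $f\colon N^n\to M^{n+1}$ is determined by: $(u_1,\dots,u_n)$ is a positively oriented orthonormal frame in $TN_p$ (for the induced metric) iff $(df_p(u_1),\dots,df_p(u_n),\nu(p))$ is a positively oriented orthonormal frame in $TM_{f(p)}$. For $M=\mathbb{S}^{n+1}$ the dual of $f$ is $f^\star\colon N\to\mathbb{S}^{n+1}$, $f^\star(p)=\exp_{f(p)}(\frac{\pi}{2}\nu(p))$, i.e. $\nu$ regarded as a map into $\mathbb{S}^{n+1}$ (it need not be an immersion in general). Principal curvatures are taken with respect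 to $\nu_f$ (for $M=\mathbb S^{n+1}$: $\kappa$ is a principal curvature with principal direction $u\neq 0$ iff $d\nu(u)=-\kappa\,df(u)$, with $\nu$ regarded as a map to $\mathbb{R}^{n+2}$). A principal radius of $f$ is an element $\rho$ of the circle $\mathbb{R} \pmod \pi$ such that $\cot\rho$ is a principal curvature of $f$ at some point. An interval of $\mathbb{R}\pmod\pi$ is a connected subset. $J(f)\subset\mathbb{R}\pmod\pi$ denotes a smallest interval containing all principal radii of $f$ (uniquely determined if all principal radii lie in a half-open interval of length $\frac{\pi}{2}$). *)

theory Defs
  imports "HOL-Analysis.Analysis" "HOL-Library.Real_Mod"
begin

section \<open>Smooth functions on open subsets of Euclidean space\<close>

primrec Ck_on ::
  "nat \<Rightarrow> 'a::euclidean_space set \<Rightarrow> ('a \<Rightarrow> 'b::real_normed_vector) \<Rightarrow> bool" where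
  "Ck_on 0 S f \<longleftrightarrow> continuous_on S f"
| "Ck_on (Suc k) S f \<longleftrightarrow>
     (\<forall>x\<in>S. f differentiable (at x)) \<and> (\<forall>v. Ck_on k S (\<lambda>x. frechet_derivative f (at x) v))"

text \<open>Only used for open \<open>S\<close>.\<close>

definition smooth_on :: "'a::euclidean_space set \<Rightarrow> ('a \<Rightarrow> 'b::real_normed_vector) \<Rightarrow> bool" where
  "smooth_on S f \<longleftrightarrow> (\<forall>k. Ck_on k S f)"


section \<open>Smooth manifolds\<close>

text \<open>
  A chart is a pair of its domain and its coordinate map; the coordinate map is irrelevant
  outside the domain. The atlas need not be maximal.
\<close>

type_synonym ('p, 'e) chart = "'p set \<times> ('p \<Rightarrow> 'e)"

record ('p, 'e) manifold =
  mtop :: "'p topology"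
  atlas :: "('p, 'e) chart set"

abbreviation points :: "('p, 'e) manifold \<Rightarrow> 'p set" where
  "points M \<equiv> topspace (mtop M)"

definition charts_at :: "('p, 'e) manifold \<Rightarrow> 'p \<Rightarrow> ('p, 'e) chart set" where
  "charts_at M p = {c \<in> atlas M. p \<in> fst c}"

definition chart_inv :: "('p, 'e) chart \<Rightarrow> 'e \<Rightarrow> 'p" where
  "chart_inv c = inv_into (fst c) (snd c)"

definition smooth_manifold :: "('p, 'e::euclidean_space) manifold \<Rightarrow> bool" where
  "smooth_manifold M \<longleftrightarrow>
     Hausdorff_space (mtop M) \<and> second_countable (mtop M) \<and>
     points M = (\<Union>c\<in>atlas M. fst c) \<and>
     (\<forall>c\<in>atlas M. openin (mtop M) (fst c) \<and> open (snd c ` fst c) \<and>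
        homeomorphic_map (subtopology (mtop M) (fst c)) (top_of_set (snd c ` fst c)) (snd c)) \<and>
     (\<forall>c\<in>atlas M. \<forall>d\<in>atlas M. smooth_on (snd c ` (fst c \<inter> fst d)) (snd d \<circ> chart_inv c))"

text \<open>
  An orientation is given by an atlas all of whose transition maps preserve the orientation.
  Connected includes nonempty.
\<close>

definition connected_oriented_manifold :: "('p, real ^ 'n::finite) manifold \<Rightarrow> bool" where
  "connected_oriented_manifold M \<longleftrightarrow>
     smooth_manifold M \<and> connected_space (mtop M) \<and> points M \<noteq> {} \<and>
     (\<forall>p. \<forall>c\<in>charts_at M p. \<forall>d\<in>charts_at M p.
        det (matrix (frechet_derivative (snd d \<circ> chart_inv c) (at (snd c p)))) > 0)"

definition euclidean_mfd :: "'e::euclidean_space set \<Rightarrow> ('e, 'e) manifold" where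
  "euclidean_mfd S = \<lparr>mtop = top_of_set S, atlas = {(S, id)}\<rparr>"

text \<open>
  The unit sphere, with the two stereographic charts. For an index type \<open>'n\<close> with
  \<open>n\<close> elements, \<open>'n option\<close> has \<open>n + 1\<close> elements, \<open>None\<close> being regarded as the last index.
\<close>

definition sphere_mfd :: "(real ^ ('n::finite) option, real ^ 'n) manifold" where
  "sphere_mfd =
     \<lparr>mtop = top_of_set (sphere 0 1),
      atlas = {(sphere 0 1 - {axis None 1}, \<lambda>x. \<chi> i. x $ Some i / (1 - x $ None)),
               (sphere 0 1 - {- axis None 1}, \<lambda>x. \<chi> i. x $ Some i / (1 + x $ None))}\<rparr>"

definition smooth_map ::
  "('p, 'd::euclidean_space) manifold \<Rightarrow> ('q, 'e::euclidean_space) manifold \<Rightarrow> ('p \<Rightarrow> 'q) \<Rightarrow> bool" where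
  "smooth_map M N f \<longleftrightarrow>
     continuous_map (mtop M) (mtop N) f \<and>
     (\<forall>c\<in>atlas M. \<forall>d\<in>atlas N.
        smooth_on (snd c ` {p \<in> fst c. f p \<in> fst d}) (snd d \<circ> f \<circ> chart_inv c))"

definition diffeomorphic ::
  "('p, 'd::euclidean_space) manifold \<Rightarrow> ('q, 'e::euclidean_space) manifold \<Rightarrow> bool" where
  "diffeomorphic M N \<longleftrightarrow>
     (\<exists>h k. smooth_map M N h \<and> smooth_map N M k \<and>
        (\<forall>p\<in>points M. k (h p) = p) \<and> (\<forall>q\<in>points N. h (k q) = q))"

definition immersion ::
  "('p, 'd::euclidean_space) manifold \<Rightarrow> ('q, 'e::euclidean_space) manifold \<Rightarrow> ('p \<Rightarrow> 'q) \<Rightarrow> bool" where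
  "immersion M N f \<longleftrightarrow>
     smooth_map M N f \<and>
     (\<forall>p. \<forall>c\<in>charts_at M p. \<forall>d\<in>charts_at N (f p).
        inj (frechet_derivative (snd d \<circ> f \<circ> chart_inv c) (at (snd c p))))"

definition embedding ::
  "('p, 'd::euclidean_space) manifold \<Rightarrow> ('q, 'e::euclidean_space) manifold \<Rightarrow> ('p \<Rightarrow> 'q) \<Rightarrow> bool" where
  "embedding M N f \<longleftrightarrow> immersion M N f \<and> embedding_map (mtop M) (mtop N) f"


section \<open>The induced metric and completeness\<close>

text \<open>
  Tangent vectors at \<open>p\<close> are written in the coordinates of a chart \<open>c\<close> at \<open>p\<close>.
  \<open>df c f p\<close> is the differential at \<open>p\<close> of a map \<open>f\<close> into a Euclidean space (in particular
  into the unit sphere of one) in these coordinates.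
\<close>

definition df ::
  "('p, 'd::euclidean_space) chart \<Rightarrow> ('p \<Rightarrow> 'e::euclidean_space) \<Rightarrow> 'p \<Rightarrow> 'd \<Rightarrow> 'e" where
  "df c f p = frechet_derivative (f \<circ> chart_inv c) (at (snd c p))"

definition induced_metric ::
  "('p, 'd::euclidean_space) chart \<Rightarrow> ('p \<Rightarrow> 'e::euclidean_space) \<Rightarrow> 'p \<Rightarrow> 'd \<Rightarrow> 'd \<Rightarrow> real" where
  "induced_metric c f p u v = df c f p u \<bullet> df c f p v"

definition piecewise_smooth_path ::
  "('p, 'd::euclidean_space) manifold \<Rightarrow> (real \<Rightarrow> 'p) \<Rightarrow> bool" where
  "piecewise_smooth_path M \<gamma> \<longleftrightarrow>
     pathin (mtop M) \<gamma> \<and>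
     (\<exists>K. finite K \<and>
        (\<forall>a b. 0 \<le> a \<and> a < b \<and> b \<le> 1 \<and> {a<..<b} \<inter> K = {} \<longrightarrow>
           (\<exists>S \<delta>. open S \<and> {a..b} \<subseteq> S \<and> smooth_map (euclidean_mfd S) M \<delta> \<and>
                  (\<forall>t\<in>{a..b}. \<delta> t = \<gamma> t))))"

text \<open>The speed does not depend on the chart chosen at \<open>\<gamma> t\<close>.\<close>

definition speed ::
  "('p, 'd::euclidean_space) manifold \<Rightarrow> ('p \<Rightarrow> 'e::euclidean_space) \<Rightarrow> (real \<Rightarrow> 'p) \<Rightarrow> real \<Rightarrow> real" where
  "speed M f \<gamma> t =
     (let c = (SOME c. c \<in> charts_at M (\<gamma> t));
          v = vector_derivative (snd c \<circ> \<gamma>) (at t)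
      in sqrt (induced_metric c f (\<gamma> t) v v))"

definition path_len ::
  "('p, 'd::euclidean_space) manifold \<Rightarrow> ('p \<Rightarrow> 'e::euclidean_space) \<Rightarrow> (real \<Rightarrow> 'p) \<Rightarrow> real" where
  "path_len M f \<gamma> = integral {0..1} (speed M f \<gamma>)"

definition induced_dist ::
  "('p, 'd::euclidean_space) manifold \<Rightarrow> ('p \<Rightarrow> 'e::euclidean_space) \<Rightarrow> 'p \<Rightarrow> 'p \<Rightarrow> real" where
  "induced_dist M f p q =
     (if p \<in> points M \<and> q \<in> points M
      then Inf {path_len M f \<gamma> | \<gamma>. piecewise_smooth_path M \<gamma> \<and> \<gamma> 0 = p \<and> \<gamma> 1 = q}
      else 0)"

definition complete_induced ::
  "('p, 'd::euclidean_space) manifold \<Rightarrow> ('p \<Rightarrow> 'e::euclidean_space) \<Rightarrow> bool" where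
  "complete_induced M f \<longleftrightarrow> Metric_space.mcomplete (points M) (induced_dist M f)"


section \<open>Gauss map, dual and principal curvatures of a hypersurface of the sphere\<close>

text \<open>
  Frames of \<open>n\<close>-dimensional, respectively \<open>(n + 1)\<close>-dimensional, tangent spaces are indexed by
  \<open>'n\<close>, respectively \<open>'n option\<close>. A family of vectors of \<open>real ^ 'k\<close> indexed by \<open>'k\<close> itself is
  positively oriented iff the determinant of the matrix with these rows is positive, whichever
  enumeration of \<open>'k\<close> is chosen. Here the sphere lies in \<open>real ^ 'n option option\<close>, and the
  index \<open>None\<close> below belongs to the base point \<open>q\<close>, which comes last.
\<close>

definition pos_orthonormal_sphere_frame ::
  "real ^ ('n::finite) option option \<Rightarrow> ('n option \<Rightarrow> real ^ 'n option option) \<Rightarrow> bool" where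
  "pos_orthonormal_sphere_frame q w \<longleftrightarrow>
     (\<forall>i. w i \<bullet> q = 0) \<and>
     (\<forall>i j. w i \<bullet> w j = (if i = j then 1 else 0)) \<and>
     det (\<chi> k. case k of None \<Rightarrow> q | Some i \<Rightarrow> w i) > 0"

definition pos_orthonormal_frame ::
  "('p, real ^ 'n::finite) chart \<Rightarrow> ('p \<Rightarrow> 'e::euclidean_space) \<Rightarrow> 'p \<Rightarrow> ('n \<Rightarrow> real ^ 'n) \<Rightarrow> bool" where
  "pos_orthonormal_frame c f p u \<longleftrightarrow>
     (\<forall>i j. induced_metric c f p (u i) (u j) = (if i = j then 1 else 0)) \<and>
     det (\<chi> i. u i) > 0"

definition gauss_map ::
  "('p, real ^ 'n::finite) manifold \<Rightarrow> ('p \<Rightarrow> real ^ 'n option option) \<Rightarrow> 'p \<Rightarrow> real ^ 'n option option"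
where
  "gauss_map M f p =
     (THE w. \<forall>c\<in>charts_at M p. \<forall>u.
        pos_orthonormal_frame c f p u \<longleftrightarrow>
        pos_orthonormal_sphere_frame (f p)
          (\<lambda>k. case k of None \<Rightarrow> w | Some i \<Rightarrow> df c f p (u i)))"

text \<open>The exponential map of the unit sphere; \<open>v = 0\<close> gives \<open>q\<close> because \<open>x / 0 = 0\<close>.\<close>

definition sphere_exp :: "'e::euclidean_space \<Rightarrow> 'e \<Rightarrow> 'e" where
  "sphere_exp q v = cos (norm v) *\<^sub>R q + (sin (norm v) / norm v) *\<^sub>R v"

definition dual ::
  "('p, real ^ 'n::finite) manifold \<Rightarrow> ('p \<Rightarrow> real ^ 'n option option) \<Rightarrow> 'p \<Rightarrow> real ^ 'n option option"
where
  "dual M f p = sphere_exp (f p) ((pi / 2) *\<^sub>R gauss_map M f p)"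

definition principal_curvature ::
  "('p, real ^ 'n::finite) manifold \<Rightarrow> ('p \<Rightarrow> real ^ 'n option option) \<Rightarrow> 'p \<Rightarrow> real \<Rightarrow> bool" where
  "principal_curvature M f p \<kappa> \<longleftrightarrow>
     (\<exists>c\<in>charts_at M p. \<exists>u. u \<noteq> 0 \<and> df c (gauss_map M f) p u = - \<kappa> *\<^sub>R df c f p u)"


section \<open>Principal radii and the circle of reals modulo pi\<close>

quotient_type real_mod_pi = real / "\<lambda>x y. [x = y] (rmod pi)"
  morphisms rep_mod_pi mod_pi
  by (intro equivpI reflpI sympI transpI) (auto simp: rcong_def)

text \<open>The quotient topology.\<close>

instantiation real_mod_pi :: topological_space
begin

definition open_real_mod_pi :: "real_mod_pi set \<Rightarrow> bool" where
  "open_real_mod_pi U \<longleftrightarrow> open (mod_pi -` U)"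

instance
  by standard (auto simp: open_real_mod_pi_def vimage_Union)

end

definition arc_interval :: "real_mod_pi set \<Rightarrow> bool" where
  "arc_interval I \<longleftrightarrow> connected I"

definition arc_len :: "real_mod_pi set \<Rightarrow> real" where
  "arc_len I = measure lborel {x \<in> {0..<pi}. mod_pi x \<in> I}"

definition shift :: "real \<Rightarrow> real_mod_pi set \<Rightarrow> real_mod_pi set" where
  "shift a I = {mod_pi (x + a) | x. mod_pi x \<in> I}"

text \<open>
  The condition \<open>sin x \<noteq> 0\<close> says that \<open>cot x\<close> is defined: the class of \<open>0\<close> is never
  a principal radius, whereas \<open>cot 0 = 0\<close> in the library.
\<close>

definition principal_radii ::
  "('p, real ^ 'n::finite) manifold \<Rightarrow> ('p \<Rightarrow> real ^ 'n option option) \<Rightarrow> real_mod_pi set" where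
  "principal_radii M f =
     {mod_pi x | x. sin x \<noteq> 0 \<and> (\<exists>p\<in>points M. principal_curvature M f p (cot x))}"

text \<open>
  A smallest interval containing a set \<open>P\<close> has minimal length and no proper subinterval that
  contains \<open>P\<close>; the latter discards superfluous end points. Minimality with
  respect to inclusion alone would also admit the complement of any gap of \<open>P\<close>.
\<close>

definition smallest_interval :: "real_mod_pi set \<Rightarrow> real_mod_pi set \<Rightarrow> bool" where
  "smallest_interval P J \<longleftrightarrow>
     arc_interval J \<and> P \<subseteq> J \<and>
     (\<forall>I. arc_interval I \<and> P \<subseteq> I \<longrightarrow> arc_len J \<le> arc_len I \<and> \<not> I \<subset> J)"

end

theory Submission
  imports Defs
begin

text \<open>
  Let \<open>\<nu>\<close> be the Gauss map of \<open>f\<close>. Since the principal radii lie in an arc shorter than \<open>\<pi>/2\<close>,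
  there is an angle \<open>a\<close> such that the parallel map \<open>g = cos a f + sin a \<nu>\<close> and its dual
  \<open>v = cos a \<nu> - sin a f\<close> satisfy \<open>- dg u \<bullet> dv u \<ge> c (|df u|^2 + |d\<nu> u|^2)\<close> with \<open>c > 0\<close>: the map
  \<open>g\<close> is locally strictly convex, and lengths for \<open>f\<close> are controlled by \<open>v\<close>.

  For a unit vector \<open>e\<close>, let \<open>h\<close> be the direction of the projection of \<open>v\<close> to the complement of \<open>e\<close>.
  On \<open>{g \<bullet> e > 0}\<close> it is a local homeomorphism to the unit sphere of that complement (invariance of
  domain). Great circle arcs can be lifted through \<open>h\<close>: if \<open>v\<close> is rescaled along a lift such that its
  projection runs along the chord, then its height over \<open>e\<close> is a convex function, which bounds the
  lift, and completeness provides limits. Hence on a component of \<open>{g \<bullet> e > 0}\<close> the map \<open>h\<close> is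
  injective and \<open>g p \<bullet> v q \<ge> 0\<close>. With \<open>e = v p\<close>, this inequality propagates to all of \<open>N\<close>. Then
  some \<open>e\<close> has \<open>g \<bullet> e\<close> bounded below by a positive constant on \<open>N\<close>, and for this \<open>e\<close> the map \<open>h\<close> is a
  diffeomorphism from \<open>N\<close> to a sphere; in particular \<open>N\<close> is compact.

  If \<open>0\<close>, respectively \<open>\<pi>/2\<close>, is not in \<open>J\<close>, then \<open>a\<close> can be chosen in \<open>(0, \<pi>/2)\<close>, respectively
  \<open>(-\<pi>/2, 0)\<close>. In these cases \<open>f\<close>, respectively \<open>\<nu>\<close>, is a combination of \<open>g\<close> and \<open>v\<close> with
  coefficients of opposite signs, and \<open>g p \<bullet> v q + g q \<bullet> v p \<ge> 0\<close> makes it injective, as in Moreau's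
  decomposition with respect to a convex cone and its polar.
\<close>

section \<open>Locally convex pairs\<close>

text \<open>Along a principal direction of radius \<rho>, df u = sin \<rho> x and d\<nu> u = - cos
  \<rho> x for some vector x, whence dg u = sin (\<rho> - a) x and dv u = - cos (\<rho> - a) x. So -
  dg u \<bullet> dv u equals 1/2 sin (2 (\<rho> - a)) times |df u|^2 + |d\<nu> u|^2. This is
  positive exactly if \<rho> - a lies in (0, pi/2) modulo pi, which is the origin of the bound pi/2,
  and the constant c asks for a margin at both ends.

  The margin decides the order of the proof. If N is only complete, it comes from the slack in the
  length of J, and a cannot be placed freely: the radii might accumulate at 0 without 0 lying in J,
  which leaves no a > 0. Hence N is first shown to be compact with some a. After that the radii form
  a closed set whose extremes in a window cut at a missing point are attained, so that a can be
  placed on the side that (b) or (c) requires. The case of closed N enters at this stage, where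
  disjointness from the translate by pi/2 bounds the distance of the extremes just as well.\<close>

definition pr :: "'e::euclidean_space \<Rightarrow> 'e \<Rightarrow> 'e" where
  "pr e w = w - (w \<bullet> e) *\<^sub>R e"

lemma linear_pr: "linear (pr e)"
  by (auto intro!: linearI simp: pr_def algebra_simps inner_add_left)

lemma pr_scaleR: "pr e (c *\<^sub>R w) = c *\<^sub>R pr e w"
  by (simp add: linear_cmul linear_pr)

lemma pr_add: "pr e (u + w) = pr e u + pr e w"
  by (simp add: linear_add linear_pr)

lemma pr_self: "norm e = 1 \<Longrightarrow> pr e e = 0"
  by (simp add: pr_def power2_norm_eq_inner[symmetric])

lemma pr_perp: "norm e = 1 \<Longrightarrow> pr e w \<bullet> e = 0"
  by (simp add: pr_def inner_diff_left power2_norm_eq_inner[symmetric])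

lemma pr_eqI: "w \<bullet> e = 0 \<Longrightarrow> pr e w = w"
  by (simp add: pr_def)

lemma pr_decomp: "w = pr e w + (w \<bullet> e) *\<^sub>R e"
  by (simp add: pr_def)

lemma inner_pr: "w \<bullet> e = 0 \<Longrightarrow> w \<bullet> pr e u = w \<bullet> u"
  by (simp add: pr_def inner_diff_right)

lemma continuous_on_pr [continuous_intros]: "continuous_on S f \<Longrightarrow> continuous_on S (\<lambda>x. pr e (f x))"
  unfolding pr_def by (intro continuous_intros)

lemma sgn_eq_imp_scale:
  fixes a b :: "'e::real_normed_vector"
  assumes "sgn a = sgn b" "b \<noteq> 0"
  obtains \<mu> where "\<mu> > 0" "a = \<mu> *\<^sub>R b"
proof
  have "a \<noteq> 0" using assms by (metis sgn_zero sgn_zero_iff)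
  then show "norm a / norm b > 0" using assms by simp
  have "a = norm a *\<^sub>R sgn a"
    using \<open>a \<noteq> 0\<close> by (simp add: sgn_div_norm)
  also have "\<dots> = (norm a / norm b) *\<^sub>R b"
    by (simp add: assms(1)) (simp add: sgn_div_norm divide_inverse)
  finally show "a = (norm a / norm b) *\<^sub>R b" .
qed

section \<open>Chords between unit vectors\<close>

definition seg :: "'e::real_vector \<Rightarrow> 'e \<Rightarrow> real \<Rightarrow> 'e" where
  "seg y z s = (1 - s) *\<^sub>R y + s *\<^sub>R z"

lemma seg_ends [simp]: "seg y z 0 = y" "seg y z 1 = z"
  by (auto simp: seg_def)

lemma seg_affine: "seg y z s = y + s *\<^sub>R (z - y)"
  by (simp add: seg_def algebra_simps)

lemma unit_indep:
  fixes y z :: "'e::real_normed_vector"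
  assumes "norm y = 1" "norm z = 1" "z \<noteq> y" "z \<noteq> - y" "a *\<^sub>R y + b *\<^sub>R z = 0"
  shows "a = 0" "b = 0"
proof -
  have eq: "b *\<^sub>R z = (- a) *\<^sub>R y"
    using assms(5) by (simp add: eq_neg_iff_add_eq_0 add.commute)
  then have "\<bar>b\<bar> = \<bar>a\<bar>"
    using assms(1,2) by (metis abs_minus_cancel mult.right_neutral norm_scaleR)
  then have "b = a \<or> b = - a" by linarith
  moreover have "b = 0" if "b = a"
  proof (rule ccontr)
    assume "b \<noteq> 0"
    have "b *\<^sub>R z = b *\<^sub>R (- y)" using eq that by simp
    then show False using \<open>b \<noteq> 0\<close> assms(4) by (simp only: scaleR_cancel_left) simp
  qed
  moreover have "b = 0" if "b = - a"
  proof (rule ccontr)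
    assume "b \<noteq> 0"
    have "b *\<^sub>R z = b *\<^sub>R y" using eq that by simp
    then show False using \<open>b \<noteq> 0\<close> assms(3) by (simp only: scaleR_cancel_left) simp
  qed
  ultimately show "b = 0" "a = 0" using \<open>\<bar>b\<bar> = \<bar>a\<bar>\<close> by auto
qed

text \<open>A chord comes closest to the origin at its midpoint: the difference of the squared norms
  is 2 (1 - c) (s - 1/2)^2. For end points that are not antipodal this is a positive bound
  independent of \<open>s\<close>, which later becomes the lower bound for
  \<open>kk\<close>.\<close>

lemma seg_norm_ge:
  fixes y z :: "'e::real_inner"
  assumes "norm y = 1" "norm z = 1" "0 \<le> s" "s \<le> 1"
  shows "norm (seg y z s) \<ge> norm (y + z) / 2"
proof -
  have yy: "y \<bullet> y = 1" "z \<bullet> z = 1" using assms by (simp_all add: norm_eq_1)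
  have "(y \<bullet> z) \<le> 1"
    using norm_cauchy_schwarz[of y z] assms by simp
  define c where "c = y \<bullet> z"
  have 1: "(norm (seg y z s))\<^sup>2 = (1 - s)\<^sup>2 + s\<^sup>2 + 2 * s * (1 - s) * c"
    unfolding power2_norm_eq_inner seg_def
    by (simp add: inner_add_left inner_add_right yy inner_commute[of z y] c_def power2_eq_square) (simp add: algebra_simps)
  have 2: "(norm (y + z))\<^sup>2 = 2 + 2 * c"
    unfolding power2_norm_eq_inner
    by (simp add: inner_add_left inner_add_right yy inner_commute[of z y] c_def)
  have "(norm (seg y z s))\<^sup>2 - (norm (y + z) / 2)\<^sup>2 = (1 - c) * 2 * (s - 1/2)\<^sup>2"
    unfolding power_divide 1 2 by (simp add: power2_eq_square field_simps)
  also have "\<dots> \<ge> 0" using \<open>y \<bullet> z \<le> 1\<close> by (simp add: c_def)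
  finally have "(norm (y + z) / 2)\<^sup>2 \<le> (norm (seg y z s))\<^sup>2" by simp
  then show ?thesis by (rule power2_le_imp_le) simp
qed

lemma seg_nonzero:
  fixes y z :: "'e::real_inner"
  assumes "norm y = 1" "norm z = 1" "z \<noteq> - y" "0 \<le> s" "s \<le> 1"
  shows "seg y z s \<noteq> 0"
proof -
  have "norm (y + z) > 0" using assms(3) by (simp add: add_eq_0_iff)
  then show ?thesis using seg_norm_ge[OF assms(1,2,4,5)] by force
qed

lemma sgn_seg_inj:
  fixes y z :: "'e::real_inner"
  assumes "norm y = 1" "norm z = 1" "z \<noteq> y" "z \<noteq> - y" "s \<in> {0..1}" "t \<in> {0..1}"
    and eq: "sgn (seg y z s) = sgn (seg y z t)"
  shows "s = t"
proof -
  have "seg y z t \<noteq> 0" by (rule seg_nonzero) (use assms in auto)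
  then obtain \<mu> where "\<mu> > 0" "seg y z s = \<mu> *\<^sub>R seg y z t"
    using sgn_eq_imp_scale[OF eq] by blast
  then have "((1 - s) - \<mu> * (1 - t)) *\<^sub>R y + (s - \<mu> * t) *\<^sub>R z = 0"
    by (simp add: seg_def algebra_simps)
  from unit_indep[OF assms(1-4) this] have "1 - s = \<mu> * (1 - t)" "s = \<mu> * t" by auto
  then have "\<mu> = 1" by (simp add: algebra_simps)
  then show ?thesis using \<open>s = \<mu> * t\<close> by simp
qed

lemma continuous_on_seg [continuous_intros]:
  fixes y z :: "'e::real_normed_vector"
  shows "continuous_on S f \<Longrightarrow> continuous_on S (\<lambda>x. seg y z (f x))"
  unfolding seg_def by (intro continuous_intros)

text \<open>
  A topological substitute for a locally strictly convex hypersurface \<open>g\<close> of the sphere with Gauss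
  map \<open>v\<close>. The axioms \<open>tang_v\<close> and \<open>tang_g\<close> are all that is used of differentiability, and
  \<open>path_complete\<close> all that is used of completeness. The type \<open>'a\<close> is the model space of the charts.
\<close>

locale convex_pair =
  fixes X :: "'p topology" and T :: "'a::euclidean_space itself"
    and g v :: "'p \<Rightarrow> 'e::euclidean_space"
  assumes haus: "Hausdorff_space X"
    and conn: "connected_space X"
    and chart: "\<And>p U. openin X U \<Longrightarrow> p \<in> U \<Longrightarrow>
       \<exists>\<psi>::'a \<Rightarrow> 'p. \<psi> 0 = p \<and> \<psi> ` cball 0 1 \<subseteq> U \<and> openin X (\<psi> ` ball 0 1) \<and>
         inj_on \<psi> (cball 0 1) \<and> continuous_map (top_of_set (cball 0 1)) X \<psi>"
    and cont_g: "continuous_map X euclidean g"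
    and cont_v: "continuous_map X euclidean v"
    and norm_g: "\<And>p. p \<in> topspace X \<Longrightarrow> norm (g p) = 1"
    and norm_v: "\<And>p. p \<in> topspace X \<Longrightarrow> norm (v p) = 1"
    and perp: "\<And>p. p \<in> topspace X \<Longrightarrow> g p \<bullet> v p = 0"
    and lsc: "\<And>p. p \<in> topspace X \<Longrightarrow>
       \<exists>V. openin X V \<and> p \<in> V \<and> (\<forall>x\<in>V. \<forall>y\<in>V. x \<noteq> y \<longrightarrow> g x \<bullet> v y > 0)"
    and tang_v: "\<And>p w V. openin X V \<Longrightarrow> p \<in> V \<Longrightarrow> (\<And>x. x \<in> V \<Longrightarrow> w \<bullet> v x \<ge> 0) \<Longrightarrow>
       w \<bullet> v p = 0 \<Longrightarrow> \<exists>c. w = c *\<^sub>R g p"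
    and tang_g: "\<And>p w V. openin X V \<Longrightarrow> p \<in> V \<Longrightarrow> (\<And>x. x \<in> V \<Longrightarrow> w \<bullet> g x \<ge> 0) \<Longrightarrow>
       w \<bullet> g p = 0 \<Longrightarrow> \<exists>c. w = c *\<^sub>R v p"
    and path_complete: "\<And>p t L. 0 < t \<Longrightarrow> continuous_map (top_of_set {0..<t}) X p \<Longrightarrow>
       (\<And>s s'. s \<in> {0..<t} \<Longrightarrow> s' \<in> {0..<t} \<Longrightarrow> norm (v (p s) - v (p s')) \<le> L * \<bar>s - s'\<bar>) \<Longrightarrow>
       \<exists>q. limitin X p q (at_left t)"
    and dim_a: "DIM('a) \<ge> 2" and dim_e: "DIM('e) = DIM('a) + 2"
begin

abbreviation "N \<equiv> topspace X"

definition hh :: "'e \<Rightarrow> 'p \<Rightarrow> 'e" where "hh e p = sgn (pr e (v p))"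

definition Pos :: "'e \<Rightarrow> 'p set" where "Pos e = {p \<in> N. g p \<bullet> e > 0}"

lemma PosD: "p \<in> Pos e \<Longrightarrow> p \<in> N" "p \<in> Pos e \<Longrightarrow> g p \<bullet> e > 0"
  by (auto simp: Pos_def)

lemma open_inner_g: "openin X {p \<in> N. g p \<bullet> w > c}"
proof -
  have "openin X {p \<in> N. g p \<in> {z. z \<bullet> w > c}}"
    by (rule openin_continuous_map_preimage[OF cont_g]) (simp add: open_halfspace_gt inner_commute[of _ w])
  then show ?thesis by simp
qed

lemma open_inner_v: "openin X {p \<in> N. v p \<bullet> w > c}"
proof -
  have "openin X {p \<in> N. v p \<in> {z. z \<bullet> w > c}}"
    by (rule openin_continuous_map_preimage[OF cont_v]) (simp add: open_halfspace_gt inner_commute[of _ w])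
  then show ?thesis by simp
qed

lemma open_Pos: "openin X (Pos e)"
  unfolding Pos_def by (rule open_inner_g)

lemma open_ball_v: "openin X {p \<in> N. norm (v p - w) < c}"
proof -
  have "openin X {p \<in> N. v p \<in> ball w c}"
    by (rule openin_continuous_map_preimage[OF cont_v]) simp
  then show ?thesis by (simp add: dist_norm norm_minus_commute)
qed

text \<open>If \<open>v p\<close> were parallel to \<open>e\<close>, it would have to vanish,
  because \<open>g p\<close> is orthogonal to \<open>v p\<close> but not to
  \<open>e\<close>.\<close>

lemma pr_v_nz:
  assumes "norm e = 1" "p \<in> Pos e" shows "pr e (v p) \<noteq> 0"
proof
  assume "pr e (v p) = 0"
  then have eq: "v p = (v p \<bullet> e) *\<^sub>R e" using pr_decomp[of "v p" e] by simp
  then have "g p \<bullet> v p = (v p \<bullet> e) * (g p \<bullet> e)" by (metis inner_scaleR_right)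
  then have "v p \<bullet> e = 0" using perp[of p] PosD[OF assms(2)] by simp
  then have "v p = 0" using eq by simp
  then show False using norm_v[of p] PosD[OF assms(2)] by simp
qed

lemma norm_hh: "norm e = 1 \<Longrightarrow> p \<in> Pos e \<Longrightarrow> norm (hh e p) = 1"
  by (simp add: hh_def norm_sgn pr_v_nz)

lemma hh_perp: "norm e = 1 \<Longrightarrow> hh e p \<bullet> e = 0"
  by (simp add: hh_def sgn_div_norm pr_perp)

lemma cont_hh:
  assumes "norm e = 1" shows "continuous_map (subtopology X (Pos e)) euclidean (hh e)"
proof -
  have c: "continuous_map (subtopology X (Pos e)) (top_of_set (v ` Pos e)) v"
    by (simp add: continuous_map_in_subtopology continuous_map_from_subtopology cont_v)
  have "continuous_on (v ` Pos e) (\<lambda>w. sgn (pr e w))"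
    using pr_v_nz[OF assms] by (auto intro!: continuous_intros)
  then have "continuous_map (top_of_set (v ` Pos e)) euclidean (\<lambda>w. sgn (pr e w))"
    by simp
  from continuous_map_compose[OF c this] show ?thesis
    by (simp add: o_def hh_def[abs_def])
qed

lemma open_hh:
  assumes "norm e = 1" "open S" shows "openin X {p \<in> Pos e. hh e p \<in> S}"
proof -
  have "openin (subtopology X (Pos e)) {p \<in> topspace (subtopology X (Pos e)). hh e p \<in> S}"
    by (rule openin_continuous_map_preimage[OF cont_hh]) (use assms in auto)
  moreover have "{p \<in> topspace (subtopology X (Pos e)). hh e p \<in> S} = {p \<in> Pos e. hh e p \<in> S}"
    by (auto simp: Pos_def)
  ultimately show ?thesis
    using open_Pos openin_trans_full by metis
qed

text \<open>Equal directions mean that \<open>v x\<close> is \<mu> \<open>v y\<close> + t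
  \<open>e\<close> with \<mu> > 0. Pairing this with \<open>g x\<close> forces t < 0, pairing it
  with \<open>g y\<close> forces t > 0.\<close>

lemma hh_loc_inj:
  assumes "norm e = 1" "x \<in> Pos e" "y \<in> Pos e" "hh e x = hh e y"
    and "g x \<bullet> v y > 0" "g y \<bullet> v x > 0"
  shows False
proof -
  obtain \<mu> where \<mu>: "\<mu> > 0" "pr e (v x) = \<mu> *\<^sub>R pr e (v y)"
    using sgn_eq_imp_scale assms(4) pr_v_nz[OF assms(1,3)] unfolding hh_def by metis
  define t where "t = v x \<bullet> e - \<mu> * (v y \<bullet> e)"
  have vx: "v x = \<mu> *\<^sub>R v y + t *\<^sub>R e"
    using pr_decomp[of "v x" e] \<mu>(2) pr_decomp[of "v y" e]
    by (simp add: t_def pr_def algebra_simps)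
  have "0 = \<mu> * (g x \<bullet> v y) + t * (g x \<bullet> e)"
    using perp[of x] PosD[OF assms(2)] vx by (metis inner_add_right inner_scaleR_right)
  then have "t * (g x \<bullet> e) < 0" using mult_pos_pos[OF \<mu>(1) assms(5)] by linarith
  then have "t < 0" using PosD[OF assms(2)] by (simp add: mult_less_0_iff)
  have "g y \<bullet> v x = \<mu> * (g y \<bullet> v y) + t * (g y \<bullet> e)"
    using vx by (metis inner_add_right inner_scaleR_right)
  then have "t * (g y \<bullet> e) > 0" using assms(6) perp[of y] PosD[OF assms(3)] by simp
  then have "t > 0" using PosD[OF assms(3)] by (simp add: zero_less_mult_iff)
  then show False using \<open>t < 0\<close> by simp
qed

text \<open>Collects what is used of a small coordinate ball. The punctured ball is connected
  because the dimension is at least 2. The closed ball is kept besides the open one because its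
  compactness serves to confine paths.\<close>

lemma good_nbhd:
  assumes "openin X U" "p \<in> U"
  obtains \<psi> :: "'a \<Rightarrow> 'p" and V where "V = \<psi> ` ball 0 1" "\<psi> 0 = p" "\<psi> ` cball 0 1 \<subseteq> U" "openin X V" "p \<in> V" "V \<subseteq> U"
    "inj_on \<psi> (cball 0 1)" "continuous_map (top_of_set (cball 0 1)) X \<psi>"
    "\<And>x y. x \<in> \<psi> ` cball 0 1 \<Longrightarrow> y \<in> \<psi> ` cball 0 1 \<Longrightarrow> x \<noteq> y \<Longrightarrow> g x \<bullet> v y > 0"
    "connectedin X V" "connectedin X (V - {p})" "V - {p} \<noteq> {}"
    "\<And>e. norm e = 1 \<Longrightarrow> inj_on (hh e) (V \<inter> Pos e)"
proof -
  have "p \<in> N" using assms openin_subset by blast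
  obtain V0 where V0: "openin X V0" "p \<in> V0" "\<forall>x\<in>V0. \<forall>y\<in>V0. x \<noteq> y \<longrightarrow> g x \<bullet> v y > 0"
    using lsc[OF \<open>p \<in> N\<close>] by blast
  obtain \<psi>::"'a \<Rightarrow> 'p" where \<psi>: "\<psi> 0 = p" "\<psi> ` cball 0 1 \<subseteq> U \<inter> V0" "openin X (\<psi> ` ball 0 1)"
      "inj_on \<psi> (cball 0 1)" "continuous_map (top_of_set (cball 0 1)) X \<psi>"
    using chart[of "U \<inter> V0" p] assms V0 by (meson IntI openin_Int)
  have sub: "\<psi> ` ball 0 1 \<subseteq> \<psi> ` cball 0 1" by (intro image_mono) auto
  have conn1: "connectedin X (\<psi> ` S)" if "connected S" "S \<subseteq> cball 0 1" for S
  proof -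
    have "connectedin (top_of_set (cball 0 1)) S"
      using that by (simp add: connectedin_subtopology)
    then show ?thesis using connectedin_continuous_map_image[OF \<psi>(5)] by blast
  qed
  have eq: "\<psi> ` ball 0 1 - {p} = \<psi> ` (ball 0 1 - {0})"
    using \<psi>(1,4) by (auto simp: inj_on_def)
  have pos: "\<And>x y. x \<in> \<psi> ` cball 0 1 \<Longrightarrow> y \<in> \<psi> ` cball 0 1 \<Longrightarrow> x \<noteq> y \<Longrightarrow> g x \<bullet> v y > 0"
    using \<psi>(2) V0(3) by blast
  show thesis
  proof (rule that[of "\<psi> ` ball 0 1" \<psi>])
    show "\<psi> ` cball 0 1 \<subseteq> U" "\<psi> ` ball 0 1 \<subseteq> U" using \<psi>(2) sub by auto
    show "p \<in> \<psi> ` ball 0 1" using \<psi>(1) by force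
    show "connectedin X (\<psi> ` ball 0 1)" by (rule conn1) auto
    show "connectedin X (\<psi> ` ball 0 1 - {p})"
      unfolding eq by (rule conn1) (use connected_punctured_ball[OF dim_a, of 0 1] in auto)
    obtain i :: 'a where "i \<in> Basis" by fastforce
    then have "(1/2) *\<^sub>R i \<in> ball 0 1 - {0}" by (auto simp: nonzero_Basis)
    then show "\<psi> ` ball 0 1 - {p} \<noteq> {}" unfolding eq by blast
    show "inj_on (hh e) (\<psi> ` ball 0 1 \<inter> Pos e)" if "norm e = 1" for e
    proof (rule inj_onI, rule ccontr)
      fix x y assume xy: "x \<in> \<psi> ` ball 0 1 \<inter> Pos e" "y \<in> \<psi> ` ball 0 1 \<inter> Pos e" "hh e x = hh e y" "x \<noteq> y"
      then show False using hh_loc_inj[OF that, of x y] pos[of x y] pos[of y x] sub by blast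
    qed
  qed (use \<psi> pos in auto)
qed

text \<open>For a unit vector \<open>e\<close> and \<open>W\<close> inside \<open>Pos e\<close>,
  this is the cone of all \<mu> \<open>v p\<close> + t \<open>e\<close> with \<mu> > 0 and
  \<open>p\<close> in \<open>W\<close>. Being a subset of the ambient Euclidean space, it stands in
  for the image of \<open>W\<close> in the sphere of directions.\<close>

definition Cn :: "'e \<Rightarrow> 'p set \<Rightarrow> 'e set" where
  "Cn e W = {w. pr e w \<noteq> 0 \<and> sgn (pr e w) \<in> hh e ` W}"

text \<open>Invariance of domain is carried from the sphere to Euclidean space: sending (a, l, t) to
  l \<open>v (\<psi> a)\<close> + t \<open>e\<close> is continuous and injective on an open set of
  dimension DIM('a) + 2, which is the dimension of the target. Injectivity comes from that of
  \<open>hh e\<close> on a small ball.\<close>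

lemma open_Cn:
  assumes e: "norm e = 1" and W: "openin X W" "W \<subseteq> Pos e"
  shows "open (Cn e W)"
proof (subst open_subopen, intro ballI)
  fix w assume w: "w \<in> Cn e W"
  then obtain p where p: "p \<in> W" "sgn (pr e w) = hh e p" and w0: "pr e w \<noteq> 0" by (auto simp: Cn_def)
  obtain \<psi> :: "'a \<Rightarrow> 'p" and V where V: "V = \<psi> ` ball 0 1" "\<psi> 0 = p" "\<psi> ` cball 0 1 \<subseteq> W" "p \<in> V"
    "inj_on \<psi> (cball 0 1)" "continuous_map (top_of_set (cball 0 1)) X \<psi>" "V \<subseteq> W"
    "\<And>e. norm e = 1 \<Longrightarrow> inj_on (hh e) (V \<inter> Pos e)"
    using good_nbhd[OF W(1) p(1)] by metis
  let ?S = "ball (0::'a) 1 \<times> {0::real<..} \<times> (UNIV::real set)"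
  define \<Phi> where "\<Phi> = (\<lambda>(a, l, t). l *\<^sub>R v (\<psi> a) + t *\<^sub>R e)"
  have PosV: "\<psi> a \<in> V \<inter> Pos e" if "a \<in> ball 0 1" for a
  proof -
    have "\<psi> a \<in> V" using V(1) that by blast
    then show ?thesis using V(7) W(2) by blast
  qed
  have prPhi: "pr e (\<Phi> (a, l, t)) = l *\<^sub>R pr e (v (\<psi> a))" for a l t
    by (simp add: \<Phi>_def pr_add pr_scaleR pr_self e)
  have nz: "pr e (v (\<psi> a)) \<noteq> 0" if "a \<in> ball 0 1" for a
    using pr_v_nz[OF e] PosV[OF that] by auto
  have sg: "sgn (pr e (\<Phi> (a, l, t))) = hh e (\<psi> a)" if "l > 0" for a l t
    by (simp add: prPhi hh_def sgn_scaleR that)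
  have "continuous_on ?S \<Phi>"
  proof -
    have "continuous_map (top_of_set (cball 0 1)) euclidean (v \<circ> \<psi>)"
      using continuous_map_compose[OF V(6) cont_v] .
    then have "continuous_on (cball 0 1) (\<lambda>a. v (\<psi> a))" by (simp add: o_def)
    then have "continuous_on (fst ` ?S) (\<lambda>a. v (\<psi> a))" by (rule continuous_on_subset) auto
    then have "continuous_on ?S (\<lambda>x. v (\<psi> (fst x)))"
      by (rule continuous_on_compose2) (auto intro: continuous_intros)
    then show ?thesis unfolding \<Phi>_def case_prod_unfold by (intro continuous_intros)
  qed
  moreover have "inj_on \<Phi> ?S"
  proof (clarsimp intro!: inj_onI)
    fix a l t a' l' t'
    assume a: "norm (a::'a) < 1" "norm (a'::'a) < 1" "0 < l" "0 < l'" and eq: "\<Phi> (a, l, t) = \<Phi> (a', l', t')"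
    have "hh e (\<psi> a) = hh e (\<psi> a')" using sg[OF a(3), of a t] sg[OF a(4), of a' t'] eq by simp
    then have "\<psi> a = \<psi> a'" using V(8)[OF e] PosV[of a] PosV[of a'] a by (auto simp: inj_on_def)
    then have aa: "a = a'" using V(5) a by (auto simp: inj_on_def)
    have "l *\<^sub>R pr e (v (\<psi> a)) = l' *\<^sub>R pr e (v (\<psi> a))" using prPhi eq aa by metis
    then have ll: "l = l'" using nz[of a] a by simp
    then have "t = t'" using eq aa e by (auto simp: \<Phi>_def)
    then show "a = a' \<and> l = l' \<and> t = t'" using aa ll by simp
  qed
  moreover have "open ?S" by (intro open_Times) auto
  ultimately have "open (\<Phi> ` ?S)"
    by (intro invariance_of_domain_gen) (simp_all add: dim_e)
  moreover have "\<Phi> ` ?S \<subseteq> Cn e W"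
  proof (clarsimp simp: Cn_def)
    fix a l t assume a: "norm (a::'a) < 1" "0 < (l::real)"
    show "pr e (\<Phi> (a, l, t)) \<noteq> 0 \<and> sgn (pr e (\<Phi> (a, l, t))) \<in> hh e ` W"
      using sg[OF a(2), of a t] nz[of a] a prPhi[of a l t] PosV[of a] V(7) by auto
  qed
  moreover have "w \<in> \<Phi> ` ?S"
  proof -
    obtain \<mu> where \<mu>: "\<mu> > 0" "pr e w = \<mu> *\<^sub>R pr e (v p)"
      using sgn_eq_imp_scale[of "pr e w" "pr e (v p)"] p(2) pr_v_nz[OF e, of p] W p
      unfolding hh_def by blast
    have "w = \<Phi> (0, \<mu>, w \<bullet> e - \<mu> * (v p \<bullet> e))"
      using pr_decomp[of w e] \<mu>(2) by (simp add: \<Phi>_def V(2) pr_def algebra_simps)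
    then show ?thesis using \<mu>(1) by force
  qed
  ultimately show "\<exists>T. open T \<and> w \<in> T \<and> T \<subseteq> Cn e W" by blast
qed

section \<open>Lifting great circle arcs\<close>

definition lift :: "'e \<Rightarrow> (real \<Rightarrow> 'p) \<Rightarrow> 'e \<Rightarrow> 'e \<Rightarrow> bool" where
  "lift e p y z \<longleftrightarrow> norm y = 1 \<and> norm z = 1 \<and> z \<noteq> - y \<and> y \<bullet> e = 0 \<and> z \<bullet> e = 0 \<and>
     continuous_map (top_of_set {0..1}) X p \<and>
     (\<forall>s\<in>{0..1}. p s \<in> Pos e \<and> hh e (p s) = sgn (seg y z s))"

text \<open>The factor \<open>kk\<close> rescales \<open>v\<close> such that its projection runs along the chord.\<close>

definition kk :: "'e \<Rightarrow> (real \<Rightarrow> 'p) \<Rightarrow> 'e \<Rightarrow> 'e \<Rightarrow> real \<Rightarrow> real" where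
  "kk e p y z s = norm (seg y z s) / norm (pr e (v (p s)))"

lemma lift_seg:
  assumes e: "norm e = 1" and L: "lift e p y z" and s: "s \<in> {0..1}"
  shows "kk e p y z s > 0"
    and "kk e p y z s *\<^sub>R v (p s) = seg y z s + (kk e p y z s * (v (p s) \<bullet> e)) *\<^sub>R e"
    and "seg y z s \<bullet> e = 0" "seg y z s \<noteq> 0"
proof -
  have P: "p s \<in> Pos e" and h: "hh e (p s) = sgn (seg y z s)" using L s by (auto simp: lift_def)
  show nz: "seg y z s \<noteq> 0" using L s by (intro seg_nonzero) (auto simp: lift_def)
  have nz2: "pr e (v (p s)) \<noteq> 0" using pr_v_nz[OF e P] .
  show "kk e p y z s > 0" using nz nz2 by (simp add: kk_def)
  have "norm (seg y z s) *\<^sub>R hh e (p s) = seg y z s" using nz h by (simp add: sgn_div_norm)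
  then have "kk e p y z s *\<^sub>R pr e (v (p s)) = seg y z s"
    by (simp add: kk_def hh_def sgn_div_norm divide_inverse)
  then show "kk e p y z s *\<^sub>R v (p s) = seg y z s + (kk e p y z s * (v (p s) \<bullet> e)) *\<^sub>R e"
    using pr_decomp[of "v (p s)" e] by (metis scaleR_add_right scaleR_scaleR)
  show "seg y z s \<bullet> e = 0" using L by (simp add: lift_def seg_def inner_add_left)
qed

lemma cont_path_v: "continuous_map (top_of_set S) X p \<Longrightarrow> continuous_on S (\<lambda>s. v (p s))"
  by (drule continuous_map_compose[OF _ cont_v]) (simp add: o_def)

lemma cont_kk:
  assumes e: "norm e = 1" and L: "lift e p y z"
  shows "continuous_on {0..1} (kk e p y z)"
proof -
  have "continuous_on {0..1} (\<lambda>s. v (p s))" using L cont_path_v[of "{0..1}" p] by (simp add: lift_def)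
  moreover have "\<And>s. s \<in> {0..1} \<Longrightarrow> pr e (v (p s)) \<noteq> 0"
    using pr_v_nz[OF e] L by (simp add: lift_def)
  ultimately have "continuous_on {0..1} (\<lambda>s. norm (seg y z s) / norm (pr e (v (p s))))"
    by (intro continuous_on_divide continuous_on_norm continuous_on_pr continuous_on_seg continuous_on_id) auto
  then show ?thesis by (simp add: kk_def[abs_def])
qed

lemma path_nbhd:
  fixes S :: "real set"
  assumes "continuous_map (top_of_set S) X p" "s \<in> S" "openin X U" "p s \<in> U"
  obtains d where "d > 0" "\<And>t. t \<in> S \<Longrightarrow> \<bar>t - s\<bar> < d \<Longrightarrow> p t \<in> U"
proof -
  have "openin (top_of_set S) {x \<in> topspace (top_of_set S). p x \<in> U}"
    by (rule openin_continuous_map_preimage[OF assms(1,3)])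
  then obtain d where "d > 0" "\<And>t. t \<in> S \<Longrightarrow> dist t s < d \<Longrightarrow> t \<in> {x \<in> S. p x \<in> U}"
    using assms(2,4) unfolding openin_euclidean_subtopology_iff by auto
  then show thesis by (intro that[of d]) (auto simp: dist_real_def)
qed

lemma lift_local_pos:
  assumes e: "norm e = 1" and L: "lift e p y z" and yz: "y \<noteq> z" and s: "s \<in> {0..1}"
  obtains d where "d > 0" "\<And>t. t \<in> {0..1} \<Longrightarrow> \<bar>t - s\<bar> < d \<Longrightarrow> t \<noteq> s \<Longrightarrow> g (p s) \<bullet> v (p t) > 0"
proof -
  have c: "continuous_map (top_of_set {0..1}) X p" and P: "\<And>s. s \<in> {0..1} \<Longrightarrow> p s \<in> Pos e"
    and h: "\<And>s. s \<in> {0..1} \<Longrightarrow> hh e (p s) = sgn (seg y z s)" using L by (auto simp: lift_def)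
  obtain V where V: "openin X V" "p s \<in> V" "\<forall>x\<in>V. \<forall>y\<in>V. x \<noteq> y \<longrightarrow> g x \<bullet> v y > 0"
    using lsc P[OF s] PosD by metis
  obtain d where d: "d > 0" "\<And>t. t \<in> {0..1} \<Longrightarrow> \<bar>t - s\<bar> < d \<Longrightarrow> p t \<in> V"
    using path_nbhd[OF c s V(1,2)] by blast
  show thesis
  proof (rule that[OF d(1)])
    fix t assume t: "t \<in> {0..1}" "\<bar>t - s\<bar> < d" "t \<noteq> s"
    have "p t \<noteq> p s"
    proof
      assume "p t = p s"
      then have "sgn (seg y z t) = sgn (seg y z s)" using h t s by metis
      then show False using sgn_seg_inj[of y z t s] L t s yz by (auto simp: lift_def)
    qed
    then show "g (p s) \<bullet> v (p t) > 0" using V d t by metis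
  qed
qed

text \<open>The vector \<open>v\<close> scaled by \<open>kk\<close> runs over the chord at height
  \<open>H\<close>, so \<open>D r s\<close> is affine in \<open>s\<close> up to \<open>H s\<close>
  times the positive number \<open>g (p r) \<bullet> e\<close>. Near \<open>r\<close>,
  \<open>D r\<close> is positive except for its zero at \<open>r\<close>: the height has a strict
  local support line at every parameter. A maximum of \<open>D s1\<close> turns this into a global
  statement.\<close>

lemma lift_convex:
  assumes e: "norm e = 1" and L: "lift e p y z" and yz: "y \<noteq> z"
    and s: "s1 \<in> {0..1}" "s2 \<in> {0..1}" "s1 \<noteq> s2"
  shows "g (p s1) \<bullet> v (p s2) > 0"
proof (rule ccontr)
  assume neg: "\<not> g (p s1) \<bullet> v (p s2) > 0"
  define H where "H s = kk e p y z s * (v (p s) \<bullet> e)" for s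
  define D where "D r s = kk e p y z s * (g (p r) \<bullet> v (p s))" for r s
  have P: "\<And>s. s \<in> {0..1} \<Longrightarrow> p s \<in> Pos e" using L by (auto simp: lift_def)
  have DH: "D r s = g (p r) \<bullet> y + s * (g (p r) \<bullet> (z - y)) + H s * (g (p r) \<bullet> e)" if "s \<in> {0..1}" for r s
  proof -
    have "D r s = g (p r) \<bullet> (kk e p y z s *\<^sub>R v (p s))" by (simp add: D_def)
    also have "\<dots> = g (p r) \<bullet> (y + s *\<^sub>R (z - y)) + H s * (g (p r) \<bullet> e)"
      by (subst lift_seg(2)[OF e L that]) (simp add: H_def seg_affine inner_add_right)
    finally show ?thesis by (simp add: inner_add_right)
  qed
  have D0: "D r r = 0" if "r \<in> {0..1}" for r using perp[of "p r"] PosD[OF P[OF that]] by (simp add: D_def)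
  have loc: "\<exists>d>0. \<forall>t\<in>{0..1}. \<bar>t - s\<bar> < d \<and> t \<noteq> s \<longrightarrow> D s t > 0" if "s \<in> {0..1}" for s
    using lift_local_pos[OF e L yz that] lift_seg(1)[OF e L] unfolding D_def by (metis mult_pos_pos)
  let ?I = "closed_segment s1 s2"
  have I: "?I \<subseteq> {0..1}" using s by (auto simp: closed_segment_eq_real_ivl)
  have "continuous_on {0..1} (\<lambda>s. g (p s1) \<bullet> v (p s))"
    using L cont_path_v[of "{0..1}" p] by (intro continuous_intros) (simp add: lift_def)
  from continuous_on_mult[OF cont_kk[OF e L] this] have "continuous_on {0..1} (D s1)"
    by (simp add: D_def[abs_def])
  then have "continuous_on ?I (D s1)" by (rule continuous_on_subset[OF _ I])
  then obtain t where t: "t \<in> ?I" "\<forall>s\<in>?I. D s1 s \<le> D s1 t"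
    using continuous_attains_sup[of ?I "D s1"] by (auto simp: compact_segment)
  obtain d where d: "d > 0" "\<forall>t\<in>{0..1}. \<bar>t - s1\<bar> < d \<and> t \<noteq> s1 \<longrightarrow> D s1 t > 0" using loc[OF s(1)] by blast
  define c where "c = min (d/2) (\<bar>s2 - s1\<bar>)"
  have "c > 0" "c < d" using d s by (auto simp: c_def)
  \<comment> \<open>A point of the segment close to \<open>s1\<close> on the side of
    \<open>s2\<close>. There \<open>D s1\<close> is positive, so its maximum over the segment is
    positive and is attained in the interior.\<close>
  define r where "r = s1 + sgn (s2 - s1) * c"
  have r: "r \<in> ?I" "\<bar>r - s1\<bar> < d" "r \<noteq> s1"
    using s(3) \<open>c > 0\<close> \<open>c < d\<close> by (auto simp: r_def closed_segment_eq_real_ivl c_def sgn_real_def)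
  have "D s1 t > 0" using d(2) r t I by (meson less_le_trans subsetD)
  have t1: "t \<noteq> s1" using D0[OF s(1)] \<open>D s1 t > 0\<close> by auto
  have t2: "t \<noteq> s2" using neg \<open>D s1 t > 0\<close> lift_seg(1)[OF e L s(2)]
    by (auto simp: D_def zero_less_mult_iff)
  have t01: "t \<in> {0..1}" using t I by blast
  obtain d' where d': "d' > 0" "\<forall>s\<in>{0..1}. \<bar>s - t\<bar> < d' \<and> s \<noteq> t \<longrightarrow> D t s > 0" using loc[OF t01] by blast
  define c' where "c' = min (d'/2) (min \<bar>t - s1\<bar> \<bar>t - s2\<bar>)"
  have c': "c' > 0" "c' < d'" using d' t1 t2 by (auto simp: c'_def)
  have mem: "t + c' \<in> ?I" "t - c' \<in> ?I" using t(1) c' by (auto simp: c'_def closed_segment_eq_real_ivl split: if_splits)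
  have pos: "D t (t + c') > 0" "D t (t - c') > 0" using d' c' mem I by auto
  define a where "a = g (p t) \<bullet> e" define b where "b = g (p s1) \<bullet> e"
  have ab: "a > 0" "b > 0" using PosD[OF P[OF t01]] PosD[OF P[OF s(1)]] by (auto simp: a_def b_def)
  \<comment> \<open>With these weights the unknown height \<open>H\<close> cancels, so
    \<open>G\<close> is affine. But \<open>D s1\<close> is largest at \<open>t\<close> and
    \<open>D t\<close> is positive on both sides of \<open>t\<close>, so \<open>G\<close> would be
    smaller at t + c' and t - c' than at their midpoint.\<close>
  define G where "G s = a * D s1 s - b * D t s" for s
  define A where "A = a * (g (p s1) \<bullet> y) - b * (g (p t) \<bullet> y)"
  define B where "B = a * (g (p s1) \<bullet> (z - y)) - b * (g (p t) \<bullet> (z - y))"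
  have aff: "G s = A + s * B" if "s \<in> {0..1}" for s
    unfolding G_def DH[OF that] A_def B_def a_def[symmetric] b_def[symmetric] by (simp add: algebra_simps)
  have m01: "t + c' \<in> {0..1}" "t - c' \<in> {0..1}" using mem I by blast+
  have "G (t + c') + G (t - c') = 2 * G t"
    unfolding aff[OF m01(1)] aff[OF m01(2)] aff[OF t01] by (simp add: algebra_simps)
  moreover have "G t = a * D s1 t" by (simp add: G_def D0[OF t01])
  moreover have "G r < a * D s1 t" if "r \<in> ?I" "D t r > 0" for r
    using mult_left_mono[of "D s1 r" "D s1 t" a] mult_pos_pos[OF ab(2) that(2)] t(2) that(1) ab
    unfolding G_def by (smt (verit))
  note this[OF mem(1) pos(1)] this[OF mem(2) pos(2)]
  ultimately show False by linarith
qed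

end

lemma norm_sgn_diff_le:
  fixes a b :: "'e::real_normed_vector"
  assumes "a \<noteq> 0" "b \<noteq> 0"
  shows "norm (sgn a - sgn b) \<le> 2 * norm (a - b) / norm a"
proof -
  have "norm a *\<^sub>R (sgn a - sgn b) = (a - b) + (norm b - norm a) *\<^sub>R sgn b"
    using assms by (simp add: sgn_div_norm algebra_simps)
  then have "norm a * norm (sgn a - sgn b) = norm ((a - b) + (norm b - norm a) *\<^sub>R sgn b)"
    by (metis abs_norm_cancel norm_scaleR)
  also have "\<dots> \<le> norm (a - b) + \<bar>norm b - norm a\<bar>"
    by (rule norm_triangle_le) (simp add: norm_sgn assms)
  also have "\<dots> \<le> 2 * norm (a - b)" using norm_triangle_ineq3[of b a] by (simp add: norm_minus_commute)
  finally show ?thesis using assms by (simp add: field_simps)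
qed

context convex_pair begin

lemma liftD:
  assumes "lift e p y z" "s \<in> {0..1}"
  shows "p s \<in> Pos e" "p s \<in> N" "g (p s) \<bullet> e > 0" "hh e (p s) = sgn (seg y z s)"
  using assms PosD[of "p s" e] by (simp_all add: lift_def)

text \<open>Over a constant arc the path stays in one fibre of \<open>hh e\<close>, and local
  injectivity makes it locally constant.\<close>

lemma lift_const:
  assumes e: "norm e = 1" and L: "lift e p y y" and s: "s \<in> {0..1}" "t \<in> {0..1}"
  shows "p s = p t"
proof -
  have c: "continuous_map (top_of_set {0..1}) X p" and P: "\<And>s. s \<in> {0..1} \<Longrightarrow> p s \<in> Pos e"
    and h: "\<And>s. s \<in> {0..1} \<Longrightarrow> hh e (p s) = sgn y"
    using L by (auto simp: lift_def seg_affine)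
  have "p constant_on {0..1}"
  proof (rule locally_constant_imp_constant)
    fix s :: real assume s: "s \<in> {0..1}"
    obtain V where V: "openin X V" "p s \<in> V" "\<And>e. norm e = 1 \<Longrightarrow> inj_on (hh e) (V \<inter> Pos e)"
      using good_nbhd[OF open_Pos P[OF s]] by metis
    let ?S = "{t \<in> topspace (top_of_set {0..1}). p t \<in> V}"
    have "p t = p s" if "t \<in> ?S" for t
      using inj_onD[OF V(3)[OF e], of "p t" "p s"] h[of t] h[OF s] P[of t] P[OF s] that V(2) by auto
    then have "\<forall>t\<in>?S. p t = p s" by blast
    moreover have "openin (top_of_set {0..1}) ?S"
      by (rule openin_continuous_map_preimage[OF c V(1)])
    ultimately show "\<exists>U. openin (top_of_set {0..1}) U \<and> s \<in> U \<and> (\<forall>t\<in>U. p t = p s)"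
      using s V(2) by (intro exI[of _ ?S]) auto
  qed auto
  then show ?thesis using s unfolding constant_on_def by metis
qed

lemma lift_nonneg:
  assumes e: "norm e = 1" and L: "lift e p y z" and s: "s \<in> {0..1}" "t \<in> {0..1}"
  shows "g (p s) \<bullet> v (p t) \<ge> 0"
proof (cases "y = z \<or> s = t")
  case True
  then have "p s = p t" using lift_const[OF e] L s by auto
  moreover have "p t \<in> N" using liftD[OF L] s by blast
  ultimately show ?thesis using perp[of "p t"] by simp
next
  case False
  then show ?thesis using lift_convex[OF e L _ s] by auto
qed

text \<open>By \<open>lift_nonneg\<close> the height \<open>H\<close> has a support line of slope
  \<open>\<beta> r\<close> at each \<open>r\<close>, so it is convex and its slopes increase. They
  are bounded by the slopes at the two end points, the only places where a lower bound for
  \<open>g \<bullet> e\<close> enters. The constant is |z - y| \<le> 2 divided by that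
  bound.\<close>

lemma lift_slope:
  assumes e: "norm e = 1" and L: "lift e p y z" and c: "c > 0" "g (p 0) \<bullet> e \<ge> c" "g (p 1) \<bullet> e \<ge> c"
    and s: "s \<in> {0..1}" "t \<in> {0..1}"
  shows "\<bar>kk e p y z s * (v (p s) \<bullet> e) - kk e p y z t * (v (p t) \<bullet> e)\<bar> \<le> 2 / c * \<bar>s - t\<bar>"
proof -
  define H where "H s = kk e p y z s * (v (p s) \<bullet> e)" for s
  define \<phi> where "\<phi> s = g (p s) \<bullet> e" for s
  define \<beta> where "\<beta> s = - (g (p s) \<bullet> (z - y)) / \<phi> s" for s
  have P: "\<And>s. s \<in> {0..1} \<Longrightarrow> p s \<in> Pos e" using L by (auto simp: lift_def)
  have \<phi>: "\<phi> s > 0" if "s \<in> {0..1}" for s using PosD[OF P[OF that]] by (simp add: \<phi>_def)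
  have DH: "kk e p y z s * (g (p r) \<bullet> v (p s)) = g (p r) \<bullet> y + s * (g (p r) \<bullet> (z - y)) + H s * \<phi> r"
    if "s \<in> {0..1}" for r s
  proof -
    have "kk e p y z s * (g (p r) \<bullet> v (p s)) = g (p r) \<bullet> (kk e p y z s *\<^sub>R v (p s))" by simp
    also have "\<dots> = g (p r) \<bullet> (y + s *\<^sub>R (z - y)) + H s * \<phi> r"
      by (subst lift_seg(2)[OF e L that]) (simp add: H_def \<phi>_def seg_affine inner_add_right)
    finally show ?thesis by (simp add: inner_add_right)
  qed
  have sup: "H s \<ge> H r + \<beta> r * (s - r)" if r: "r \<in> {0..1}" and s: "s \<in> {0..1}" for r s
  proof -
    have "0 \<le> kk e p y z s * (g (p r) \<bullet> v (p s))"
      using lift_nonneg[OF e L r s] lift_seg(1)[OF e L s] by simp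
    moreover have "0 = kk e p y z r * (g (p r) \<bullet> v (p r))"
      using perp[of "p r"] PosD[OF P[OF r]] by simp
    ultimately have "0 \<le> (s - r) * (g (p r) \<bullet> (z - y)) + (H s - H r) * \<phi> r"
      unfolding DH[OF r] DH[OF s] by (simp add: algebra_simps)
    moreover have "(s - r) * (g (p r) \<bullet> (z - y)) = - (\<beta> r * (s - r)) * \<phi> r"
      using \<phi>[OF r] by (simp add: \<beta>_def field_simps)
    ultimately have "0 \<le> (H s - H r - \<beta> r * (s - r)) * \<phi> r" by (simp add: algebra_simps)
    then show ?thesis using \<phi>[OF r] by (simp add: zero_le_mult_iff)
  qed
  have mono: "\<beta> r \<le> \<beta> s" if "r \<in> {0..1}" "s \<in> {0..1}" "r \<le> s" for r s
  proof (cases "r = s")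
    case False
    have "\<beta> r * (s - r) \<le> \<beta> s * (s - r)" using sup[OF that(1,2)] sup[OF that(2,1)] by (simp add: algebra_simps)
    then show ?thesis using False that(3) by simp
  qed simp
  have yz: "norm (z - y) \<le> 2" using norm_triangle_ineq4[of z y] L by (simp add: lift_def)
  have bd: "\<bar>\<beta> r\<bar> \<le> 2 / c" if r: "r = 0 \<or> r = 1" for r
  proof -
    have r01: "r \<in> {0..1}" using r by auto
    have "\<bar>g (p r) \<bullet> (z - y)\<bar> \<le> 2"
      using Cauchy_Schwarz_ineq2[of "g (p r)" "z - y"] norm_g[of "p r"] PosD[OF P[OF r01]] yz by simp
    moreover have "\<phi> r \<ge> c" using r c by (auto simp: \<phi>_def)
    ultimately show ?thesis using c(1) unfolding \<beta>_def by (simp add: abs_divide frac_le)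
  qed
  have bd2: "\<bar>\<beta> r\<bar> \<le> 2 / c" if r: "r \<in> {0..1}" for r
    using mono[of 0 r] mono[of r 1] bd[of 0] bd[of 1] r by auto
  have main: "\<bar>H s - H t\<bar> \<le> 2 / c * \<bar>s - t\<bar>" if "s \<in> {0..1}" "t \<in> {0..1}" "s \<le> t" for s t
  proof -
    have 1: "\<beta> s * (t - s) \<le> H t - H s" "H t - H s \<le> \<beta> t * (t - s)"
      using sup[OF that(1,2)] sup[OF that(2,1)] by (simp_all add: algebra_simps)
    have 2: "\<beta> t * (t - s) \<le> 2 / c * (t - s)" "- (2 / c) * (t - s) \<le> \<beta> s * (t - s)"
      using bd2[OF that(1)] bd2[OF that(2)] that(3) by (intro mult_right_mono; linarith)+
    show ?thesis using 1 2 that(3) by (simp add: abs_le_iff)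
  qed
  show ?thesis using main[of s t] main[of t s] s unfolding H_def[symmetric]
    by (cases "s \<le> t") (auto simp: abs_minus_commute)
qed

lemma lift_norm_kk:
  assumes e: "norm e = 1" and L: "lift e p y z" and s: "s \<in> {0..1}"
  shows "norm (kk e p y z s *\<^sub>R v (p s)) = kk e p y z s" "kk e p y z s \<ge> norm (y + z) / 2"
proof -
  have "p s \<in> N" using liftD[OF L] s by blast
  then show 1: "norm (kk e p y z s *\<^sub>R v (p s)) = kk e p y z s"
    using norm_v lift_seg(1)[OF e L s] by simp
  have "norm (seg y z s) * norm (seg y z s) = (kk e p y z s *\<^sub>R v (p s)) \<bullet> seg y z s"
    unfolding lift_seg(2)[OF e L s]
    using lift_seg(3)[OF e L s] by (simp add: inner_add_left inner_commute[of e] power2_norm_eq_inner[symmetric] power2_eq_square)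
  also have "\<dots> \<le> kk e p y z s * norm (seg y z s)"
    using norm_cauchy_schwarz[of "kk e p y z s *\<^sub>R v (p s)" "seg y z s"] unfolding 1 .
  finally have "norm (seg y z s) \<le> kk e p y z s" using lift_seg(4)[OF e L s] by simp
  moreover have "norm (y + z) / 2 \<le> norm (seg y z s)" using L s by (intro seg_norm_ge) (auto simp: lift_def)
  ultimately show "kk e p y z s \<ge> norm (y + z) / 2" by simp
qed

text \<open>The scaled vector \<open>m\<close> has a chord part with Lipschitz constant 2 and a
  height part with constant 2 / c. Normalizing vectors of length at least \<open>d\<close> costs a
  factor 2 / d, by \<open>norm_sgn_diff_le\<close>.\<close>

lemma lift_Lipschitz:
  assumes e: "norm e = 1" and L: "lift e p y z" and c: "c > 0" "g (p 0) \<bullet> e \<ge> c" "g (p 1) \<bullet> e \<ge> c"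
    and d: "d > 0" "norm (y + z) / 2 \<ge> d" and s: "s \<in> {0..1}" "t \<in> {0..1}"
  shows "norm (v (p s) - v (p t)) \<le> 2 * (2 + 2 / c) / d * \<bar>s - t\<bar>"
proof -
  define m where "m s = kk e p y z s *\<^sub>R v (p s)" for s
  have k: "kk e p y z s \<ge> d" if "s \<in> {0..1}" for s using lift_norm_kk(2)[OF e L that] d by simp
  have nz: "m s \<noteq> 0" if "s \<in> {0..1}" for s
    using k[OF that] lift_norm_kk(1)[OF e L that] d(1) unfolding m_def by force
  have vm: "v (p s) = sgn (m s)" if "s \<in> {0..1}" for s
  proof -
    have "p s \<in> N" using liftD[OF L] that by blast
    then show ?thesis using norm_v k[OF that] d(1) by (simp add: m_def sgn_scaleR sgn_div_norm)
  qed
  have "m s - m t = (s - t) *\<^sub>R (z - y) + (kk e p y z s * (v (p s) \<bullet> e) - kk e p y z t * (v (p t) \<bullet> e)) *\<^sub>R e"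
    unfolding m_def lift_seg(2)[OF e L s(1)] lift_seg(2)[OF e L s(2)] seg_affine by (simp add: algebra_simps)
  then have "norm (m s - m t) \<le> norm ((s - t) *\<^sub>R (z - y)) + norm ((kk e p y z s * (v (p s) \<bullet> e) - kk e p y z t * (v (p t) \<bullet> e)) *\<^sub>R e)"
    by (metis norm_triangle_ineq)
  also have "\<dots> \<le> \<bar>s - t\<bar> * 2 + 2 / c * \<bar>s - t\<bar>"
  proof (rule add_mono)
    have yz: "norm (z - y) \<le> 2" using norm_triangle_ineq4[of z y] L by (simp add: lift_def)
    show "norm ((s - t) *\<^sub>R (z - y)) \<le> \<bar>s - t\<bar> * 2" using yz by (simp add: mult_left_mono)
    show "norm ((kk e p y z s * (v (p s) \<bullet> e) - kk e p y z t * (v (p t) \<bullet> e)) *\<^sub>R e) \<le> 2 / c * \<bar>s - t\<bar>"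
      using lift_slope[OF e L c s] e by simp
  qed
  finally have mm: "norm (m s - m t) \<le> (2 + 2 / c) * \<bar>s - t\<bar>" by (simp add: algebra_simps)
  have "norm (v (p s) - v (p t)) \<le> 2 * norm (m s - m t) / norm (m s)"
    unfolding vm[OF s(1)] vm[OF s(2)] by (intro norm_sgn_diff_le nz s)
  also have "\<dots> \<le> 2 * ((2 + 2 / c) * \<bar>s - t\<bar>) / d"
    using mm k[OF s(1)] d(1) lift_norm_kk(1)[OF e L s(1)] c(1) unfolding m_def by (intro frac_le) (auto intro!: mult_nonneg_nonneg add_nonneg_nonneg)
  finally show ?thesis by (simp add: algebra_simps)
qed

text \<open>Confines paths in a space that carries no metric. On the boundary of a coordinate ball
  at \<open>q\<close>, \<open>v\<close> differs from \<open>v q\<close> by local strict convexity,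
  hence by at least 2 \<rho> by compactness. A connected path that starts near \<open>q\<close> and
  along which \<open>v\<close> varies by less than \<rho> cannot cross this boundary.\<close>

lemma stay:
  assumes U: "openin X U" "q \<in> U"
  obtains \<rho> U' where "\<rho> > 0" "openin X U'" "q \<in> U'"
    "\<forall>S p s t. connected (S::real set) \<longrightarrow> continuous_map (top_of_set S) X p \<longrightarrow> s \<in> S \<longrightarrow> p s \<in> U' \<longrightarrow>
       (\<forall>r\<in>S. norm (v (p r) - v (p s)) < \<rho>) \<longrightarrow> t \<in> S \<longrightarrow> p t \<in> U"
proof -
  obtain \<psi> :: "'a \<Rightarrow> 'p" and V where V: "V = \<psi> ` ball 0 1" "\<psi> 0 = q" "\<psi> ` cball 0 1 \<subseteq> U" "openin X V" "q \<in> V" "V \<subseteq> U"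
    "inj_on \<psi> (cball 0 1)" "continuous_map (top_of_set (cball 0 1)) X \<psi>"
    "\<And>x y. x \<in> \<psi> ` cball 0 1 \<Longrightarrow> y \<in> \<psi> ` cball 0 1 \<Longrightarrow> x \<noteq> y \<Longrightarrow> g x \<bullet> v y > 0"
    using good_nbhd[OF U] by metis
  have cN: "\<psi> ` cball 0 1 \<subseteq> N" using V(3) openin_subset[OF U(1)] by blast
  have "continuous_map (top_of_set (cball 0 1)) euclidean (v \<circ> \<psi>)"
    using continuous_map_compose[OF V(8) cont_v] .
  then have cv: "continuous_on (cball 0 1) (\<lambda>a. v (\<psi> a))" by (simp add: o_def)
  have "compact ((\<lambda>a. norm (v (\<psi> a) - v q)) ` sphere 0 1)"
    using cv by (intro compact_continuous_image continuous_intros) (auto intro: continuous_on_subset)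
  moreover have "sphere (0::'a) 1 \<noteq> {}" by (simp add: sphere_eq_empty)
  ultimately obtain a where a: "a \<in> sphere 0 1" "\<forall>b\<in>sphere 0 1. norm (v (\<psi> a) - v q) \<le> norm (v (\<psi> b) - v q)"
    using compact_attains_inf[of "(\<lambda>a. norm (v (\<psi> a) - v q)) ` sphere 0 1"] by auto
  define \<rho> where "\<rho> = norm (v (\<psi> a) - v q) / 2"
  have "\<psi> a \<noteq> q"
  proof
    assume "\<psi> a = q"
    then have "a = 0" using V(2,7) a(1) by (auto simp: inj_on_def)
    then show False using a(1) by simp
  qed
  have "v (\<psi> a) \<noteq> v q"
  proof
    assume eq: "v (\<psi> a) = v q"
    have "g q \<bullet> v (\<psi> a) > 0" using V(9)[of q "\<psi> a"] \<open>\<psi> a \<noteq> q\<close> V(1,5) a(1) by auto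
    moreover have "q \<in> N" using U openin_subset by blast
    ultimately show False using eq perp[of q] by simp
  qed
  then have "\<rho> > 0" by (simp add: \<rho>_def)
  define U' where "U' = V \<inter> {x \<in> N. norm (v x - v q) < \<rho>}"
  have main: "p t \<in> U"
    if S: "connected S" "continuous_map (top_of_set S) X p" "s \<in> S" "p s \<in> U'" "t \<in> S"
      and r: "\<forall>r\<in>S. norm (v (p r) - v (p s)) < \<rho>" for S :: "real set" and p s t
  proof -
    have con: "connectedin X (p ` S)"
      using connectedin_continuous_map_image[OF S(2)] S(1) by (simp add: connectedin_subtopology)
    have pN: "p ` S \<subseteq> N" using con by (simp add: connectedin_def)
    have "compactin X (\<psi> ` cball 0 1)"
      using image_compactin[OF _ V(8)] by (simp add: compactin_subtopology)
    then have "closedin X (\<psi> ` cball 0 1)" using compactin_imp_closedin[OF haus] by blast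
    then have op: "openin X (N - \<psi> ` cball 0 1)" by (simp add: openin_diff)
    have sph: "p r \<notin> \<psi> ` sphere 0 1" if "r \<in> S" for r
    proof
      assume "p r \<in> \<psi> ` sphere 0 1"
      then have "2 * \<rho> \<le> norm (v (p r) - v q)" using a(2) by (auto simp: \<rho>_def)
      also have "\<dots> \<le> norm (v (p r) - v (p s)) + norm (v (p s) - v q)"
        using norm_triangle_ineq[of "v (p r) - v (p s)" "v (p s) - v q"] by simp
      also have "\<dots> < 2 * \<rho>" using bspec[OF r that] S(4) by (auto simp: U'_def)
      finally show False by simp
    qed
    have cover: "p ` S \<subseteq> V \<union> (N - \<psi> ` cball 0 1)"
    proof
      fix x assume "x \<in> p ` S"
      then obtain r where r: "r \<in> S" "x = p r" by blast
      have "cball (0::'a) 1 = ball 0 1 \<union> sphere 0 1" by auto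
      then have "\<psi> ` cball 0 1 = V \<union> \<psi> ` sphere 0 1" unfolding V(1) by (metis image_Un)
      then show "x \<in> V \<union> (N - \<psi> ` cball 0 1)" using sph[OF r(1)] pN r by auto
    qed
    have dis: "V \<inter> (N - \<psi> ` cball 0 1) \<inter> p ` S = {}" unfolding V(1) by auto
    have "p s \<in> V" using S(4) by (simp add: U'_def)
    then have "(N - \<psi> ` cball 0 1) \<inter> p ` S = {}"
      using con V(4) op cover dis S(3) unfolding connectedin by blast
    then have "p t \<in> V" using cover S(5) by auto
    then show "p t \<in> U" using V(6) by blast
  qed
  have "openin X U'" unfolding U'_def using V(4) open_ball_v by blast
  moreover have "q \<in> U'" using V(5) \<open>\<rho> > 0\<close> cN V(1) by (auto simp: U'_def)
  ultimately show thesis using that[of \<rho> U'] \<open>\<rho> > 0\<close> main by blast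
qed

lemma limit_v: "limitin X f q F \<Longrightarrow> ((\<lambda>i. v (f i)) \<longlongrightarrow> v q) F"
  by (drule continuous_map_limit[OF cont_v]) (simp add: o_def)

lemma limit_g: "limitin X f q F \<Longrightarrow> ((\<lambda>i. g (f i)) \<longlongrightarrow> g q) F"
  by (drule continuous_map_limit[OF cont_g]) (simp add: o_def)

lemma limit_hh:
  assumes "norm e = 1" "limitin X f q F" "q \<in> Pos e"
  shows "((\<lambda>i. hh e (f i)) \<longlongrightarrow> hh e q) F"
proof -
  have "((\<lambda>i. pr e (v (f i))) \<longlongrightarrow> pr e (v q)) F"
    unfolding pr_def by (intro tendsto_intros limit_v assms)
  then show ?thesis unfolding hh_def using pr_v_nz[OF assms(1,3)] by (rule tendsto_sgn)
qed

lemma tendsto_seg: "(Y \<longlongrightarrow> z) F \<Longrightarrow> ((\<lambda>i. seg y (Y i) s) \<longlongrightarrow> seg y (z::'b::real_normed_vector) s) F"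
  unfolding seg_def by (intro tendsto_intros)

lemma mem_Cn_seg:
  assumes L: "lift e p y z" and s: "s \<in> {0..1}" and e: "norm e = 1"
  shows "seg y z s \<in> Cn e W \<longleftrightarrow> hh e (p s) \<in> hh e ` W"
  using lift_seg(3,4)[OF e L s] liftD(4)[OF L s] by (simp add: Cn_def pr_eqI)

end

text \<open>
  Lifts of arcs \<open>y Y\<^sub>i\<close> starting at \<open>p0\<close>, whose end points stay in \<open>{g \<bullet> e \<ge> c}\<close>: they converge
  along \<open>F\<close>, pointwise, to a lift of the limiting arc.
\<close>

locale lift_family = convex_pair X T g v
  for X :: "'p topology" and T :: "'a::euclidean_space itself" and g v :: "'p \<Rightarrow> 'e::euclidean_space" +
  fixes F :: "'i filter" and P :: "'i \<Rightarrow> real \<Rightarrow> 'p" and Y :: "'i \<Rightarrow> 'e" and e y z p0 c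
  assumes e: "norm e = 1" and F: "F \<noteq> bot" and c: "c > 0"
    and fam: "\<forall>\<^sub>F i in F. lift e (P i) y (Y i) \<and> P i 0 = p0 \<and> g (P i 1) \<bullet> e \<ge> c"
    and p0: "g p0 \<bullet> e \<ge> c"
    and Yz: "(Y \<longlongrightarrow> z) F" and zy: "z \<noteq> - y"
begin

text \<open>Half the limit of \<open>norm (y + Y i) / 2\<close>, hence eventually a lower bound for
  it, as \<open>lift_Lipschitz\<close> demands.\<close>

definition d where "d = norm (y + z) / 4"
definition Lam where "Lam = 2 * (2 + 2 / c) / d"

lemma d_pos: "d > 0"
  using zy by (simp add: d_def add_eq_0_iff)

lemma Lam_pos: "Lam > 0"
  unfolding Lam_def using c d_pos by (intro divide_pos_pos mult_pos_pos add_pos_pos) auto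

lemma norm_z: "norm z = 1"
proof -
  have "\<forall>\<^sub>F i in F. norm (Y i) = 1" using fam by eventually_elim (simp add: lift_def)
  then have "((\<lambda>i. norm (Y i)) \<longlongrightarrow> 1) F" by (rule tendsto_eventually)
  then show ?thesis using tendsto_unique[OF F tendsto_norm[OF Yz]] by simp
qed

lemma z_perp: "z \<bullet> e = 0"
proof -
  have "\<forall>\<^sub>F i in F. Y i \<bullet> e = 0" using fam by eventually_elim (simp add: lift_def)
  then have "((\<lambda>i. Y i \<bullet> e) \<longlongrightarrow> 0) F" by (rule tendsto_eventually)
  from tendsto_unique[OF F this tendsto_inner[OF Yz tendsto_const]] show ?thesis by simp
qed

lemma y_facts: "norm y = 1" "y \<bullet> e = 0" "p0 \<in> Pos e" "hh e p0 = y"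
proof -
  obtain i where i: "lift e (P i) y (Y i)" "P i 0 = p0"
    using eventually_happens'[OF F fam] by blast
  show 1: "norm y = 1" "y \<bullet> e = 0" using i by (auto simp: lift_def)
  show "p0 \<in> Pos e" "hh e p0 = y" using liftD[OF i(1), of 0] i(2) 1 by (auto simp: sgn_div_norm)
qed

lemma seg_facts:
  assumes "s \<in> {0..1}" shows "seg y z s \<noteq> 0" "seg y z s \<bullet> e = 0"
  using seg_nonzero[OF y_facts(1) norm_z zy, of s] assms y_facts z_perp
  by (auto simp: seg_def inner_add_left)

lemma family_Lipschitz: "\<forall>\<^sub>F i in F. lift e (P i) y (Y i) \<and> P i 0 = p0 \<and> g (P i 1) \<bullet> e \<ge> c \<and>
   (\<forall>s\<in>{0..1}. \<forall>t\<in>{0..1}. norm (v (P i s) - v (P i t)) \<le> Lam * \<bar>s - t\<bar>)"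
proof -
  have "((\<lambda>i. norm (y + Y i) / 2) \<longlongrightarrow> norm (y + z) / 2) F" by (intro tendsto_intros Yz) auto
  then have "\<forall>\<^sub>F i in F. d < norm (y + Y i) / 2"
    by (rule order_tendstoD) (use d_pos in \<open>simp add: d_def\<close>)
  then show ?thesis using fam
  proof eventually_elim
    case (elim i)
    then show ?case using lift_Lipschitz[OF e, of "P i" y "Y i" c d] c p0 d_pos unfolding Lam_def by auto
  qed
qed

definition lim :: "real \<Rightarrow> 'p \<Rightarrow> bool" where
  "lim s q \<longleftrightarrow> limitin X (\<lambda>i. P i s) q F"

lemma lim_unique: "lim s q \<Longrightarrow> lim s q' \<Longrightarrow> q = q'"
  unfolding lim_def by (rule limitin_Hausdorff_unique[OF _ _ F haus])

lemma lim_hh: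
  assumes "lim s q" "q \<in> Pos e" "s \<in> {0..1}"
  shows "hh e q = sgn (seg y z s)"
proof -
  have *: "((\<lambda>i. sgn (seg y (Y i) s)) \<longlongrightarrow> sgn (seg y z s)) F"
    using tendsto_seg[OF Yz] seg_facts(1)[OF assms(3)] by (rule tendsto_sgn)
  have "((\<lambda>i. hh e (P i s)) \<longlongrightarrow> hh e q) F" using limit_hh[OF e] assms by (simp add: lim_def)
  moreover have "\<forall>\<^sub>F i in F. hh e (P i s) = sgn (seg y (Y i) s)"
    using fam by eventually_elim (use liftD assms(3) in blast)
  ultimately have "((\<lambda>i. sgn (seg y (Y i) s)) \<longlongrightarrow> hh e q) F" by (simp add: tendsto_cong)
  then show ?thesis by (rule tendsto_unique[OF F _ *])
qed

lemma mem_Cn: "s \<in> {0..1} \<Longrightarrow> seg y z s \<in> Cn e W \<longleftrightarrow> sgn (seg y z s) \<in> hh e ` W"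
  using seg_facts by (simp add: Cn_def pr_eqI)

text \<open>Convergence at time \<open>s\<close> spreads to nearby times. The common Lipschitz bound
  keeps the lifts in a small \<open>V\<close> around \<open>q\<close>; in \<open>V\<close> a point
  is determined by its direction, and depends continuously on it by \<open>open_Cn\<close>; and the
  directions of the lifts converge because \<open>Y\<close> does.\<close>

lemma step:
  assumes q: "lim s q" "q \<in> Pos e" "s \<in> {0..1}" and U: "openin X U" "q \<in> U"
  obtains r where "r > 0" "\<And>t. t \<in> {0..1} \<Longrightarrow> \<bar>t - s\<bar> < r \<Longrightarrow> \<exists>q'\<in>U \<inter> Pos e. lim t q'"
proof -
  have "openin X (U \<inter> Pos e)" "q \<in> U \<inter> Pos e" using U q open_Pos by auto
  from good_nbhd[OF this] obtain V where V: "openin X V" "q \<in> V" "V \<subseteq> U \<inter> Pos e"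
    and inj: "\<And>e. norm e = 1 \<Longrightarrow> inj_on (hh e) (V \<inter> Pos e)" by metis
  have VP: "V \<inter> Pos e = V" using V(3) by blast
  obtain \<rho> U' where st: "\<rho> > 0" "openin X U'" "q \<in> U'"
    "\<forall>S p s t. connected (S::real set) \<longrightarrow> continuous_map (top_of_set S) X p \<longrightarrow> s \<in> S \<longrightarrow> p s \<in> U' \<longrightarrow>
       (\<forall>r\<in>S. norm (v (p r) - v (p s)) < \<rho>) \<longrightarrow> t \<in> S \<longrightarrow> p t \<in> V"
    by (rule stay[OF V(1,2)])
  have opC: "open (Cn e (V \<inter> W))" if "openin X W" for W
    by (rule open_Cn[OF e]) (use V that in auto)
  have "seg y z s \<in> Cn e V" using mem_Cn[OF q(3)] lim_hh[OF q] V(2) by (metis imageI)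
  moreover have "open {r. seg y z r \<in> Cn e V}"
    using continuous_open_vimage[of "Cn e V" "seg y z"] opC[OF V(1)]
    by (simp add: vimage_def continuous_on_eq_continuous_at seg_def[abs_def])
  ultimately obtain r1 where r1: "r1 > 0" "\<And>r. \<bar>r - s\<bar> < r1 \<Longrightarrow> seg y z r \<in> Cn e V"
    unfolding open_dist by (metis dist_real_def mem_Collect_eq)
  \<comment> \<open>Within time \<rho> / \<open>Lam\<close> the vector \<open>v\<close> moves by
    less than \<rho> along each lift, which is the hypothesis of \<open>stay\<close>.\<close>
  define r where "r = min r1 (\<rho> / Lam)"
  have "r > 0" using r1 st Lam_pos by (simp add: r_def)
  have evU: "\<forall>\<^sub>F i in F. P i s \<in> U'" using q(1) st by (simp add: lim_def limitin_def)
  show thesis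
  proof (rule that[OF \<open>r > 0\<close>])
    fix t assume t: "t \<in> {0..1}" "\<bar>t - s\<bar> < r"
    have "seg y z t \<in> Cn e V" using r1 t by (simp add: r_def)
    then obtain q' where q': "q' \<in> V" "hh e q' = sgn (seg y z t)" using mem_Cn[OF t(1)] by auto
    have evV: "\<forall>\<^sub>F i in F. lift e (P i) y (Y i) \<and> P i t \<in> V" using evU family_Lipschitz
    proof eventually_elim
      case (elim i)
      let ?S = "{0..1} \<inter> ball s r"
      have "continuous_map (top_of_set ?S) X (P i)"
        using elim continuous_map_from_subtopology_mono[of euclidean "{0..1}" X "P i" ?S] by (auto simp: lift_def)
      moreover have "norm (v (P i x) - v (P i s)) < \<rho>" if "x \<in> ?S" for x
      proof -
        have "norm (v (P i x) - v (P i s)) \<le> Lam * \<bar>x - s\<bar>" using elim that q(3) by auto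
        also have "\<dots> < Lam * (\<rho> / Lam)"
          using that Lam_pos by (intro mult_strict_left_mono) (auto simp: r_def dist_real_def)
        finally show ?thesis using Lam_pos by simp
      qed
      moreover have "connected ?S" by (intro convex_connected convex_Int) auto
      ultimately have "P i t \<in> V"
        using elim t q(3) \<open>r > 0\<close> by (intro st(4)[rule_format, of ?S "P i" s t]) (auto simp: dist_real_def)
      then show ?case using elim by blast
    qed
    have "lim t q'"
      unfolding lim_def limitin_def
    proof (intro conjI allI impI)
      show "q' \<in> N" using q' V(1) openin_subset by blast
      fix W assume W: "openin X W \<and> q' \<in> W"
      have "seg y z t \<in> Cn e (V \<inter> W)" using mem_Cn[OF t(1)] q' W by (metis IntI image_eqI)
      then have "\<forall>\<^sub>F i in F. seg y (Y i) t \<in> Cn e (V \<inter> W)"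
        using tendsto_seg[OF Yz] opC W unfolding tendsto_def by blast
      then show "\<forall>\<^sub>F i in F. P i t \<in> W" using evV
      proof eventually_elim
        case (elim i)
        then have "hh e (P i t) \<in> hh e ` (V \<inter> W)" using mem_Cn_seg[of e "P i" y "Y i" t] t e by blast
        then show ?case using inj[OF e] elim VP by (auto simp: inj_on_def)
      qed
    qed
    then show "\<exists>q'\<in>U \<inter> Pos e. lim t q'" using q' V by blast
  qed
qed

text \<open>The times at which the lifts converge inside \<open>Pos e\<close>. By
  \<open>step\<close> this set is open in [0, 1], by \<open>closed_step\<close> it is closed under
  limits from the left, and it contains 0.\<close>

definition A where "A = {s\<in>{0..1}. \<exists>q\<in>Pos e. lim s q}"

definition path where "path s = (SOME q. q \<in> Pos e \<and> lim s q)"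

lemma pathI: assumes "s \<in> A" shows "path s \<in> Pos e" "lim s (path s)"
proof -
  have "\<exists>q. q \<in> Pos e \<and> lim s q" using assms unfolding A_def by blast
  from someI_ex[OF this] show "path s \<in> Pos e" "lim s (path s)" unfolding path_def by auto
qed

lemma path_domain_sub: "A \<subseteq> {0..1}" unfolding A_def by auto

lemma path_cont:
  assumes "S \<subseteq> A" shows "continuous_map (top_of_set S) X path"
  unfolding continuous_map_def
proof (intro conjI allI impI)
  show "path \<in> topspace (top_of_set S) \<rightarrow> N" using assms PosD(1)[OF pathI(1)] by auto
  fix U assume U: "openin X U"
  show "openin (top_of_set S) {x \<in> topspace (top_of_set S). path x \<in> U}"
    unfolding openin_euclidean_subtopology_iff
  proof (intro conjI ballI)
    fix s assume "s \<in> {x \<in> topspace (top_of_set S). path x \<in> U}"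
    then have s: "s \<in> S" "s \<in> A" "path s \<in> U" using assms by auto
    obtain r where r: "r > 0" "\<And>t. t \<in> {0..1} \<Longrightarrow> \<bar>t - s\<bar> < r \<Longrightarrow> \<exists>q'\<in>U \<inter> Pos e. lim t q'"
      using step[OF pathI(2,1)[OF s(2)] _ U s(3)] s(2) path_domain_sub by blast
    have "path t \<in> U" if t: "t \<in> S" "dist t s < r" for t
    proof -
      have "t \<in> A" using t assms by blast
      then have "t \<in> {0..1}" "\<bar>t - s\<bar> < r" using t path_domain_sub by (auto simp: dist_real_def)
      then obtain q' where "q' \<in> U" "lim t q'" using r(2)[of t] by blast
      then show ?thesis using lim_unique pathI(2)[OF \<open>t \<in> A\<close>] by metis
    qed
    then show "\<exists>e>0. \<forall>x'\<in>S. dist x' s < e \<longrightarrow> x' \<in> {x \<in> topspace (top_of_set S). path x \<in> U}"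
      using r(1) by auto
  qed auto
qed

lemma path_Lip:
  assumes "s \<in> A" "t \<in> A"
  shows "norm (v (path s) - v (path t)) \<le> Lam * \<bar>s - t\<bar>"
proof -
  have "((\<lambda>i. norm (v (P i s) - v (P i t))) \<longlongrightarrow> norm (v (path s) - v (path t))) F"
    using pathI(2)[OF assms(1)] pathI(2)[OF assms(2)] unfolding lim_def by (intro tendsto_intros limit_v)
  moreover have "\<forall>\<^sub>F i in F. norm (v (P i s) - v (P i t)) \<le> Lam * \<bar>s - t\<bar>"
    using family_Lipschitz by eventually_elim (use assms path_domain_sub in auto)
  ultimately show ?thesis by (rule tendsto_upperbound[OF _ _ F])
qed

text \<open>A version of \<open>stay\<close> for the whole family. The radius \<rho> depends neither
  on the time \<open>s\<close> nor on the limit \<open>q'\<close> in \<open>U'\<close>, so it can be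
  used at times that approach one at which convergence is still unknown.\<close>

lemma stay_near:
  assumes U: "openin X U" "q \<in> U"
  obtains \<rho> U' where "\<rho> > 0" "openin X U'" "q \<in> U'"
    "\<forall>s q'. s \<in> {0..1} \<longrightarrow> lim s q' \<longrightarrow> q' \<in> U' \<longrightarrow>
       (\<forall>\<^sub>F i in F. \<forall>t\<in>{0..1}. \<bar>t - s\<bar> < \<rho> \<longrightarrow> P i t \<in> U)"
proof -
  obtain \<rho> U' where st: "\<rho> > 0" "openin X U'" "q \<in> U'"
    "\<forall>S p s t. connected (S::real set) \<longrightarrow> continuous_map (top_of_set S) X p \<longrightarrow> s \<in> S \<longrightarrow> p s \<in> U' \<longrightarrow>
       (\<forall>r\<in>S. norm (v (p r) - v (p s)) < \<rho>) \<longrightarrow> t \<in> S \<longrightarrow> p t \<in> U"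
    by (rule stay[OF U])
  have main: "\<forall>\<^sub>F i in F. \<forall>t\<in>{0..1}. \<bar>t - s\<bar> < \<rho> / Lam \<longrightarrow> P i t \<in> U"
    if s: "s \<in> {0..1}" "lim s q'" "q' \<in> U'" for s q'
  proof -
    have "\<forall>\<^sub>F i in F. P i s \<in> U'" using st s by (simp add: lim_def limitin_def)
    then show ?thesis using family_Lipschitz
    proof eventually_elim
      case (elim i)
      show ?case
      proof (intro ballI impI)
        fix t :: real assume t: "t \<in> {0..1}" "\<bar>t - s\<bar> < \<rho> / Lam"
        let ?S = "{0..1} \<inter> ball s (\<rho> / Lam)"
        have "continuous_map (top_of_set ?S) X (P i)"
          using elim continuous_map_from_subtopology_mono[of euclidean "{0..1}" X "P i" ?S] by (auto simp: lift_def)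
        moreover have "norm (v (P i x) - v (P i s)) < \<rho>" if "x \<in> ?S" for x
        proof -
          have "norm (v (P i x) - v (P i s)) \<le> Lam * \<bar>x - s\<bar>" using elim that s(1) by auto
          also have "\<dots> < Lam * (\<rho> / Lam)"
            using that Lam_pos by (intro mult_strict_left_mono) (auto simp: dist_real_def)
          finally show ?thesis using Lam_pos by simp
        qed
        moreover have "connected ?S" by (intro convex_connected convex_Int) auto
        ultimately show "P i t \<in> U"
          using elim t s(1) st(1) Lam_pos by (intro st(4)[rule_format, of ?S "P i" s t]) (auto simp: dist_real_def)
      qed
    qed
  qed
  show thesis
    by (rule that[of "\<rho> / Lam" U']) (use st Lam_pos main in auto)
qed

text \<open>A chord point has norm at most 1. The height at time 0 is at most the factor there,
  which is 1 / \<open>norm (pr e (v p0))\<close>, and by \<open>lift_slope\<close> it changes by at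
  most 2 / c over the unit interval.\<close>

lemma kk_bounded: "\<forall>\<^sub>F i in F. \<forall>t\<in>{0..1}. kk e (P i) y (Y i) t \<le> 1 + (1 / norm (pr e (v p0)) + 2 / c)"
  using family_Lipschitz
proof eventually_elim
  case (elim i)
  show ?case
  proof
    fix t :: real assume t: "t \<in> {0..1}"
    have L: "lift e (P i) y (Y i)" using elim by blast
    let ?k = "kk e (P i) y (Y i)" and ?H = "\<lambda>t. kk e (P i) y (Y i) t * (v (P i t) \<bullet> e)"
    have "\<bar>?H t - ?H 0\<bar> \<le> 2 / c * \<bar>t - 0\<bar>"
      by (rule lift_slope[OF e L]) (use elim c p0 t in auto)
    also have "\<dots> \<le> 2 / c * 1" using t c by (intro mult_left_mono) auto
    finally have 1: "\<bar>?H t - ?H 0\<bar> \<le> 2 / c" by simp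
    have k0: "?k 0 = 1 / norm (pr e (v p0))" using elim y_facts by (simp add: kk_def)
    have "\<bar>v p0 \<bullet> e\<bar> \<le> 1"
      using Cauchy_Schwarz_ineq2[of "v p0" e] e norm_v[of p0] y_facts(3) PosD by auto
    then have "\<bar>?H 0\<bar> \<le> 1 / norm (pr e (v p0))"
      using elim k0 mult_left_le[of "\<bar>v p0 \<bullet> e\<bar>" "1 / norm (pr e (v p0))"] by (simp add: abs_mult)
    then have 2: "\<bar>?H t\<bar> \<le> 1 / norm (pr e (v p0)) + 2 / c" using 1 by linarith
    have "norm (seg y (Y i) t) \<le> norm ((1 - t) *\<^sub>R y) + norm (t *\<^sub>R Y i)"
      unfolding seg_def by (rule norm_triangle_ineq)
    also have "\<dots> = 1" using t L by (simp add: lift_def)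
    finally have 3: "norm (seg y (Y i) t) \<le> 1" .
    have "?k t = norm (seg y (Y i) t + ?H t *\<^sub>R e)"
      using lift_norm_kk(1)[OF e L t] lift_seg(2)[OF e L t] by metis
    also have "\<dots> \<le> norm (seg y (Y i) t) + norm (?H t *\<^sub>R e)" by (rule norm_triangle_ineq)
    finally show "?k t \<le> 1 + (1 / norm (pr e (v p0)) + 2 / c)" using 2 3 e by simp
  qed
qed

text \<open>Completeness gives a limit \<open>q\<close> of the limiting path at time
  \<open>t\<close>, and \<open>stay_near\<close> shows that the lifts converge to \<open>q\<close>
  at that time. What remains is that \<open>q\<close> does not fall on the boundary of
  \<open>Pos e\<close>.\<close>

lemma closed_step:
  assumes t: "0 < t" "t \<le> 1" and sub: "{0..<t} \<subseteq> A"
  shows "t \<in> A"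
proof -
  have t01: "t \<in> {0..1}" using t by simp
  have "\<exists>q. limitin X path q (at_left t)"
    by (rule path_complete[OF t(1) path_cont[OF sub], of Lam]) (use path_Lip sub in blast)
  then obtain q where q: "limitin X path q (at_left t)" by blast
  have near: "\<exists>s. 0 \<le> s \<and> s < t \<and> t - s < r \<and> (\<forall>x\<in>{s..<t}. path x \<in> U)" if "openin X U" "q \<in> U" "r > 0" for U r
  proof -
    have "\<forall>\<^sub>F s in at_left t. path s \<in> U" using q that by (simp add: limitin_def)
    then obtain b where b: "b < t" "\<And>s. b < s \<Longrightarrow> s < t \<Longrightarrow> path s \<in> U"
      unfolding eventually_at_left_field by blast
    define s where "s = max ((b + t)/2) (max (t - r/2) (t/2))"
    show ?thesis
      by (rule exI[of _ s]) (use b t that(3) in \<open>auto simp: s_def\<close>)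
  qed
  have qN: "q \<in> N" using q by (rule limitin_topspace)
  have lq: "lim t q"
    unfolding lim_def limitin_def
  proof (intro conjI allI impI)
    show "q \<in> N" by fact
    fix U assume "openin X U \<and> q \<in> U"
    then have U: "openin X U" "q \<in> U" by auto
    obtain \<rho> U' where st: "\<rho> > 0" "openin X U'" "q \<in> U'"
      "\<forall>s q'. s \<in> {0..1} \<longrightarrow> lim s q' \<longrightarrow> q' \<in> U' \<longrightarrow>
       (\<forall>\<^sub>F i in F. \<forall>t\<in>{0..1}. \<bar>t - s\<bar> < \<rho> \<longrightarrow> P i t \<in> U)"
      by (rule stay_near[OF U])
    obtain s where s: "0 \<le> s" "s < t" "t - s < \<rho>" "\<forall>x\<in>{s..<t}. path x \<in> U'"
      using near[OF st(2,3,1)] by blast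
    have "\<forall>\<^sub>F i in F. \<forall>t\<in>{0..1}. \<bar>t - s\<bar> < \<rho> \<longrightarrow> P i t \<in> U"
      by (rule st(4)[rule_format, of s "path s"]) (use s t sub pathI in auto)
    then show "\<forall>\<^sub>F i in F. P i t \<in> U" by eventually_elim (use t01 s in auto)
  qed
  have "((\<lambda>i. g (P i t) \<bullet> e) \<longlongrightarrow> g q \<bullet> e) F"
    by (intro tendsto_intros limit_g) (use lq in \<open>simp add: lim_def\<close>)
  moreover have "\<forall>\<^sub>F i in F. 0 \<le> g (P i t) \<bullet> e" using fam by eventually_elim (use liftD(3) t01 in force)
  ultimately have "g q \<bullet> e \<ge> 0" by (rule tendsto_lowerbound[OF _ _ F])
  \<comment> \<open>If g q is orthogonal to \<open>e\<close>, the affine function \<alpha> of the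
    chord does not see the heights and is a limit of positive multiples of
    \<open>g q \<bullet> v (P i r)\<close>. By local convexity it is nonnegative around
    \<open>t\<close>; it is 0 at \<open>t\<close> and positive at an earlier \<open>s\<close>. No
    affine function has all these properties, and there is room after \<open>t\<close> because the
    end points of the lifts satisfy \<open>g \<bullet> e \<ge> c\<close>.\<close>
  have "g q \<bullet> e \<noteq> 0"
  proof
    assume q0: "g q \<bullet> e = 0"
    have "t < 1"
    proof (rule ccontr)
      assume "\<not> t < 1"
      then have "t = 1" using t by simp
      then have "((\<lambda>i. g (P i 1) \<bullet> e) \<longlongrightarrow> g q \<bullet> e) F"
        by (intro tendsto_intros limit_g) (use lq in \<open>simp add: lim_def\<close>)
      moreover have "\<forall>\<^sub>F i in F. c \<le> g (P i 1) \<bullet> e" using fam by eventually_elim blast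
      ultimately have "c \<le> g q \<bullet> e" by (rule tendsto_lowerbound[OF _ _ F])
      then show False using q0 c by simp
    qed
    obtain V where V: "openin X V" "q \<in> V" "\<forall>x\<in>V. \<forall>y\<in>V. x \<noteq> y \<longrightarrow> g x \<bullet> v y > 0"
      using lsc[OF qN] by blast
    obtain \<rho> U' where st: "\<rho> > 0" "openin X U'" "q \<in> U'"
      "\<forall>s q'. s \<in> {0..1} \<longrightarrow> lim s q' \<longrightarrow> q' \<in> U' \<longrightarrow>
       (\<forall>\<^sub>F i in F. \<forall>t\<in>{0..1}. \<bar>t - s\<bar> < \<rho> \<longrightarrow> P i t \<in> V)"
      by (rule stay_near[OF V(1,2)])
    obtain s where s: "0 \<le> s" "s < t" "t - s < \<rho>" "\<forall>x\<in>{s..<t}. path x \<in> U' \<inter> V"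
      using near[of "U' \<inter> V" \<rho>] st V by blast
    have s01: "s \<in> {0..1}" "s \<in> A" using s t sub by auto
    have ev: "\<forall>\<^sub>F i in F. \<forall>t\<in>{0..1}. \<bar>t - s\<bar> < \<rho> \<longrightarrow> P i t \<in> V"
      by (rule st(4)[rule_format, of s "path s"]) (use s s01 pathI in auto)
    define \<alpha> where "\<alpha> r = g q \<bullet> seg y z r" for r
    have lim\<alpha>: "((\<lambda>i. g q \<bullet> seg y (Y i) r) \<longlongrightarrow> \<alpha> r) F" for r
      unfolding \<alpha>_def by (intro tendsto_intros tendsto_seg Yz)
    have eqi: "g q \<bullet> seg y (Y i) r = kk e (P i) y (Y i) r * (g q \<bullet> v (P i r))"
      if "lift e (P i) y (Y i)" "r \<in> {0..1}" for i r
      using arg_cong[OF lift_seg(2)[OF e that], of "\<lambda>w. g q \<bullet> w"] q0 by (simp add: inner_add_right)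
    have nonneg: "\<alpha> r \<ge> 0" if r: "r \<in> {0..1}" "\<bar>r - s\<bar> < \<rho>" for r
    proof -
      have "\<forall>\<^sub>F i in F. 0 \<le> g q \<bullet> seg y (Y i) r" using ev fam
      proof eventually_elim
        case (elim i)
        then have L: "lift e (P i) y (Y i)" by blast
        have "P i r \<noteq> q" using liftD(3)[OF L r(1)] q0 by auto
        then have "g q \<bullet> v (P i r) > 0" using V(2,3) elim(1) r by metis
        then show ?case unfolding eqi[OF L r(1)] using lift_seg(1)[OF e L r(1)] by simp
      qed
      then show ?thesis by (rule tendsto_lowerbound[OF lim\<alpha> _ F])
    qed
    have at: "\<alpha> t = 0"
    proof -
      \<comment> \<open>The factor in front of \<open>g q \<bullet> v (P i t)\<close> depends on
        \<open>i\<close>; its uniform bound from \<open>kk_bounded\<close> is what carries the limit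
        0 over to \<alpha>.\<close>
      define M where "M = 1 + (1 / norm (pr e (v p0)) + 2 / c)"
      have "((\<lambda>i. g q \<bullet> v (P i t)) \<longlongrightarrow> g q \<bullet> v q) F"
        by (intro tendsto_intros limit_v) (use lq in \<open>simp add: lim_def\<close>)
      then have "((\<lambda>i. M * \<bar>g q \<bullet> v (P i t)\<bar>) \<longlongrightarrow> M * \<bar>0\<bar>) F"
        using perp[OF qN] by (intro tendsto_intros) simp
      then have *: "((\<lambda>i. M * \<bar>g q \<bullet> v (P i t)\<bar>) \<longlongrightarrow> 0) F" by simp
      have "\<forall>\<^sub>F i in F. norm (g q \<bullet> seg y (Y i) t) \<le> M * \<bar>g q \<bullet> v (P i t)\<bar>"
        using kk_bounded fam
      proof eventually_elim
        case (elim i)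
        then have L: "lift e (P i) y (Y i)" by blast
        have "kk e (P i) y (Y i) t \<le> M" using elim t01 by (auto simp: M_def)
        then show ?case unfolding eqi[OF L t01] using lift_seg(1)[OF e L t01]
          by (simp add: abs_mult mult_right_mono)
      qed
      then have "((\<lambda>i. g q \<bullet> seg y (Y i) t) \<longlongrightarrow> 0) F" using * by (rule Lim_null_comparison)
      then show ?thesis by (rule tendsto_unique[OF F lim\<alpha>])
    qed
    have as: "\<alpha> s > 0"
    proof -
      have ps: "path s \<in> V" "path s \<in> Pos e" using s s01 pathI by auto
      then have "path s \<noteq> q" using q0 PosD(2)[of "path s" e] by auto
      then have pos: "g q \<bullet> v (path s) > 0" using V ps by metis
      have "sgn (seg y z s) = sgn (pr e (v (path s)))"
        using lim_hh[OF pathI(2)[OF s01(2)] ps(2) s01(1)] by (simp add: hh_def)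
      then obtain \<mu> where "\<mu> > 0" "seg y z s = \<mu> *\<^sub>R pr e (v (path s))"
        using sgn_eq_imp_scale pr_v_nz[OF e ps(2)] by blast
      then show ?thesis using pos q0 by (simp add: \<alpha>_def inner_pr)
    qed
    \<comment> \<open>A time after \<open>t\<close> that is still within \<rho> of \<open>s\<close>,
      capped at 1.\<close>
    define r where "r = min 1 ((t + (s + \<rho>)) / 2)"
    have r0: "t < r" "r \<le> 1" using s t \<open>t < 1\<close> by (auto simp: r_def)
    have "r \<le> (t + (s + \<rho>)) / 2" unfolding r_def by (rule min.cobounded2)
    then have "r * 2 \<le> t + (s + \<rho>)" by simp
    moreover have "t < s + \<rho>" using s(3) by simp
    ultimately have "r * 2 < (s + \<rho>) * 2" by simp
    then have "\<bar>r - s\<bar> < \<rho>" using r0(1) s(2) by simp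
    then have r: "r \<in> {0..1}" "t < r" "\<bar>r - s\<bar> < \<rho>" using r0 t by auto
    have aff: "\<alpha> x = g q \<bullet> y + x * (g q \<bullet> (z - y))" for x by (simp add: \<alpha>_def seg_affine inner_add_right)
    define b where "b = g q \<bullet> (z - y)"
    have "\<alpha> t - \<alpha> s = (t - s) * b" "\<alpha> r - \<alpha> t = (r - t) * b" unfolding aff b_def by (simp_all add: algebra_simps)
    then have "(t - s) * b < 0" "(r - t) * b \<ge> 0" using as at nonneg[OF r(1,3)] by simp_all
    then show False using s r by (auto simp: mult_less_0_iff zero_le_mult_iff)
  qed
  then have "q \<in> Pos e" using \<open>g q \<bullet> e \<ge> 0\<close> qN by (simp add: Pos_def)
  then show ?thesis using lq t01 unfolding A_def by blast
qed

lemma zero_path_domain: "0 \<in> A"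
proof -
  have "lim 0 p0" unfolding lim_def
  proof (rule limitin_transform_eventually)
    show "\<forall>\<^sub>F i in F. p0 = P i 0" using fam by eventually_elim simp
    show "limitin X (\<lambda>i. p0) p0 F" using y_facts(3) PosD by simp
  qed
  then show ?thesis using y_facts(3) unfolding A_def by auto
qed

lemma path_domain_all: "A = {0..1}"
proof (rule ccontr)
  define B where "B = {0..1} - A"
  assume "A \<noteq> {0..1}"
  then have ne: "B \<noteq> {}" using path_domain_sub by (auto simp: B_def)
  have bdd: "bdd_below B" by (rule bdd_belowI[of _ 0]) (auto simp: B_def)
  define t where "t = Inf B"
  have t01: "t \<in> {0..1}"
  proof -
    obtain b where b: "b \<in> B" using ne by blast
    have "t \<le> b" unfolding t_def by (rule cInf_lower[OF b bdd])
    moreover have "0 \<le> t" unfolding t_def by (rule cInf_greatest[OF ne]) (auto simp: B_def)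
    ultimately show ?thesis using b by (auto simp: B_def)
  qed
  have lo: "{0..<t} \<subseteq> A"
  proof
    fix s assume s: "s \<in> {0..<t}"
    then have "s \<notin> B" using cInf_lower[OF _ bdd, of s] by (auto simp: t_def)
    then show "s \<in> A" using s t01 by (auto simp: B_def)
  qed
  have tA: "t \<in> A"
  proof (cases "t = 0")
    case True then show ?thesis using zero_path_domain by simp
  next
    case False then show ?thesis using closed_step[of t] lo t01 by auto
  qed
  obtain r where r: "r > 0" "\<And>x. x \<in> {0..1} \<Longrightarrow> \<bar>x - t\<bar> < r \<Longrightarrow> \<exists>q'\<in>N \<inter> Pos e. lim x q'"
    using step[OF pathI(2,1)[OF tA] t01, of N] PosD(1)[OF pathI(1)[OF tA]] by blast
  have "t + r \<le> Inf B"
  proof (rule cInf_greatest[OF ne])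
    fix b assume b: "b \<in> B"
    then have "t \<le> b" unfolding t_def by (rule cInf_lower[OF _ bdd])
    show "t + r \<le> b"
    proof (rule ccontr)
      assume "\<not> t + r \<le> b"
      then have "\<exists>q'\<in>N \<inter> Pos e. lim b q'" using r(2)[of b] b \<open>t \<le> b\<close> by (auto simp: B_def)
      then have "b \<in> A" using b unfolding A_def B_def by blast
      then show False using b by (simp add: B_def)
    qed
  qed
  then show False using r by (simp add: t_def)
qed

lemma lift_limit:
  "lift e path y z" "path 0 = p0" "\<And>s. s \<in> {0..1} \<Longrightarrow> limitin X (\<lambda>i. P i s) (path s) F"
proof -
  show lim: "limitin X (\<lambda>i. P i s) (path s) F" if "s \<in> {0..1}" for s
    using pathI(2)[of s] that path_domain_all by (simp add: lim_def)
  have "limitin X (\<lambda>i. P i 0) p0 F"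
  proof (rule limitin_transform_eventually)
    show "\<forall>\<^sub>F i in F. p0 = P i 0" using fam by eventually_elim simp
    show "limitin X (\<lambda>i. p0) p0 F" using y_facts(3) PosD by simp
  qed
  then show "path 0 = p0" using limitin_Hausdorff_unique[OF lim[of 0] _ F haus] by simp
  show "lift e path y z"
    unfolding lift_def using y_facts norm_z zy z_perp path_cont[of "{0..1}"] pathI path_domain_all lim_hh by auto
qed

end

section \<open>Connectedness after removal of a discrete set\<close>

lemma connectedin_splitD:
  assumes "connectedin X S" "openin X E1" "openin X E2" "S \<subseteq> E1 \<union> E2" "E1 \<inter> E2 \<inter> S = {}"
  shows "E1 \<inter> S = {} \<or> E2 \<inter> S = {}"
  using assms unfolding connectedin by meson

text \<open>A separation of S - D extends to S: the punctured neighbourhood of a removed point is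
  connected, so it lies on one side, and the point joins that side. It will be applied to the points
  whose direction is antipodal to a given one.\<close>

lemma connectedin_remove_discrete:
  assumes con: "connectedin X S" and S: "openin X S"
    and D: "openin X (S - D)"
    and nb: "\<And>d. d \<in> S \<inter> D \<Longrightarrow> \<exists>V. openin X V \<and> d \<in> V \<and> V \<subseteq> S \<and> V \<inter> D = {d} \<and> connectedin X (V - {d}) \<and> V - {d} \<noteq> {}"
  shows "connectedin X (S - D)"
proof (rule ccontr)
  assume "\<not> connectedin X (S - D)"
  moreover have "S - D \<subseteq> topspace X" using openin_subset[OF D] .
  ultimately obtain E1 E2 where E: "openin X E1" "openin X E2" "S - D \<subseteq> E1 \<union> E2"
    "E1 \<inter> E2 \<inter> (S - D) = {}" "E1 \<inter> (S - D) \<noteq> {}" "E2 \<inter> (S - D) \<noteq> {}"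
    unfolding connectedin by blast
  obtain V where V: "\<And>d. d \<in> S \<inter> D \<Longrightarrow> openin X (V d) \<and> d \<in> V d \<and> V d \<subseteq> S \<and> V d \<inter> D = {d} \<and> connectedin X (V d - {d}) \<and> V d - {d} \<noteq> {}"
    using nb by metis
  define B where "B E = (E \<inter> (S - D)) \<union> \<Union>{V d |d. d \<in> S \<inter> D \<and> V d - {d} \<subseteq> E}" for E
  have Vsub: "V d - {d} \<subseteq> S - D" if "d \<in> S \<inter> D" for d using V[OF that] by blast
  have one: "V d - {d} \<subseteq> E1 \<or> V d - {d} \<subseteq> E2" if "d \<in> S \<inter> D" for d
  proof -
    have c: "connectedin X (V d - {d})" using V[OF that] by blast
    have "E1 \<inter> (V d - {d}) = {} \<or> E2 \<inter> (V d - {d}) = {}"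
    proof (rule connectedin_splitD[OF c E(1,2)])
      show "V d - {d} \<subseteq> E1 \<union> E2" using E(3) Vsub[OF that] by (rule subset_trans[rotated])
      show "E1 \<inter> E2 \<inter> (V d - {d}) = {}" using E(4) Vsub[OF that] by blast
    qed
    then show ?thesis using E(3) Vsub[OF that] by blast
  qed
  have opB: "openin X (B E)" if "openin X E" for E
    unfolding B_def using that D V by (intro openin_Un openin_Int openin_Union) auto
  have cover: "S \<subseteq> B E1 \<union> B E2"
  proof
    fix x assume x: "x \<in> S"
    show "x \<in> B E1 \<union> B E2"
    proof (cases "x \<in> D")
      case True
      then show ?thesis using one[of x] V[of x] x unfolding B_def by blast
    next
      case False
      then show ?thesis using x E(3) unfolding B_def by blast
    qed
  qed
  have "B E1 \<inter> B E2 \<inter> S = {}"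
  proof (rule ccontr)
    assume "B E1 \<inter> B E2 \<inter> S \<noteq> {}"
    then obtain x where x: "x \<in> B E1" "x \<in> B E2" "x \<in> S" by blast
    have key: "x \<in> E" if "x \<in> B E" "x \<notin> D" for E using that Vsub unfolding B_def by blast
    have key2: "V x - {x} \<subseteq> E" if asm: "x \<in> B E" "x \<in> D" for E
    proof -
      obtain d where d: "d \<in> S \<inter> D" "V d - {d} \<subseteq> E" "x \<in> V d" using asm unfolding B_def by auto
      then have "x = d" using V[OF d(1)] \<open>x \<in> D\<close> by blast
      then show ?thesis using d by blast
    qed
    show False
    proof (cases "x \<in> D")
      case True
      then have "V x - {x} \<subseteq> E1" "V x - {x} \<subseteq> E2" using key2 x by auto
      then show False using V[of x] True x Vsub[of x] E(4) by blast
    next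
      case False
      then show False using key x E(4) by blast
    qed
  qed
  moreover have "B E1 \<inter> S \<noteq> {}" "B E2 \<inter> S \<noteq> {}" using E(5,6) unfolding B_def by blast+
  ultimately show False using connectedin_splitD[OF con opB[OF E(1)] opB[OF E(2)] cover] by simp
qed

lemma (in lift_family) lift_limit_ex:
  "\<exists>p. lift e p y z \<and> p 0 = p0 \<and> (\<forall>s\<in>{0..1}. limitin X (\<lambda>i. P i s) (p s) F)"
  using lift_limit by blast

lemma vec_eq_neg: "(x::'e::real_vector) = - x \<Longrightarrow> x = 0"
  by (metis add.right_inverse scaleR_2 scaleR_eq_0_iff zero_neq_numeral)

context convex_pair begin

text \<open>On the compact image \<open>K\<close> of the lift \<open>hh e\<close> is injective, and
  it is locally injective, so it is injective on a neighbourhood \<open>W\<close> of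
  \<open>K\<close>, with a continuous inverse by \<open>open_Cn\<close>. Chords from
  \<open>y\<close> to points near \<open>z\<close> remain over \<open>W\<close>, and the inverse
  lifts them.\<close>

lemma lift_open:
  assumes e: "norm e = 1" and L: "lift e p y z"
  obtains U where "openin X U" "p 1 \<in> U"
    "\<forall>q'\<in>U. \<exists>p'. lift e p' y (hh e q') \<and> p' 0 = p 0 \<and> p' 1 = q'"
proof -
  define K where "K = p ` {0..1}"
  have cp: "continuous_map (top_of_set {0..1}) X p" using L by (simp add: lift_def)
  have K: "compactin X K" unfolding K_def
    by (rule image_compactin[OF _ cp]) (simp add: compactin_subtopology)
  have KP: "K \<subseteq> Pos e" using liftD(1)[OF L] by (auto simp: K_def)
  \<comment> \<open>Union of the open boxes A \<times> B on which equal directions imply equal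
    points. It contains K \<times> K, so by the tube lemma it contains an open box around K \<times>
    K.\<close>
  define WW where "WW = \<Union>{A \<times> B |A B. openin X A \<and> openin X B \<and> A \<subseteq> Pos e \<and> B \<subseteq> Pos e \<and> (\<forall>x\<in>A. \<forall>x'\<in>B. hh e x = hh e x' \<longrightarrow> x = x')}"
  have "openin (prod_topology X X) WW"
    unfolding WW_def by (rule openin_Union) (auto simp: openin_prod_Times_iff)
  moreover have "K \<times> K \<subseteq> WW"
  proof clarify
    fix a b assume ab: "a \<in> K" "b \<in> K"
    have aP: "a \<in> Pos e" "b \<in> Pos e" using ab KP by auto
    have "\<exists>A B. openin X A \<and> openin X B \<and> A \<subseteq> Pos e \<and> B \<subseteq> Pos e \<and> (\<forall>x\<in>A. \<forall>x'\<in>B. hh e x = hh e x' \<longrightarrow> x = x') \<and> a \<in> A \<and> b \<in> B"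
    proof (cases "a = b")
      case True
      obtain V where V: "openin X V" "a \<in> V" "V \<subseteq> Pos e" "\<And>e. norm e = 1 \<Longrightarrow> inj_on (hh e) (V \<inter> Pos e)"
        using good_nbhd[OF open_Pos aP(1)] by metis
      then show ?thesis using True e by (intro exI[of _ V]) (auto simp: inj_on_def)
    next
      case False
      obtain s t where st: "s \<in> {0..1}" "t \<in> {0..1}" "a = p s" "b = p t" using ab by (auto simp: K_def)
      have "hh e a \<noteq> hh e b"
      proof
        assume eq: "hh e a = hh e b"
        show False
        proof (cases "y = z")
          case True
          then show False using lift_const[OF e] L st False by metis
        next
          case yz: False
          have "sgn (seg y z s) = sgn (seg y z t)" using eq liftD(4)[OF L] st by metis
          moreover have "norm y = 1" "norm z = 1" "z \<noteq> -y" using L by (auto simp: lift_def)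
          ultimately have "s = t" using sgn_seg_inj[of y z s t] yz st by metis
          then show False using False st by simp
        qed
      qed
      then obtain S1 S2 where S: "open S1" "open S2" "hh e a \<in> S1" "hh e b \<in> S2" "S1 \<inter> S2 = {}"
        using hausdorff by metis
      show ?thesis
        by (rule exI[of _ "{x \<in> Pos e. hh e x \<in> S1}"], rule exI[of _ "{x \<in> Pos e. hh e x \<in> S2}"])
          (use S aP open_hh[OF e] in auto)
    qed
    then show "(a, b) \<in> WW" unfolding WW_def by blast
  qed
  ultimately obtain U1 V1 where UV: "openin X U1" "openin X V1" "K \<subseteq> U1" "K \<subseteq> V1" "U1 \<times> V1 \<subseteq> WW"
    using Wallace_theorem_prod_topology[OF K K] by metis
  define W where "W = U1 \<inter> V1 \<inter> Pos e"
  have W: "openin X W" "K \<subseteq> W" "W \<subseteq> Pos e" using UV KP open_Pos by (auto simp: W_def)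
  have inj: "inj_on (hh e) W"
  proof (rule inj_onI)
    fix x x' assume x: "x \<in> W" "x' \<in> W" "hh e x = hh e x'"
    then have "(x, x') \<in> WW" using UV(5) by (auto simp: W_def)
    then show "x = x'" using x(3) unfolding WW_def by blast
  qed
  have opC: "open (Cn e (W \<inter> O'))" if "openin X O'" for O'
    by (rule open_Cn[OF e]) (use W that in auto)
  have "compact (seg y z ` {0..1})"
    by (intro compact_continuous_image continuous_on_seg continuous_on_id) auto
  moreover have "seg y z ` {0..1} \<subseteq> Cn e W"
    using mem_Cn_seg[OF L _ e] W(2) unfolding K_def by blast
  ultimately obtain \<eta> where \<eta>: "\<eta> > 0" "(\<Union>x\<in>seg y z ` {0..1}. ball x \<eta>) \<subseteq> Cn e W"
    using compact_subset_open_imp_ball_epsilon_subset open_Cn[OF e W(1,3)] by metis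
  \<comment> \<open>Moving the end point by less than \<eta> moves every point of the chord by less
    than \<eta>. The direction - y is excluded because it does not determine an arc from
    \<open>y\<close>.\<close>
  define U where "U = W \<inter> {q \<in> Pos e. hh e q \<in> ball z \<eta> - {- y}}"
  have p0: "p 0 \<in> W" "p 1 \<in> W" using W(2) by (auto simp: K_def)
  have y1: "norm y = 1" "norm z = 1" "z \<noteq> - y" "y \<bullet> e = 0" using L by (auto simp: lift_def)
  have h01: "hh e (p 0) = y" "hh e (p 1) = z"
    using liftD(4)[OF L, of 0] liftD(4)[OF L, of 1] y1 by (simp_all add: sgn_div_norm)
  show thesis
  proof (rule that[of U])
    show "openin X U" unfolding U_def
      by (intro openin_Int W open_hh e open_Diff) auto
    show "p 1 \<in> U" using p0 h01 y1 W(3) \<eta>(1) by (auto simp: U_def)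
    show "\<forall>q'\<in>U. \<exists>p'. lift e p' y (hh e q') \<and> p' 0 = p 0 \<and> p' 1 = q'"
    proof
      fix q' assume q': "q' \<in> U"
      define z' where "z' = hh e q'"
      have z': "norm z' = 1" "z' \<noteq> - y" "z' \<bullet> e = 0" "dist z z' < \<eta>" "q' \<in> W"
        using q' norm_hh[OF e] hh_perp[OF e] by (auto simp: U_def z'_def)
      have nz: "seg y z' s \<noteq> 0" "pr e (seg y z' s) = seg y z' s" if "s \<in> {0..1}" for s
        using seg_nonzero[OF y1(1) z'(1,2)] that y1(4) z'(3)
        by (auto intro!: pr_eqI simp: seg_def inner_add_left)
      have inC: "seg y z' s \<in> Cn e W" if s: "s \<in> {0..1}" for s
      proof -
        have "dist (seg y z s) (seg y z' s) = s * dist z z'"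
          using s by (simp add: seg_def dist_norm scaleR_diff_right[symmetric])
        also have "\<dots> \<le> dist z z'" using s by (simp add: mult_left_le_one_le)
        finally have "seg y z' s \<in> ball (seg y z s) \<eta>" using z'(4) by simp
        then show ?thesis using \<eta>(2) s by blast
      qed
      define p' where "p' s = inv_into W (hh e) (sgn (seg y z' s))" for s
      have im: "sgn (seg y z' s) \<in> hh e ` W" if "s \<in> {0..1}" for s
        using inC[OF that] nz[OF that] by (simp add: Cn_def)
      have p': "p' s \<in> W" "hh e (p' s) = sgn (seg y z' s)" if "s \<in> {0..1}" for s
        using im[OF that] unfolding p'_def by (auto intro: inv_into_into f_inv_into_f)
      have cont: "continuous_map (top_of_set {0..1}) X p'"
        unfolding continuous_map_def
      proof (intro conjI allI impI)
        show "p' \<in> topspace (top_of_set {0..1}) \<rightarrow> N" using p'(1) openin_subset[OF W(1)] by auto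
        fix O' assume O': "openin X O'"
        have "{s \<in> topspace (top_of_set {0..1}). p' s \<in> O'} = {0..1} \<inter> seg y z' -` Cn e (W \<inter> O')"
        proof (intro set_eqI iffI)
          fix s assume s: "s \<in> {s \<in> topspace (top_of_set {0..1}). p' s \<in> O'}"
          then have "sgn (seg y z' s) \<in> hh e ` (W \<inter> O')" using p'[of s] by (metis (no_types, lifting) IntI image_eqI mem_Collect_eq topspace_euclidean_subtopology)
          then show "s \<in> {0..1} \<inter> seg y z' -` Cn e (W \<inter> O')" using s nz[of s] by (simp add: Cn_def)
        next
          fix s assume s: "s \<in> {0..1} \<inter> seg y z' -` Cn e (W \<inter> O')"
          then obtain x where x: "x \<in> W \<inter> O'" "hh e x = sgn (seg y z' s)" using nz[of s] by (auto simp: Cn_def)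
          then have "p' s = x" using inj_onD[OF inj, of "p' s" x] p'[of s] s by auto
          then show "s \<in> {s \<in> topspace (top_of_set {0..1}). p' s \<in> O'}" using x s by auto
        qed
        moreover have "openin (top_of_set {0..1}) ({0..1} \<inter> seg y z' -` Cn e (W \<inter> O'))"
          by (intro continuous_openin_preimage_gen continuous_on_seg continuous_on_id opC O')
        ultimately show "openin (top_of_set {0..1}) {s \<in> topspace (top_of_set {0..1}). p' s \<in> O'}" by simp
      qed
      have "lift e p' y z'"
        unfolding lift_def using y1 z' cont p' W(3) by blast
      moreover have "p' 0 = p 0"
        using inj_onD[OF inj, of "p' 0" "p 0"] p'[of 0] p0 h01 y1 by (simp add: sgn_div_norm)
      moreover have "p' 1 = q'"
        using inj_onD[OF inj, of "p' 1" q'] p'[of 1] z' z'_def by (simp add: sgn_div_norm)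
      ultimately show "\<exists>p'. lift e p' y (hh e q') \<and> p' 0 = p 0 \<and> p' 1 = q'" unfolding z'_def by blast
    qed
  qed
qed

text \<open>The points that are reached from \<open>p0\<close> by lifting the arc to their own
  direction. For these, \<open>lift_nonneg\<close> gives convexity with respect to \<open>p0\<close>
  and \<open>lift_const\<close> gives injectivity of the direction.\<close>

definition Good :: "'e \<Rightarrow> 'p \<Rightarrow> 'p set" where
  "Good e p0 = {q. \<exists>p. lift e p (hh e p0) (hh e q) \<and> p 0 = p0 \<and> p 1 = q}"

lemma Good_nonneg:
  assumes e: "norm e = 1" and q: "q \<in> Good e p0"
  shows "g p0 \<bullet> v q \<ge> 0" "g q \<bullet> v p0 \<ge> 0"
proof -
  obtain p where "lift e p (hh e p0) (hh e q)" "p 0 = p0" "p 1 = q" using q by (auto simp: Good_def)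
  then show "g p0 \<bullet> v q \<ge> 0" "g q \<bullet> v p0 \<ge> 0"
    using lift_nonneg[OF e, of p _ _ 0 1] lift_nonneg[OF e, of p _ _ 1 0] by auto
qed

lemma Good_inj:
  assumes e: "norm e = 1" and q: "q \<in> Good e p0" "hh e q = hh e p0"
  shows "q = p0"
proof -
  obtain p where "lift e p (hh e p0) (hh e q)" "p 0 = p0" "p 1 = q" using q by (auto simp: Good_def)
  then show ?thesis using lift_const[OF e, of p _ 0 1] q(2) by auto
qed

lemma Good_refl:
  assumes e: "norm e = 1" and p0: "p0 \<in> Pos e" shows "p0 \<in> Good e p0"
proof -
  have "lift e (\<lambda>_. p0) (hh e p0) (hh e p0)"
    unfolding lift_def using norm_hh[OF e p0] hh_perp[OF e] p0 PosD[OF p0]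
    by (auto simp: seg_affine sgn_div_norm dest: vec_eq_neg)
  then show ?thesis unfolding Good_def by blast
qed

lemma Good_open:
  assumes e: "norm e = 1" shows "openin X (Good e p0)"
proof (subst openin_subopen, intro ballI)
  fix q assume "q \<in> Good e p0"
  then obtain p where p: "lift e p (hh e p0) (hh e q)" "p 0 = p0" "p 1 = q" by (auto simp: Good_def)
  obtain U where "openin X U" "p 1 \<in> U"
    "\<forall>q'\<in>U. \<exists>p'. lift e p' (hh e p0) (hh e q') \<and> p' 0 = p 0 \<and> p' 1 = q'"
    by (rule lift_open[OF e p(1)])
  then show "\<exists>T. openin X T \<and> q \<in> T \<and> T \<subseteq> Good e p0" using p by (intro exI[of _ U]) (auto simp: Good_def)
qed

lemma Good_sub:
  assumes "norm e = 1" shows "Good e p0 \<subseteq> {q \<in> Pos e. hh e q \<noteq> - hh e p0}"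
proof
  fix q assume "q \<in> Good e p0"
  then obtain p where p: "lift e p (hh e p0) (hh e q)" "p 0 = p0" "p 1 = q" by (auto simp: Good_def)
  then show "q \<in> {q \<in> Pos e. hh e q \<noteq> - hh e p0}" using liftD(1)[OF p(1), of 1] by (auto simp: lift_def)
qed

text \<open>The lifts that reach the \<open>Q i\<close> form a \<open>lift_family\<close>, and the
  end point of the limiting lift is a limit of the \<open>Q i\<close>. The bound on
  \<open>g \<bullet> e\<close> along the \<open>Q i\<close> keeps them away from the boundary of
  \<open>Pos e\<close>; existence of the limit is a conclusion.\<close>

lemma Good_limit:
  assumes e: "norm e = 1" and F: "F \<noteq> bot" and c: "c > 0" and p0: "p0 \<in> Pos e"
    and ev: "\<forall>\<^sub>F i in F. Q i \<in> Good e p0 \<and> g (Q i) \<bullet> e \<ge> c"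
    and z: "((\<lambda>i. hh e (Q i)) \<longlongrightarrow> z) F" "z \<noteq> - hh e p0"
  obtains q where "q \<in> Good e p0" "limitin X Q q F" "hh e q = z"
proof -
  define P where "P i = (SOME p. lift e p (hh e p0) (hh e (Q i)) \<and> p 0 = p0 \<and> p 1 = Q i)" for i
  have P: "lift e (P i) (hh e p0) (hh e (Q i)) \<and> P i 0 = p0 \<and> P i 1 = Q i" if "Q i \<in> Good e p0" for i
    using that someI_ex[of "\<lambda>p. lift e p (hh e p0) (hh e (Q i)) \<and> p 0 = p0 \<and> p 1 = Q i"]
    unfolding P_def Good_def by blast
  define c' where "c' = min c (g p0 \<bullet> e)"
  have c': "c' > 0" "c' \<le> c" "c' \<le> g p0 \<bullet> e" using c PosD(2)[OF p0] by (auto simp: c'_def)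
  have lf: "lift_family TYPE('a) X g v F P (\<lambda>i. hh e (Q i)) e (hh e p0) z p0 c'"
  proof (intro lift_family.intro convex_pair_axioms lift_family_axioms.intro)
    show "\<forall>\<^sub>F i in F. lift e (P i) (hh e p0) (hh e (Q i)) \<and> P i 0 = p0 \<and> c' \<le> g (P i 1) \<bullet> e"
      using ev by eventually_elim (use P c' in force)
  qed (use e F c' z in auto)
  obtain p where p: "lift e p (hh e p0) z" "p 0 = p0" "\<forall>s\<in>{0..1}. limitin X (\<lambda>i. P i s) (p s) F"
    using lift_family.lift_limit_ex[OF lf] by blast
  have l1: "limitin X (\<lambda>i. P i 1) (p 1) F" using p(3) by simp
  have l2: "limitin X Q (p 1) F"
  proof (rule limitin_transform_eventually[OF _ l1])
    show "\<forall>\<^sub>F i in F. P i 1 = Q i" using ev by eventually_elim (use P in blast)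
  qed
  have h: "hh e (p 1) = z" using liftD(4)[OF p(1), of 1] p(1) by (simp add: sgn_div_norm lift_def)
  then have "p 1 \<in> Good e p0" using p(1,2) unfolding Good_def by blast
  then show thesis using that l2 h by blast
qed

definition near :: "'p \<Rightarrow> 'p set \<Rightarrow> 'p filter" where
  "near q S = inf (nhdsin X q) (principal S)"

lemma eventually_near: "q \<in> N \<Longrightarrow> eventually P (near q S) \<longleftrightarrow> (\<exists>U. openin X U \<and> q \<in> U \<and> (\<forall>x\<in>U \<inter> S. P x))"
  unfolding near_def eventually_inf_principal eventually_nhdsin by auto

lemma near_nontrivial:
  assumes "q \<in> X closure_of S" shows "near q S \<noteq> bot"
proof
  assume b: "near q S = bot"
  have q: "q \<in> N" using assms closure_of_subset_topspace by fast
  have "eventually (\<lambda>_. False) (near q S)" using b by simp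
  then show False using assms unfolding eventually_near[OF q] in_closure_of by blast
qed

lemma limit_near: "q \<in> N \<Longrightarrow> limitin X (\<lambda>x. x) q (near q S)"
  unfolding limitin_def using eventually_near by blast

lemma Good_closed:
  assumes e: "norm e = 1" and p0: "p0 \<in> Pos e" and q: "q \<in> Pos e" "hh e q \<noteq> - hh e p0"
    and cl: "q \<in> X closure_of (Good e p0)"
  shows "q \<in> Good e p0"
proof -
  define c where "c = g q \<bullet> e / 2"
  have c: "c > 0" "c < g q \<bullet> e" using PosD[OF q(1)] by (auto simp: c_def)
  let ?F = "near q (Good e p0)"
  have qN: "q \<in> N" using q PosD by blast
  have ev: "\<forall>\<^sub>F i in ?F. i \<in> Good e p0 \<and> c \<le> g i \<bullet> e"
    unfolding eventually_near[OF qN]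
    by (rule exI[of _ "{p \<in> N. g p \<bullet> e > c}"]) (use open_inner_g c qN in auto)
  have "((\<lambda>i. hh e i) \<longlongrightarrow> hh e q) ?F"
    by (rule limit_hh[OF e limit_near[OF qN] q(1)])
  from Good_limit[OF e near_nontrivial[OF cl] c(1) p0 ev this q(2)]
  obtain q' where q': "q' \<in> Good e p0" "limitin X (\<lambda>x. x) q' ?F" by metis
  have "q' = q" using limitin_Hausdorff_unique[OF q'(2) limit_near[OF qN] near_nontrivial[OF cl] haus] .
  then show ?thesis using q' by simp
qed

text \<open>\<open>Good e p0\<close> is open and, away from the directions antipodal to that of
  \<open>p0\<close>, closed. The antipodal points form a discrete set since \<open>hh e\<close> is
  locally injective, so the rest of \<open>S\<close> is connected and contained in
  \<open>Good e p0\<close>.\<close>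

lemma Good_all:
  assumes e: "norm e = 1" and S: "connectedin X S" "openin X S" "S \<subseteq> Pos e" and p0: "p0 \<in> S"
    and q: "q \<in> S" "hh e q \<noteq> - hh e p0"
  shows "q \<in> Good e p0"
proof -
  define D where "D = {x. hh e x = - hh e p0}"
  have p0P: "p0 \<in> Pos e" using S p0 by blast
  have SD: "S - D = S \<inter> {x \<in> Pos e. hh e x \<in> - {- hh e p0}}" using S by (auto simp: D_def)
  have opSD: "openin X (S - D)" unfolding SD by (intro openin_Int S open_hh e) auto
  have con: "connectedin X (S - D)"
  proof (rule connectedin_remove_discrete[OF S(1,2) opSD])
    fix d assume d: "d \<in> S \<inter> D"
    obtain V where V: "openin X V" "d \<in> V" "V \<subseteq> S" "connectedin X (V - {d})" "V - {d} \<noteq> {}" "\<And>e. norm e = 1 \<Longrightarrow> inj_on (hh e) (V \<inter> Pos e)"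
      using good_nbhd[OF S(2)] d by (metis IntD1)
    have "x = d" if "x \<in> V" "x \<in> D" for x
      using inj_onD[OF V(6)[OF e], of x d] V S d that by (auto simp: D_def)
    then have "V \<inter> D = {d}" using V d by blast
    then show "\<exists>V. openin X V \<and> d \<in> V \<and> V \<subseteq> S \<and> V \<inter> D = {d} \<and> connectedin X (V - {d}) \<and> V - {d} \<noteq> {}"
      using V by blast
  qed
  have "hh e p0 \<noteq> - hh e p0"
  proof
    assume "hh e p0 = - hh e p0"
    then have "hh e p0 = 0" by (rule vec_eq_neg)
    then show False using norm_hh[OF e p0P] by simp
  qed
  then have p0SD: "p0 \<in> S - D" using p0 by (simp add: D_def)
  have op2: "openin X ((S - D) - X closure_of (Good e p0))"
    by (rule openin_diff[OF opSD closedin_closure_of])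
  have cl: "x \<in> Good e p0" if "x \<in> S - D" "x \<in> X closure_of (Good e p0)" for x
    using Good_closed[OF e p0P _ _ that(2)] that(1) S by (auto simp: D_def)
  have "Good e p0 \<subseteq> X closure_of (Good e p0)"
    by (rule closure_of_subset) (use Good_sub[OF e, of p0] PosD in blast)
  then have "(S - D) - X closure_of (Good e p0) \<inter> (S - D) = {} \<or> Good e p0 \<inter> (S - D) = {} \<or> True" by blast
  have "(S - D) \<subseteq> Good e p0 \<union> ((S - D) - X closure_of (Good e p0))" using cl by blast
  moreover have "Good e p0 \<inter> ((S - D) - X closure_of (Good e p0)) \<inter> (S - D) = {}"
    using \<open>Good e p0 \<subseteq> X closure_of (Good e p0)\<close> by blast
  moreover have "Good e p0 \<inter> (S - D) \<noteq> {}" using p0SD Good_refl[OF e p0P] by blast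
  ultimately have "((S - D) - X closure_of (Good e p0)) \<inter> (S - D) = {}"
    using connectedin_splitD[OF con Good_open[OF e] op2, of p0] by simp
  then show ?thesis using q cl by (auto simp: D_def)
qed

lemma hh_inj:
  assumes e: "norm e = 1" and S: "connectedin X S" "openin X S" "S \<subseteq> Pos e" and p: "p \<in> S" "q \<in> S" "hh e p = hh e q"
  shows "p = q"
proof -
  have "hh e q \<noteq> - hh e p" using norm_hh[OF e, of p] S p vec_eq_neg[of "hh e p"] by auto
  then have "q \<in> Good e p" using Good_all[OF e S p(1,2)] by blast
  then show ?thesis using Good_inj[OF e] p by metis
qed

text \<open>The antipodal case, which \<open>Good_all\<close> leaves out, is reached by perturbing
  \<open>q\<close>: nearby points have other directions, and the inequality to be refuted is an open
  condition.\<close>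

lemma convex_component:
  assumes e: "norm e = 1" and S: "connectedin X S" "openin X S" "S \<subseteq> Pos e" and p: "p \<in> S" "q \<in> S"
  shows "g p \<bullet> v q \<ge> 0"
proof (cases "hh e q = - hh e p")
  case False
  then show ?thesis using Good_all[OF e S p] Good_nonneg[OF e] by blast
next
  case True
  show ?thesis
  proof (rule ccontr)
    assume "\<not> g p \<bullet> v q \<ge> 0"
    define U where "U = S \<inter> {x \<in> N. v x \<bullet> (- g p) > 0}"
    have "q \<in> U" using p openin_subset[OF S(2)] \<open>\<not> g p \<bullet> v q \<ge> 0\<close> by (auto simp: U_def inner_commute)
    moreover have "openin X U" unfolding U_def using S open_inner_v by blast
    ultimately obtain V where V: "openin X V" "q \<in> V" "V \<subseteq> U" "V - {q} \<noteq> {}" "\<And>e. norm e = 1 \<Longrightarrow> inj_on (hh e) (V \<inter> Pos e)"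
      using good_nbhd by metis
    then obtain x where x: "x \<in> V" "x \<noteq> q" by blast
    have "x \<in> S" using x V by (auto simp: U_def)
    have "hh e x \<noteq> hh e q" using inj_onD[OF V(5)[OF e], of x q] x V(2) S \<open>x \<in> S\<close> p by blast
    then have "x \<in> Good e p" using Good_all[OF e S p(1) \<open>x \<in> S\<close>] True by simp
    then have "g p \<bullet> v x \<ge> 0" using Good_nonneg[OF e] by blast
    then show False using x V by (auto simp: U_def inner_commute)
  qed
qed

end

section \<open>Global convexity\<close>

lemma closure_meets: "x \<in> X closure_of S \<Longrightarrow> openin X T \<Longrightarrow> x \<in> T \<Longrightarrow> \<exists>y. y \<in> S \<and> y \<in> T"
  by (simp add: in_closure_of)

context convex_pair begin

lemma closure_nonneg:
  assumes "x \<in> X closure_of S" "\<And>y. y \<in> S \<Longrightarrow> 0 \<le> g y \<bullet> w" shows "0 \<le> g x \<bullet> w"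
proof (rule ccontr)
  assume "\<not> 0 \<le> g x \<bullet> w"
  then have "x \<in> {p \<in> N. g p \<bullet> (- w) > 0}" using assms(1) by (auto simp: in_closure_of)
  then obtain y where "y \<in> S" "g y \<bullet> (- w) > 0"
    using closure_meets[OF assms(1) open_inner_g[of 0 "- w"]] by auto
  then show False using assms(2)[of y] by simp
qed

lemma closure_nonneg_v:
  assumes "x \<in> X closure_of S" "\<And>y. y \<in> S \<Longrightarrow> 0 \<le> w \<bullet> v y" shows "0 \<le> w \<bullet> v x"
proof (rule ccontr)
  assume "\<not> 0 \<le> w \<bullet> v x"
  then have "x \<in> {p \<in> N. v p \<bullet> (- w) > 0}" using assms(1) by (auto simp: in_closure_of inner_commute)
  then obtain y where "y \<in> S" "v y \<bullet> (- w) > 0"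
    using closure_meets[OF assms(1) open_inner_v[of 0 "- w"]] by auto
  then show False using assms(2)[of y] by (simp add: inner_commute)
qed

lemma unit_parallel:
  assumes "(w::'e) = c *\<^sub>R u" "norm w = 1" "norm u = 1" "w \<noteq> - u" shows "w = u"
proof -
  have "\<bar>c\<bar> = 1" using assms by simp
  then have "c = 1 \<or> c = -1" by linarith
  then show ?thesis using assms by auto
qed

lemma openin_remove: "openin X V \<Longrightarrow> p \<in> N \<Longrightarrow> openin X (V - {p})"
  using Hausdorff_imp_t1_space[OF haus] by (simp add: openin_diff closedin_t1_singleton)

text \<open>For \<open>e = v p0\<close>, a punctured neighbourhood of \<open>p0\<close> lies in
  \<open>Pos e\<close>. Let \<open>C\<close> be the component of \<open>Pos e\<close> containing it.
  The inequality holds on \<open>C\<close> by \<open>convex_component\<close> and on its closure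
  \<open>K\<close> by continuity, so it is enough that \<open>K\<close> is open. The critical points
  of \<open>K\<close> are those with \<open>g x \<bullet> e = 0\<close>.\<close>

lemma global_convex:
  assumes p0: "p0 \<in> N" and q: "q \<in> N"
  shows "0 \<le> g q \<bullet> v p0"
proof -
  define e where "e = v p0"
  have e: "norm e = 1" using norm_v[OF p0] by (simp add: e_def)
  obtain \<psi> :: "'a \<Rightarrow> 'p" and V where V0: "V = \<psi> ` ball 0 1" "openin X V" "p0 \<in> V"
    "\<And>x y. x \<in> \<psi> ` cball 0 1 \<Longrightarrow> y \<in> \<psi> ` cball 0 1 \<Longrightarrow> x \<noteq> y \<Longrightarrow> g x \<bullet> v y > 0"
    "connectedin X (V - {p0})" "V - {p0} \<noteq> {}"
    using good_nbhd[OF openin_topspace p0] by metis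
  have V: "openin X V" "p0 \<in> V" "connectedin X (V - {p0})" "V - {p0} \<noteq> {}"
    and pos: "\<And>x y. x \<in> V \<Longrightarrow> y \<in> V \<Longrightarrow> x \<noteq> y \<Longrightarrow> g x \<bullet> v y > 0"
    using V0 by auto
  have VP: "V - {p0} \<subseteq> Pos e" using pos[of _ p0] V(1,2) openin_subset[OF V(1)] by (auto simp: Pos_def e_def)
  have opV: "openin X (V - {p0})" by (rule openin_remove[OF V(1) p0])
  define SS where "SS = {S. connectedin X S \<and> openin X S \<and> S \<subseteq> Pos e \<and> V - {p0} \<subseteq> S}"
  define C where "C = \<Union>SS"
  have VS: "V - {p0} \<in> SS" using V VP opV by (simp add: SS_def)
  have C1: "openin X C" "C \<subseteq> Pos e" "V - {p0} \<subseteq> C"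
    unfolding C_def using VS by (auto simp: SS_def intro!: openin_Union)
  have C2: "connectedin X C" unfolding C_def
  proof (rule connectedin_Union)
    show "\<Inter> SS \<noteq> {}" using V(4) unfolding SS_def by blast
  qed (auto simp: SS_def)
  have absorb: "S \<subseteq> C" if S: "connectedin X S" "openin X S" "S \<subseteq> Pos e" "S \<inter> C \<noteq> {}" for S
  proof -
    have "S \<union> C \<in> SS" unfolding SS_def using S C1 C2 connectedin_Un[OF S(1) C2 S(4)] by auto
    then show ?thesis unfolding C_def by blast
  qed
  define K where "K = X closure_of C"
  have CK: "C \<subseteq> K" unfolding K_def by (rule closure_of_subset[OF openin_subset[OF C1(1)]])
  have KK: "0 \<le> g x \<bullet> v y" if "x \<in> K" "y \<in> K" for x y
  proof (rule closure_nonneg[of x C])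
    show "x \<in> X closure_of C" using that by (simp add: K_def)
    fix z assume z: "z \<in> C"
    show "0 \<le> g z \<bullet> v y"
      by (rule closure_nonneg_v[of y C]) (use that convex_component[OF e C2 C1(1,2) z] in \<open>auto simp: K_def\<close>)
  qed
  have p0K: "p0 \<in> K"
    unfolding K_def in_closure_of
  proof (intro conjI allI impI)
    fix T assume T: "p0 \<in> T \<and> openin X T"
    then have "openin X (T \<inter> V)" "p0 \<in> T \<inter> V" using V by auto
    then obtain W where "W - {p0} \<noteq> {}" "W \<subseteq> T \<inter> V"
      by (rule good_nbhd)
    then show "\<exists>y. y \<in> C \<and> y \<in> T" using C1(3) by blast
  qed (fact p0)
  have VK: "V \<subseteq> K" using C1(3) CK p0K by blast
  have KN: "K \<subseteq> N" unfolding K_def by (rule closure_of_subset_topspace)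
  have "openin X K"
  proof (subst openin_subopen, intro ballI)
    fix x assume x: "x \<in> K"
    then have xN: "x \<in> N" using KN by blast
    show "\<exists>T. openin X T \<and> x \<in> T \<and> T \<subseteq> K"
    proof (cases "x \<in> Pos e")
      case True
      then obtain W where W: "openin X W" "x \<in> W" "W \<subseteq> Pos e" "connectedin X W"
        using good_nbhd[OF open_Pos] by metis
      have "W \<inter> C \<noteq> {}" using closure_meets[OF x[unfolded K_def] W(1,2)] by blast
      then have "W \<subseteq> C" using absorb W by blast
      then show ?thesis using W CK by blast
    next
      case False
      \<comment> \<open>Equality at \<open>p0\<close> and the inequality on \<open>V\<close> make
        \<open>g x\<close> parallel to \<open>g p0\<close> by \<open>tang_v\<close>, and then
        \<open>v x\<close> parallel to \<open>v p0\<close> by \<open>tang_g\<close>; strict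
        convexity near \<open>p0\<close> decides both signs. So \<open>x\<close> has the position
        and the normal of \<open>p0\<close>, although it is not known to be the same point.\<close>
      then have x0: "g x \<bullet> v p0 = 0" using KK[OF x p0K] xN by (auto simp: Pos_def e_def)
      obtain y where y: "y \<in> V" "y \<noteq> p0" using V(4) by blast
      obtain c where "g x = c *\<^sub>R g p0" using tang_v[OF V(1,2) _ x0] KK[OF x] VK by blast
      moreover have "g x \<noteq> - g p0"
      proof
        assume "g x = - g p0"
        then have "g x \<bullet> v y < 0" using pos[of p0 y] y V by auto
        then show False using KK[OF x, of y] VK y by auto
      qed
      ultimately have gx: "g x = g p0" using unit_parallel norm_g[OF xN] norm_g[OF p0] by blast
      have "v x \<bullet> g p0 = 0" using gx perp[OF xN] by (simp add: inner_commute)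
      then obtain c where "v x = c *\<^sub>R v p0" using tang_g[OF V(1,2), of "v x"] KK[OF _ x] VK by (metis inner_commute subsetD)
      moreover have "v x \<noteq> - v p0"
      proof
        assume "v x = - v p0"
        then have "g y \<bullet> v x < 0" using pos[of y p0] y V by auto
        then show False using KK[OF _ x, of y] VK y by auto
      qed
      ultimately have vx: "v x = v p0" using unit_parallel norm_v[OF xN] norm_v[OF p0] by blast
      obtain \<psi> :: "'a \<Rightarrow> 'p" and W where W0: "W = \<psi> ` ball 0 1" "openin X W" "x \<in> W"
        "\<And>x y. x \<in> \<psi> ` cball 0 1 \<Longrightarrow> y \<in> \<psi> ` cball 0 1 \<Longrightarrow> x \<noteq> y \<Longrightarrow> g x \<bullet> v y > 0"
        "connectedin X (W - {x})"
        using good_nbhd[OF openin_topspace xN] by metis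
      have Wpos: "g y \<bullet> v x > 0" if "y \<in> W - {x}" for y using W0(1,3,4) that by auto
      \<comment> \<open>Since \<open>v x\<close> is \<open>e\<close>, the punctured neighbourhood of
        \<open>x\<close> lies in \<open>Pos e\<close>, as that of \<open>p0\<close> does. It is
        connected and meets \<open>C\<close>, hence is part of \<open>C\<close>.\<close>
      have WP: "W - {x} \<subseteq> Pos e" using Wpos openin_subset[OF W0(2)] vx by (auto simp: Pos_def e_def)
      have "W \<inter> C \<noteq> {}" using closure_meets[OF x[unfolded K_def] W0(2,3)] by blast
      then have "(W - {x}) \<inter> C \<noteq> {}" using False C1(2) by blast
      then have "W - {x} \<subseteq> C" using absorb[OF W0(5) openin_remove[OF W0(2) xN] WP] by blast
      then have "W \<subseteq> K" using CK x by blast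
      then show ?thesis using W0 by blast
    qed
  qed
  moreover have "closedin X K" unfolding K_def by simp
  ultimately have "K = N" using conn p0K unfolding connected_space_clopen_in by blast
  then show ?thesis using KK p0 q by blast
qed

text \<open>The vector \<open>v p0\<close> is nonnegative against every \<open>g q\<close>, but zero
  at q = p0; it is tilted slightly toward \<open>g p0\<close>. If every small tilt failed, a limit
  \<open>w\<close> of offending \<open>g q\<close> would be orthogonal to \<open>v p0\<close> and
  nonnegative against all \<open>v p\<close>, so \<open>w = g p0\<close> by \<open>tang_v\<close>
  and local strictness. Near \<open>g p0\<close>, however, the tilt by \<tau> gains more than \<tau>
  / 2. The compactness in this argument is that of the unit sphere.\<close>

lemma hemisphere:
  assumes p0: "p0 \<in> N"
  obtains b c where "norm b = 1" "c > 0" "\<And>q. q \<in> N \<Longrightarrow> g q \<bullet> b \<ge> c"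
proof -
  have "\<exists>\<tau>>0. \<forall>q\<in>N. g q \<bullet> (v p0 + \<tau> *\<^sub>R g p0) \<ge> \<tau> / 2"
  proof (rule ccontr)
    assume neg: "\<not> ?thesis"
    define \<tau> where "\<tau> k = inverse (real (Suc k))" for k
    have \<tau>: "\<tau> k > 0" for k by (simp add: \<tau>_def)
    have \<tau>0: "\<tau> \<longlonglongrightarrow> 0" unfolding \<tau>_def by (rule LIMSEQ_inverse_real_of_nat)
    have "\<exists>q\<in>N. g q \<bullet> (v p0 + \<tau> k *\<^sub>R g p0) < \<tau> k / 2" for k using neg \<tau>[of k] by (metis not_le)
    then obtain q where q: "\<And>k. q k \<in> N" "\<And>k. g (q k) \<bullet> (v p0 + \<tau> k *\<^sub>R g p0) < \<tau> k / 2" by metis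
    have "\<forall>k. g (q k) \<in> sphere 0 1" using norm_g q by simp
    then have "\<exists>w\<in>sphere 0 1. \<exists>r. strict_mono r \<and> ((\<lambda>k. g (q k)) \<circ> r) \<longlonglongrightarrow> w"
      using compact_sphere[of "0::'e" 1, unfolded compact_def, rule_format, of "\<lambda>k. g (q k)"] by simp
    then obtain w r where w: "w \<in> sphere 0 1" "strict_mono r" "((\<lambda>k. g (q k)) \<circ> r) \<longlonglongrightarrow> w" by metis
    have w3: "(\<lambda>k. g (q (r k))) \<longlonglongrightarrow> w" using w(3) by (simp add: o_def)
    have \<tau>r: "(\<lambda>k. \<tau> (r k)) \<longlonglongrightarrow> 0" using LIMSEQ_subseq_LIMSEQ[OF \<tau>0 w(2)] by (simp add: o_def)
    have wv: "w \<bullet> v p \<ge> 0" if "p \<in> N" for p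
    proof (rule tendsto_lowerbound)
      show "(\<lambda>k. g (q (r k)) \<bullet> v p) \<longlonglongrightarrow> w \<bullet> v p" by (intro tendsto_intros w3)
      show "\<forall>\<^sub>F k in sequentially. 0 \<le> g (q (r k)) \<bullet> v p" using global_convex[OF that q(1)] by simp
    qed simp
    have "w \<bullet> v p0 \<le> 0"
    proof (rule LIMSEQ_le)
      show "(\<lambda>k. g (q (r k)) \<bullet> (v p0 + \<tau> (r k) *\<^sub>R g p0)) \<longlonglongrightarrow> w \<bullet> v p0"
        using tendsto_inner[OF w3 tendsto_add[OF tendsto_const tendsto_scaleR[OF \<tau>r tendsto_const]], of "v p0" "g p0"] by simp
      show "(\<lambda>k. \<tau> (r k) / 2) \<longlonglongrightarrow> 0" using tendsto_divide[OF \<tau>r tendsto_const, of 2] by simp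
      show "\<exists>M. \<forall>n\<ge>M. g (q (r n)) \<bullet> (v p0 + \<tau> (r n) *\<^sub>R g p0) \<le> \<tau> (r n) / 2" using q(2) by (meson less_imp_le)
    qed
    then have w0: "w \<bullet> v p0 = 0" using wv[OF p0] by simp
    obtain \<psi> :: "'a \<Rightarrow> 'p" and V where V: "V = \<psi> ` ball 0 1" "openin X V" "p0 \<in> V"
      "\<And>x y. x \<in> \<psi> ` cball 0 1 \<Longrightarrow> y \<in> \<psi> ` cball 0 1 \<Longrightarrow> x \<noteq> y \<Longrightarrow> g x \<bullet> v y > 0" "V - {p0} \<noteq> {}"
      using good_nbhd[OF openin_topspace p0] by metis
    have VN: "V \<subseteq> N" using openin_subset[OF V(2)] .
    obtain c where "w = c *\<^sub>R g p0" using tang_v[OF V(2,3) _ w0] wv VN by blast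
    moreover have "w \<noteq> - g p0"
    proof
      assume eq: "w = - g p0"
      obtain y where y: "y \<in> V" "y \<noteq> p0" using V(5) by blast
      have "g p0 \<bullet> v y > 0" using V(4)[of p0 y] V(1,3) y by auto
      then show False using wv[of y] eq y VN by auto
    qed
    ultimately have "w = g p0" using unit_parallel w(1) norm_g[OF p0] by (metis dist_0_norm mem_sphere)
    then have "(\<lambda>k. g (q (r k)) \<bullet> g p0) \<longlonglongrightarrow> 1"
      using tendsto_inner[OF w3 tendsto_const, of "g p0"] norm_g[OF p0] by (simp add: norm_eq_1)
    then have "\<forall>\<^sub>F k in sequentially. 1/2 < g (q (r k)) \<bullet> g p0" by (rule order_tendstoD) simp
    then obtain k where k: "1/2 < g (q (r k)) \<bullet> g p0" by (meson eventually_happens' sequentially_bot)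
    have "\<tau> (r k) * (1/2) < \<tau> (r k) * (g (q (r k)) \<bullet> g p0)" using k \<tau> by (rule mult_strict_left_mono)
    then show False using q(2)[of "r k"] global_convex[OF p0 q(1)[of "r k"]] by (simp add: inner_add_right)
  qed
  then obtain \<tau> where \<tau>: "\<tau> > 0" "\<And>q. q \<in> N \<Longrightarrow> g q \<bullet> (v p0 + \<tau> *\<^sub>R g p0) \<ge> \<tau> / 2" by blast
  define u where "u = v p0 + \<tau> *\<^sub>R g p0"
  have "u \<noteq> 0" using \<tau>(2)[OF p0] \<tau>(1) by (auto simp: u_def[symmetric])
  show thesis
  proof (rule that[of "sgn u" "\<tau> / 2 / norm u"])
    show "norm (sgn u) = 1" using \<open>u \<noteq> 0\<close> by (simp add: norm_sgn)
    show "\<tau> / 2 / norm u > 0" using \<tau>(1) \<open>u \<noteq> 0\<close> by simp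
    fix q assume "q \<in> N"
    then have "\<tau> / 2 \<le> g q \<bullet> u" using \<tau>(2) by (simp add: u_def)
    then have "\<tau> / 2 / norm u \<le> (g q \<bullet> u) / norm u" by (rule divide_right_mono) simp
    also have "\<dots> = g q \<bullet> sgn u" by (simp add: sgn_div_norm divide_inverse mult.commute)
    finally show "\<tau> / 2 / norm u \<le> g q \<bullet> sgn u" .
  qed
qed

text \<open>As \<open>g \<bullet> b\<close> is bounded below on the whole space,
  \<open>Good_limit\<close> applies with a single constant. So along an arc the directions that are
  attained form a closed set, and an open one by \<open>open_Cn\<close>: all directions are
  attained. Compactness of \<open>X\<close> then comes from the continuous inverse on the
  sphere.\<close>

lemma sphere_structure:
  assumes ne: "N \<noteq> {}"
  obtains b where "norm b = 1" "\<And>q. q \<in> N \<Longrightarrow> g q \<bullet> b > 0" "inj_on (hh b) N"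
    "hh b ` N = {z. norm z = 1 \<and> z \<bullet> b = 0}"
    "continuous_map (top_of_set {z. norm z = 1 \<and> z \<bullet> b = 0}) X (inv_into N (hh b))"
    "compact_space X"
proof -
  obtain p1 where p1: "p1 \<in> N" using ne by blast
  obtain b c where b: "norm b = 1" "c > 0" "\<And>q. q \<in> N \<Longrightarrow> g q \<bullet> b \<ge> c"
    using hemisphere[OF p1] by metis
  have PN: "Pos b = N" using b by (force simp: Pos_def)
  have S: "connectedin X N" "openin X N" "N \<subseteq> Pos b" using conn PN by (auto simp: connectedin_topspace)
  have inj: "inj_on (hh b) N" using hh_inj[OF b(1) S] by (rule inj_onI)
  let ?Z = "{z. norm z = 1 \<and> z \<bullet> b = 0}"
  have sub: "hh b ` N \<subseteq> ?Z" using norm_hh[OF b(1)] hh_perp[OF b(1)] PN by auto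
  have surj: "z \<in> hh b ` N" if z: "norm z = 1" "z \<bullet> b = 0" for z
  proof -
    \<comment> \<open>The space has two points, and their directions differ by injectivity, so one
      of them is not antipodal to \<open>z\<close>.\<close>
    have "\<exists>p0\<in>N. hh b p0 \<noteq> - z"
    proof -
      obtain V where "openin X V" "V - {p1} \<noteq> {}" using good_nbhd[OF S(2) p1] by metis
      then obtain p2 where "p2 \<in> N" "p2 \<noteq> p1" using openin_subset by blast
      then show ?thesis using inj p1 by (metis inj_onD)
    qed
    then obtain p0 where p0: "p0 \<in> N" "hh b p0 \<noteq> - z" by blast
    define y where "y = hh b p0"
    have y: "norm y = 1" "y \<bullet> b = 0" "z \<noteq> - y" using sub p0 by (auto simp: y_def)
    have nz: "seg y z s \<noteq> 0" "pr b (seg y z s) = seg y z s" if "s \<in> {0..1}" for s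
      using seg_nonzero[OF y(1) z(1) y(3)] that y(2) z(2) by (auto intro!: pr_eqI simp: seg_def inner_add_left)
    \<comment> \<open>No point of the arc is antipodal to its start, so \<open>Good_all\<close>
      covers every attained direction on it.\<close>
    have nanti: "sgn (seg y z s) \<noteq> - y" if s: "s \<in> {0..1}" for s
    proof
      assume eq: "sgn (seg y z s) = - y"
      have yy: "sgn (- y) = - y" using y by (simp add: sgn_div_norm)
      have "sgn (seg y z s) = sgn (- y)" using eq yy by simp
      then obtain \<mu> where \<mu>: "\<mu> > 0" "seg y z s = \<mu> *\<^sub>R (- y)" by (rule sgn_eq_imp_scale) (use y in auto)
      then have lin: "(1 - s + \<mu>) *\<^sub>R y + s *\<^sub>R z = 0" by (simp add: seg_def algebra_simps)
      show False
      proof (cases "z = y")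
        case True
        then have "(1 + \<mu>) *\<^sub>R y = 0" using lin by (simp add: algebra_simps)
        then show False using \<mu> y by auto
      next
        case False
        from unit_indep(1)[OF y(1) z(1) False y(3) lin] show False using \<mu> s by auto
      qed
    qed
    define B where "B = {0..1} \<inter> seg y z -` Cn b N"
    have BC: "s \<in> B \<longleftrightarrow> s \<in> {0..1} \<and> sgn (seg y z s) \<in> hh b ` N" for s
      using nz[of s] by (auto simp: B_def Cn_def)
    have "openin (top_of_set {0..1}) B" unfolding B_def
      by (intro continuous_openin_preimage_gen continuous_on_seg continuous_on_id open_Cn[OF b(1) S(2,3)])
    moreover have "closed B"
      unfolding closed_sequential_limits
    proof (intro allI impI, elim conjE)
      fix x l assume x: "\<forall>n. x n \<in> B" "x \<longlonglongrightarrow> l"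
      have l01: "l \<in> {0..1}"
        by (rule closed_sequentially[OF closed_atLeastAtMost _ x(2)]) (use x(1) BC in auto)
      have "\<forall>n. \<exists>q\<in>N. hh b q = sgn (seg y z (x n))" using x(1) BC by (metis imageE)
      then obtain Q where Q: "\<And>n. Q n \<in> N" "\<And>n. hh b (Q n) = sgn (seg y z (x n))" by metis
      have "(\<lambda>n. seg y z (x n)) \<longlonglongrightarrow> seg y z l" unfolding seg_def by (intro tendsto_intros x)
      then have lim: "(\<lambda>n. hh b (Q n)) \<longlonglongrightarrow> sgn (seg y z l)" unfolding Q(2) using nz(1)[OF l01] by (rule tendsto_sgn)
      have "Q n \<in> Good b p0" for n
        by (rule Good_all[OF b(1) S p0(1) Q(1)]) (use nanti[of "x n"] x BC Q(2) in \<open>auto simp: y_def\<close>)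
      then have ev: "\<forall>\<^sub>F n in sequentially. Q n \<in> Good b p0 \<and> c \<le> g (Q n) \<bullet> b" using b(3) Q(1) by simp
      obtain q where "q \<in> Good b p0" "hh b q = sgn (seg y z l)"
        using Good_limit[OF b(1) sequentially_bot b(2) _ ev lim] p0 PN nanti[OF l01] unfolding y_def by metis
      then show "l \<in> B" using BC l01 Good_sub[OF b(1)] PN by (metis (no_types, lifting) image_eqI mem_Collect_eq subsetD)
    qed
    then have "closedin (top_of_set {0..1}) B" using BC by (intro closed_subset) auto
    ultimately have "B = {} \<or> B = {0..1}" using connected_clopen[of "{0..1::real}"] by auto
    moreover have "0 \<in> B" using BC p0 y by (auto simp: y_def sgn_div_norm)
    ultimately have "1 \<in> B" by auto
    then show ?thesis using BC z by (simp add: sgn_div_norm)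
  qed
  have im: "hh b ` N = ?Z" using sub surj by blast
  have cont: "continuous_map (top_of_set ?Z) X (inv_into N (hh b))"
    unfolding continuous_map_def
  proof (intro conjI allI impI)
    show "inv_into N (hh b) \<in> topspace (top_of_set ?Z) \<rightarrow> N"
      using im by (auto intro!: inv_into_into)
    fix U assume U: "openin X U"
    have UN: "U \<subseteq> N" using openin_subset[OF U] .
    have "{z \<in> topspace (top_of_set ?Z). inv_into N (hh b) z \<in> U} = ?Z \<inter> Cn b U"
    proof (intro set_eqI iffI)
      fix z assume z: "z \<in> {z \<in> topspace (top_of_set ?Z). inv_into N (hh b) z \<in> U}"
      then have "z \<in> hh b ` N" using im by simp
      then have "hh b (inv_into N (hh b) z) = z" by (rule f_inv_into_f)
      then have "z \<in> hh b ` U" using z by (metis (no_types, lifting) image_eqI mem_Collect_eq)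
      then show "z \<in> ?Z \<inter> Cn b U" using z by (auto simp: Cn_def pr_eqI sgn_div_norm)
    next
      fix z assume z: "z \<in> ?Z \<inter> Cn b U"
      then obtain x where x: "x \<in> U" "z = hh b x" by (auto simp: Cn_def pr_eqI sgn_div_norm)
      then have "inv_into N (hh b) z = x" using inv_into_f_f[OF inj] UN by blast
      then show "z \<in> {z \<in> topspace (top_of_set ?Z). inv_into N (hh b) z \<in> U}" using x z by simp
    qed
    moreover have "openin (top_of_set ?Z) (?Z \<inter> Cn b U)"
      by (rule openin_open_Int) (use open_Cn[OF b(1) U] UN PN in auto)
    ultimately show "openin (top_of_set ?Z) {z \<in> topspace (top_of_set ?Z). inv_into N (hh b) z \<in> U}" by simp
  qed
  have "compact ?Z"
  proof -
    have "?Z = sphere 0 1 \<inter> {z. b \<bullet> z = 0}" by (auto simp: inner_commute)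
    then show ?thesis by (simp add: compact_Int_closed closed_hyperplane)
  qed
  then have "compactin X (inv_into N (hh b) ` ?Z)"
    by (intro image_compactin[OF _ cont]) (simp add: compactin_subtopology)
  moreover have "inv_into N (hh b) ` ?Z = N" using im inj by (metis inv_into_image_cancel subset_refl)
  ultimately have "compact_space X" by (simp add: compact_space_def)
  moreover have "g q \<bullet> b > 0" if "q \<in> N" for q using b(2) b(3)[OF that] by simp
  ultimately show thesis using that b(1) inj im cont by blast
qed

end

section \<open>Smooth functions\<close>

lemma Ck_on_has_derivative:
  "Ck_on (Suc k) S f \<Longrightarrow> x \<in> S \<Longrightarrow> (f has_derivative frechet_derivative f (at x)) (at x)"
  by (simp add: frechet_derivative_works[symmetric])

lemma Ck_on_SucI:
  assumes "\<And>x. x \<in> S \<Longrightarrow> (f has_derivative f' x) (at x)" and "\<And>v. Ck_on k S (\<lambda>x. frechet_derivative f (at x) v)"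
  shows "Ck_on (Suc k) S f"
  using assms by (auto intro: differentiableI)

lemma Ck_on_cong:
  fixes f g :: "'a::euclidean_space \<Rightarrow> 'b::real_normed_vector"
  assumes "open S" "\<And>x. x \<in> S \<Longrightarrow> f x = g x"
  shows "Ck_on k S f \<longleftrightarrow> Ck_on k S g"
proof -
  have *: "Ck_on k S f \<Longrightarrow> (\<And>x. x \<in> S \<Longrightarrow> f x = g x) \<Longrightarrow> Ck_on k S g" for f g :: "'a \<Rightarrow> 'b"
  proof (induction k arbitrary: f g)
    case 0
    then show ?case by (simp cong: continuous_on_cong)
  next
    case (Suc k)
    have d: "frechet_derivative f (at x) = frechet_derivative g (at x)" if "x \<in> S" for x
      using Suc.prems that assms(1) by (intro frechet_derivative_transform_within_open) auto
    have "(g has_derivative frechet_derivative f (at x)) (at x)" if "x \<in> S" for x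
      using has_derivative_transform_within_open[OF Ck_on_has_derivative[OF Suc.prems(1) that] assms(1) that] Suc.prems(2)
      by simp
    then show ?case
    proof (rule Ck_on_SucI)
      fix v show "Ck_on k S (\<lambda>x. frechet_derivative g (at x) v)"
        by (rule Suc.IH[of "\<lambda>x. frechet_derivative f (at x) v"]) (use Suc.prems d in auto)
    qed
  qed
  show ?thesis using *[of f g] *[of g f] assms(2) by auto
qed

lemma Ck_on_subset: "Ck_on k S f \<Longrightarrow> T \<subseteq> S \<Longrightarrow> Ck_on k T f"
  by (induction k arbitrary: f) (auto intro: continuous_on_subset)

lemma Ck_on_SucD: "Ck_on (Suc k) S f \<Longrightarrow> Ck_on k S f"
proof (induction k arbitrary: f)
  case 0
  then have "\<forall>x\<in>S. isCont f x" by (auto intro: differentiable_imp_continuous_within)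
  then show ?case by (simp add: continuous_at_imp_continuous_on)
next
  case (Suc k)
  then show ?case by (meson Ck_on.simps(2))
qed

lemma Ck_on_const: "Ck_on k S (\<lambda>x. c)"
proof (induction k arbitrary: c)
  case (Suc k)
  show ?case
    by (rule Ck_on_SucI[of _ _ "\<lambda>_ _. 0"]) (use Suc in \<open>auto intro: derivative_eq_intros\<close>)
qed (simp)

lemma Ck_on_SucI':
  assumes S: "open S" and "\<And>x. x \<in> S \<Longrightarrow> (f has_derivative f' x) (at x)" and "\<And>v. Ck_on k S (\<lambda>x. f' x v)"
  shows "Ck_on (Suc k) S f"
proof (rule Ck_on_SucI[OF assms(2)])
  fix v
  have "frechet_derivative f (at x) v = f' x v" if "x \<in> S" for x
    using frechet_derivative_at[OF assms(2)[OF that]] by simp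
  then show "Ck_on k S (\<lambda>x. frechet_derivative f (at x) v)"
    using Ck_on_cong[OF S, of "\<lambda>x. frechet_derivative f (at x) v"] assms(3)[of v] by simp
qed

lemma Ck_on_linear_compose:
  assumes "open S" "Ck_on k S f" "bounded_linear L"
  shows "Ck_on k S (\<lambda>x. L (f x))"
  using assms(2)
proof (induction k arbitrary: f)
  case 0
  then show ?case using bounded_linear.continuous_on[OF assms(3)] by simp
next
  case (Suc k)
  show ?case
  proof (rule Ck_on_SucI'[OF assms(1)])
    fix x assume "x \<in> S"
    show "((\<lambda>x. L (f x)) has_derivative (\<lambda>v. L (frechet_derivative f (at x) v))) (at x)"
      by (rule bounded_linear.has_derivative[OF assms(3) Ck_on_has_derivative[OF Suc.prems \<open>x \<in> S\<close>]])
  next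
    fix v show "Ck_on k S (\<lambda>x. L (frechet_derivative f (at x) v))"
      using Suc by simp
  qed
qed

lemma Ck_on_id:
  assumes "open S" shows "Ck_on k S (\<lambda>x. x)"
proof (cases k)
  case (Suc j)
  show ?thesis unfolding Suc
    by (rule Ck_on_SucI'[OF assms, of _ "\<lambda>_ v. v"]) (auto simp: Ck_on_const intro: derivative_eq_intros)
qed simp

lemma Ck_on_add:
  assumes "open S" "Ck_on k S f" "Ck_on k S g"
  shows "Ck_on k S (\<lambda>x. f x + g x)"
  using assms(2,3)
proof (induction k arbitrary: f g)
  case 0 then show ?case by (simp add: continuous_on_add)
next
  case (Suc k)
  show ?case
  proof (rule Ck_on_SucI'[OF assms(1)])
    fix x assume "x \<in> S"
    show "((\<lambda>x. f x + g x) has_derivative (\<lambda>v. frechet_derivative f (at x) v + frechet_derivative g (at x) v)) (at x)"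
      by (rule has_derivative_add; rule Ck_on_has_derivative[OF _ \<open>x \<in> S\<close>]; fact)
  next
    fix v show "Ck_on k S (\<lambda>x. frechet_derivative f (at x) v + frechet_derivative g (at x) v)"
      using Suc by simp
  qed
qed

lemma Ck_on_sum:
  assumes "open S" "\<And>i. i \<in> I \<Longrightarrow> Ck_on k S (f i)"
  shows "Ck_on k S (\<lambda>x. \<Sum>i\<in>I. f i x)"
  using assms(2)
  by (induction I rule: infinite_finite_induct) (auto simp: Ck_on_const intro!: Ck_on_add assms(1))

lemma Ck_on_bilinear:
  assumes S: "open S" and B: "bounded_bilinear B" and "Ck_on k S f" "Ck_on k S g"
  shows "Ck_on k S (\<lambda>x. B (f x) (g x))"
  using assms(3,4)
proof (induction k arbitrary: f g)
  case 0 then show ?case using bounded_bilinear.continuous_on[OF B] by simp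
next
  case (Suc k)
  show ?case
  proof (rule Ck_on_SucI'[OF S])
    fix x assume "x \<in> S"
    show "((\<lambda>x. B (f x) (g x)) has_derivative
       (\<lambda>v. B (f x) (frechet_derivative g (at x) v) + B (frechet_derivative f (at x) v) (g x))) (at x)"
      by (rule bounded_bilinear.FDERIV[OF B]; rule Ck_on_has_derivative[OF _ \<open>x \<in> S\<close>]; fact)
  next
    fix v
    have "Ck_on k S f" "Ck_on k S g" using Suc.prems Ck_on_SucD by blast+
    then show "Ck_on k S (\<lambda>x. B (f x) (frechet_derivative g (at x) v) + B (frechet_derivative f (at x) v) (g x))"
      using Suc by (intro Ck_on_add S) auto
  qed
qed

lemma Ck_on_compose:
  fixes g :: "'a::euclidean_space \<Rightarrow> 'b::euclidean_space" and f :: "'b \<Rightarrow> 'c::real_normed_vector"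
  assumes S: "open S" and T: "open T" and "Ck_on k S g" "Ck_on k T f" "\<And>x. x \<in> S \<Longrightarrow> g x \<in> T"
  shows "Ck_on k S (\<lambda>x. f (g x))"
  using assms(3,4)
proof (induction k arbitrary: f)
  case 0
  then show ?case using continuous_on_compose2[of T f S g] assms(5) by auto
next
  case (Suc k)
  have dg: "(g has_derivative frechet_derivative g (at x)) (at x)" if "x \<in> S" for x
    using Ck_on_has_derivative[OF Suc.prems(1) that] .
  have dfx: "(f has_derivative frechet_derivative f (at (g x))) (at (g x))" if "x \<in> S" for x
    using Ck_on_has_derivative[OF Suc.prems(2) assms(5)[OF that]] .
  \<comment> \<open>The derivative of \<open>f\<close> is applied to a vector that itself depends on
    \<open>x\<close>. Expanded over the basis, each term is a product of a component of the
    derivative of \<open>g\<close> with a derivative of \<open>f\<close> in a fixed direction, to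
    which the induction hypothesis applies.\<close>
  define f' where "f' x v = (\<Sum>b\<in>Basis. (frechet_derivative g (at x) v \<bullet> b) *\<^sub>R frechet_derivative f (at (g x)) b)" for x v
  show ?case
  proof (rule Ck_on_SucI'[OF S])
    fix x assume x: "x \<in> S"
    have "frechet_derivative f (at (g x)) (frechet_derivative g (at x) v) = f' x v" for v
    proof -
      have lin: "linear (frechet_derivative f (at (g x)))" using dfx[OF x] by (rule has_derivative_linear)
      have "frechet_derivative f (at (g x)) (frechet_derivative g (at x) v)
          = frechet_derivative f (at (g x)) (\<Sum>b\<in>Basis. (frechet_derivative g (at x) v \<bullet> b) *\<^sub>R b)"
        by (simp add: euclidean_representation)
      also have "\<dots> = f' x v" unfolding f'_def by (simp add: linear_sum[OF lin] linear_cmul[OF lin])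
      finally show ?thesis .
    qed
    then have "(\<lambda>v. frechet_derivative f (at (g x)) (frechet_derivative g (at x) v)) = f' x" by (rule ext)
    then show "((\<lambda>x. f (g x)) has_derivative f' x) (at x)"
      using has_derivative_compose[OF dg[OF x] dfx[OF x]] by simp
  next
    fix v
    have "Ck_on k S (\<lambda>x. frechet_derivative f (at (g x)) b)" for b
      by (rule Suc.IH[of "\<lambda>y. frechet_derivative f (at y) b"])
        (use Suc.prems Ck_on_SucD in \<open>auto simp del: Ck_on.simps(1)\<close>)
    then show "Ck_on k S (\<lambda>x. f' x v)"
      unfolding f'_def using Suc.prems
      by (intro Ck_on_sum S Ck_on_bilinear[OF S bounded_bilinear_scaleR] Ck_on_linear_compose[OF S _ bounded_linear_inner_left]) auto
  qed
qed

lemma Ck_on_inverse: "Ck_on k {x::real. x \<noteq> 0} inverse"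
proof (induction k)
  case 0 show ?case by (auto intro!: continuous_intros)
next
  case (Suc k)
  have op: "open {x::real. x \<noteq> 0}" by (simp add: open_Collect_neq continuous_on_id)
  show ?case
  proof (rule Ck_on_SucI'[OF op])
    fix x :: real assume "x \<in> {x. x \<noteq> 0}"
    then show "(inverse has_derivative (\<lambda>v. v * (- (inverse x * inverse x)))) (at x)"
      by (auto intro!: derivative_eq_intros simp: algebra_simps)
  next
    fix v :: real
    have "Ck_on k {x::real. x \<noteq> 0} (\<lambda>x. inverse x * inverse x)"
      by (rule Ck_on_bilinear[OF op bounded_bilinear_mult Suc Suc])
    from Ck_on_linear_compose[OF op this bounded_linear_mult_right[of "- v"]]
    show "Ck_on k {x::real. x \<noteq> 0} (\<lambda>x. v * (- (inverse x * inverse x)))" by simp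
  qed
qed

text \<open>The derivative is - 1/2 times the cube of the function itself, so the induction on the
  order of differentiability stays within products of \<open>rsqrt\<close>. It serves to normalize
  vectors.\<close>

definition rsqrt :: "real \<Rightarrow> real" where "rsqrt x = inverse (sqrt x)"

lemma Ck_on_rsqrt: "Ck_on k {0<..} rsqrt"
proof (induction k)
  case 0 show ?case unfolding rsqrt_def by (auto intro!: continuous_intros)
next
  case (Suc k)
  have op: "open {(0::real)<..}" by simp
  show ?case
  proof (rule Ck_on_SucI'[OF op])
    fix x :: real assume "x \<in> {0<..}"
    then show "(rsqrt has_derivative (\<lambda>v. v * (- (1/2) * (rsqrt x * (rsqrt x * rsqrt x))))) (at x)"
      unfolding rsqrt_def by (auto intro!: derivative_eq_intros simp: field_simps)
  next
    fix v :: real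
    have "Ck_on k {0<..} (\<lambda>x. rsqrt x * (rsqrt x * rsqrt x))"
      by (intro Ck_on_bilinear[OF op bounded_bilinear_mult] Suc)
    from Ck_on_linear_compose[OF op this bounded_linear_mult_right[of "v * (- (1/2))"]]
    show "Ck_on k {0<..} (\<lambda>x. v * (- (1/2) * (rsqrt x * (rsqrt x * rsqrt x))))" by (simp add: mult.assoc)
  qed
qed

lemma smooth_on_cong:
  "open S \<Longrightarrow> (\<And>x. x \<in> S \<Longrightarrow> f x = g x) \<Longrightarrow> smooth_on S f \<longleftrightarrow> smooth_on S g"
  unfolding smooth_on_def using Ck_on_cong by blast

lemma smooth_on_subset: "smooth_on S f \<Longrightarrow> T \<subseteq> S \<Longrightarrow> smooth_on T f"
  unfolding smooth_on_def using Ck_on_subset by blast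

lemma smooth_on_const: "smooth_on S (\<lambda>x. c)"
  by (simp add: smooth_on_def Ck_on_const)

lemma smooth_on_id: "open S \<Longrightarrow> smooth_on S (\<lambda>x. x)"
  by (simp add: smooth_on_def Ck_on_id)

lemma smooth_on_linear: "open S \<Longrightarrow> smooth_on S f \<Longrightarrow> bounded_linear L \<Longrightarrow> smooth_on S (\<lambda>x. L (f x))"
  by (simp add: smooth_on_def Ck_on_linear_compose)

lemma smooth_on_add: "open S \<Longrightarrow> smooth_on S f \<Longrightarrow> smooth_on S g \<Longrightarrow> smooth_on S (\<lambda>x. f x + g x)"
  by (simp add: smooth_on_def Ck_on_add)

lemma smooth_on_sum: "open S \<Longrightarrow> (\<And>i. i \<in> I \<Longrightarrow> smooth_on S (f i)) \<Longrightarrow> smooth_on S (\<lambda>x. \<Sum>i\<in>I. f i x)"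
  by (simp add: smooth_on_def Ck_on_sum)

lemma smooth_on_bilinear:
  "open S \<Longrightarrow> bounded_bilinear B \<Longrightarrow> smooth_on S f \<Longrightarrow> smooth_on S g \<Longrightarrow> smooth_on S (\<lambda>x. B (f x) (g x))"
  by (simp add: smooth_on_def Ck_on_bilinear)

lemma smooth_on_scaleR: "open S \<Longrightarrow> smooth_on S f \<Longrightarrow> smooth_on S g \<Longrightarrow> smooth_on S (\<lambda>x. f x *\<^sub>R g x)"
  by (rule smooth_on_bilinear[OF _ bounded_bilinear_scaleR])

lemma smooth_on_mult: "open S \<Longrightarrow> smooth_on S f \<Longrightarrow> smooth_on S g \<Longrightarrow> smooth_on S (\<lambda>x. f x * g x :: real)"
  by (rule smooth_on_bilinear[OF _ bounded_bilinear_mult])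

lemma smooth_on_inner: "open S \<Longrightarrow> smooth_on S f \<Longrightarrow> smooth_on S g \<Longrightarrow> smooth_on S (\<lambda>x. f x \<bullet> g x)"
  by (rule smooth_on_bilinear[OF _ bounded_bilinear_inner])

lemma smooth_on_minus: "open S \<Longrightarrow> smooth_on S f \<Longrightarrow> smooth_on S (\<lambda>x. - f x)"
  by (rule smooth_on_linear[OF _ _ bounded_linear_minus[OF bounded_linear_ident]])

lemma smooth_on_diff: "open S \<Longrightarrow> smooth_on S f \<Longrightarrow> smooth_on S g \<Longrightarrow> smooth_on S (\<lambda>x. f x - g x)"
  using smooth_on_add[OF _ _ smooth_on_minus] by fastforce

lemma smooth_on_compose:
  fixes g :: "'a::euclidean_space \<Rightarrow> 'b::euclidean_space"
  shows "open S \<Longrightarrow> open T \<Longrightarrow> smooth_on S g \<Longrightarrow> smooth_on T f \<Longrightarrow> (\<And>x. x \<in> S \<Longrightarrow> g x \<in> T) \<Longrightarrow> smooth_on S (\<lambda>x. f (g x))"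
  unfolding smooth_on_def using Ck_on_compose[of S T _ g f] by blast

lemma smooth_on_prod:
  "open S \<Longrightarrow> (\<And>i. i \<in> I \<Longrightarrow> smooth_on S (f i)) \<Longrightarrow> smooth_on S (\<lambda>x. \<Prod>i\<in>I. f i x :: real)"
  by (induction I rule: infinite_finite_induct) (auto simp: smooth_on_const intro!: smooth_on_mult)

lemma smooth_on_inverse:
  fixes f :: "'a::euclidean_space \<Rightarrow> real"
  assumes "open S" "smooth_on S f" "\<And>x. x \<in> S \<Longrightarrow> f x \<noteq> 0"
  shows "smooth_on S (\<lambda>x. inverse (f x))"
  by (rule smooth_on_compose[of S "{x. x \<noteq> 0}" f inverse])
    (use assms in \<open>auto simp: smooth_on_def Ck_on_inverse open_Collect_neq continuous_on_id\<close>)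

lemma smooth_on_divide:
  fixes f g :: "'a::euclidean_space \<Rightarrow> real"
  assumes "open S" "smooth_on S f" "smooth_on S g" "\<And>x. x \<in> S \<Longrightarrow> g x \<noteq> 0"
  shows "smooth_on S (\<lambda>x. f x / g x)"
  unfolding divide_inverse by (intro smooth_on_mult smooth_on_inverse assms)

lemma smooth_on_sgn:
  fixes f :: "'a::euclidean_space \<Rightarrow> 'b::euclidean_space"
  assumes S: "open S" "smooth_on S f" "\<And>x. x \<in> S \<Longrightarrow> f x \<noteq> 0"
  shows "smooth_on S (\<lambda>x. sgn (f x))"
proof -
  have "smooth_on {0<..} rsqrt" by (simp add: smooth_on_def Ck_on_rsqrt)
  from smooth_on_compose[of S "{0<..}" "\<lambda>x. f x \<bullet> f x" rsqrt, OF S(1) _ smooth_on_inner[OF S(1,2,2)] this]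
  have "smooth_on S (\<lambda>x. rsqrt (f x \<bullet> f x))" using S(3) by simp
  then have "smooth_on S (\<lambda>x. rsqrt (f x \<bullet> f x) *\<^sub>R f x)" using S by (intro smooth_on_scaleR)
  then show ?thesis by (simp add: rsqrt_def sgn_div_norm norm_eq_sqrt_inner)
qed

lemma smooth_on_vec:
  fixes f :: "'a::euclidean_space \<Rightarrow> real ^ 'm::finite"
  assumes S: "open S" and "\<And>i. smooth_on S (\<lambda>x. f x $ i)"
  shows "smooth_on S f"
proof -
  have eq: "f = (\<lambda>x. \<Sum>i\<in>UNIV. (f x $ i) *\<^sub>R axis i 1)"
    by (rule ext) (simp add: vec_eq_iff axis_def if_distrib cong: if_cong)
  show ?thesis by (subst eq) (intro smooth_on_sum smooth_on_scaleR smooth_on_const S assms)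
qed

lemma smooth_on_nth: "open S \<Longrightarrow> smooth_on S f \<Longrightarrow> smooth_on S (\<lambda>x. f x $ i)"
  for f :: "'a::euclidean_space \<Rightarrow> real ^ 'm::finite"
  by (rule smooth_on_linear[OF _ _ bounded_linear_vec_nth])

lemma smooth_on_det:
  fixes A :: "'a::euclidean_space \<Rightarrow> real ^ 'm::finite ^ 'm"
  assumes S: "open S" and "\<And>i j. smooth_on S (\<lambda>x. A x $ i $ j)"
  shows "smooth_on S (\<lambda>x. det (A x))"
  unfolding det_def by (intro smooth_on_sum smooth_on_mult smooth_on_const smooth_on_prod assms)

lemma smooth_on_frechet:
  "smooth_on S f \<Longrightarrow> smooth_on S (\<lambda>x. frechet_derivative f (at x) v)"
  unfolding smooth_on_def by (metis Ck_on.simps(2))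

lemma smooth_on_has_derivative:
  "smooth_on S f \<Longrightarrow> x \<in> S \<Longrightarrow> (f has_derivative frechet_derivative f (at x)) (at x)"
  unfolding smooth_on_def using Ck_on_has_derivative by blast

lemma smooth_on_continuous: "smooth_on S f \<Longrightarrow> continuous_on S f"
  unfolding smooth_on_def by (metis Ck_on.simps(1))

text \<open>Continuity of \<theta> already makes it differentiable, and Cramer's rule writes its
  derivative as a rational function of the derivative of \<Psi> at \<theta> y. So if \<theta> is of
  class C^k, its derivative is too, and \<theta> is of class C^(k+1).\<close>

lemma smooth_on_inverse_function:
  fixes \<Psi> :: "real ^ 'n::finite \<Rightarrow> real ^ 'n"
  assumes O1: "open O1" and sm: "smooth_on O1 \<Psi>" and O2: "open O2" and cont: "continuous_on O2 \<theta>"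
    and in1: "\<And>y. y \<in> O2 \<Longrightarrow> \<theta> y \<in> O1" and inv: "\<And>y. y \<in> O2 \<Longrightarrow> \<Psi> (\<theta> y) = y"
    and inj: "\<And>x. x \<in> O1 \<Longrightarrow> inj (frechet_derivative \<Psi> (at x))"
  shows "smooth_on O2 \<theta>"
proof -
  define A where "A x = (\<chi> i j. frechet_derivative \<Psi> (at x) (axis j 1) $ i)" for x
  have lin: "linear (frechet_derivative \<Psi> (at x))" if "x \<in> O1" for x
    using smooth_on_has_derivative[OF sm that] by (rule has_derivative_linear)
  have Am: "A x = matrix (frechet_derivative \<Psi> (at x))" for x by (simp add: A_def matrix_def)
  have Av: "A x *v w = frechet_derivative \<Psi> (at x) w" if "x \<in> O1" for x w
    unfolding Am using lin[OF that] by (simp add: matrix_works)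
  have detA: "det (A x) \<noteq> 0" if x: "x \<in> O1" for x
  proof -
    have "inj ((*v) (A x))" using inj[OF x] Av[OF x] by (simp add: inj_def)
    then show ?thesis using matrix_left_invertible_injective invertible_left_inverse invertible_det_nz by metis
  qed
  \<comment> \<open>Cramer's formula for the solution of the linear system with matrix
    \<open>A (\<theta> y)\<close> and right-hand side \<open>v\<close>; its differentiability in
    \<open>y\<close> can be read off.\<close>
  define D where "D y v = (\<chi> k. det (\<chi> i j. if j = k then v $ i else A (\<theta> y) $ i $ j) / det (A (\<theta> y)))" for y v
  have der: "(\<theta> has_derivative D y) (at y)" if y: "y \<in> O2" for y
  proof -
    have x: "\<theta> y \<in> O1" using in1[OF y] .
    have DAv: "A (\<theta> y) *v D y v = v" for v using cramer[OF detA[OF x], of "D y v" v] by (simp add: D_def)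
    have Dunique: "w = D y v" if "A (\<theta> y) *v w = v" for v w
      using cramer[OF detA[OF x], of w v] that by (simp add: D_def)
    have "linear (D y)"
    proof (rule linearI)
      show "D y (a + b) = D y a + D y b" for a b
        by (rule Dunique[symmetric]) (simp add: matrix_vector_right_distrib DAv)
      show "D y (r *\<^sub>R a) = r *\<^sub>R D y a" for r a
        by (rule Dunique[symmetric]) (simp add: matrix_vector_mult_scaleR DAv)
    qed
    then have bl: "bounded_linear (D y)" by (simp add: linear_conv_bounded_linear)
    have "D y \<circ> frechet_derivative \<Psi> (at (\<theta> y)) = id"
      using Dunique[OF Av[OF x]] by (simp add: fun_eq_iff)
    moreover have "isCont \<theta> y" using cont O2 y by (simp add: continuous_on_eq_continuous_at)
    ultimately show ?thesis
      by (rule has_derivative_inverse_basic[of \<Psi> "frechet_derivative \<Psi> (at (\<theta> y))" \<theta> y "D y" O2,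
            OF smooth_on_has_derivative[OF sm x] bl _ _ O2 y inv])
  qed
  have "Ck_on k O2 \<theta>" for k
  proof (induction k)
    case 0 show ?case using cont by simp
  next
    case (Suc k)
    have ent: "Ck_on k O2 (\<lambda>y. A (\<theta> y) $ i $ j)" for i j
    proof -
      have "Ck_on k O1 (\<lambda>x. A x $ i $ j)"
        unfolding A_def using smooth_on_nth[OF O1 smooth_on_frechet[OF sm]] by (simp add: smooth_on_def)
      from Ck_on_compose[OF O2 O1 Suc this in1] show ?thesis .
    qed
    have prodC: "Ck_on k O2 (\<lambda>x. \<Prod>i\<in>I. f i x)" if "\<And>i. i \<in> I \<Longrightarrow> Ck_on k O2 (f i)" for I and f :: "_ \<Rightarrow> _ \<Rightarrow> real"
      using that by (induction I rule: infinite_finite_induct)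
        (auto simp: Ck_on_const intro!: Ck_on_bilinear[OF O2 bounded_bilinear_mult])
    have detC: "Ck_on k O2 (\<lambda>y. det (B y))" if "\<And>i j. Ck_on k O2 (\<lambda>y. B y $ i $ j)" for B :: "_ \<Rightarrow> real^'n^'n"
      unfolding det_def by (intro Ck_on_sum O2 Ck_on_bilinear[OF O2 bounded_bilinear_mult] Ck_on_const prodC that)
    show ?case
    proof (rule Ck_on_SucI'[OF O2 der])
      fix v
      have c: "Ck_on k O2 (\<lambda>y. D y v $ m)" for m
      proof -
        have "Ck_on k O2 (\<lambda>y. inverse (det (A (\<theta> y))))"
          by (rule Ck_on_compose[of O2 "{x. x \<noteq> 0}" k "\<lambda>y. det (A (\<theta> y))" inverse])
            (use O2 detC ent detA in1 in \<open>auto simp: Ck_on_inverse open_Collect_neq continuous_on_id\<close>)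
        moreover have "Ck_on k O2 (\<lambda>y. if j = m then v $ i else A (\<theta> y) $ i $ j)" for i j
          by (cases "j = m") (auto simp: Ck_on_const ent)
        then have "Ck_on k O2 (\<lambda>y. det (\<chi> i j. if j = m then v $ i else A (\<theta> y) $ i $ j))"
          by (intro detC) simp
        ultimately show ?thesis
          unfolding D_def divide_inverse using Ck_on_bilinear[OF O2 bounded_bilinear_mult] by simp
      qed
      have eq: "D y v = (\<Sum>m\<in>UNIV. (D y v $ m) *\<^sub>R axis m 1)" for y
        by (simp add: vec_eq_iff axis_def if_distrib cong: if_cong)
      show "Ck_on k O2 (\<lambda>y. D y v)"
        by (subst eq) (intro Ck_on_sum O2 Ck_on_bilinear[OF O2 bounded_bilinear_scaleR] Ck_on_const c)
    qed
  qed
  then show ?thesis by (simp add: smooth_on_def)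
qed

text \<open>The mean value theorem is applied in direction \<open>u\<close> to the difference over
  \<open>w\<close>, and then in direction \<open>w\<close> to the derivative in direction
  \<open>u\<close>. The second difference is symmetric in \<open>u\<close> and \<open>w\<close>,
  which is the source of the symmetry below.\<close>

lemma second_difference:
  fixes f :: "'a::euclidean_space \<Rightarrow> real"
  assumes "convex S" "open S" "Ck_on 2 S f" and S: "x \<in> S" "x + u \<in> S" "x + w \<in> S" "x + u + w \<in> S"
  obtains \<xi> where "\<xi> \<in> S" "f (x + u + w) - f (x + u) - f (x + w) + f x
     = frechet_derivative (\<lambda>z. frechet_derivative f (at z) u) (at \<xi>) w"
proof -
  have c1: "Ck_on (Suc 0) S (\<lambda>z. frechet_derivative f (at z) u)" and c2: "Ck_on (Suc (Suc 0)) S f"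
    using assms(3) by (auto simp: numeral_2_eq_2)
  have inS: "x + s *\<^sub>R u + t *\<^sub>R w \<in> S" if "0 \<le> s" "s \<le> 1" "0 \<le> t" "t \<le> 1" for s t
  proof -
    have a: "x + s *\<^sub>R u \<in> S" "x + w + s *\<^sub>R u \<in> S"
      using convexD_alt[OF assms(1) S(1) S(2) that(1,2)] convexD_alt[OF assms(1) S(3) S(4) that(1,2)]
      by (simp_all add: algebra_simps)
    show ?thesis using convexD_alt[OF assms(1) a that(3,4)] by (simp add: algebra_simps)
  qed
  define \<phi> where "\<phi> s = f (x + w + s *\<^sub>R u) - f (x + s *\<^sub>R u)" for s
  have d\<phi>: "(\<phi> has_derivative (\<lambda>h. h * (frechet_derivative f (at (x + w + s *\<^sub>R u)) u - frechet_derivative f (at (x + s *\<^sub>R u)) u))) (at s)"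
    if "0 \<le> s" "s \<le> 1" for s
  proof -
    have m: "x + w + s *\<^sub>R u \<in> S" "x + s *\<^sub>R u \<in> S"
      using inS[of s 1] inS[of s 0] that by (simp_all add: algebra_simps)
    have d: "((\<lambda>s. f (y + s *\<^sub>R u)) has_derivative (\<lambda>h. frechet_derivative f (at (y + s *\<^sub>R u)) (h *\<^sub>R u))) (at s)" if "y + s *\<^sub>R u \<in> S" for y
      by (rule has_derivative_compose[of "\<lambda>s. y + s *\<^sub>R u" "\<lambda>h. h *\<^sub>R u" s UNIV f, OF _ Ck_on_has_derivative[OF c2 that]])
        (auto intro!: derivative_eq_intros)
    have l: "linear (frechet_derivative f (at y))" if "y \<in> S" for y
      using Ck_on_has_derivative[OF c2 that] by (rule has_derivative_linear)
    show ?thesis unfolding \<phi>_def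
      using has_derivative_diff[OF d[OF m(1)] d[OF m(2)]]
      unfolding linear_cmul[OF l[OF m(1)]] linear_cmul[OF l[OF m(2)]]
      by (simp add: right_diff_distrib)
  qed
  have "DERIV \<phi> s :> frechet_derivative f (at (x + w + s *\<^sub>R u)) u - frechet_derivative f (at (x + s *\<^sub>R u)) u"
    if "0 \<le> s" "s \<le> 1" for s
    using d\<phi>[OF that] unfolding has_field_derivative_def mult_commute_abs .
  from MVT2[of 0 1, OF _ this] obtain s where s: "0 < s" "s < 1"
    "\<phi> 1 - \<phi> 0 = frechet_derivative f (at (x + w + s *\<^sub>R u)) u - frechet_derivative f (at (x + s *\<^sub>R u)) u" by auto
  define p where "p z = frechet_derivative f (at z) u" for z
  define \<psi> where "\<psi> t = p (x + s *\<^sub>R u + t *\<^sub>R w)" for t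
  have d\<psi>: "(\<psi> has_derivative (\<lambda>h. h * frechet_derivative p (at (x + s *\<^sub>R u + t *\<^sub>R w)) w)) (at t)"
    if "0 \<le> t" "t \<le> 1" for t
  proof -
    have m: "x + s *\<^sub>R u + t *\<^sub>R w \<in> S" using inS[of s t] s that by simp
    have dp: "(p has_derivative frechet_derivative p (at (x + s *\<^sub>R u + t *\<^sub>R w))) (at (x + s *\<^sub>R u + t *\<^sub>R w))"
      using Ck_on_has_derivative[OF c1 m] unfolding p_def[abs_def] .
    have "((\<lambda>t. p (x + s *\<^sub>R u + t *\<^sub>R w)) has_derivative (\<lambda>h. frechet_derivative p (at (x + s *\<^sub>R u + t *\<^sub>R w)) (h *\<^sub>R w))) (at t)"
      by (rule has_derivative_compose[of "\<lambda>t. x + s *\<^sub>R u + t *\<^sub>R w" "\<lambda>h. h *\<^sub>R w" t UNIV p, OF _ dp])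
        (auto intro!: derivative_eq_intros)
    then show ?thesis unfolding \<psi>_def using linear_cmul[OF has_derivative_linear[OF dp]] by simp
  qed
  have "DERIV \<psi> t :> frechet_derivative p (at (x + s *\<^sub>R u + t *\<^sub>R w)) w" if "0 \<le> t" "t \<le> 1" for t
    using d\<psi>[OF that] unfolding has_field_derivative_def mult_commute_abs .
  from MVT2[of 0 1, OF _ this] obtain t where t: "0 < t" "t < 1"
    "\<psi> 1 - \<psi> 0 = frechet_derivative p (at (x + s *\<^sub>R u + t *\<^sub>R w)) w" by auto
  have "f (x + u + w) - f (x + u) - f (x + w) + f x = \<phi> 1 - \<phi> 0" by (simp add: \<phi>_def algebra_simps)
  also have "\<dots> = \<psi> 1 - \<psi> 0" unfolding s(3) \<psi>_def p_def by (simp add: algebra_simps)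
  finally show thesis using that[of "x + s *\<^sub>R u + t *\<^sub>R w"] inS[of s t] s t p_def[abs_def] by simp
qed

text \<open>One small second difference, evaluated in both orders, equates the two mixed derivatives
  at two points near \<open>x\<close>; by continuity they cannot differ at \<open>x\<close>.\<close>

lemma second_derivative_symmetric:
  fixes f :: "'a::euclidean_space \<Rightarrow> real"
  assumes S: "open S" and C: "Ck_on 2 S f" and x: "x \<in> S"
  shows "frechet_derivative (\<lambda>z. frechet_derivative f (at z) u) (at x) w
       = frechet_derivative (\<lambda>z. frechet_derivative f (at z) w) (at x) u" (is "?a u w x = ?a w u x")
proof (rule ccontr)
  assume ne: "?a u w x \<noteq> ?a w u x"
  define \<epsilon> where "\<epsilon> = \<bar>?a u w x - ?a w u x\<bar> / 2"
  have \<epsilon>: "\<epsilon> > 0" using ne by (simp add: \<epsilon>_def)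
  have cont: "continuous_on S (?a u w)" for u w using C by (auto simp: numeral_2_eq_2)
  have "\<exists>d>0. \<forall>z\<in>ball x d. z \<in> S \<and> dist (?a u w z) (?a u w x) < \<epsilon>" for u w
  proof -
    have "isCont (?a u w) x" using cont S x by (simp add: continuous_on_eq_continuous_at)
    then obtain d where d: "d > 0" "\<forall>z. dist z x < d \<longrightarrow> dist (?a u w z) (?a u w x) < \<epsilon>"
      unfolding continuous_at_eps_delta using \<epsilon> by (metis dist_commute)
    obtain d' where "d' > 0" "ball x d' \<subseteq> S" using S x open_contains_ball by blast
    then show ?thesis using d by (intro exI[of _ "min d d'"]) (auto simp: dist_commute)
  qed
  then obtain d1 d2 where d: "d1 > 0" "d2 > 0" "\<forall>z\<in>ball x d1. z \<in> S \<and> dist (?a u w z) (?a u w x) < \<epsilon>"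
    "\<forall>z\<in>ball x d2. z \<in> S \<and> dist (?a w u z) (?a w u x) < \<epsilon>" by metis
  define d where "d = min d1 d2"
  define m where "m = norm u + norm w + 1"
  \<comment> \<open>Scales \<open>u\<close> and \<open>w\<close> such that their parallelogram at
    \<open>x\<close> fits into the ball; the summand 1 in \<open>m\<close> keeps the divisor
    positive.\<close>
  define h where "h = d / (2 * m)"
  have pos: "m > 0" by (simp add: m_def add_nonneg_pos)
  have "d > 0" using d(1,2) by (simp add: d_def)
  then have h: "h > 0" "h * (norm u + norm w + 1) = d / 2" using pos unfolding m_def[symmetric] by (auto simp: h_def)
  have nb: "h * norm u < d" "h * norm w < d" "h * norm u + h * norm w < d"
  proof -
    have "h * norm u + h * norm w + h = d / 2" using h(2) by (simp add: algebra_simps)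
    moreover have "h * norm u \<ge> 0" "h * norm w \<ge> 0" "d > 0" using h(1) d(1,2) by (auto simp: d_def)
    ultimately show "h * norm u < d" "h * norm w < d" "h * norm u + h * norm w < d" using h(1) by linarith+
  qed
  have B: "convex (ball x d)" "open (ball x d)" by auto
  have CB: "Ck_on 2 (ball x d) f" by (rule Ck_on_subset[OF C]) (use d in \<open>auto simp: d_def\<close>)
  have mem: "x \<in> ball x d" "x + h *\<^sub>R u \<in> ball x d" "x + h *\<^sub>R w \<in> ball x d" "x + h *\<^sub>R u + h *\<^sub>R w \<in> ball x d"
    "x + h *\<^sub>R w + h *\<^sub>R u \<in> ball x d"
  proof -
    have "norm (h *\<^sub>R u + h *\<^sub>R w) < d"
      using norm_triangle_ineq[of "h *\<^sub>R u" "h *\<^sub>R w"] nb(3) h(1) by simp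
    moreover have dd: "dist x (x + a) = norm a" for a by (simp add: dist_norm)
    moreover have "x + h *\<^sub>R u + h *\<^sub>R w = x + (h *\<^sub>R u + h *\<^sub>R w)"
      "x + h *\<^sub>R w + h *\<^sub>R u = x + (h *\<^sub>R u + h *\<^sub>R w)" by (simp_all add: ac_simps)
    ultimately show "x + h *\<^sub>R u + h *\<^sub>R w \<in> ball x d" "x + h *\<^sub>R w + h *\<^sub>R u \<in> ball x d"
      unfolding mem_ball by metis+
    show "x \<in> ball x d" "x + h *\<^sub>R u \<in> ball x d" "x + h *\<^sub>R w \<in> ball x d"
      using nb h d by (simp_all add: dist_norm d_def)
  qed
  obtain \<xi> where \<xi>: "\<xi> \<in> ball x d" "f (x + h *\<^sub>R u + h *\<^sub>R w) - f (x + h *\<^sub>R u) - f (x + h *\<^sub>R w) + f x = ?a (h *\<^sub>R u) (h *\<^sub>R w) \<xi>"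
    by (rule second_difference[OF B CB mem(1-4)])
  obtain \<zeta> where \<zeta>: "\<zeta> \<in> ball x d" "f (x + h *\<^sub>R w + h *\<^sub>R u) - f (x + h *\<^sub>R w) - f (x + h *\<^sub>R u) + f x = ?a (h *\<^sub>R w) (h *\<^sub>R u) \<zeta>"
    by (rule second_difference[OF B CB mem(1,3,2,5)])
  have sc: "?a (h *\<^sub>R u) (h *\<^sub>R w) \<xi> = h * (h * ?a u w \<xi>)" if \<xi>: "\<xi> \<in> ball x d" for u w \<xi>
  proof -
    have c2: "Ck_on (Suc (Suc 0)) (ball x d) f" and c1: "\<And>u. Ck_on (Suc 0) (ball x d) (\<lambda>z. frechet_derivative f (at z) u)"
      using CB by (auto simp: numeral_2_eq_2)
    have e: "frechet_derivative f (at z) (h *\<^sub>R u) = h * frechet_derivative f (at z) u" if "z \<in> ball x d" for z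
      using linear_cmul[OF has_derivative_linear[OF Ck_on_has_derivative[OF c2 that]]] by simp
    have "frechet_derivative (\<lambda>z. frechet_derivative f (at z) (h *\<^sub>R u)) (at \<xi>) = frechet_derivative (\<lambda>z. h * frechet_derivative f (at z) u) (at \<xi>)"
      by (rule frechet_derivative_transform_within_open[OF _ B(2) \<xi> e]) (use c1 \<xi> in auto)
    also have "\<dots> = (\<lambda>v. h * frechet_derivative (\<lambda>z. frechet_derivative f (at z) u) (at \<xi>) v)"
      by (rule frechet_derivative_at[symmetric], rule has_derivative_mult_right, rule Ck_on_has_derivative[OF c1 \<xi>])
    finally show ?thesis using linear_cmul[OF has_derivative_linear[OF Ck_on_has_derivative[OF c1 \<xi>]]] by simp
  qed
  have "?a u w \<xi> = ?a w u \<zeta>" using \<xi>(2) \<zeta>(2) sc[OF \<xi>(1)] sc[OF \<zeta>(1)] h(1)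
    by (simp add: algebra_simps)
  moreover have "\<bar>?a u w \<xi> - ?a u w x\<bar> < \<epsilon>" "\<bar>?a w u \<zeta> - ?a w u x\<bar> < \<epsilon>"
    using d(3,4) \<xi>(1) \<zeta>(1) by (auto simp: d_def dist_real_def)
  ultimately show False unfolding \<epsilon>_def by (simp add: abs_if split: if_splits)
qed

section \<open>Linear algebra\<close>

text \<open>A dimension count: the range of \<open>F\<close> together with \<open>a\<close> and
  \<open>b\<close> is an injective linear image of a space of dimension DIM('a) + 2, so it is
  everything.\<close>

lemma orth_decomp:
  fixes F :: "'a::euclidean_space \<Rightarrow> 'e::euclidean_space"
  assumes lin: "linear F" and inj: "inj F" and dim: "DIM('e) = DIM('a) + 2"
    and ab: "norm a = 1" "norm b = 1" "a \<bullet> b = 0" and perp: "\<And>u. F u \<bullet> a = 0" "\<And>u. F u \<bullet> b = 0"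
  obtains u where "w = F u + (w \<bullet> a) *\<^sub>R a + (w \<bullet> b) *\<^sub>R b"
proof -
  have n: "a \<bullet> a = 1" "b \<bullet> b = 1" "b \<bullet> a = 0" using ab by (simp_all add: norm_eq_1 inner_commute)
  define G where "G = (\<lambda>(u, s, t). F u + s *\<^sub>R a + t *\<^sub>R (b::'e))"
  have linG: "linear G"
    unfolding G_def by (rule linearI) (auto simp: linear_add[OF lin] linear_cmul[OF lin] algebra_simps)
  have "inj G"
  proof (rule injI, clarsimp)
    fix u s t u' s' t' assume eq: "G (u, s, t) = G (u', s', t')"
    have "s = s'" using arg_cong[OF eq, of "\<lambda>x. x \<bullet> a"] by (simp add: G_def inner_add_left perp n)
    moreover have "t = t'" using arg_cong[OF eq, of "\<lambda>x. x \<bullet> b"] by (simp add: G_def inner_add_left perp n ab)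
    ultimately show "u = u' \<and> s = s' \<and> t = t'" using eq inj by (auto simp: G_def inj_def)
  qed
  then have "dim (range G) = dim (UNIV :: ('a \<times> real \<times> real) set)"
    by (intro dim_image_eq[OF linG]) (simp add: inj_on_subset)
  then have "dim (range G) = DIM('e)" by (simp add: dim)
  then have "span (range G) = UNIV" by (simp add: dim_eq_full)
  moreover have "subspace (range G)" by (rule linear_subspace_image[OF linG]) simp
  ultimately have "w \<in> range G" by (metis UNIV_I span_eq_iff)
  then obtain u s t where w: "w = F u + s *\<^sub>R a + t *\<^sub>R b" by (auto simp: G_def)
  have "s = w \<bullet> a" "t = w \<bullet> b" by (simp_all add: w inner_add_left perp n ab)
  then show thesis using that w by blast
qed

lemma quadratic_nonneg_linear_zero:
  fixes b c :: real
  assumes "\<And>t. 0 \<le> t * b + t\<^sup>2 * c" shows "b = 0"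
proof (rule ccontr)
  assume "b \<noteq> 0"
  define q where "q = \<bar>c\<bar> + 1"
  have q: "q > 0" "c \<le> q" by (auto simp: q_def)
  \<comment> \<open>The minimizer of t b + t^2 q, where \<open>q\<close> replaces \<open>c\<close>
    to have a positive leading coefficient.\<close>
  define t where "t = - b / (2 * q)"
  have "t * b + t\<^sup>2 * c \<le> t * b + t\<^sup>2 * q" using q by (simp add: mult_left_mono)
  also have "\<dots> = - (b\<^sup>2 / (4 * q))"
    using q unfolding t_def by (simp add: power2_eq_square field_simps)
  also have "\<dots> < 0" using q \<open>b \<noteq> 0\<close> by simp
  finally show False using assms[of t] by simp
qed

text \<open>Minimizes the Rayleigh quotient for the inner product F u \<bullet> F w over the unit
  sphere of the invariant subspace. At a minimum the first variation vanishes along the subspace,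
  which contains S u - \<kappa> u, so that vector is 0. Minimality also yields the inequality:
  \<kappa> is the least eigenvalue there.\<close>

lemma self_adjoint_eigenvector:
  fixes F :: "'a::euclidean_space \<Rightarrow> 'e::euclidean_space" and S :: "'a \<Rightarrow> 'a"
  assumes F: "linear F" "inj F" and S: "linear S" and sa: "\<And>u w. F (S u) \<bullet> F w = F u \<bullet> F (S w)"
    and X: "subspace X" "x0 \<in> X" "x0 \<noteq> 0" and inv: "\<And>x. x \<in> X \<Longrightarrow> S x \<in> X"
  shows "\<exists>u \<kappa>. u \<in> X \<and> u \<noteq> 0 \<and> S u = \<kappa> *\<^sub>R u \<and> (\<forall>w\<in>X. \<kappa> * (F w \<bullet> F w) \<le> F (S w) \<bullet> F w)"
proof -
  note Fs = linear_add[OF F(1)] linear_cmul[OF F(1)] linear_diff[OF F(1)]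
  note Ss = linear_add[OF S] linear_cmul[OF S]
  have F0: "F u \<bullet> F u > 0" if "u \<noteq> 0" for u
    using F that linear_injective_0 by (metis inner_gt_zero_iff)
  define r where "r u = (F (S u) \<bullet> F u) / (F u \<bullet> F u)" for u
  let ?K = "sphere 0 1 \<inter> X"
  have "compact ?K" by (intro compact_Int_closed compact_sphere closed_subspace X)
  moreover have "sgn x0 \<in> ?K"
    using X by (auto simp: norm_sgn sgn_div_norm intro: subspace_scale)
  moreover have "F u \<bullet> F u \<noteq> 0" if "u \<in> ?K" for u
    using F0[of u] that by force
  then have "continuous_on ?K r"
    unfolding r_def
    by (intro continuous_intros linear_continuous_on_compose[OF _ F(1)] linear_continuous_on_compose[OF _ S]) blast
  ultimately obtain u where u: "u \<in> ?K" "\<And>w. w \<in> ?K \<Longrightarrow> r u \<le> r w"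
    using continuous_attains_inf[of ?K r] by blast
  define \<kappa> where "\<kappa> = r u"
  have u0: "u \<noteq> 0" "u \<in> X" using u by auto
  have low: "\<kappa> * (F w \<bullet> F w) \<le> F (S w) \<bullet> F w" if w: "w \<in> X" for w
  proof (cases "w = 0")
    case True then show ?thesis using linear_0[OF F(1)] by simp
  next
    case False
    then have "sgn w \<in> ?K" using w X by (auto simp: norm_sgn sgn_div_norm intro: subspace_scale)
    then have "\<kappa> \<le> r (sgn w)" using u by (simp add: \<kappa>_def)
    also have "r (sgn w) = r w"
      using False by (simp add: r_def sgn_div_norm Fs Ss)
    finally show ?thesis using F0[OF False] by (simp add: r_def field_simps)
  qed
  have ku: "\<kappa> * (F u \<bullet> F u) = F (S u) \<bullet> F u" using F0[OF u0(1)] by (simp add: \<kappa>_def r_def)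
  have zero: "F (S u) \<bullet> F w - \<kappa> * (F u \<bullet> F w) = 0" if w: "w \<in> X" for w
  proof -
    have "0 \<le> t * (2 * (F (S u) \<bullet> F w - \<kappa> * (F u \<bullet> F w))) + t\<^sup>2 * (F (S w) \<bullet> F w - \<kappa> * (F w \<bullet> F w))" for t
    proof -
      have "u + t *\<^sub>R w \<in> X" using u0 w X by (auto intro: subspace_add subspace_scale)
      from low[OF this] ku sa[of w u] show ?thesis
        by (simp add: Fs Ss inner_add_left inner_add_right inner_commute power2_eq_square algebra_simps)
    qed
    from quadratic_nonneg_linear_zero[OF this] show ?thesis by simp
  qed
  define z where "z = S u - \<kappa> *\<^sub>R u"
  have "z \<in> X" unfolding z_def using u0 X inv by (auto intro: subspace_diff subspace_scale)
  have "F z \<bullet> F z = F (S u) \<bullet> F z - \<kappa> * (F u \<bullet> F z)"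
    by (simp add: z_def Fs inner_diff_left)
  then have "F z \<bullet> F z = 0" using zero[OF \<open>z \<in> X\<close>] by simp
  then have "z = 0" using F0[of z] by auto
  then have "S u = \<kappa> *\<^sub>R u" by (simp add: z_def)
  then show ?thesis using u0 low by blast
qed

text \<open>
  The lowest eigenspace of the given polynomial in \<open>S\<close> is invariant under \<open>S\<close>, and so contains an
  eigenvector of \<open>S\<close>.
\<close>

lemma quadratic_form_nonneg:
  fixes F :: "'a::euclidean_space \<Rightarrow> 'e::euclidean_space" and S :: "'a \<Rightarrow> 'a"
  assumes F: "linear F" "inj F" and S: "linear S" and sa: "\<And>u w. F (S u) \<bullet> F w = F u \<bullet> F (S w)"
    and P: "\<And>\<kappa> u. u \<noteq> 0 \<Longrightarrow> S u = \<kappa> *\<^sub>R u \<Longrightarrow> 0 \<le> \<alpha> + \<beta> * \<kappa> + \<gamma> * \<kappa>\<^sup>2"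
  shows "0 \<le> \<alpha> * (F w \<bullet> F w) + \<beta> * (F (S w) \<bullet> F w) + \<gamma> * (F (S w) \<bullet> F (S w))"
proof -
  note Fs = linear_add[OF F(1)] linear_cmul[OF F(1)]
  note Ss = linear_add[OF S] linear_cmul[OF S]
  define T where "T u = \<alpha> *\<^sub>R u + \<beta> *\<^sub>R S u + \<gamma> *\<^sub>R S (S u)" for u
  have T: "linear T" unfolding T_def by (rule linearI) (simp_all add: Ss algebra_simps)
  have saT: "F (T u) \<bullet> F w = F u \<bullet> F (T w)" for u w
    using sa[of "S u" w] sa[of u "S w"] sa[of u w]
    by (simp add: T_def Fs inner_add_left inner_add_right)
  obtain i :: 'a where i: "i \<in> Basis" by fastforce
  obtain u0 \<mu> where u0: "u0 \<noteq> 0" "T u0 = \<mu> *\<^sub>R u0" "\<And>w. \<mu> * (F w \<bullet> F w) \<le> F (T w) \<bullet> F w"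
    using self_adjoint_eigenvector[of F T UNIV i, OF F T saT subspace_UNIV UNIV_I nonzero_Basis[OF i] UNIV_I] by auto
  define Y where "Y = {u. T u = \<mu> *\<^sub>R u}"
  have sub: "subspace Y" unfolding Y_def subspace_def
    by (simp add: linear_0[OF T] linear_add[OF T] linear_cmul[OF T] algebra_simps)
  have invY: "S u \<in> Y" if "u \<in> Y" for u
  proof -
    have "T (S u) = S (T u)" by (simp add: T_def Ss)
    then show ?thesis using that by (simp add: Y_def Ss)
  qed
  have uY: "u0 \<in> Y" using u0 by (simp add: Y_def)
  obtain u1 \<kappa> where u1: "u1 \<in> Y" "u1 \<noteq> 0" "S u1 = \<kappa> *\<^sub>R u1"
    using self_adjoint_eigenvector[of F S Y u0, OF F S sa sub uY u0(1) invY] by auto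
  have "T u1 = (\<alpha> + \<beta> * \<kappa> + \<gamma> * \<kappa>\<^sup>2) *\<^sub>R u1"
    by (simp add: T_def u1(3) Ss power2_eq_square algebra_simps)
  then have "\<mu> = \<alpha> + \<beta> * \<kappa> + \<gamma> * \<kappa>\<^sup>2" using u1(1,2) by (simp add: Y_def)
  then have "\<mu> \<ge> 0" using P[OF u1(2,3)] by simp
  then have "0 \<le> F (T w) \<bullet> F w" using u0(3)[of w] by (meson inner_ge_zero mult_nonneg_nonneg order_trans)
  also have "\<dots> = \<alpha> * (F w \<bullet> F w) + \<beta> * (F (S w) \<bullet> F w) + \<gamma> * (F (S w) \<bullet> F (S w))"
    using sa[of "S w" w] by (simp add: T_def Fs inner_add_left)
  finally show ?thesis .
qed

text \<open>
  Apply \<open>quadratic_form_nonneg\<close> to the shape operator \<open>S\<close>, where \<open>M = - F S\<close>: its eigenvalues are the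
  cotangents of the \<open>\<rho>\<close> in the hypothesis.
\<close>

lemma pinching:
  fixes F M :: "'a::euclidean_space \<Rightarrow> 'e::euclidean_space"
  assumes F: "linear F" "inj F" and M: "linear M" and ran: "\<And>u. M u \<in> range F"
    and sa: "\<And>u w. M u \<bullet> F w = F u \<bullet> M w"
    and P: "\<And>\<rho> u. u \<noteq> 0 \<Longrightarrow> cos \<rho> *\<^sub>R F u + sin \<rho> *\<^sub>R M u = 0 \<Longrightarrow> k \<le> sin (2 * (\<rho> - a))"
  shows "k / 2 * (F w \<bullet> F w + M w \<bullet> M w) \<le> - ((cos a *\<^sub>R F w + sin a *\<^sub>R M w) \<bullet> (cos a *\<^sub>R M w - sin a *\<^sub>R F w))"
proof -
  obtain L where L: "linear L" "L \<circ> F = id" using linear_injective_left_inverse[OF F] by blast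
  define S where "S u = - L (M u)" for u
  have S: "linear S" unfolding S_def
    by (rule linearI) (simp_all add: linear_add[OF M] linear_cmul[OF M] linear_add[OF L(1)] linear_cmul[OF L(1)])
  have FS: "F (S u) = - M u" for u
  proof -
    obtain x where "M u = F x" using ran by blast
    then have "F (L (M u)) = M u" using L(2) by (metis comp_apply id_apply)
    then show ?thesis by (simp add: S_def linear_neg[OF F(1)])
  qed
  \<comment> \<open>If cot \<rho> = \<kappa>, then (1 + \<kappa>^2) sin (2 (\<rho> - a)) = 2
    \<kappa> cos (2 a) - (\<kappa>^2 - 1) sin (2 a). Subtracting k (1 + \<kappa>^2) leaves the
    quadratic polynomial in \<kappa> with these coefficients.\<close>
  have "0 \<le> (sin (2*a) - k) * (F w \<bullet> F w) + (2 * cos (2*a)) * (F (S w) \<bullet> F w) + (- sin (2*a) - k) * (F (S w) \<bullet> F (S w))"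
  proof (rule quadratic_form_nonneg[OF F S])
    show "F (S u) \<bullet> F w = F u \<bullet> F (S w)" for u w using sa[of u w] by (simp add: FS)
    fix \<kappa> u assume u: "u \<noteq> 0" "S u = \<kappa> *\<^sub>R u"
    define \<rho> where "\<rho> = pi / 2 - arctan \<kappa>"
    have gen: "q \<noteq> 0 \<Longrightarrow> (x / q * c - y / q * s) * q = x * c - y * s" for x y q c s :: real
      by (simp add: left_diff_distrib)
    have p: "1 + \<kappa>\<^sup>2 > 0" by (simp add: add_pos_nonneg)
    then have sq: "sqrt (1 + \<kappa>\<^sup>2) * sqrt (1 + \<kappa>\<^sup>2) = 1 + \<kappa>\<^sup>2" by simp
    have cs: "cos \<rho> = \<kappa> / sqrt (1 + \<kappa>\<^sup>2)" "sin \<rho> = 1 / sqrt (1 + \<kappa>\<^sup>2)"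
      by (simp_all add: \<rho>_def cos_diff sin_diff sin_arctan cos_arctan)
    have "M u = - \<kappa> *\<^sub>R F u" using FS[of u] u(2) by (simp add: linear_cmul[OF F(1)])
    then have "cos \<rho> *\<^sub>R F u + sin \<rho> *\<^sub>R M u = 0" by (simp add: cs)
    then have "k \<le> sin (2 * (\<rho> - a))" using P u(1) by blast
    also have "\<dots> = sin (2*\<rho>) * cos (2*a) - cos (2*\<rho>) * sin (2*a)" by (simp add: right_diff_distrib sin_diff)
    also have "sin (2*\<rho>) = 2 * \<kappa> / (1 + \<kappa>\<^sup>2)" by (simp add: sin_double cs sq)
    also have "cos (2*\<rho>) = (\<kappa>\<^sup>2 - 1) / (1 + \<kappa>\<^sup>2)"
      by (simp add: cos_double cs power_divide diff_divide_distrib abs_of_pos[OF p])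
    finally have "k * (1 + \<kappa>\<^sup>2) \<le> (2 * \<kappa> / (1 + \<kappa>\<^sup>2) * cos (2*a) - (\<kappa>\<^sup>2 - 1) / (1 + \<kappa>\<^sup>2) * sin (2*a)) * (1 + \<kappa>\<^sup>2)"
      using p by (intro mult_right_mono) auto
    also have "\<dots> = 2 * \<kappa> * cos (2*a) - (\<kappa>\<^sup>2 - 1) * sin (2*a)"
      using gen[of "1 + \<kappa>\<^sup>2" "2 * \<kappa>" "cos (2*a)" "\<kappa>\<^sup>2 - 1" "sin (2*a)"] p by linarith
    finally show "0 \<le> (sin (2*a) - k) + (2 * cos (2*a)) * \<kappa> + (- sin (2*a) - k) * \<kappa>\<^sup>2"
      by (simp add: algebra_simps)
  qed
  then have *: "0 \<le> (sin (2*a) - k) * (F w \<bullet> F w) - (2 * cos (2*a)) * (M w \<bullet> F w) + (- sin (2*a) - k) * (M w \<bullet> M w)"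
    by (simp add: FS)
  have "2 * - ((cos a *\<^sub>R F w + sin a *\<^sub>R M w) \<bullet> (cos a *\<^sub>R M w - sin a *\<^sub>R F w))
     = (2 * sin a * cos a) * (F w \<bullet> F w) - 2 * ((cos a)\<^sup>2 - (sin a)\<^sup>2) * (M w \<bullet> F w) - (2 * sin a * cos a) * (M w \<bullet> M w)"
    by (simp add: inner_add_left inner_diff_right inner_commute[of "F w" "M w"] power2_eq_square algebra_simps)
  then have "2 * - ((cos a *\<^sub>R F w + sin a *\<^sub>R M w) \<bullet> (cos a *\<^sub>R M w - sin a *\<^sub>R F w))
     = sin (2*a) * (F w \<bullet> F w) - 2 * cos (2*a) * (M w \<bullet> F w) - sin (2*a) * (M w \<bullet> M w)"
    by (simp add: sin_double cos_double)
  with * show ?thesis by (simp add: algebra_simps)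
qed

section \<open>Determinants of frames\<close>

lemma sum_option: "(\<Sum>x\<in>UNIV. h x) = h None + (\<Sum>i\<in>UNIV. h (Some i))" for h :: "'n::finite option \<Rightarrow> 'b::comm_monoid_add"
  by (simp add: UNIV_option_conv sum.reindex)

lemma prod_option: "(\<Prod>x\<in>UNIV. h x) = h None * (\<Prod>i\<in>UNIV. h (Some i))" for h :: "'n::finite option \<Rightarrow> 'b::comm_monoid_mult"
  by (simp add: UNIV_option_conv prod.reindex)

text \<open>The block matrix diag(1, U), with the index \<open>None\<close> for the entry 1. Applied
  twice, it extends a change of tangent frame to the whole ambient space.\<close>

definition blk :: "real ^ 'n ^ 'n \<Rightarrow> real ^ ('n::finite) option ^ 'n option" where
  "blk U = (\<chi> i j. case i of None \<Rightarrow> (if j = None then 1 else 0) | Some i' \<Rightarrow> (case j of None \<Rightarrow> 0 | Some j' \<Rightarrow> U $ i' $ j'))"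

lemma blk_nth [simp]:
  "blk U $ None $ None = 1" "blk U $ None $ Some j = 0" "blk U $ Some i $ None = 0" "blk U $ Some i $ Some j = U $ i $ j"
  by (simp_all add: blk_def)

lemma option_matrix_eqI:
  "A $ None $ None = B $ None $ None \<Longrightarrow> (\<And>j. A $ None $ Some j = B $ None $ Some j) \<Longrightarrow> (\<And>i. A $ Some i $ None = B $ Some i $ None) \<Longrightarrow>
   (\<And>i j. A $ Some i $ Some j = B $ Some i $ Some j) \<Longrightarrow> A = (B :: real ^ ('n::finite) option ^ 'n option)"
  unfolding vec_eq_iff by (metis not_None_eq)

lemma det_idplus:
  fixes m n :: "'n::finite" and c :: real
  assumes "m \<noteq> n" shows "det (\<chi> i j. if i = m \<and> j = n then c else of_bool (i = j)) = 1"
proof -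
  have "(\<chi> i j. if i = m \<and> j = n then c else of_bool (i = j)) = (\<chi> k. if k = m then row m (mat 1) + c *s row n (mat 1) else row k (mat 1 :: real^'n^'n))"
    using assms by (auto simp: vec_eq_iff row_def mat_def)
  then show ?thesis using det_row_operation[OF assms, where c = c and A = "mat 1"] by simp
qed

lemma det_swap:
  fixes m n :: "'n::finite"
  assumes "m \<noteq> n" shows "det (\<chi> i j. (mat 1 :: real^'n^'n) $ i $ Transposition.transpose m n j) = - 1"
  using det_permute_columns[where p = "Transposition.transpose m n" and A = "mat 1 :: real^'n^'n"] assms
  by (simp add: permutes_swap_id sign_swap_id)

text \<open>Induction over elementary matrices takes the place of a comparison of permutations of
  the two index types: the determinant and \<open>blk\<close> are multiplicative, and
  \<open>blk\<close> maps each elementary matrix to one of the same kind.\<close>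

lemma det_blk: "det (blk U) = det U"
proof (induction U rule: induct_matrix_elementary)
  case (1 A B)
  have "blk (A ** B) = blk A ** blk B"
    by (rule option_matrix_eqI) (simp_all add: matrix_matrix_mult_def sum_option)
  then show ?case by (simp add: det_mul 1)
next
  case (2 A i)
  have "A $ i $ j = 0" for j using 2 by (simp add: row_def vec_eq_iff)
  then have "row (Some i) (blk A) = 0" unfolding vec_eq_iff row_def by (simp add: blk_def split: option.split)
  then show ?case using det_zero_row 2 by metis
next
  case (3 A)
  have "blk A $ i $ j = 0" if "i \<noteq> j" for i j
    using that 3 by (cases i; cases j) auto
  then show ?case using 3 by (simp add: det_diagonal prod_option)
next
  case (4 m n)
  have "blk (\<chi> i j. mat 1 $ i $ Transposition.transpose m n j) = (\<chi> i j. mat 1 $ i $ Transposition.transpose (Some m) (Some n) j)"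
    by (rule option_matrix_eqI) (auto simp: mat_def Transposition.transpose_def)
  then show ?case using det_swap[OF 4] det_swap[of "Some m" "Some n"] 4 by simp
next
  case (5 m n c)
  have "blk (\<chi> i j. if i = m \<and> j = n then c else of_bool (i = j)) = (\<chi> i j. if i = Some m \<and> j = Some n then c else of_bool (i = j))"
    by (rule option_matrix_eqI) (auto simp: mat_def)
  then show ?case using det_idplus[OF 5] det_idplus[of "Some m" "Some n"] 5 by simp
qed

text \<open>The matrix whose determinant is tested in \<open>pos_orthonormal_sphere_frame\<close>,
  with the candidate normal \<open>w\<close> separated from the tangent vectors
  \<open>r\<close>.\<close>

definition frame_matrix :: "real ^ 'n option option \<Rightarrow> real ^ 'n option option \<Rightarrow> (('n::finite) \<Rightarrow> real ^ 'n option option) \<Rightarrow> real ^ 'n option option ^ 'n option option" where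
  "frame_matrix q w r = (\<chi> k. case k of None \<Rightarrow> q | Some i \<Rightarrow> (case i of None \<Rightarrow> w | Some j \<Rightarrow> r j))"

lemma frame_matrix_nth [simp]:
  "frame_matrix q w r $ None = q" "frame_matrix q w r $ Some None = w" "frame_matrix q w r $ Some (Some j) = r j"
  by (simp_all add: frame_matrix_def)

text \<open>A change of tangent frame multiplies the frame matrix from the left by diag(1, 1, U),
  where the rows of U are the new vectors in coordinates.\<close>

lemma det_frame_linear:
  fixes D :: "real ^ 'n::finite \<Rightarrow> real ^ 'n option option"
  assumes "linear D"
  shows "det (frame_matrix q w (\<lambda>j. D (u j))) = det (\<chi> i. u i) * det (frame_matrix q w (\<lambda>j. D (axis j 1)))"
proof -
  have Du: "D (u j) = (\<Sum>i\<in>UNIV. (u j $ i) *\<^sub>R D (axis i 1))" for j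
  proof -
    have "u j = (\<Sum>i\<in>UNIV. (u j $ i) *\<^sub>R axis i 1)"
      by (simp add: vec_eq_iff axis_def if_distrib cong: if_cong)
    then have "D (u j) = D (\<Sum>i\<in>UNIV. (u j $ i) *\<^sub>R axis i 1)" by simp
    then show ?thesis by (simp add: linear_sum[OF assms] linear_cmul[OF assms])
  qed
  have "frame_matrix q w (\<lambda>j. D (u j)) = blk (blk (\<chi> i. u i)) ** frame_matrix q w (\<lambda>j. D (axis j 1))"
  proof (subst vec_eq_iff, rule allI)
    fix k :: "'n option option"
    show "frame_matrix q w (\<lambda>j. D (u j)) $ k = (blk (blk (\<chi> i. u i)) ** frame_matrix q w (\<lambda>j. D (axis j 1))) $ k"
    proof (cases k)
      case None
      then show ?thesis by (simp add: vec_eq_iff matrix_matrix_mult_def sum_option)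
    next
      case (Some i)
      then show ?thesis
        by (cases i) (simp_all add: vec_eq_iff matrix_matrix_mult_def sum_option Du)
    qed
  qed
  then show ?thesis by (simp add: det_mul det_blk)
qed

section \<open>Local convexity from first derivatives\<close>

text \<open>Continuity in each fixed direction gives closeness in operator norm because a basis is
  finite: an error \<epsilon> / DIM('a) for each basis vector adds up to \<epsilon>.\<close>

lemma deriv_close:
  fixes F' :: "'a::euclidean_space \<Rightarrow> 'a \<Rightarrow> 'e::euclidean_space"
  assumes S: "open S" "x0 \<in> S" and cont: "\<And>u. continuous_on S (\<lambda>x. F' x u)"
    and lin: "\<And>x. x \<in> S \<Longrightarrow> linear (F' x)" and \<epsilon>: "\<epsilon> > 0"
  shows "\<exists>d>0. ball x0 d \<subseteq> S \<and> (\<forall>x\<in>ball x0 d. \<forall>u. norm (F' x u - F' x0 u) \<le> \<epsilon> * norm u)"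
proof -
  define \<eta> where "\<eta> = \<epsilon> / real DIM('a)"
  have \<eta>: "\<eta> > 0" using \<epsilon> by (simp add: \<eta>_def)
  have "\<forall>\<^sub>F x in nhds x0. \<forall>b\<in>Basis. norm (F' x b - F' x0 b) < \<eta>"
  proof (rule eventually_ball_finite)
    show "\<forall>b\<in>Basis. \<forall>\<^sub>F x in nhds x0. norm (F' x b - F' x0 b) < \<eta>"
    proof
      fix b :: 'a
      have "isCont (\<lambda>x. F' x b) x0" using cont S by (simp add: continuous_on_eq_continuous_at)
      then have "((\<lambda>x. F' x b) \<longlongrightarrow> F' x0 b) (nhds x0)" unfolding isCont_def tendsto_at_iff_tendsto_nhds[of "\<lambda>x. F' x b" x0] .
      then show "\<forall>\<^sub>F x in nhds x0. norm (F' x b - F' x0 b) < \<eta>"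
        using tendstoD[OF _ \<eta>] by (force simp: dist_norm)
    qed
  qed simp
  moreover have "\<forall>\<^sub>F x in nhds x0. x \<in> S" using S by (rule eventually_nhds_in_open)
  ultimately have "\<forall>\<^sub>F x in nhds x0. x \<in> S \<and> (\<forall>b\<in>Basis. norm (F' x b - F' x0 b) < \<eta>)" by eventually_elim auto
  then obtain d where d: "d > 0" "\<And>x. dist x x0 < d \<Longrightarrow> x \<in> S \<and> (\<forall>b\<in>Basis. norm (F' x b - F' x0 b) < \<eta>)"
    unfolding eventually_nhds_metric by blast
  have "norm (F' x u - F' x0 u) \<le> \<epsilon> * norm u" if "x \<in> ball x0 d" for x u
  proof -
    have x: "x \<in> S" "\<And>b. b \<in> Basis \<Longrightarrow> norm (F' x b - F' x0 b) < \<eta>" using d(2)[of x] that by (auto simp: dist_commute)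
    have exp: "F' y u = (\<Sum>b\<in>Basis. (u \<bullet> b) *\<^sub>R F' y b)" if "y \<in> S" for y
    proof -
      have "F' y u = F' y (\<Sum>b\<in>Basis. (u \<bullet> b) *\<^sub>R b)" by (simp add: euclidean_representation)
      then show ?thesis by (simp add: linear_sum[OF lin[OF that]] linear_cmul[OF lin[OF that]])
    qed
    have "F' x u - F' x0 u = (\<Sum>b\<in>Basis. (u \<bullet> b) *\<^sub>R (F' x b - F' x0 b))"
      unfolding exp[OF x(1)] exp[OF S(2)] by (simp add: sum_subtractf scaleR_diff_right)
    also have "norm \<dots> \<le> (\<Sum>b\<in>(Basis::'a set). norm u * \<eta>)"
    proof (rule sum_norm_le)
      fix b :: 'a assume b: "b \<in> Basis"
      show "norm ((u \<bullet> b) *\<^sub>R (F' x b - F' x0 b)) \<le> norm u * \<eta>"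
        unfolding norm_scaleR using x(2)[OF b] Basis_le_norm[OF b, of u] by (intro mult_mono) auto
    qed
    also have "\<dots> = \<epsilon> * norm u" by (simp add: \<eta>_def)
    finally show ?thesis .
  qed
  moreover have "ball x0 d \<subseteq> S" using d(2) by (auto simp: dist_commute)
  ultimately show ?thesis using d(1) by blast
qed

lemma deriv_linearization:
  fixes F :: "'a::euclidean_space \<Rightarrow> 'e::euclidean_space"
  assumes B: "convex B" and der: "\<And>x. x \<in> B \<Longrightarrow> (F has_derivative F' x) (at x)"
    and cl: "\<And>x u. x \<in> B \<Longrightarrow> norm (F' x u - F' x0 u) \<le> \<epsilon> * norm u" and x0: "x0 \<in> B" and xy: "x \<in> B" "y \<in> B"
    and \<epsilon>: "\<epsilon> \<ge> 0"
  shows "norm (F x - F y - F' x0 (x - y)) \<le> \<epsilon> * norm (x - y)"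
proof -
  have "norm (F x - F y - F' x0 (x - y)) \<le> norm (x - y) * \<epsilon>"
  proof (rule differentiable_bound_linearization[of y x B F F' x0 \<epsilon>])
    show "y + t *\<^sub>R (x - y) \<in> B" if "t \<in> {0..1}" for t
      using convexD_alt[OF B xy(2,1), of t] that by (simp add: algebra_simps)
    show "(F has_derivative F' z) (at z within B)" if "z \<in> B" for z
      using der[OF that] by (rule has_derivative_at_withinI)
    show "onorm (F' z - F' x0) \<le> \<epsilon>" if "z \<in> B" for z
      by (rule onorm_bound[OF \<epsilon>]) (use cl[OF that] in simp)
  qed (rule x0)
  then show ?thesis by (simp add: mult.commute)
qed

text \<open>The pair (g, v) in one chart: \<open>F\<close> for \<open>g\<close>, \<open>M\<close>
  for \<open>v\<close>. By \<open>FM'\<close>, \<open>M\<close> is a normal field of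
  \<open>F\<close>, and \<open>pinch\<close> is the infinitesimal form of strict convexity; it also
  forces \<open>M'\<close> to be injective.\<close>

locale pair_chart =
  fixes O1 :: "'a::euclidean_space set" and F M :: "'a \<Rightarrow> 'e::euclidean_space" and F' M' k
  assumes O1: "open O1"
    and dF: "\<And>x. x \<in> O1 \<Longrightarrow> (F has_derivative F' x) (at x)" and dM: "\<And>x. x \<in> O1 \<Longrightarrow> (M has_derivative M' x) (at x)"
    and cF: "\<And>u. continuous_on O1 (\<lambda>x. F' x u)" and cM: "\<And>u. continuous_on O1 (\<lambda>x. M' x u)"
    and nF: "\<And>x. x \<in> O1 \<Longrightarrow> norm (F x) = 1" and nM: "\<And>x. x \<in> O1 \<Longrightarrow> norm (M x) = 1"
    and FM: "\<And>x. x \<in> O1 \<Longrightarrow> F x \<bullet> M x = 0" and FM': "\<And>x u. x \<in> O1 \<Longrightarrow> F' x u \<bullet> M x = 0"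
    and injF: "\<And>x. x \<in> O1 \<Longrightarrow> inj (F' x)"
    and k: "k > 0" and pinch: "\<And>x u. x \<in> O1 \<Longrightarrow> k * (F' x u \<bullet> F' x u + M' x u \<bullet> M' x u) \<le> - (F' x u \<bullet> M' x u)"
    and dim: "DIM('e) = DIM('a) + 2"
begin

lemma linF: "x \<in> O1 \<Longrightarrow> linear (F' x)" using dF has_derivative_linear by blast
lemma linM: "x \<in> O1 \<Longrightarrow> linear (M' x)" using dM has_derivative_linear by blast

lemma injM: assumes "x \<in> O1" shows "inj (M' x)"
proof -
  have "u = 0" if "M' x u = 0" for u
  proof -
    have "k * (F' x u \<bullet> F' x u) \<le> 0" using pinch[OF assms, of u] that by simp
    then have "F' x u \<bullet> F' x u \<le> 0" using k by (simp add: mult_le_0_iff)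
    then have "F' x u = 0" by (metis inner_eq_zero_iff inner_ge_zero order_antisym)
    then show ?thesis using injF[OF assms] linear_injective_0[OF linF[OF assms]] by blast
  qed
  then show ?thesis using linear_injective_0[OF linM[OF assms]] by blast
qed

lemma perps:
  assumes x: "x \<in> O1"
  shows "F' x u \<bullet> F x = 0" "M' x u \<bullet> M x = 0" "M' x u \<bullet> F x = 0"
proof -
  have const: "((\<lambda>x. A x \<bullet> B x) has_derivative (\<lambda>_. 0)) (at x)" if "\<And>x. x \<in> O1 \<Longrightarrow> A x \<bullet> B x = c" for A B :: "'a \<Rightarrow> 'e" and c
    by (rule has_derivative_transform_within_open[OF has_derivative_const[of c] O1 x]) (use that in simp)
  have uniq: "A x \<bullet> B' u + A' u \<bullet> B x = 0"
    if "(A has_derivative A') (at x)" "(B has_derivative B') (at x)" "\<And>x. x \<in> O1 \<Longrightarrow> A x \<bullet> B x = c" for A B :: "'a \<Rightarrow> 'e" and A' B' c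
    using has_derivative_unique[OF has_derivative_inner[OF that(1,2)] const[of A B c, OF that(3)]] by (metis (no_types))
  show "F' x u \<bullet> F x = 0" using uniq[OF dF[OF x] dF[OF x], of 1] nF by (simp add: norm_eq_1 inner_commute)
  show "M' x u \<bullet> M x = 0" using uniq[OF dM[OF x] dM[OF x], of 1] nM by (simp add: norm_eq_1 inner_commute)
  show "M' x u \<bullet> F x = 0" using uniq[OF dF[OF x] dM[OF x], of 0] FM FM'[OF x] by (simp add: inner_commute)
qed

text \<open>The function \<open>w \<bullet> M\<close> has a local minimum at \<open>x\<close>, so
  \<open>w\<close> is orthogonal to the range of \<open>M' x\<close>. That range spans everything
  together with \<open>F x\<close> and \<open>M x\<close>.\<close>

lemma tangM:
  assumes x: "x \<in> O1" and S: "open S" "x \<in> S" "\<And>y. y \<in> S \<Longrightarrow> 0 \<le> w \<bullet> M y" and w0: "w \<bullet> M x = 0"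
  shows "\<exists>c. w = c *\<^sub>R F x"
proof -
  have "((\<lambda>y. w \<bullet> M y) has_derivative (\<lambda>u. w \<bullet> M' x u)) (at x)"
    by (intro has_derivative_inner_right dM x)
  moreover have "\<forall>\<^sub>F y in at x. w \<bullet> M x \<le> w \<bullet> M y"
    using eventually_at_in_open'[OF S(1,2)] by eventually_elim (use S(3) w0 in simp)
  ultimately have "(\<lambda>u. w \<bullet> M' x u) = (\<lambda>_. 0)" by (rule has_derivative_local_min)
  then have wz: "w \<bullet> M' x u = 0" for u by metis
  obtain u where u: "w = M' x u + (w \<bullet> F x) *\<^sub>R F x + (w \<bullet> M x) *\<^sub>R M x"
    using orth_decomp[OF linM[OF x] injM[OF x] dim nF[OF x] nM[OF x] FM[OF x] perps(3,2)[OF x]] by metis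
  have "M' x u \<bullet> M' x u = w \<bullet> M' x u"
    using arg_cong[OF u, of "\<lambda>z. z \<bullet> M' x u"] perps[OF x] w0 by (simp add: inner_add_left inner_add_right inner_commute)
  then have "M' x u = 0" using wz by simp
  then show ?thesis using u w0 by auto
qed

lemma tangF:
  assumes x: "x \<in> O1" and S: "open S" "x \<in> S" "\<And>y. y \<in> S \<Longrightarrow> 0 \<le> w \<bullet> F y" and w0: "w \<bullet> F x = 0"
  shows "\<exists>c. w = c *\<^sub>R M x"
proof -
  have "((\<lambda>y. w \<bullet> F y) has_derivative (\<lambda>u. w \<bullet> F' x u)) (at x)"
    by (intro has_derivative_inner_right dF x)
  moreover have "\<forall>\<^sub>F y in at x. w \<bullet> F x \<le> w \<bullet> F y"
    using eventually_at_in_open'[OF S(1,2)] by eventually_elim (use S(3) w0 in simp)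
  ultimately have "(\<lambda>u. w \<bullet> F' x u) = (\<lambda>_. 0)" by (rule has_derivative_local_min)
  then have wz: "w \<bullet> F' x u = 0" for u by metis
  obtain u where u: "w = F' x u + (w \<bullet> F x) *\<^sub>R F x + (w \<bullet> M x) *\<^sub>R M x"
    using orth_decomp[OF linF[OF x] injF[OF x] dim nF[OF x] nM[OF x] FM[OF x] perps(1)[OF x] FM'[OF x]] by metis
  have "F' x u \<bullet> F' x u = w \<bullet> F' x u"
    using arg_cong[OF u, of "\<lambda>z. z \<bullet> F' x u"] perps[OF x] FM'[OF x] w0 by (simp add: inner_add_left inner_add_right inner_commute)
  then have "F' x u = 0" using wz by simp
  then show ?thesis using u w0 by auto
qed

text \<open>By the mean value theorem and \<open>FM'\<close>, F x \<bullet> M y = - F' u \<bullet>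
  (M z - M y) with u = x - y and the derivative taken at a point z = y + t u. To leading order this
  is - t F' u \<bullet> M' u at \<open>x0\<close>, which \<open>pinch\<close> bounds below by t c1
  |u|^2. Replacing derivatives by those at \<open>x0\<close> costs a small multiple of t
  |u|^2.\<close>

lemma local_strict:
  assumes x0: "x0 \<in> O1"
  shows "\<exists>d>0. ball x0 d \<subseteq> O1 \<and> (\<forall>x\<in>ball x0 d. \<forall>y\<in>ball x0 d. x \<noteq> y \<longrightarrow> 0 < F x \<bullet> M y)"
proof -
  obtain b where b: "b > 0" "\<And>u. b * norm u \<le> norm (F' x0 u)"
    using linear_inj_bounded_below_pos[OF linF[OF x0] injF[OF x0]] by metis
  obtain C1 where C1: "C1 > 0" "\<And>u. norm (F' x0 u) \<le> C1 * norm u" using linear_bounded_pos[OF linF[OF x0]] by blast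
  obtain C2 where C2: "C2 > 0" "\<And>u. norm (M' x0 u) \<le> C2 * norm u" using linear_bounded_pos[OF linM[OF x0]] by blast
  define c1 where "c1 = k * b\<^sup>2"
  have c1: "c1 > 0" using k b by (simp add: c1_def)
  have low: "c1 * (norm u)\<^sup>2 \<le> - (F' x0 u \<bullet> M' x0 u)" for u
  proof -
    have "(b * norm u)\<^sup>2 \<le> (norm (F' x0 u))\<^sup>2" using b by (intro power_mono) auto
    then have "k * (b * norm u)\<^sup>2 \<le> k * (F' x0 u \<bullet> F' x0 u)" using k by (simp add: power2_norm_eq_inner)
    also have "\<dots> \<le> k * (F' x0 u \<bullet> F' x0 u + M' x0 u \<bullet> M' x0 u)" using k by simp
    also have "\<dots> \<le> - (F' x0 u \<bullet> M' x0 u)" by (rule pinch[OF x0])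
    finally show ?thesis by (simp add: c1_def power_mult_distrib)
  qed
  \<comment> \<open>Chosen such that the two error coefficients \<epsilon> C2 and (C1 + \<epsilon>)
    \<epsilon> together are at most c1 / 2; the bound \<epsilon> \<le> 1 makes the second one linear
    in \<epsilon>.\<close>
  define \<epsilon> where "\<epsilon> = min 1 (c1 / (2 * (C1 + C2 + 1)))"
  have \<epsilon>: "\<epsilon> > 0" "\<epsilon> \<le> 1" using c1 C1 C2 by (auto simp: \<epsilon>_def)
  have \<epsilon>c: "\<epsilon> * C2 + (C1 + \<epsilon>) * \<epsilon> < c1"
  proof -
    have "\<epsilon> * (C1 + C2 + \<epsilon>) \<le> \<epsilon> * (C1 + C2 + 1)" using \<epsilon> by simp
    also have "\<dots> \<le> c1 / (2 * (C1 + C2 + 1)) * (C1 + C2 + 1)" using C1 C2 by (intro mult_right_mono) (auto simp: \<epsilon>_def)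
    also have "\<dots> = c1 / 2"
    proof -
      have "c1 / (2 * q) * q = c1 / 2" if "q > 0" for q :: real using that by simp
      from this[of "C1 + C2 + 1"] show ?thesis using C1(1) C2(1) by linarith
    qed
    also have "\<dots> < c1" using c1 by simp
    finally show ?thesis by (simp add: algebra_simps)
  qed
  obtain d1 where d1: "d1 > 0" "ball x0 d1 \<subseteq> O1" "\<forall>x\<in>ball x0 d1. \<forall>u. norm (F' x u - F' x0 u) \<le> \<epsilon> * norm u"
    using deriv_close[of O1 x0 F', OF O1 x0 cF linF \<epsilon>(1)] by blast
  obtain d2 where d2: "d2 > 0" "ball x0 d2 \<subseteq> O1" "\<forall>x\<in>ball x0 d2. \<forall>u. norm (M' x u - M' x0 u) \<le> \<epsilon> * norm u"
    using deriv_close[of O1 x0 M', OF O1 x0 cM linM \<epsilon>(1)] by blast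
  define d where "d = min d1 d2"
  have sub: "ball x0 d \<subseteq> O1" "ball x0 d \<subseteq> ball x0 d1" "ball x0 d \<subseteq> ball x0 d2" using d1 by (auto simp: d_def)
  have "0 < F x \<bullet> M y" if xy: "x \<in> ball x0 d" "y \<in> ball x0 d" "x \<noteq> y" for x y
  proof -
    define u where "u = x - y"
    have u0: "norm u > 0" using xy by (simp add: u_def)
    define z where "z t = y + t *\<^sub>R u" for t
    have zB: "z t \<in> ball x0 d" if "0 \<le> t" "t \<le> 1" for t
      using convexD_alt[OF convex_ball xy(2,1) that] by (simp add: z_def u_def algebra_simps)
    have der: "DERIV (\<lambda>t. F (z t) \<bullet> M y) t :> F' (z t) u \<bullet> M y" if "0 \<le> t" "t \<le> 1" for t
    proof -
      have zO: "z t \<in> O1" using zB[OF that] sub by blast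
      have "((\<lambda>t. F (z t)) has_derivative (\<lambda>h. F' (z t) (h *\<^sub>R u))) (at t)"
        unfolding z_def
        by (rule has_derivative_compose[of "\<lambda>t. y + t *\<^sub>R u" "\<lambda>h. h *\<^sub>R u" t UNIV F, OF _ dF[OF zO, unfolded z_def]])
          (auto intro!: derivative_eq_intros)
      then have "((\<lambda>t. F (z t) \<bullet> M y) has_derivative (\<lambda>h. F' (z t) (h *\<^sub>R u) \<bullet> M y)) (at t)"
        by (rule has_derivative_inner_left)
      then show ?thesis
        unfolding has_field_derivative_def by (simp add: linear_cmul[OF linF[OF zO]] mult_commute_abs)
    qed
    obtain t where t: "0 < t" "t < 1" "F (z 1) \<bullet> M y - F (z 0) \<bullet> M y = (1 - 0) * (F' (z t) u \<bullet> M y)"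
      using MVT2[OF zero_less_one der] by blast
    have zt: "z t \<in> ball x0 d" "z t \<in> O1" using zB[of t] t sub by auto
    have "F x \<bullet> M y = F' (z t) u \<bullet> M y" using t(3) FM[of y] xy sub by (auto simp: z_def u_def)
    also have "\<dots> = - (F' (z t) u \<bullet> (M (z t) - M y))" using FM'[OF zt(2)] by (simp add: inner_diff_right)
    finally have main: "F x \<bullet> M y = - (F' (z t) u \<bullet> (M (z t) - M y))" .
    define err where "err = M (z t) - M y - M' x0 (z t - y)"
    have err: "norm err \<le> \<epsilon> * (t * norm u)"
    proof -
      have "norm err \<le> \<epsilon> * norm (z t - y)" unfolding err_def
      proof (rule deriv_linearization[of "ball x0 d" M M' x0 \<epsilon>])
        show "\<And>x. x \<in> ball x0 d \<Longrightarrow> (M has_derivative M' x) (at x)" using dM sub by blast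
        show "\<And>x u. x \<in> ball x0 d \<Longrightarrow> norm (M' x u - M' x0 u) \<le> \<epsilon> * norm u" using d2 sub by blast
        show "x0 \<in> ball x0 d" using d1 d2 by (simp add: d_def)
      qed (use zt xy \<epsilon> in auto)
      then show ?thesis using t by (simp add: z_def)
    qed
    have "M (z t) - M y = t *\<^sub>R M' x0 u + err"
      unfolding err_def by (simp add: z_def linear_cmul[OF linM[OF x0]])
    then have "F x \<bullet> M y = t * - (F' x0 u \<bullet> M' x0 u) - t * ((F' (z t) u - F' x0 u) \<bullet> M' x0 u) - F' (z t) u \<bullet> err"
      unfolding main by (simp add: inner_add_right inner_diff_left algebra_simps)
    moreover have "t * - (F' x0 u \<bullet> M' x0 u) \<ge> t * (c1 * (norm u)\<^sup>2)" using low[of u] t by (intro mult_left_mono) auto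
    moreover have "t * ((F' (z t) u - F' x0 u) \<bullet> M' x0 u) \<le> t * ((\<epsilon> * norm u) * (C2 * norm u))"
    proof (rule mult_left_mono)
      have "(F' (z t) u - F' x0 u) \<bullet> M' x0 u \<le> norm (F' (z t) u - F' x0 u) * norm (M' x0 u)" by (rule norm_cauchy_schwarz)
      also have "\<dots> \<le> (\<epsilon> * norm u) * (C2 * norm u)" using d1(3) zt(1) sub C2 \<epsilon> by (intro mult_mono) auto
      finally show "(F' (z t) u - F' x0 u) \<bullet> M' x0 u \<le> (\<epsilon> * norm u) * (C2 * norm u)" .
    qed (use t in simp)
    moreover have "F' (z t) u \<bullet> err \<le> ((C1 + \<epsilon>) * norm u) * (\<epsilon> * (t * norm u))"
    proof -
      have "norm (F' (z t) u - F' x0 u) \<le> \<epsilon> * norm u" using d1(3) zt(1) sub by blast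
      then have "norm (F' (z t) u) \<le> (C1 + \<epsilon>) * norm u"
        using norm_triangle_sub[of "F' (z t) u" "F' x0 u"] C1(2)[of u] by (simp add: algebra_simps)
      moreover have "F' (z t) u \<bullet> err \<le> norm (F' (z t) u) * norm err" by (rule norm_cauchy_schwarz)
      moreover have "norm (F' (z t) u) * norm err \<le> ((C1 + \<epsilon>) * norm u) * (\<epsilon> * (t * norm u))"
        using calculation(1) err C1(1) \<epsilon> by (intro mult_mono) auto
      ultimately show ?thesis by linarith
    qed
    ultimately have "F x \<bullet> M y \<ge> t * (c1 * (norm u)\<^sup>2) - t * ((\<epsilon> * norm u) * (C2 * norm u)) - ((C1 + \<epsilon>) * norm u) * (\<epsilon> * (t * norm u))"
      by linarith
    also have "t * (c1 * (norm u)\<^sup>2) - t * ((\<epsilon> * norm u) * (C2 * norm u)) - ((C1 + \<epsilon>) * norm u) * (\<epsilon> * (t * norm u))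
       = t * (norm u)\<^sup>2 * (c1 - (\<epsilon> * C2 + (C1 + \<epsilon>) * \<epsilon>))"
      by (simp add: power2_eq_square algebra_simps)
    finally have "F x \<bullet> M y \<ge> t * (norm u)\<^sup>2 * (c1 - (\<epsilon> * C2 + (C1 + \<epsilon>) * \<epsilon>))" .
    moreover have "t * (norm u)\<^sup>2 * (c1 - (\<epsilon> * C2 + (C1 + \<epsilon>) * \<epsilon>)) > 0"
      using t u0 \<epsilon>c by (intro mult_pos_pos) auto
    ultimately show ?thesis by linarith
  qed
  moreover have "d > 0" using d1 d2 by (simp add: d_def)
  ultimately show ?thesis using sub(1) by blast
qed

text \<open>For \<open>G'\<close> the differential of \<open>f\<close>, this bounds lengths by
  displacements of \<open>M\<close>. With Q = |F' u|^2 + |M' u|^2, \<open>pinch\<close> and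
  Cauchy-Schwarz give k Q \<le> sqrt Q |M' u|, hence |G' u| \<le> |M' u| / k at \<open>x0\<close>.
  In the chosen ball the derivatives vary by at most half the lower bound \<open>b\<close> of
  \<open>M'\<close>, so |M' u| / 2 \<le> |M x - M y|, which leads to the constant 2 (1/k +
  1).\<close>

lemma local_length:
  fixes G' :: "'a \<Rightarrow> 'a \<Rightarrow> 'e"
  assumes x0: "x0 \<in> O1" and cG: "\<And>u. continuous_on O1 (\<lambda>x. G' x u)" and linG: "\<And>x. x \<in> O1 \<Longrightarrow> linear (G' x)"
    and G: "\<And>x u. x \<in> O1 \<Longrightarrow> G' x u \<bullet> G' x u \<le> F' x u \<bullet> F' x u + M' x u \<bullet> M' x u"
  shows "\<exists>d>0. ball x0 d \<subseteq> O1 \<and> (\<forall>x\<in>ball x0 d. \<forall>y\<in>ball x0 d. \<forall>z\<in>ball x0 d. norm (G' z (x - y)) \<le> 2 * (1 / k + 1) * norm (M x - M y))"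
proof -
  obtain b where b: "b > 0" "\<And>u. b * norm u \<le> norm (M' x0 u)"
    using linear_inj_bounded_below_pos[OF linM[OF x0] injM[OF x0]] by metis
  have GM: "norm (G' x0 u) \<le> norm (M' x0 u) / k" for u
  proof -
    define Q where "Q = F' x0 u \<bullet> F' x0 u + M' x0 u \<bullet> M' x0 u"
    have Q0: "Q \<ge> 0" by (simp add: Q_def)
    have "k * Q \<le> norm (F' x0 u) * norm (M' x0 u)"
      using pinch[OF x0, of u] Cauchy_Schwarz_ineq2[of "F' x0 u" "M' x0 u"] by (simp add: Q_def)
    also have "\<dots> \<le> sqrt Q * norm (M' x0 u)"
      by (intro mult_right_mono) (auto simp: norm_eq_sqrt_inner Q_def)
    finally have "k * (sqrt Q * sqrt Q) \<le> sqrt Q * norm (M' x0 u)" using Q0 by simp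
    then have "sqrt Q * (k * sqrt Q) \<le> sqrt Q * norm (M' x0 u)" by (simp add: algebra_simps)
    then have "k * sqrt Q \<le> norm (M' x0 u) \<or> sqrt Q = 0" using Q0 by (auto simp: mult_le_cancel_left)
    then have "k * sqrt Q \<le> norm (M' x0 u)" by auto
    moreover have "norm (G' x0 u) \<le> sqrt Q" using G[OF x0, of u] by (simp add: norm_eq_sqrt_inner Q_def)
    ultimately show ?thesis using k by (simp add: field_simps) (meson mult_left_mono less_imp_le order_trans)
  qed
  define \<epsilon> where "\<epsilon> = b / 2"
  have \<epsilon>: "\<epsilon> > 0" using b by (simp add: \<epsilon>_def)
  obtain d1 where d1: "d1 > 0" "ball x0 d1 \<subseteq> O1" "\<forall>x\<in>ball x0 d1. \<forall>u. norm (G' x u - G' x0 u) \<le> \<epsilon> * norm u"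
    using deriv_close[of O1 x0 G', OF O1 x0 cG linG \<epsilon>(1)] by blast
  obtain d2 where d2: "d2 > 0" "ball x0 d2 \<subseteq> O1" "\<forall>x\<in>ball x0 d2. \<forall>u. norm (M' x u - M' x0 u) \<le> \<epsilon> * norm u"
    using deriv_close[of O1 x0 M', OF O1 x0 cM linM \<epsilon>(1)] by blast
  define d where "d = min d1 d2"
  have sub: "ball x0 d \<subseteq> O1" "ball x0 d \<subseteq> ball x0 d1" "ball x0 d \<subseteq> ball x0 d2" using d1 by (auto simp: d_def)
  have "norm (G' z (x - y)) \<le> 2 * (1 / k + 1) * norm (M x - M y)"
    if xyz: "x \<in> ball x0 d" "y \<in> ball x0 d" "z \<in> ball x0 d" for x y z
  proof -
    define u where "u = x - y"
    have e: "\<epsilon> * norm u \<le> norm (M' x0 u) / 2" using b(2)[of u] by (simp add: \<epsilon>_def)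
    have "norm (M x - M y - M' x0 u) \<le> \<epsilon> * norm u" unfolding u_def
    proof (rule deriv_linearization[of "ball x0 d" M M' x0 \<epsilon>])
      show "\<And>x. x \<in> ball x0 d \<Longrightarrow> (M has_derivative M' x) (at x)" using dM sub by blast
      show "\<And>x u. x \<in> ball x0 d \<Longrightarrow> norm (M' x u - M' x0 u) \<le> \<epsilon> * norm u" using d2 sub by blast
      show "x0 \<in> ball x0 d" using d1 d2 by (simp add: d_def)
    qed (use xyz \<epsilon> in auto)
    then have "norm (M' x0 u) / 2 \<le> norm (M x - M y)"
      using e norm_triangle_ineq2[of "M' x0 u" "M' x0 u - (M x - M y)"] by (simp add: norm_minus_commute)
    moreover have "norm (G' z u) \<le> norm (M' x0 u) / k + norm (M' x0 u) / 2"
    proof -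
      have "norm (G' z u - G' x0 u) \<le> \<epsilon> * norm u" using d1 xyz sub by blast
      then show ?thesis using norm_triangle_sub[of "G' z u" "G' x0 u"] GM[of u] e by linarith
    qed
    moreover have "norm (M' x0 u) / k + norm (M' x0 u) / 2 \<le> 2 * (1 / k + 1) * (norm (M' x0 u) / 2)"
      using k by (simp add: field_simps)
    moreover have "2 * (1 / k + 1) * (norm (M' x0 u) / 2) \<le> 2 * (1 / k + 1) * norm (M x - M y)"
      using calculation(1) k by (intro mult_left_mono) auto
    ultimately show ?thesis unfolding u_def by linarith
  qed
  moreover have "d > 0" using d1 d2 by (simp add: d_def)
  ultimately show ?thesis using sub(1) by blast
qed

end

section \<open>Charts\<close>

lemma Ck_on_local:
  "(\<And>x. x \<in> S \<Longrightarrow> \<exists>T. open T \<and> x \<in> T \<and> Ck_on k T f) \<Longrightarrow> Ck_on k S f"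
proof (induction k arbitrary: f)
  case 0
  have "isCont f x" if "x \<in> S" for x
    using 0[OF that] by (auto simp: continuous_on_eq_continuous_at)
  then show ?case by (simp add: continuous_at_imp_continuous_on)
next
  case (Suc k)
  have "f differentiable (at x)" if "x \<in> S" for x using Suc.prems[OF that] by auto
  moreover have "Ck_on k S (\<lambda>x. frechet_derivative f (at x) v)" for v
  proof (rule Suc.IH)
    fix x assume "x \<in> S"
    from Suc.prems[OF this] obtain T where T: "open T" "x \<in> T" "Ck_on (Suc k) T f" by blast
    from T(3) have "Ck_on k T (\<lambda>x. frechet_derivative f (at x) v)" by simp
    with T show "\<exists>T. open T \<and> x \<in> T \<and> Ck_on k T (\<lambda>x. frechet_derivative f (at x) v)" by blast
  qed
  ultimately show ?case by simp
qed

lemma smooth_on_local: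
  assumes "\<And>x. x \<in> S \<Longrightarrow> \<exists>T. open T \<and> x \<in> T \<and> smooth_on T f" shows "smooth_on S f"
proof (unfold smooth_on_def, intro allI Ck_on_local)
  fix k x assume "x \<in> S"
  from assms[OF this] show "\<exists>T. open T \<and> x \<in> T \<and> Ck_on k T f" unfolding smooth_on_def by blast
qed

abbreviation cran :: "('p, 'e) chart \<Rightarrow> 'e set" where "cran c \<equiv> snd c ` fst c"

locale smooth_mfd =
  fixes M :: "('p, 'd::euclidean_space) manifold"
  assumes mfd: "smooth_manifold M"
begin

lemma haus: "Hausdorff_space (mtop M)" using mfd by (simp add: smooth_manifold_def)

lemma covered: "p \<in> points M \<Longrightarrow> \<exists>c. c \<in> charts_at M p"
  using mfd unfolding smooth_manifold_def charts_at_def by blast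

lemma charts_atD: "c \<in> charts_at M p \<Longrightarrow> c \<in> atlas M" "c \<in> charts_at M p \<Longrightarrow> p \<in> fst c"
  by (auto simp: charts_at_def)

context
  fixes c assumes c: "c \<in> atlas M"
begin

lemma dom_open: "openin (mtop M) (fst c)" and ran_open: "open (cran c)"
  and homeo: "homeomorphic_map (subtopology (mtop M) (fst c)) (top_of_set (cran c)) (snd c)"
  using mfd c unfolding smooth_manifold_def by blast+

lemma dom_sub: "fst c \<subseteq> points M"
  using openin_subset[OF dom_open] .

lemma top_dom: "topspace (subtopology (mtop M) (fst c)) = fst c"
  using dom_sub by auto

lemma chart_inj: "inj_on (snd c) (fst c)"
  using homeomorphic_imp_injective_map[OF homeo] unfolding top_dom .

lemma chart_inv_chart [simp]: "p \<in> fst c \<Longrightarrow> chart_inv c (snd c p) = p"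
  using chart_inj by (simp add: chart_inv_def)

lemma chart_inv_in: "x \<in> cran c \<Longrightarrow> chart_inv c x \<in> fst c"
  by (simp add: chart_inv_def inv_into_into)

lemma chart_chart_inv [simp]: "x \<in> cran c \<Longrightarrow> snd c (chart_inv c x) = x"
  by (simp add: chart_inv_def f_inv_into_f)

lemma chart_inv_points: "x \<in> cran c \<Longrightarrow> chart_inv c x \<in> points M"
  using chart_inv_in dom_sub by blast

lemma cont_chart: "continuous_map (subtopology (mtop M) (fst c)) euclidean (snd c)"
  using homeomorphic_imp_continuous_map[OF homeo] by (simp add: continuous_map_in_subtopology)

lemma open_image:
  assumes "openin (mtop M) U" shows "open (snd c ` (U \<inter> fst c))"
proof -
  have "openin (subtopology (mtop M) (fst c)) (U \<inter> fst c)"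
    using assms by (auto simp: openin_subtopology)
  then have "openin (top_of_set (cran c)) (snd c ` (U \<inter> fst c))"
    using homeomorphic_map_openness[OF homeo, of "U \<inter> fst c"] top_dom by auto
  then show ?thesis using ran_open openin_open_trans by blast
qed

lemma open_preimage:
  assumes "open W" shows "openin (mtop M) {p \<in> fst c. snd c p \<in> W}"
proof -
  have "openin (subtopology (mtop M) (fst c)) {p \<in> topspace (subtopology (mtop M) (fst c)). snd c p \<in> W}"
    by (rule openin_continuous_map_preimage[OF cont_chart]) (use assms in simp)
  then show ?thesis unfolding top_dom using dom_open openin_trans_full by blast
qed

lemma chart_inv_image: "W \<subseteq> cran c \<Longrightarrow> chart_inv c ` W = {p \<in> fst c. snd c p \<in> W}"
proof (intro set_eqI iffI)
  fix p assume W: "W \<subseteq> cran c"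
  show "p \<in> {p \<in> fst c. snd c p \<in> W}" if "p \<in> chart_inv c ` W" using that W chart_inv_in by auto
  show "p \<in> chart_inv c ` W" if "p \<in> {p \<in> fst c. snd c p \<in> W}" using that by (auto intro!: image_eqI[of _ _ "snd c p"])
qed

lemma open_chart_inv: "open W \<Longrightarrow> W \<subseteq> cran c \<Longrightarrow> openin (mtop M) (chart_inv c ` W)"
  using chart_inv_image open_preimage by simp

lemma cont_chart_inv: "continuous_map (top_of_set (cran c)) (mtop M) (chart_inv c)"
  unfolding continuous_map_def
proof (intro conjI allI impI)
  show "chart_inv c \<in> topspace (top_of_set (cran c)) \<rightarrow> points M" using chart_inv_points by auto
  fix U assume U: "openin (mtop M) U"
  have "{x \<in> topspace (top_of_set (cran c)). chart_inv c x \<in> U} = snd c ` (U \<inter> fst c)"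
  proof (intro set_eqI iffI)
    fix x assume x: "x \<in> {x \<in> topspace (top_of_set (cran c)). chart_inv c x \<in> U}"
    then have "x = snd c (chart_inv c x)" "chart_inv c x \<in> U \<inter> fst c" using chart_inv_in by simp_all
    then show "x \<in> snd c ` (U \<inter> fst c)" by (rule image_eqI)
  next
    fix x assume "x \<in> snd c ` (U \<inter> fst c)"
    then show "x \<in> {x \<in> topspace (top_of_set (cran c)). chart_inv c x \<in> U}" by auto
  qed
  moreover have "openin (top_of_set (cran c)) (snd c ` (U \<inter> fst c))"
    by (rule open_subset[OF _ open_image[OF U]]) blast
  ultimately show "openin (top_of_set (cran c)) {x \<in> topspace (top_of_set (cran c)). chart_inv c x \<in> U}" by simp
qed

end

lemma trans_smooth:
  "c \<in> atlas M \<Longrightarrow> d \<in> atlas M \<Longrightarrow> smooth_on (snd c ` (fst c \<inter> fst d)) (\<lambda>x. snd d (chart_inv c x))"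
  using mfd unfolding smooth_manifold_def by (auto simp: o_def)

lemma overlap_open: "c \<in> atlas M \<Longrightarrow> d \<in> atlas M \<Longrightarrow> open (snd c ` (fst c \<inter> fst d))"
  using open_image[of c "fst d"] dom_open by (metis inf_commute)

end

section \<open>Stereographic charts\<close>

text \<open>Stereographic projection from \<open>pole \<sigma>\<close>. The signs \<sigma> = 1 and
  \<sigma> = - 1 give the two charts of \<open>sphere_mfd\<close>, which are thus treated together;
  \<open>ist\<close> is the inverse.\<close>

definition st :: "real \<Rightarrow> real ^ ('m::finite) option \<Rightarrow> real ^ 'm" where
  "st \<sigma> x = (\<chi> i. x $ Some i / (1 - \<sigma> * x $ None))"

definition ist :: "real \<Rightarrow> real ^ ('m::finite) \<Rightarrow> real ^ 'm option" where
  "ist \<sigma> y = (\<chi> k. case k of None \<Rightarrow> \<sigma> * (y \<bullet> y - 1) / (y \<bullet> y + 1) | Some i \<Rightarrow> 2 * y $ i / (y \<bullet> y + 1))"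

definition pole :: "real \<Rightarrow> real ^ ('m::finite) option" where "pole \<sigma> = \<sigma> *\<^sub>R axis None 1"

lemma inner_option: "x \<bullet> y = x $ None * y $ None + (\<Sum>i\<in>UNIV. x $ Some i * y $ Some i)" for x y :: "real ^ ('m::finite) option"
  by (simp add: inner_vec_def sum_option)

lemma ist_st_aux:
  assumes \<sigma>: "\<sigma> = 1 \<or> \<sigma> = - 1" and x: "norm x = 1" "x \<noteq> pole \<sigma>"
  shows "1 - \<sigma> * x $ None > 0" "ist \<sigma> (st \<sigma> x) = x"
proof -
  have s2: "\<sigma> * \<sigma> = 1" "\<bar>\<sigma>\<bar> = 1" using \<sigma> by auto
  have n1: "x \<bullet> x = 1" using x by (simp add: norm_eq_1)
  have "\<bar>x $ None\<bar> \<le> 1" using component_le_norm_cart[of x None] x by simp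
  then have le: "\<sigma> * x $ None \<le> 1" using \<sigma> by auto
  have "\<sigma> * x $ None \<noteq> 1"
  proof
    assume "\<sigma> * x $ None = 1"
    then have xn: "x $ None = \<sigma>" using s2 \<sigma> by auto
    then have "(\<Sum>i\<in>UNIV. x $ Some i * x $ Some i) = 0" using n1 s2 by (simp add: inner_option)
    then have "x $ Some i = 0" for i by (subst (asm) sum_nonneg_eq_0_iff) auto
    then have "x = pole \<sigma>" using xn by (simp add: vec_eq_iff pole_def axis_def) (metis not_None_eq)
    then show False using x by simp
  qed
  then show pos: "1 - \<sigma> * x $ None > 0" using le by simp
  define q where "q = 1 - \<sigma> * x $ None"
  have q: "q > 0" "\<sigma> * x $ None = 1 - q" using pos by (auto simp: q_def)
  have xn: "x $ None = \<sigma> * (1 - q)" using s2 by (simp add: q_def algebra_simps)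
  have "(\<Sum>i\<in>UNIV. x $ Some i * x $ Some i) = 1 - (1 - q)\<^sup>2"
  proof -
    have "x $ None * x $ None = (1 - q)\<^sup>2" unfolding xn power2_eq_square using s2 by (metis mult.assoc mult.commute mult_1)
    then show ?thesis using n1 by (simp add: inner_option)
  qed
  then have "st \<sigma> x \<bullet> st \<sigma> x = (1 - (1 - q)\<^sup>2) / q\<^sup>2"
    unfolding st_def q_def[symmetric] by (simp add: inner_vec_def power2_eq_square sum_divide_distrib[symmetric])
  also have "\<dots> = (2 - q) / q" using q by (simp add: power2_eq_square field_simps)
  finally have y: "st \<sigma> x \<bullet> st \<sigma> x = (2 - q) / q" .
  have y1: "st \<sigma> x \<bullet> st \<sigma> x + 1 = 2 / q" "st \<sigma> x \<bullet> st \<sigma> x - 1 = 2 * (1 - q) / q"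
    unfolding y using q by (simp_all add: field_simps)
  have "ist \<sigma> (st \<sigma> x) $ k = x $ k" for k
  proof (cases k)
    case None
    then show ?thesis using q by (simp add: ist_def y1 xn)
  next
    case (Some i)
    then show ?thesis using q by (simp add: ist_def y1) (simp add: st_def q_def[symmetric])
  qed
  then show "ist \<sigma> (st \<sigma> x) = x" by (simp add: vec_eq_iff)
qed

lemma st_ist:
  assumes \<sigma>: "\<sigma> = 1 \<or> \<sigma> = - 1"
  shows "st \<sigma> (ist \<sigma> y) = y" "norm (ist \<sigma> y) = 1" "ist \<sigma> y \<noteq> pole \<sigma>"
proof -
  have s2: "\<sigma> * \<sigma> = 1" using \<sigma> by auto
  define r where "r = y \<bullet> y"
  have r: "r \<ge> 0" "r + 1 > 0" by (auto simp: r_def intro: add_nonneg_pos)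
  have n: "ist \<sigma> y $ None = \<sigma> * ((r - 1) / (r + 1))" "\<And>i. ist \<sigma> y $ Some i = 2 * y $ i / (r + 1)"
    by (simp_all add: ist_def r_def)
  have q: "1 - \<sigma> * ist \<sigma> y $ None = 2 / (r + 1)"
    unfolding n using r s2 by (simp add: mult.assoc[symmetric]) (simp add: field_simps)
  show "st \<sigma> (ist \<sigma> y) = y" unfolding st_def q using r by (simp add: n vec_eq_iff)
  have "(\<Sum>i\<in>UNIV. y $ i * y $ i) = r" by (simp add: r_def inner_vec_def)
  then have "ist \<sigma> y \<bullet> ist \<sigma> y = ((r - 1) / (r + 1))\<^sup>2 + 4 * r / (r + 1)\<^sup>2"
    unfolding inner_option n using s2
    by (simp add: power2_eq_square sum_divide_distrib[symmetric] sum_distrib_left[symmetric] mult.assoc[symmetric])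
       (simp add: mult.assoc sum_distrib_left[symmetric] mult.left_commute[of _ 2])
  also have "\<dots> = 1" using r by (simp add: power_divide add_divide_distrib[symmetric]) (simp add: power2_eq_square algebra_simps)
  finally show "norm (ist \<sigma> y) = 1" by (simp add: norm_eq_1)
  show "ist \<sigma> y \<noteq> pole \<sigma>"
  proof
    assume "ist \<sigma> y = pole \<sigma>"
    then have "ist \<sigma> y $ None = \<sigma>" by (simp add: pole_def axis_def)
    then show False using q s2 r by simp
  qed
qed

lemma smooth_st: "smooth_on {x. 1 - \<sigma> * x $ None > 0} (st \<sigma>)"
proof (rule smooth_on_vec)
  show op: "open {x::real ^ 'a option. 1 - \<sigma> * x $ None > 0}"
    by (intro open_Collect_less continuous_intros)
  fix i
  have "smooth_on {x::real ^ 'a option. 1 - \<sigma> * x $ None > 0} (\<lambda>x. x $ Some i / (1 - \<sigma> * x $ None))"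
    by (intro smooth_on_divide smooth_on_diff smooth_on_mult smooth_on_const op smooth_on_nth smooth_on_id) auto
  then show "smooth_on {x::real ^ 'a option. 1 - \<sigma> * x $ None > 0} (\<lambda>x. st \<sigma> x $ i)" by (simp add: st_def)
qed

lemma open_st: "open {x::real ^ ('a::finite) option. 1 - \<sigma> * x $ None > 0}"
  by (intro open_Collect_less continuous_intros)

lemma smooth_ist: "smooth_on UNIV (ist \<sigma>)"
proof (rule smooth_on_vec)
  fix k :: "'a option"
  have pos: "y \<bullet> y + 1 \<noteq> 0" for y :: "real ^ 'a" by (metis add_nonneg_pos inner_ge_zero less_irrefl zero_less_one)
  show "smooth_on UNIV (\<lambda>y. ist \<sigma> y $ k)"
  proof (cases k)
    case None
    have "smooth_on UNIV (\<lambda>y::real^'a. \<sigma> * (y \<bullet> y - 1) / (y \<bullet> y + 1))"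
      by (intro smooth_on_divide smooth_on_diff smooth_on_add smooth_on_mult smooth_on_const smooth_on_inner smooth_on_id open_UNIV pos)
    then show ?thesis by (simp add: ist_def None)
  next
    case (Some i)
    have "smooth_on UNIV (\<lambda>y::real^'a. 2 * y $ i / (y \<bullet> y + 1))"
      by (intro smooth_on_divide smooth_on_add smooth_on_mult smooth_on_const smooth_on_inner smooth_on_nth smooth_on_id open_UNIV pos)
    then show ?thesis by (simp add: ist_def Some)
  qed
qed simp

definition sch :: "real \<Rightarrow> (real ^ ('m::finite) option, real ^ 'm) chart" where
  "sch \<sigma> = (sphere 0 1 - {pole \<sigma>}, st \<sigma>)"

lemma atlas_sphere: "atlas sphere_mfd = {sch 1, sch (- 1)}"
  by (simp add: sphere_mfd_def sch_def pole_def st_def[abs_def])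

lemma mtop_sphere [simp]: "mtop sphere_mfd = top_of_set (sphere 0 1)"
  by (simp add: sphere_mfd_def)

lemma sch_cran: assumes "\<sigma> = 1 \<or> \<sigma> = - 1" shows "cran (sch \<sigma>) = UNIV"
proof -
  have "y \<in> cran (sch \<sigma>)" for y
    using st_ist[OF assms, of y] by (intro image_eqI[of _ _ "ist \<sigma> y"]) (auto simp: sch_def)
  then show ?thesis by blast
qed

lemma sch_inv: assumes "\<sigma> = 1 \<or> \<sigma> = - 1" shows "chart_inv (sch \<sigma>) y = ist \<sigma> y"
proof -
  have y: "y \<in> cran (sch \<sigma>)" using sch_cran[OF assms] by blast
  have "chart_inv (sch \<sigma>) y \<in> fst (sch \<sigma>)" "st \<sigma> (chart_inv (sch \<sigma>) y) = y"
    using inv_into_into[OF y] f_inv_into_f[OF y] by (simp_all add: chart_inv_def sch_def)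
  then show ?thesis using ist_st_aux(2)[OF assms, of "chart_inv (sch \<sigma>) y"] by (simp add: sch_def)
qed

lemma sch_dom_open:
  "\<sigma> = 1 \<or> \<sigma> = - 1 \<Longrightarrow> openin (top_of_set (sphere 0 1)) (fst (sch \<sigma>))"
  by (simp add: sch_def openin_delete)

context smooth_mfd begin

text \<open>Since \<open>st\<close> and \<open>ist\<close> are smooth on open subsets of Euclidean
  spaces, composing with them passes between the chart expression and the vector valued map. Near
  each point a chart is taken whose pole is not the image of that point.\<close>

lemma smooth_map_sphere_iff:
  fixes h :: "'p \<Rightarrow> real ^ ('m::finite) option"
  shows "smooth_map M sphere_mfd h \<longleftrightarrow>
    (\<forall>p\<in>points M. norm (h p) = 1) \<and> (\<forall>c\<in>atlas M. smooth_on (cran c) (\<lambda>x. h (chart_inv c x)))" (is "?L \<longleftrightarrow> ?R")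
proof
  assume L: ?L
  then have cont: "continuous_map (mtop M) (top_of_set (sphere 0 1)) h" by (simp add: smooth_map_def)
  then have n: "norm (h p) = 1" if "p \<in> points M" for p
    using that by (auto simp: continuous_map_def Pi_iff)
  have "smooth_on (cran c) (\<lambda>x. h (chart_inv c x))" if c: "c \<in> atlas M" for c
  proof (rule smooth_on_local)
    fix x assume x: "x \<in> cran c"
    let ?p = "chart_inv c x"
    have p: "?p \<in> fst c" "?p \<in> points M" using chart_inv_in[OF c x] chart_inv_points[OF c x] .
    obtain \<sigma> :: real where \<sigma>: "\<sigma> = 1 \<or> \<sigma> = - 1" "h ?p \<noteq> pole \<sigma>"
    proof (cases "h ?p = pole 1")
      case True
      have "h ?p \<noteq> pole (- 1)" unfolding True pole_def by (simp add: vec_eq_iff axis_def)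
      then show thesis using that by blast
    next
      case False then show thesis using that by blast
    qed
    define T where "T = snd c ` {p \<in> fst c. h p \<in> fst (sch \<sigma>)}"
    have hd: "h ?p \<in> fst (sch \<sigma>)" using n[OF p(2)] \<sigma> by (simp add: sch_def)
    have "openin (mtop M) {p \<in> points M. h p \<in> fst (sch \<sigma>)}"
      using openin_continuous_map_preimage[OF cont sch_dom_open[OF \<sigma>(1)]] .
    from open_image[OF c this]
    have op: "open (snd c ` ({p \<in> points M. h p \<in> fst (sch \<sigma>)} \<inter> fst c))" .
    have "{p \<in> points M. h p \<in> fst (sch \<sigma>)} \<inter> fst c = {p \<in> fst c. h p \<in> fst (sch \<sigma>)}"
      using dom_sub[OF c] by blast
    with op have "open T" by (simp add: T_def)
    moreover have "x \<in> T" unfolding T_def using x p hd c by (intro image_eqI[of _ _ ?p]) auto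
    moreover have "smooth_on T (\<lambda>x. h (chart_inv c x))"
    proof -
      have "sch \<sigma> \<in> atlas sphere_mfd" using \<sigma> by (auto simp: atlas_sphere)
      then have "smooth_on T (snd (sch \<sigma>) \<circ> h \<circ> chart_inv c)"
        using L c unfolding smooth_map_def T_def by blast
      then have sm: "smooth_on T (\<lambda>x. st \<sigma> (h (chart_inv c x)))" by (simp add: sch_def o_def)
      have eq: "ist \<sigma> (st \<sigma> (h (chart_inv c y))) = h (chart_inv c y)" if "y \<in> T" for y
        using that ist_st_aux(2)[OF \<sigma>(1)] c by (auto simp: T_def sch_def)
      have "smooth_on T (\<lambda>x. ist \<sigma> (st \<sigma> (h (chart_inv c x))))"
        by (rule smooth_on_compose[OF \<open>open T\<close> open_UNIV sm smooth_ist]) simp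
      then show ?thesis using smooth_on_cong[OF \<open>open T\<close>, of "\<lambda>x. ist \<sigma> (st \<sigma> (h (chart_inv c x)))"] eq by simp
    qed
    ultimately show "\<exists>T. open T \<and> x \<in> T \<and> smooth_on T (\<lambda>x. h (chart_inv c x))" by blast
  qed
  then show ?R using n by blast
next
  assume R: ?R
  have cont: "continuous_map (mtop M) (top_of_set (sphere 0 1)) h"
  proof -
    have "continuous_map (mtop M) euclidean h"
      unfolding continuous_map_def
    proof (intro conjI allI impI)
      fix U :: "(real ^ 'm option) set" assume "openin euclidean U"
      then have U: "open U" by simp
      show "openin (mtop M) {p \<in> points M. h p \<in> U}"
      proof (subst openin_subopen, intro ballI)
        fix p assume p: "p \<in> {p \<in> points M. h p \<in> U}"
        obtain c where c: "c \<in> atlas M" "p \<in> fst c" using covered[of p] p charts_atD by blast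
        have "continuous_on (cran c) (\<lambda>x. h (chart_inv c x))" using R c smooth_on_continuous by blast
        then have W: "open (cran c \<inter> (\<lambda>x. h (chart_inv c x)) -` U)"
          using continuous_open_preimage[OF _ ran_open[OF c(1)] U] by blast
        let ?T = "{q \<in> fst c. snd c q \<in> cran c \<inter> (\<lambda>x. h (chart_inv c x)) -` U}"
        have *: "h (chart_inv c (snd c q)) = h q" if "q \<in> fst c" for q using that c(1) by simp
        have "?T \<subseteq> {p \<in> points M. h p \<in> U}"
        proof
          fix q assume "q \<in> ?T"
          then have "q \<in> fst c \<and> h (chart_inv c (snd c q)) \<in> U" by (simp only: mem_Collect_eq Int_iff vimage_eq)
          then show "q \<in> {p \<in> points M. h p \<in> U}" using *[of q] dom_sub[OF c(1)] by auto
        qed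
        moreover have "p \<in> ?T" using c(2) p *[of p] by simp
        ultimately show "\<exists>T. openin (mtop M) T \<and> p \<in> T \<and> T \<subseteq> {p \<in> points M. h p \<in> U}"
          using open_preimage[OF c(1) W] by blast
      qed
    qed auto
    then show ?thesis using R by (auto simp: continuous_map_in_subtopology)
  qed
  have "smooth_on (snd c ` {p \<in> fst c. h p \<in> fst d}) (snd d \<circ> h \<circ> chart_inv c)"
    if c: "c \<in> atlas M" and d: "d \<in> atlas sphere_mfd" for c d
  proof -
    obtain \<sigma> :: real where \<sigma>: "\<sigma> = 1 \<or> \<sigma> = - 1" "d = sch \<sigma>" using d by (auto simp: atlas_sphere)
    define T where "T = snd c ` {p \<in> fst c. h p \<in> fst (sch \<sigma>)}"
    have "openin (mtop M) {p \<in> points M. h p \<in> fst (sch \<sigma>)}"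
      using openin_continuous_map_preimage[OF cont sch_dom_open[OF \<sigma>(1)]] .
    from open_image[OF c this]
    have op: "open (snd c ` ({p \<in> points M. h p \<in> fst (sch \<sigma>)} \<inter> fst c))" .
    have "{p \<in> points M. h p \<in> fst (sch \<sigma>)} \<inter> fst c = {p \<in> fst c. h p \<in> fst (sch \<sigma>)}"
      using dom_sub[OF c] by blast
    with op have "open T" by (simp add: T_def)
    have "smooth_on T (\<lambda>x. h (chart_inv c x))"
      by (rule smooth_on_subset[of "cran c"]) (use R c in \<open>auto simp: T_def\<close>)
    then have "smooth_on T (\<lambda>x. st \<sigma> (h (chart_inv c x)))"
    proof (rule smooth_on_compose[OF \<open>open T\<close> open_st _ smooth_st])
      fix x assume "x \<in> T"
      then show "h (chart_inv c x) \<in> {x. 0 < 1 - \<sigma> * x $ None}"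
        using ist_st_aux(1)[OF \<sigma>(1)] c by (auto simp: T_def sch_def)
    qed
    then show ?thesis unfolding T_def \<sigma>(2) by (simp add: sch_def o_def)
  qed
  then show ?L using cont by (simp add: smooth_map_def)
qed

text \<open>In a chart of the sphere the derivative is \<open>D1\<close> after
  \<open>df c h p\<close>. As \<open>ist\<close> inverts \<open>st\<close> on the sphere,
  \<open>D2\<close> after \<open>D1\<close> fixes the range of \<open>df c h p\<close>, so
  \<open>D1\<close> is injective on that range.\<close>

lemma immersion_sphere_iff:
  fixes h :: "'p \<Rightarrow> real ^ ('m::finite) option"
  shows "immersion M sphere_mfd h \<longleftrightarrow>
    smooth_map M sphere_mfd h \<and> (\<forall>p. \<forall>c\<in>charts_at M p. inj (df c h p))" (is "?L \<longleftrightarrow> ?R")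
proof -
  have key: "inj (frechet_derivative (snd d \<circ> h \<circ> chart_inv c) (at (snd c p))) \<longleftrightarrow> inj (df c h p)"
    if sm: "smooth_map M sphere_mfd h" and c: "c \<in> charts_at M p" and d: "d \<in> charts_at sphere_mfd (h p)" for p c d
  proof -
    have cA: "c \<in> atlas M" "p \<in> fst c" using c charts_atD by auto
    obtain \<sigma> :: real where \<sigma>: "\<sigma> = 1 \<or> \<sigma> = - 1" "d = sch \<sigma>" using d by (auto simp: atlas_sphere charts_at_def)
    let ?x = "snd c p" let ?H = "\<lambda>x. h (chart_inv c x)"
    have hp: "norm (h p) = 1" "h p \<noteq> pole \<sigma>" using d by (auto simp: charts_at_def \<sigma> sch_def)
    have xr: "?x \<in> cran c" using cA by simp
    have smH: "smooth_on (cran c) ?H" using sm cA smooth_map_sphere_iff by blast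
    have dH: "(?H has_derivative df c h p) (at ?x)"
      using smooth_on_has_derivative[OF smH xr] by (simp add: df_def o_def)
    have "h p \<in> {x. 1 - \<sigma> * x $ None > 0}" using ist_st_aux(1)[OF \<sigma>(1) hp] by simp
    then obtain D1 where D1: "(st \<sigma> has_derivative D1) (at (h p))" using smooth_on_has_derivative[OF smooth_st] by blast
    obtain D2 where D2: "(ist \<sigma> has_derivative D2) (at (st \<sigma> (h p)))" using smooth_on_has_derivative[OF smooth_ist] by blast
    have e: "?H ?x = h p" using cA by simp
    have d1: "((\<lambda>x. st \<sigma> (?H x)) has_derivative (\<lambda>u. D1 (df c h p u))) (at ?x)"
      using has_derivative_compose[OF dH, of "st \<sigma>" D1] D1 e by simp
    have d2: "((\<lambda>x. ist \<sigma> (st \<sigma> (?H x))) has_derivative (\<lambda>u. D2 (D1 (df c h p u)))) (at ?x)"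
      using has_derivative_compose[OF d1, of "ist \<sigma>" D2] D2 e by simp
    have cont: "continuous_on (cran c) ?H" by (rule smooth_on_continuous[OF smH])
    define W where "W = cran c \<inter> ?H -` (- {pole \<sigma>})"
    have W: "open W" unfolding W_def by (rule continuous_open_preimage[OF cont ran_open[OF cA(1)]]) auto
    have xW: "?x \<in> W" using xr e hp by (simp add: W_def)
    have "ist \<sigma> (st \<sigma> (?H y)) = ?H y" if "y \<in> W" for y
    proof (rule ist_st_aux(2)[OF \<sigma>(1)])
      have "chart_inv c y \<in> points M" using that chart_inv_points[OF cA(1)] by (simp add: W_def)
      then show "norm (?H y) = 1" using sm smooth_map_sphere_iff by blast
    qed (use that in \<open>simp add: W_def\<close>)
    from has_derivative_transform_within_open[OF d2 W xW this]
    have eq: "df c h p = (\<lambda>u. D2 (D1 (df c h p u)))" by (rule has_derivative_unique[OF dH])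
    have fd: "frechet_derivative (snd d \<circ> h \<circ> chart_inv c) (at ?x) = (\<lambda>u. D1 (df c h p u))"
      using frechet_derivative_at[OF d1] by (simp add: \<sigma>(2) sch_def o_def)
    show ?thesis unfolding fd
    proof
      assume "inj (\<lambda>u. D1 (df c h p u))" then show "inj (df c h p)" by (auto simp: inj_def)
    next
      assume i: "inj (df c h p)"
      show "inj (\<lambda>u. D1 (df c h p u))"
      proof (rule injI)
        fix u w assume "D1 (df c h p u) = D1 (df c h p w)"
        then have "df c h p u = df c h p w" using eq by metis
        then show "u = w" using i by (simp add: inj_def)
      qed
    qed
  qed
  have ex: "\<exists>d. d \<in> charts_at sphere_mfd (h p)" if sm: "smooth_map M sphere_mfd h" and "c \<in> charts_at M p" for c p
  proof -
    have "p \<in> points M" using that charts_atD dom_sub by blast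
    then have n: "norm (h p) = 1" using sm smooth_map_sphere_iff by blast
    have "pole 1 \<noteq> (pole (- 1) :: real ^ 'm option)" unfolding pole_def by (simp add: vec_eq_iff axis_def)
    then obtain \<sigma> :: real where "\<sigma> = 1 \<or> \<sigma> = - 1" "h p \<noteq> pole \<sigma>" by metis
    then have "sch \<sigma> \<in> charts_at sphere_mfd (h p)"
      using n by (auto simp: charts_at_def atlas_sphere) (auto simp: sch_def)
    then show ?thesis by blast
  qed
  show ?thesis unfolding immersion_def using key ex by blast
qed

end

section \<open>The Gauss map\<close>

text \<open>A generalized cross product: the vector that represents the frame determinant as a
  linear form in the row of the normal. It is polynomial in the entries, from which smoothness of
  the Gauss map will follow.\<close>

definition cross :: "real ^ 'n option option \<Rightarrow> (('n::finite) \<Rightarrow> real ^ 'n option option) \<Rightarrow> real ^ 'n option option" where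
  "cross q r = (\<chi> k. det (frame_matrix q (axis k 1) r))"

lemma frame_matrix_alt: "frame_matrix q w r = (\<chi> k. if k = Some None then w else frame_matrix q 0 r $ k)"
proof (subst vec_eq_iff, rule allI)
  fix k :: "'a option option"
  show "frame_matrix q w r $ k = (\<chi> k. if k = Some None then w else frame_matrix q 0 r $ k) $ k"
  proof (cases k)
    case (Some i) then show ?thesis by (cases i) simp_all
  qed simp
qed

lemma cross_inner: "cross q r \<bullet> v = det (frame_matrix q v r)"
proof -
  have lin: "linear (\<lambda>w. det (frame_matrix q w r))"
  proof (rule linearI)
    fix w z :: "real ^ 'a option option" and s :: real
    have fm: "frame_matrix q y r = (\<chi> k. if k = Some None then y else frame_matrix q 0 r $ k)" for y by (rule frame_matrix_alt)
    show "det (frame_matrix q (w + z) r) = det (frame_matrix q w r) + det (frame_matrix q z r)"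
      unfolding fm[of "w + z"] fm[of w] fm[of z] by (rule det_row_add)
    show "det (frame_matrix q (s *\<^sub>R w) r) = s *\<^sub>R det (frame_matrix q w r)"
      unfolding fm[of "s *\<^sub>R w"] fm[of w] unfolding scalar_mult_eq_scaleR[symmetric] real_scaleR_def by (rule det_row_mul)
  qed
  have "v = (\<Sum>k\<in>UNIV. (v $ k) *\<^sub>R axis k 1)"
    by (simp add: vec_eq_iff axis_def if_distrib cong: if_cong)
  then have "det (frame_matrix q v r) = det (frame_matrix q (\<Sum>k\<in>UNIV. (v $ k) *\<^sub>R axis k 1) r)" by simp
  also have "\<dots> = (\<Sum>k\<in>UNIV. (v $ k) * det (frame_matrix q (axis k 1) r))"
    by (simp add: linear_sum[OF lin] linear_cmul[OF lin])
  finally show ?thesis by (simp add: cross_def inner_vec_def mult.commute)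
qed

text \<open>The condition on the Gauss map, tested on the coordinate frame only. It is computable,
  whereas the description in \<open>gauss_map\<close> ranges over all charts and all frames.\<close>

definition unit_normal :: "real ^ 'n option option \<Rightarrow> (real ^ ('n::finite) \<Rightarrow> real ^ 'n option option) \<Rightarrow> real ^ 'n option option \<Rightarrow> bool" where
  "unit_normal q D w \<longleftrightarrow> norm w = 1 \<and> w \<bullet> q = 0 \<and> (\<forall>u. w \<bullet> D u = 0) \<and> det (frame_matrix q w (\<lambda>j. D (axis j 1))) > 0"

lemma dim_option: "DIM(real ^ ('n::finite) option option) = DIM(real ^ 'n) + 2"
  by simp

context
  fixes q :: "real ^ ('n::finite) option option" and D :: "real ^ 'n \<Rightarrow> real ^ 'n option option"
  assumes D: "linear D" "inj D" and q: "norm q = 1" and perp: "\<And>u. D u \<bullet> q = 0"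
begin

lemma frame_det_nz:
  assumes v: "norm v = 1" "v \<bullet> q = 0" "\<And>u. v \<bullet> D u = 0"
  shows "det (frame_matrix q v (\<lambda>j. D (axis j 1))) \<noteq> 0"
proof -
  let ?A = "frame_matrix q v (\<lambda>j. D (axis j 1))"
  have "z = 0" if z: "?A *v z = 0" for z
  proof -
    have r: "?A $ k \<bullet> z = 0" for k using arg_cong[OF z, of "\<lambda>x. x $ k"] by (simp add: matrix_vector_mul_component)
    have z1: "q \<bullet> z = 0" "v \<bullet> z = 0" and zD: "\<And>j. D (axis j 1) \<bullet> z = 0"
      using r[of None] r[of "Some None"] r[of "Some (Some _)"] by simp_all
    have zDu: "D u \<bullet> z = 0" for u
    proof -
      have "u = (\<Sum>k\<in>UNIV. (u $ k) *\<^sub>R axis k 1)" by (simp add: vec_eq_iff axis_def if_distrib cong: if_cong)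
      then have "D u = D (\<Sum>k\<in>UNIV. (u $ k) *\<^sub>R axis k 1)" by simp
      then have "D u = (\<Sum>k\<in>UNIV. (u $ k) *\<^sub>R D (axis k 1))" by (simp add: linear_sum[OF D(1)] linear_cmul[OF D(1)])
      then show ?thesis by (simp add: inner_sum_left zD)
    qed
    have qv: "q \<bullet> v = 0" using v by (simp add: inner_commute)
    have Dv: "D u \<bullet> v = 0" for u using v by (simp add: inner_commute)
    obtain u where u: "z = D u + (z \<bullet> q) *\<^sub>R q + (z \<bullet> v) *\<^sub>R v"
      using orth_decomp[OF D dim_option q v(1) qv perp Dv] by metis
    then have "z = D u" using z1 by (simp add: inner_commute)
    then show "z = 0" using zDu[of u] by simp
  qed
  then have "inj ((*v) ?A)" by (simp add: linear_injective_0)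
  then show ?thesis using matrix_left_invertible_injective invertible_left_inverse invertible_det_nz by metis
qed

lemma exists_perp: "\<exists>v. norm v = 1 \<and> v \<bullet> q = 0 \<and> (\<forall>u. v \<bullet> D u = 0)"
proof -
  let ?S = "insert q (D ` Basis)"
  have "dim ?S \<le> card ?S" by (rule dim_le_card') auto
  also have "\<dots> \<le> Suc (card (D ` Basis))" by (rule card_insert_le_m1) auto
  also have "\<dots> \<le> Suc (card (Basis :: (real^'n) set))" using card_image_le[of Basis D] by simp
  also have "\<dots> < DIM(real ^ 'n option option)" unfolding dim_option by simp
  finally have "dim ?S < DIM(real ^ 'n option option)" .
  then obtain x where x: "x \<noteq> 0" "\<And>y. y \<in> span ?S \<Longrightarrow> orthogonal x y"
    by (rule orthogonal_to_subspace_exists) auto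
  have "D u \<in> span ?S" for u
  proof -
    have "D u = (\<Sum>b\<in>Basis. (u \<bullet> b) *\<^sub>R D b)"
      using linear_sum[OF D(1), of "\<lambda>b. (u \<bullet> b) *\<^sub>R b" Basis] by (simp add: euclidean_representation linear_cmul[OF D(1)])
    then show ?thesis by (auto intro!: span_sum span_scale intro: span_base)
  qed
  moreover have "q \<in> span ?S" by (simp add: span_base)
  ultimately show ?thesis
    using x by (intro exI[of _ "sgn x"]) (auto simp: norm_sgn sgn_div_norm orthogonal_def)
qed

text \<open>By dimension there is a unit vector normal to \<open>q\<close> and to the range of
  \<open>D\<close>. Its inner product with the cross product is its frame determinant, which is
  nonzero.\<close>

lemma cross_nz: "cross q (\<lambda>j. D (axis j 1)) \<noteq> 0"
  using exists_perp frame_det_nz cross_inner by (metis inner_zero_left)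

lemma cross_unit_normal: "unit_normal q D (sgn (cross q (\<lambda>j. D (axis j 1))))"
proof -
  let ?w = "cross q (\<lambda>j. D (axis j 1))"
  have "?w \<bullet> q = 0" unfolding cross_inner
    by (rule det_identical_rows[of None "Some None"]) (simp_all add: row_def vec_eq_iff)
  moreover have "?w \<bullet> D u = 0" for u
  proof -
    have "?w \<bullet> D (axis j 1) = 0" for j unfolding cross_inner
      by (rule det_identical_rows[of "Some (Some j)" "Some None"]) (simp_all add: row_def vec_eq_iff)
    moreover have "D u = (\<Sum>k\<in>UNIV. (u $ k) *\<^sub>R D (axis k 1))"
    proof -
      have "u = (\<Sum>k\<in>UNIV. (u $ k) *\<^sub>R axis k 1)" by (simp add: vec_eq_iff axis_def if_distrib cong: if_cong)
      then have "D u = D (\<Sum>k\<in>UNIV. (u $ k) *\<^sub>R axis k 1)" by simp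
      then show ?thesis by (simp add: linear_sum[OF D(1)] linear_cmul[OF D(1)])
    qed
    ultimately show ?thesis by (simp add: inner_sum_right)
  qed
  moreover have "det (frame_matrix q (sgn ?w) (\<lambda>j. D (axis j 1))) > 0"
    unfolding cross_inner[symmetric] using cross_nz
    by (simp add: sgn_div_norm power2_norm_eq_inner[symmetric])
  ultimately show ?thesis using cross_nz by (simp add: unit_normal_def norm_sgn sgn_div_norm)
qed

text \<open>By \<open>orth_decomp\<close> the normals form a line, and the sign of the determinant
  selects one of its two unit vectors.\<close>

lemma unit_normal_unique:
  assumes "unit_normal q D w" "unit_normal q D z" shows "w = z"
proof -
  have w: "norm w = 1" "q \<bullet> w = 0" "\<And>u. D u \<bullet> w = 0" and z: "norm z = 1" "z \<bullet> q = 0" "\<And>u. z \<bullet> D u = 0"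
    using assms by (simp_all add: unit_normal_def inner_commute)
  obtain u where u: "z = D u + (z \<bullet> q) *\<^sub>R q + (z \<bullet> w) *\<^sub>R w"
    using orth_decomp[OF D dim_option q w(1) w(2) perp w(3)] by metis
  have "D u \<bullet> D u = z \<bullet> D u"
    using arg_cong[OF u, of "\<lambda>x. x \<bullet> D u"] z w perp by (simp add: inner_add_left inner_add_right inner_commute)
  then have "D u = 0" using z by simp
  then have zw: "z = (z \<bullet> w) *\<^sub>R w" using u z by simp
  then have "\<bar>z \<bullet> w\<bar> = 1" using z(1) w(1) by (metis mult.right_neutral norm_scaleR)
  moreover have "z \<bullet> w > 0"
  proof -
    have "det (frame_matrix q z (\<lambda>j. D (axis j 1))) = (z \<bullet> w) * det (frame_matrix q w (\<lambda>j. D (axis j 1)))"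
      unfolding cross_inner[symmetric] by (subst zw) simp
    then show ?thesis using assms by (metis unit_normal_def zero_less_mult_pos2)
  qed
  ultimately show ?thesis using zw by simp
qed

text \<open>An orthonormal basis of the range of \<open>D\<close> is pulled back, and one vector is
  negated if the orientation is wrong. Through the clause on spans a vector is recognized as normal
  by its inner products with this frame.\<close>

lemma exists_orthonormal_frame:
  "\<exists>u :: 'n \<Rightarrow> real ^ 'n. (\<forall>i j. D (u i) \<bullet> D (u j) = (if i = j then 1 else 0)) \<and> det (\<chi> i. u i) > 0 \<and> (\<forall>x. D x \<in> span (range (\<lambda>i. D (u i))))"
proof -
  have sub: "subspace (range D)" by (rule linear_subspace_image[OF D(1)]) simp
  obtain B where B: "B \<subseteq> range D" "pairwise orthogonal B" "\<And>x. x \<in> B \<Longrightarrow> norm x = 1" "independent B" "card B = dim (range D)" "span B = range D"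
    using orthonormal_basis_subspace[OF sub] by metis
  have "dim (range D) = DIM(real ^ 'n)" using dim_image_eq[OF D(1), of UNIV] D(2) by (simp add: inj_on_subset)
  then have cB: "card B = CARD('n)" using B(5) by simp
  have fB: "finite B" using B(4) by (rule independent_imp_finite)
  obtain b where b: "bij_betw b (UNIV::'n set) B" using finite_same_card_bij[OF finite fB] cB by metis
  define u where "u i = inv D (b i)" for i
  have Du: "D (u i) = b i" for i
    using b B(1) unfolding u_def by (metis UNIV_I bij_betwE f_inv_into_f subsetD)
  have on: "D (u i) \<bullet> D (u j) = (if i = j then 1 else 0)" for i j
  proof (cases "i = j")
    case True
    have "norm (b j) = 1" using B(3) b by (metis UNIV_I bij_betwE)
    then show ?thesis using True by (simp add: Du norm_eq_1)
  next
    case False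
    then have "b i \<noteq> b j" "b i \<in> B" "b j \<in> B" using b by (auto simp: bij_betw_def inj_on_def)
    then show ?thesis using False B(2) by (auto simp: Du pairwise_def orthogonal_def)
  qed
  have rng: "range (\<lambda>i. D (u i)) = B" using b by (simp add: Du bij_betw_def)
  have sp: "D x \<in> span (range (\<lambda>i. D (u i)))" for x unfolding rng B(6) by simp
  have det_nz: "det (\<chi> i. u i) \<noteq> 0"
  proof -
    let ?A = "\<chi> i. u i"
    have "z = 0" if z: "transpose ?A *v z = 0" for z
    proof -
      have "transpose ?A *v z = (\<Sum>i\<in>UNIV. (z $ i) *\<^sub>R u i)"
        by (simp add: vec_eq_iff matrix_vector_mult_def transpose_def mult.commute)
      then have "D (\<Sum>i\<in>UNIV. (z $ i) *\<^sub>R u i) = 0" using z linear_0[OF D(1)] by simp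
      then have s: "(\<Sum>i\<in>UNIV. (z $ i) *\<^sub>R D (u i)) = 0" by (simp add: linear_sum[OF D(1)] linear_cmul[OF D(1)])
      have "z $ j = 0" for j
      proof -
        have "(\<Sum>i\<in>UNIV. (z $ i) *\<^sub>R D (u i)) \<bullet> D (u j) = z $ j"
          by (simp add: inner_sum_left on if_distrib cong: if_cong)
        then show ?thesis using s by simp
      qed
      then show "z = 0" by (simp add: vec_eq_iff)
    qed
    then have "inj ((*v) (transpose ?A))" by (simp add: linear_injective_0)
    then have "det (transpose ?A) \<noteq> 0" using matrix_left_invertible_injective invertible_left_inverse invertible_det_nz by metis
    then show ?thesis by simp
  qed
  show ?thesis
  proof (cases "det (\<chi> i. u i) > 0")
    case True then show ?thesis using on sp by blast
  next
    case False
    obtain k :: 'n where True by blast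
    define u' where "u' i = (if i = k then - u i else u i)" for i
    have "(\<chi> i. u' i) = (\<chi> i. if i = k then (- 1) *s u i else u i)" "(\<chi> i. if i = k then u i else u i) = (\<chi> i. u i)"
      by (simp_all add: vec_eq_iff u'_def)
    then have "det (\<chi> i. u' i) = - det (\<chi> i. u i)"
      using det_row_mul[of k "- 1" u u] by (simp only: minus_mult_left[symmetric] mult_1)
    then have "det (\<chi> i. u' i) > 0" using False det_nz by simp
    moreover have "D (u' i) \<bullet> D (u' j) = (if i = j then 1 else 0)" for i j
      by (simp add: u'_def linear_neg[OF D(1)] on)
    moreover have "D x \<in> span (range (\<lambda>i. D (u' i)))" for x
    proof -
      have "D (u i) \<in> span (range (\<lambda>i. D (u' i)))" for i
      proof -
        have "D (u' i) \<in> span (range (\<lambda>i. D (u' i)))" by (rule span_base) blast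
        then show ?thesis
          using span_neg[of "D (u' i)"] by (auto simp: u'_def linear_neg[OF D(1)] split: if_splits)
      qed
      then have "span (range (\<lambda>i. D (u i))) \<subseteq> span (range (\<lambda>i. D (u' i)))" by (intro span_minimal) auto
      then show ?thesis using sp by blast
    qed
    ultimately show ?thesis by blast
  qed
qed

end

locale hypersurface = smooth_mfd N for N :: "('p, real ^ 'n::finite) manifold" +
  fixes f :: "'p \<Rightarrow> real ^ 'n option option"
  assumes oriented: "connected_oriented_manifold N" and imm: "immersion N sphere_mfd f"
begin

definition \<nu> where "\<nu> = gauss_map N f"

lemma smooth_f: "c \<in> atlas N \<Longrightarrow> smooth_on (cran c) (\<lambda>x. f (chart_inv c x))"
  and norm_f: "p \<in> points N \<Longrightarrow> norm (f p) = 1"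
  and inj_df: "c \<in> charts_at N p \<Longrightarrow> inj (df c f p)"
  using imm unfolding immersion_sphere_iff smooth_map_sphere_iff by blast+

lemma df_has_derivative:
  assumes c: "c \<in> atlas N" and sm: "smooth_on (cran c) (\<lambda>x. h (chart_inv c x))" and x: "x \<in> cran c"
  shows "((\<lambda>x. h (chart_inv c x)) has_derivative df c h (chart_inv c x)) (at x)"
  using smooth_on_has_derivative[OF sm x] chart_chart_inv[OF c x] by (simp add: df_def o_def)

lemma sphere_df_perp:
  assumes c: "c \<in> charts_at N p" and sm: "smooth_on (cran c) (\<lambda>x. h (chart_inv c x))"
    and n: "\<And>p. p \<in> points N \<Longrightarrow> norm (h p) = (1::real)"
  shows "df c h p u \<bullet> (h p :: 'e::euclidean_space) = 0"
proof -
  have cA: "c \<in> atlas N" "p \<in> fst c" using c charts_atD by auto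
  let ?x = "snd c p" let ?H = "\<lambda>x. h (chart_inv c x)"
  have x: "?x \<in> cran c" using cA by simp
  have d: "(?H has_derivative df c h p) (at ?x)" using df_has_derivative[OF cA(1) sm x] cA by simp
  have d1: "((\<lambda>x. ?H x \<bullet> ?H x) has_derivative (\<lambda>u. ?H ?x \<bullet> df c h p u + df c h p u \<bullet> ?H ?x)) (at ?x)"
    by (rule has_derivative_inner[OF d d])
  have "((\<lambda>x. ?H x \<bullet> ?H x) has_derivative (\<lambda>_. 0)) (at ?x)"
    by (rule has_derivative_transform_within_open[OF has_derivative_const[of 1] ran_open[OF cA(1)] x])
      (use n chart_inv_points[OF cA(1)] in \<open>simp add: norm_eq_1\<close>)
  from has_derivative_unique[OF d1 this] have "h p \<bullet> df c h p u + df c h p u \<bullet> h p = 0"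
    using cA by (simp add: fun_eq_iff)
  then show ?thesis by (simp add: inner_commute)
qed

lemma df_facts:
  assumes c: "c \<in> charts_at N p"
  shows "linear (df c f p)" "inj (df c f p)" "norm (f p) = 1" "df c f p u \<bullet> f p = 0"
proof -
  have cA: "c \<in> atlas N" "p \<in> fst c" using c charts_atD by auto
  have x: "snd c p \<in> cran c" using cA by simp
  show "linear (df c f p)"
    using df_has_derivative[OF cA(1) smooth_f[OF cA(1)] x] cA by (auto dest: has_derivative_linear)
  show "inj (df c f p)" by (rule inj_df[OF c])
  show "norm (f p) = 1" using norm_f dom_sub cA by blast
  show "df c f p u \<bullet> f p = 0" by (rule sphere_df_perp[OF c smooth_f[OF cA(1)] norm_f])
qed

lemma df_change:
  assumes c: "c \<in> charts_at N p" and d: "d \<in> charts_at N p" and sm: "smooth_on (cran c) (\<lambda>x. h (chart_inv c x))"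
  shows "df d h p = (\<lambda>u. df c h p (frechet_derivative (\<lambda>x. snd c (chart_inv d x)) (at (snd d p)) u))"
proof -
  have cA: "c \<in> atlas N" "p \<in> fst c" "d \<in> atlas N" "p \<in> fst d" using c d charts_atD by auto
  let ?T = "\<lambda>x. snd c (chart_inv d x)" let ?x = "snd d p" let ?W = "snd d ` (fst d \<inter> fst c)"
  have W: "open ?W" "?x \<in> ?W" using overlap_open[OF cA(3,1)] cA by auto
  have dT: "(?T has_derivative frechet_derivative ?T (at ?x)) (at ?x)"
    using smooth_on_has_derivative[OF trans_smooth[OF cA(3,1)] W(2)] .
  have e: "?T ?x = snd c p" using cA by simp
  have dh: "((\<lambda>x. h (chart_inv c x)) has_derivative df c h p) (at (?T ?x))"
    using df_has_derivative[OF cA(1) sm, of "snd c p"] cA e by simp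
  have "((\<lambda>x. h (chart_inv c (?T x))) has_derivative (\<lambda>u. df c h p (frechet_derivative ?T (at ?x) u))) (at ?x)"
    by (rule has_derivative_compose[OF dT dh])
  then have "((\<lambda>x. h (chart_inv d x)) has_derivative (\<lambda>u. df c h p (frechet_derivative ?T (at ?x) u))) (at ?x)"
    by (rule has_derivative_transform_within_open[OF _ W]) (use cA in auto)
  from frechet_derivative_at[OF this] show ?thesis by (simp add: df_def o_def)
qed

lemma transition_det:
  assumes c: "c \<in> charts_at N p" and d: "d \<in> charts_at N p"
  shows "linear (frechet_derivative (\<lambda>x. snd c (chart_inv d x)) (at (snd d p)))"
    "det (matrix (frechet_derivative (\<lambda>x. snd c (chart_inv d x)) (at (snd d p)))) > 0"
proof -
  have cA: "c \<in> atlas N" "p \<in> fst c" "d \<in> atlas N" "p \<in> fst d" using c d charts_atD by auto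
  have W: "snd d p \<in> snd d ` (fst d \<inter> fst c)" using cA by auto
  show "linear (frechet_derivative (\<lambda>x. snd c (chart_inv d x)) (at (snd d p)))"
    using smooth_on_has_derivative[OF trans_smooth[OF cA(3,1)] W] by (rule has_derivative_linear)
  show "det (matrix (frechet_derivative (\<lambda>x. snd c (chart_inv d x)) (at (snd d p)))) > 0"
    using oriented c d unfolding connected_oriented_manifold_def by (auto simp: o_def)
qed

lemma unit_normal_change:
  assumes c: "c \<in> charts_at N p" and d: "d \<in> charts_at N p" and w: "unit_normal (f p) (df c f p) w"
  shows "unit_normal (f p) (df d f p) w"
proof -
  have cA: "c \<in> atlas N" using c charts_atD by auto
  let ?T = "frechet_derivative (\<lambda>x. snd c (chart_inv d x)) (at (snd d p))"
  have ch: "df d f p u = df c f p (?T u)" for u using df_change[OF c d smooth_f[OF cA]] by (rule fun_cong)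
  have "det (frame_matrix (f p) w (\<lambda>j. df d f p (axis j 1))) = det (\<chi> i. ?T (axis i 1)) * det (frame_matrix (f p) w (\<lambda>j. df c f p (axis j 1)))"
    unfolding ch by (rule det_frame_linear[OF df_facts(1)[OF c]])
  moreover have "(\<chi> i. ?T (axis i 1)) = transpose (matrix ?T)" by (simp add: vec_eq_iff matrix_def transpose_def)
  ultimately have "det (frame_matrix (f p) w (\<lambda>j. df d f p (axis j 1))) > 0"
    using transition_det[OF c d] w by (simp add: unit_normal_def)
  then show ?thesis using w by (simp add: unit_normal_def ch)
qed

text \<open>For a unit normal the orthogonality relations of the extended frame are automatic, and
  its determinant is that of \<open>u\<close> times a positive number, so the two frame conditions
  coincide in every chart.\<close>

lemma gauss_eq:
  assumes c: "c \<in> charts_at N p" and w: "unit_normal (f p) (df c f p) w"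
  shows "\<nu> p = w"
  unfolding \<nu>_def gauss_map_def
proof (rule the_equality)
  let ?fr = "\<lambda>w d u. (\<lambda>k. case k of None \<Rightarrow> w | Some i \<Rightarrow> df d f p (u i))"
  have fm: "(\<chi> k. case k of None \<Rightarrow> f p | Some i \<Rightarrow> ?fr w d u i) = frame_matrix (f p) w (\<lambda>j. df d f p (u j))" for w d u
    by (simp add: frame_matrix_def)
  show "\<forall>d\<in>charts_at N p. \<forall>u. pos_orthonormal_frame d f p u \<longleftrightarrow> pos_orthonormal_sphere_frame (f p) (?fr w d u)"
  proof (intro ballI allI)
    fix d u assume d: "d \<in> charts_at N p"
    have wd: "unit_normal (f p) (df d f p) w" by (rule unit_normal_change[OF c d w])
    note D = df_facts[OF d]
    have det: "det (frame_matrix (f p) w (\<lambda>j. df d f p (u j))) = det (\<chi> i. u i) * det (frame_matrix (f p) w (\<lambda>j. df d f p (axis j 1)))"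
      by (rule det_frame_linear[OF D(1)])
    have pos: "det (frame_matrix (f p) w (\<lambda>j. df d f p (u j))) > 0 \<longleftrightarrow> det (\<chi> i. u i) > 0"
      unfolding det using wd by (simp add: unit_normal_def zero_less_mult_iff)
    have w1: "w \<bullet> w = 1" "w \<bullet> f p = 0" "\<And>z. w \<bullet> df d f p z = 0" "\<And>z. df d f p z \<bullet> w = 0"
      using wd by (auto simp: unit_normal_def norm_eq_1 inner_commute)
    have o1: "(\<forall>i. ?fr w d u i \<bullet> f p = 0)" using w1 D(4) by (simp split: option.split)
    have o2: "(\<forall>i j. ?fr w d u i \<bullet> ?fr w d u j = (if i = j then 1 else 0)) \<longleftrightarrow> (\<forall>i j. df d f p (u i) \<bullet> df d f p (u j) = (if i = j then 1 else 0))"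
    proof
      assume *: "\<forall>i j. ?fr w d u i \<bullet> ?fr w d u j = (if i = j then 1 else 0)"
      show "\<forall>i j. df d f p (u i) \<bullet> df d f p (u j) = (if i = j then 1 else 0)"
      proof (intro allI)
        fix i j show "df d f p (u i) \<bullet> df d f p (u j) = (if i = j then 1 else 0)"
          using *[rule_format, of "Some i" "Some j"] by simp
      qed
    next
      assume *: "\<forall>i j. df d f p (u i) \<bullet> df d f p (u j) = (if i = j then 1 else 0)"
      show "\<forall>i j. ?fr w d u i \<bullet> ?fr w d u j = (if i = j then 1 else 0)"
      proof (intro allI)
        fix i j show "?fr w d u i \<bullet> ?fr w d u j = (if i = j then 1 else 0)"
          using * w1 by (cases i; cases j) auto
      qed
    qed
    show "pos_orthonormal_frame d f p u \<longleftrightarrow> pos_orthonormal_sphere_frame (f p) (?fr w d u)"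
      unfolding pos_orthonormal_frame_def pos_orthonormal_sphere_frame_def fm pos o2 induced_metric_def
      using o1 by blast
  qed
  \<comment> \<open>Uniqueness: on one actual positive orthonormal frame, the equivalence yields the
    conditions of \<open>unit_normal\<close> for \<open>w'\<close>.\<close>
  fix w' assume w': "\<forall>d\<in>charts_at N p. \<forall>u. pos_orthonormal_frame d f p u \<longleftrightarrow> pos_orthonormal_sphere_frame (f p) (?fr w' d u)"
  note D = df_facts[OF c]
  obtain u where u: "\<forall>i j. df c f p (u i) \<bullet> df c f p (u j) = (if i = j then 1 else 0)" "det (\<chi> i. u i) > 0"
    "\<forall>x. df c f p x \<in> span (range (\<lambda>i. df c f p (u i)))"
    using exists_orthonormal_frame[OF D(1-4)] by metis
  have "pos_orthonormal_frame c f p u" using u by (simp add: pos_orthonormal_frame_def induced_metric_def)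
  then have "pos_orthonormal_sphere_frame (f p) (?fr w' c u)" using w' c by blast
  then have s: "\<And>i. ?fr w' c u i \<bullet> f p = 0" "\<And>i j. ?fr w' c u i \<bullet> ?fr w' c u j = (if i = j then 1 else 0)"
    "det (frame_matrix (f p) w' (\<lambda>j. df c f p (u j))) > 0"
    unfolding pos_orthonormal_sphere_frame_def fm by blast+
  have "w' \<bullet> df c f p x = 0" for x
  proof -
    have "orthogonal w' y" if "y \<in> range (\<lambda>i. df c f p (u i))" for y
      using that s(2)[of None "Some _"] by (auto simp: orthogonal_def)
    then have "orthogonal w' (df c f p x)" using u(3) orthogonal_to_span by blast
    then show ?thesis by (simp add: orthogonal_def)
  qed
  moreover have "det (frame_matrix (f p) w' (\<lambda>j. df c f p (axis j 1))) > 0"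
    using s(3) u(2) det_frame_linear[OF D(1), of "f p" w' u] by (simp add: zero_less_mult_iff)
  ultimately have "unit_normal (f p) (df c f p) w'"
    using s(1)[of None] s(2)[of None None] by (simp add: unit_normal_def norm_eq_1)
  then show "w' = w" using unit_normal_unique[OF D(1-4)] w by blast
qed

lemma gauss_normal: "c \<in> charts_at N p \<Longrightarrow> unit_normal (f p) (df c f p) (\<nu> p)"
  using gauss_eq[OF _ cross_unit_normal[OF df_facts]] cross_unit_normal[OF df_facts] by simp

lemma gauss_cross: "c \<in> charts_at N p \<Longrightarrow> \<nu> p = sgn (cross (f p) (\<lambda>j. df c f p (axis j 1)))"
  by (rule gauss_eq[OF _ cross_unit_normal[OF df_facts]])

text \<open>In coordinates the cross product is polynomial in \<open>f\<close> and its first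
  derivatives and never vanishes, so its normalization is smooth.\<close>

lemma smooth_nu:
  assumes c: "c \<in> atlas N" shows "smooth_on (cran c) (\<lambda>x. \<nu> (chart_inv c x))"
proof -
  let ?F = "\<lambda>x. f (chart_inv c x)"
  let ?cr = "\<lambda>x. cross (?F x) (\<lambda>j. frechet_derivative ?F (at x) (axis j 1))"
  have op: "open (cran c)" by (rule ran_open[OF c])
  have ch: "c \<in> charts_at N (chart_inv c x)" if "x \<in> cran c" for x
    using chart_inv_in[OF c that] c by (simp add: charts_at_def)
  have dfe: "df c f (chart_inv c x) = frechet_derivative ?F (at x)" if "x \<in> cran c" for x
    using c that by (simp add: df_def o_def)
  have "smooth_on (cran c) ?cr"
    unfolding cross_def
  proof (rule smooth_on_vec[OF op], simp, rule smooth_on_det[OF op])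
    fix k i j
    show "smooth_on (cran c) (\<lambda>x. frame_matrix (?F x) (axis k 1) (\<lambda>j. frechet_derivative ?F (at x) (axis j 1)) $ i $ j)"
    proof (cases i)
      case None
      then show ?thesis using smooth_on_nth[OF op smooth_f[OF c]] by simp
    next
      case (Some i')
      then show ?thesis
        by (cases i') (simp_all add: smooth_on_const smooth_on_nth[OF op smooth_on_frechet[OF smooth_f[OF c]]])
    qed
  qed
  moreover have "?cr x \<noteq> 0" if "x \<in> cran c" for x
    using cross_nz[OF df_facts(1-4)[OF ch[OF that]]] unfolding dfe[OF that] .
  ultimately have "smooth_on (cran c) (\<lambda>x. sgn (?cr x))" by (intro smooth_on_sgn op)
  moreover have "\<nu> (chart_inv c x) = sgn (?cr x)" if "x \<in> cran c" for x
    using gauss_cross[OF ch[OF that]] unfolding dfe[OF that] .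
  ultimately show ?thesis using smooth_on_cong[OF op, of "\<lambda>x. \<nu> (chart_inv c x)"] by simp
qed

lemma nu_facts:
  assumes p: "p \<in> points N"
  shows "norm (\<nu> p) = 1" "\<nu> p \<bullet> f p = 0" "c \<in> charts_at N p \<Longrightarrow> \<nu> p \<bullet> df c f p u = 0"
proof -
  obtain d where "d \<in> charts_at N p" using covered[OF p] by blast
  from gauss_normal[OF this] show "norm (\<nu> p) = 1" "\<nu> p \<bullet> f p = 0" by (auto simp: unit_normal_def)
  show "\<nu> p \<bullet> df c f p u = 0" if "c \<in> charts_at N p" using gauss_normal[OF that] by (simp add: unit_normal_def)
qed

lemma dual_eq: "p \<in> points N \<Longrightarrow> dual N f p = \<nu> p"
  using nu_facts(1)[of p] by (simp add: dual_def sphere_exp_def \<nu>_def)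

lemma dnu_facts:
  assumes c: "c \<in> charts_at N p"
  shows "linear (df c \<nu> p)" "df c \<nu> p u \<bullet> \<nu> p = 0" "df c \<nu> p u \<bullet> f p = 0" "df c \<nu> p u \<in> range (df c f p)"
    "df c \<nu> p u \<bullet> df c f p w = df c f p u \<bullet> df c \<nu> p w"
proof -
  have cA: "c \<in> atlas N" "p \<in> fst c" using c charts_atD by auto
  have pN: "p \<in> points N" using dom_sub cA by blast
  let ?x = "snd c p" let ?F = "\<lambda>x. f (chart_inv c x)" let ?G = "\<lambda>x. \<nu> (chart_inv c x)"
  have x: "?x \<in> cran c" using cA by simp
  have op: "open (cran c)" by (rule ran_open[OF cA(1)])
  have ch: "c \<in> charts_at N (chart_inv c x)" "chart_inv c x \<in> points N" if "x \<in> cran c" for x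
    using chart_inv_in[OF cA(1) that] chart_inv_points[OF cA(1) that] cA by (simp_all add: charts_at_def)
  have dfe: "df c h (chart_inv c x) = frechet_derivative (\<lambda>x. h (chart_inv c x)) (at x)" if "x \<in> cran c" for x and h :: "'p \<Rightarrow> real ^ 'n option option"
    using cA that by (simp add: df_def o_def)
  have dG: "(?G has_derivative df c \<nu> p) (at ?x)" and dF: "(?F has_derivative df c f p) (at ?x)"
    using df_has_derivative[OF cA(1) smooth_nu[OF cA(1)] x] df_has_derivative[OF cA(1) smooth_f[OF cA(1)] x] cA by simp_all
  show lin: "linear (df c \<nu> p)" using dG by (rule has_derivative_linear)
  have Gp: "df c \<nu> p u \<bullet> \<nu> p = 0" for u by (rule sphere_df_perp[OF c smooth_nu[OF cA(1)] nu_facts(1)])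
  show "df c \<nu> p u \<bullet> \<nu> p = 0" by (rule Gp)
  have Gf: "df c \<nu> p u \<bullet> f p = 0" for u
  proof -
    have d1: "((\<lambda>x. ?G x \<bullet> ?F x) has_derivative (\<lambda>u. ?G ?x \<bullet> df c f p u + df c \<nu> p u \<bullet> ?F ?x)) (at ?x)"
      by (rule has_derivative_inner[OF dG dF])
    have "((\<lambda>x. ?G x \<bullet> ?F x) has_derivative (\<lambda>_. 0)) (at ?x)"
      by (rule has_derivative_transform_within_open[OF has_derivative_const[of 0] op x]) (use nu_facts(2) ch in simp)
    from has_derivative_unique[OF d1 this] show ?thesis
      using cA nu_facts(3)[OF pN c] by (simp add: fun_eq_iff)
  qed
  show "df c \<nu> p u \<bullet> f p = 0" by (rule Gf)
  have fn: "f p \<bullet> \<nu> p = 0" using nu_facts(2)[OF pN] by (simp add: inner_commute)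
  have dn: "df c f p u \<bullet> \<nu> p = 0" for u using nu_facts(3)[OF pN c, of u] by (simp add: inner_commute)
  obtain z where "df c \<nu> p u = df c f p z + (df c \<nu> p u \<bullet> f p) *\<^sub>R f p + (df c \<nu> p u \<bullet> \<nu> p) *\<^sub>R \<nu> p"
    using orth_decomp[OF df_facts(1,2)[OF c] dim_option df_facts(3)[OF c] nu_facts(1)[OF pN] fn df_facts(4)[OF c] dn] by metis
  then show "df c \<nu> p u \<in> range (df c f p)" using Gf Gp by simp
  \<comment> \<open>With the normal frozen at \<open>p\<close>, \<phi> is a real function whose
    second derivatives at \<open>p\<close> are the second fundamental form. Differentiating the
    orthogonality of the tangent vectors and \<nu> identifies them with the inner products in
    question, and \<open>second_derivative_symmetric\<close> applies.\<close>
  define m where "m = \<nu> p"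
  define \<phi> where "\<phi> x = ?F x \<bullet> m" for x
  have sm\<phi>: "smooth_on (cran c) \<phi>" unfolding \<phi>_def by (intro smooth_on_inner op smooth_f cA smooth_on_const)
  have second: "frechet_derivative (\<lambda>z. frechet_derivative \<phi> (at z) w) (at ?x) u = - (df c f p w \<bullet> df c \<nu> p u)" for u w
  proof -
    have e1: "frechet_derivative \<phi> (at z) w = frechet_derivative ?F (at z) w \<bullet> m" if "z \<in> cran c" for z
    proof -
      have "(\<phi> has_derivative (\<lambda>w. frechet_derivative ?F (at z) w \<bullet> m)) (at z)"
        unfolding \<phi>_def by (rule has_derivative_inner_left[OF smooth_on_has_derivative[OF smooth_f[OF cA(1)] that]])
      from frechet_derivative_at[OF this] show ?thesis by metis
    qed
    define K where "K z = frechet_derivative ?F (at z) w" for z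
    have smK: "smooth_on (cran c) K" unfolding K_def[abs_def] by (rule smooth_on_frechet[OF smooth_f[OF cA(1)]])
    define K' where "K' = frechet_derivative K (at ?x)"
    have dK: "(K has_derivative K') (at ?x)" unfolding K'_def by (rule smooth_on_has_derivative[OF smK x])
    have "((\<lambda>z. K z \<bullet> m) has_derivative (\<lambda>u. K' u \<bullet> m)) (at ?x)" by (rule has_derivative_inner_left[OF dK])
    then have "((\<lambda>z. frechet_derivative \<phi> (at z) w) has_derivative (\<lambda>u. K' u \<bullet> m)) (at ?x)"
      by (rule has_derivative_transform_within_open[OF _ op x]) (simp add: e1 K_def)
    from frechet_derivative_at[OF this] have l: "frechet_derivative (\<lambda>z. frechet_derivative \<phi> (at z) w) (at ?x) u = K' u \<bullet> m" by metis
    have d1: "((\<lambda>z. K z \<bullet> ?G z) has_derivative (\<lambda>u. K ?x \<bullet> df c \<nu> p u + K' u \<bullet> ?G ?x)) (at ?x)"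
      by (rule has_derivative_inner[OF dK dG])
    have "((\<lambda>z. K z \<bullet> ?G z) has_derivative (\<lambda>_. 0)) (at ?x)"
    proof (rule has_derivative_transform_within_open[OF has_derivative_const[of 0] op x])
      fix z assume z: "z \<in> cran c"
      show "0 = K z \<bullet> ?G z" using nu_facts(3)[OF ch(2)[OF z] ch(1)[OF z], of w] unfolding dfe[OF z] K_def by (simp add: inner_commute)
    qed
    from has_derivative_unique[OF d1 this] have "K ?x \<bullet> df c \<nu> p u + K' u \<bullet> m = 0"
      using cA by (simp add: fun_eq_iff m_def)
    moreover have "K ?x = df c f p w" using dfe[OF x, of f] cA by (simp add: K_def)
    ultimately show ?thesis using l by simp
  qed
  have "Ck_on 2 (cran c) \<phi>" using sm\<phi> by (simp add: smooth_on_def)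
  from second_derivative_symmetric[OF op this x, of w u]
  have "df c f p w \<bullet> df c \<nu> p u = df c f p u \<bullet> df c \<nu> p w" unfolding second by simp
  then show "df c \<nu> p u \<bullet> df c f p w = df c f p u \<bullet> df c \<nu> p w" by (simp add: inner_commute)
qed

end

section \<open>Piecewise smooth paths and their lengths\<close>

text \<open>Induction on the number of break points inside the interval, cutting at one of
  them.\<close>

lemma interval_pieces:
  fixes a b :: real
  assumes K: "finite K" and ab: "a < b"
    and piece: "\<And>x y. a \<le> x \<Longrightarrow> x < y \<Longrightarrow> y \<le> b \<Longrightarrow> {x<..<y} \<inter> K = {} \<Longrightarrow> P x y"
    and join: "\<And>x y z. a \<le> x \<Longrightarrow> x < y \<Longrightarrow> y < z \<Longrightarrow> z \<le> b \<Longrightarrow> P x y \<Longrightarrow> P y z \<Longrightarrow> P x z"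
  shows "P a b"
proof -
  have "a \<le> x \<Longrightarrow> x < y \<Longrightarrow> y \<le> b \<Longrightarrow> P x y" for x y
  proof (induction "card ({x<..<y} \<inter> K)" arbitrary: x y rule: less_induct)
    case less
    show ?case
    proof (cases "{x<..<y} \<inter> K = {}")
      case True then show ?thesis using piece less.prems by blast
    next
      case False
      then obtain k where k: "x < k" "k < y" "k \<in> K" by auto
      have "card ({x<..<k} \<inter> K) < card ({x<..<y} \<inter> K)" "card ({k<..<y} \<inter> K) < card ({x<..<y} \<inter> K)"
        by (rule psubset_card_mono; use k K in auto)+
      then have "P x k" "P k y" using less k by auto
      then show ?thesis using join less.prems k by blast
    qed
  qed
  then show ?thesis using ab by blast
qed

context smooth_mfd begin

lemma smooth_path_iff:
  fixes S :: "real set"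
  assumes S: "open S"
  shows "smooth_map (euclidean_mfd S) M \<delta> \<longleftrightarrow>
    continuous_map (top_of_set S) (mtop M) \<delta> \<and> (\<forall>c\<in>atlas M. smooth_on {t\<in>S. \<delta> t \<in> fst c} (\<lambda>t. snd c (\<delta> t)))"
proof -
  have "smooth_on {t\<in>S. \<delta> t \<in> fst c} (snd c \<circ> \<delta> \<circ> chart_inv (S, id)) \<longleftrightarrow> smooth_on {t\<in>S. \<delta> t \<in> fst c} (\<lambda>t. snd c (\<delta> t))"
    if c: "c \<in> atlas M" and cont: "continuous_map (top_of_set S) (mtop M) \<delta>" for c
  proof (rule smooth_on_cong)
    have "openin (top_of_set S) {t \<in> topspace (top_of_set S). \<delta> t \<in> fst c}"
      by (rule openin_continuous_map_preimage[OF cont dom_open[OF c]])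
    then show "open {t\<in>S. \<delta> t \<in> fst c}" using S openin_open_trans by auto
    fix x assume "x \<in> {t\<in>S. \<delta> t \<in> fst c}"
    then have "chart_inv (S, id) x = x" using inv_into_f_f[of id S x] by (simp add: chart_inv_def)
    then show "(snd c \<circ> \<delta> \<circ> chart_inv (S, id)) x = snd c (\<delta> x)" by simp
  qed
  then show ?thesis by (auto simp: smooth_map_def euclidean_mfd_def)
qed

lemma smooth_path_affine:
  fixes S :: "real set"
  assumes S: "open S" and d: "smooth_map (euclidean_mfd S) M \<delta>"
  shows "smooth_map (euclidean_mfd ((\<lambda>t. m * t + k) -` S)) M (\<lambda>t. \<delta> (m * t + k))"
proof -
  let ?\<sigma> = "\<lambda>t::real. m * t + k"
  have oS: "open (?\<sigma> -` T)" if "open T" for T by (rule open_vimage[OF that]) (intro continuous_intros)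
  have c: "continuous_map (top_of_set S) (mtop M) \<delta>" and sm: "\<And>c. c \<in> atlas M \<Longrightarrow> smooth_on {t\<in>S. \<delta> t \<in> fst c} (\<lambda>t. snd c (\<delta> t))"
    using d unfolding smooth_path_iff[OF S] by blast+
  have o: "open {t\<in>S. \<delta> t \<in> fst c}" if "c \<in> atlas M" for c
    using openin_continuous_map_preimage[OF c dom_open[OF that]] S openin_open_trans by auto
  show ?thesis unfolding smooth_path_iff[OF oS[OF S]]
  proof (intro conjI ballI)
    have "continuous_map (top_of_set (?\<sigma> -` S)) (top_of_set S) ?\<sigma>" by (auto intro!: continuous_intros)
    from continuous_map_compose[OF this c] show "continuous_map (top_of_set (?\<sigma> -` S)) (mtop M) (\<lambda>t. \<delta> (?\<sigma> t))" by (simp add: o_def)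
    fix c assume c: "c \<in> atlas M"
    have e: "{t \<in> ?\<sigma> -` S. \<delta> (?\<sigma> t) \<in> fst c} = ?\<sigma> -` {t\<in>S. \<delta> t \<in> fst c}" by auto
    show "smooth_on {t \<in> ?\<sigma> -` S. \<delta> (?\<sigma> t) \<in> fst c} (\<lambda>t. snd c (\<delta> (?\<sigma> t)))"
      unfolding e
    proof (rule smooth_on_compose[OF oS[OF o[OF c]] o[OF c] _ sm[OF c]])
      show "smooth_on (?\<sigma> -` {t\<in>S. \<delta> t \<in> fst c}) ?\<sigma>"
        by (intro smooth_on_add smooth_on_mult smooth_on_const smooth_on_id oS[OF o[OF c]])
    qed simp
  qed
qed

end

context hypersurface begin

lemma smooth_f_path:
  assumes S: "open S" and d: "smooth_map (euclidean_mfd S) N \<delta>"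
  shows "smooth_on S (\<lambda>t::real. f (\<delta> t))"
proof (rule smooth_on_local)
  fix t assume t: "t \<in> S"
  have ct: "continuous_map (top_of_set S) (mtop N) \<delta>" and sm: "\<And>c. c \<in> atlas N \<Longrightarrow> smooth_on {t\<in>S. \<delta> t \<in> fst c} (\<lambda>t. snd c (\<delta> t))"
    using d unfolding smooth_path_iff[OF S] by blast+
  have "\<delta> t \<in> points N" using ct t by (auto simp: continuous_map_def)
  then obtain c where c: "c \<in> atlas N" "\<delta> t \<in> fst c" using covered charts_atD by blast
  have o: "open {t\<in>S. \<delta> t \<in> fst c}"
    using openin_continuous_map_preimage[OF ct dom_open[OF c(1)]] S openin_open_trans by auto
  have "smooth_on {t\<in>S. \<delta> t \<in> fst c} (\<lambda>t. f (chart_inv c (snd c (\<delta> t))))"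
    by (rule smooth_on_compose[OF o ran_open[OF c(1)] sm[OF c(1)] smooth_f[OF c(1)]]) auto
  then have "smooth_on {t\<in>S. \<delta> t \<in> fst c} (\<lambda>t. f (\<delta> t))"
    using smooth_on_cong[OF o, of "\<lambda>t. f (chart_inv c (snd c (\<delta> t)))" "\<lambda>t. f (\<delta> t)"] c(1) by simp
  then show "\<exists>T. open T \<and> t \<in> T \<and> smooth_on T (\<lambda>t. f (\<delta> t))" using o t c(2) by blast
qed

text \<open>By the chain rule the chart chosen in \<open>speed\<close> cancels. Lengths can then be
  estimated in the ambient Euclidean space.\<close>

lemma smooth_path_speed:
  assumes S: "open S" and d: "smooth_map (euclidean_mfd S) N \<delta>" and t: "t \<in> S"
    and eq: "\<And>s. s \<in> S \<Longrightarrow> \<gamma> s = \<delta> s"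
  shows "(\<lambda>s. f (\<gamma> s)) differentiable (at t)" "speed N f \<gamma> t = norm (vector_derivative (\<lambda>s. f (\<gamma> s)) (at t))"
proof -
  have ct: "continuous_map (top_of_set S) (mtop N) \<delta>" and sm: "\<And>c. c \<in> atlas N \<Longrightarrow> smooth_on {t\<in>S. \<delta> t \<in> fst c} (\<lambda>t. snd c (\<delta> t))"
    using d unfolding smooth_path_iff[OF S] by blast+
  have gt: "\<gamma> t \<in> points N" using ct t eq by (auto simp: continuous_map_def)
  define c where "c = (SOME c. c \<in> charts_at N (\<gamma> t))"
  have cc: "c \<in> charts_at N (\<gamma> t)" unfolding c_def using covered[OF gt] by (rule someI_ex)
  then have c: "c \<in> atlas N" "\<gamma> t \<in> fst c" using charts_atD by auto
  let ?O = "{t\<in>S. \<delta> t \<in> fst c}"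
  have o: "open ?O" using openin_continuous_map_preimage[OF ct dom_open[OF c(1)]] S openin_open_trans by auto
  have tO: "t \<in> ?O" using t c(2) eq by auto
  define w where "w = vector_derivative (snd c \<circ> \<gamma>) (at t)"
  have "((\<lambda>t. snd c (\<delta> t)) has_derivative frechet_derivative (\<lambda>t. snd c (\<delta> t)) (at t)) (at t)"
    by (rule smooth_on_has_derivative[OF sm[OF c(1)] tO])
  then have "((snd c \<circ> \<gamma>) has_derivative frechet_derivative (\<lambda>t. snd c (\<delta> t)) (at t)) (at t)"
    by (rule has_derivative_transform_within_open[OF _ o tO]) (simp add: eq)
  then have "(snd c \<circ> \<gamma>) differentiable (at t)" by (rule differentiableI)
  then have dw: "((snd c \<circ> \<gamma>) has_derivative (\<lambda>h. h *\<^sub>R w)) (at t)"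
    unfolding w_def vector_derivative_works has_vector_derivative_def .
  have dF: "((\<lambda>x. f (chart_inv c x)) has_derivative df c f (\<gamma> t)) (at ((snd c \<circ> \<gamma>) t))"
    using df_has_derivative[OF c(1) smooth_f[OF c(1)], of "snd c (\<gamma> t)"] c by simp
  have "((\<lambda>s. f (chart_inv c ((snd c \<circ> \<gamma>) s))) has_derivative (\<lambda>h. df c f (\<gamma> t) (h *\<^sub>R w))) (at t)"
    by (rule has_derivative_compose[OF dw dF])
  then have "((\<lambda>s. f (\<gamma> s)) has_derivative (\<lambda>h. df c f (\<gamma> t) (h *\<^sub>R w))) (at t)"
    by (rule has_derivative_transform_within_open[OF _ o tO]) (simp add: eq c(1))
  moreover have "(\<lambda>h. df c f (\<gamma> t) (h *\<^sub>R w)) = (\<lambda>h. h *\<^sub>R df c f (\<gamma> t) w)"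
    using df_facts(1)[OF cc] by (simp add: linear_cmul)
  ultimately have v: "((\<lambda>s. f (\<gamma> s)) has_vector_derivative df c f (\<gamma> t) w) (at t)"
    by (simp add: has_vector_derivative_def)
  then show "(\<lambda>s. f (\<gamma> s)) differentiable (at t)" unfolding has_vector_derivative_def by (rule differentiableI)
  show "speed N f \<gamma> t = norm (vector_derivative (\<lambda>s. f (\<gamma> s)) (at t))"
    unfolding vector_derivative_at[OF v] speed_def Let_def c_def[symmetric] w_def[symmetric] induced_metric_def
    by (simp add: norm_eq_sqrt_inner)
qed

text \<open>Piecewise smoothness on any interval instead of [0, 1], so that paths can be cut, joined
  and reparametrized.\<close>

definition pws :: "real \<Rightarrow> real \<Rightarrow> (real \<Rightarrow> 'p) \<Rightarrow> bool" where
  "pws a b \<gamma> \<longleftrightarrow> continuous_map (top_of_set {a..b}) (mtop N) \<gamma> \<and>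
     (\<exists>K. finite K \<and> (\<forall>x y. a \<le> x \<and> x < y \<and> y \<le> b \<and> {x<..<y} \<inter> K = {} \<longrightarrow>
        (\<exists>S \<delta>. open S \<and> {x..y} \<subseteq> S \<and> smooth_map (euclidean_mfd S) N \<delta> \<and> (\<forall>t\<in>{x..y}. \<delta> t = \<gamma> t))))"

definition len :: "real \<Rightarrow> real \<Rightarrow> (real \<Rightarrow> 'p) \<Rightarrow> real" where
  "len a b \<gamma> = integral {a..b} (speed N f \<gamma>)"

lemma pws_unit: "piecewise_smooth_path N \<gamma> \<longleftrightarrow> pws 0 1 \<gamma>" "path_len N f \<gamma> = len 0 1 \<gamma>"
  unfolding piecewise_smooth_path_def pws_def path_len_def len_def pathin_def by blast+

lemma speed_nonneg: "speed N f \<gamma> t \<ge> 0"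
  by (simp add: speed_def Let_def induced_metric_def)

lemma piecewise_smoothE:
  assumes "pws a b \<gamma>"
  obtains K where "finite K" "\<forall>x y. a \<le> x \<and> x < y \<and> y \<le> b \<and> {x<..<y} \<inter> K = {} \<longrightarrow>
      (\<exists>S \<delta>. open S \<and> {x..y} \<subseteq> S \<and> smooth_map (euclidean_mfd S) N \<delta> \<and> (\<forall>t\<in>{x..y}. \<delta> t = \<gamma> t))"
    "continuous_map (top_of_set {a..b}) (mtop N) \<gamma>"
proof -
  from assms have c: "continuous_map (top_of_set {a..b}) (mtop N) \<gamma>"
    and "\<exists>K. finite K \<and> (\<forall>x y. a \<le> x \<and> x < y \<and> y \<le> b \<and> {x<..<y} \<inter> K = {} \<longrightarrow>
      (\<exists>S \<delta>. open S \<and> {x..y} \<subseteq> S \<and> smooth_map (euclidean_mfd S) N \<delta> \<and> (\<forall>t\<in>{x..y}. \<delta> t = \<gamma> t)))"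
    unfolding pws_def by (rule conjunct1, rule conjunct2)
  then obtain K where K: "finite K" "\<forall>x y. a \<le> x \<and> x < y \<and> y \<le> b \<and> {x<..<y} \<inter> K = {} \<longrightarrow>
      (\<exists>S \<delta>. open S \<and> {x..y} \<subseteq> S \<and> smooth_map (euclidean_mfd S) N \<delta> \<and> (\<forall>t\<in>{x..y}. \<delta> t = \<gamma> t))" by (elim exE conjE)
  show thesis by (rule that[OF K c])
qed

lemma pws_speed:
  assumes "pws a b \<gamma>"
  shows "\<exists>K. finite K \<and> (\<forall>t\<in>{a..b} - K. (\<lambda>s. f (\<gamma> s)) differentiable (at t) \<and>
    speed N f \<gamma> t = norm (vector_derivative (\<lambda>s. f (\<gamma> s)) (at t)))"
proof -
  obtain K where K0: "finite K" "\<forall>x y. a \<le> x \<and> x < y \<and> y \<le> b \<and> {x<..<y} \<inter> K = {} \<longrightarrow>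
        (\<exists>S \<delta>. open S \<and> {x..y} \<subseteq> S \<and> smooth_map (euclidean_mfd S) N \<delta> \<and> (\<forall>t\<in>{x..y}. \<delta> t = \<gamma> t))"
    and ct: "continuous_map (top_of_set {a..b}) (mtop N) \<gamma>"
    by (rule piecewise_smoothE[OF assms])
  have K: "finite K" "\<And>x y. a \<le> x \<Longrightarrow> x < y \<Longrightarrow> y \<le> b \<Longrightarrow> {x<..<y} \<inter> K = {} \<Longrightarrow>
        \<exists>S \<delta>. open S \<and> {x..y} \<subseteq> S \<and> smooth_map (euclidean_mfd S) N \<delta> \<and> (\<forall>t\<in>{x..y}. \<delta> t = \<gamma> t)" using K0 by blast+
  have "(\<lambda>s. f (\<gamma> s)) differentiable (at t) \<and> speed N f \<gamma> t = norm (vector_derivative (\<lambda>s. f (\<gamma> s)) (at t))"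
    if t: "t \<in> {a..b} - (K \<union> {a, b})" for t
  proof -
    have "open ({a<..<b} - K)" using K(1) by (simp add: open_Diff finite_imp_closed)
    then obtain e where e: "e > 0" "cball t e \<subseteq> {a<..<b} - K" using t unfolding open_contains_cball by force
    have sub: "{t - e..t + e} \<subseteq> {a<..<b} - K" using e(2) by (simp add: cball_eq_atLeastAtMost)
    have disj: "{t - e<..<t + e} \<inter> K = {}" using sub greaterThanLessThan_subseteq_atLeastAtMost_iff[of "t - e" "t + e" "t - e" "t + e"] by blast
    have "t - e \<in> {t - e..t + e}" "t + e \<in> {t - e..t + e}" using e by auto
    then have "t - e \<in> {a<..<b}" "t + e \<in> {a<..<b}" using sub by blast+
    then have "\<exists>S \<delta>. open S \<and> {t - e..t + e} \<subseteq> S \<and> smooth_map (euclidean_mfd S) N \<delta> \<and> (\<forall>s\<in>{t - e..t + e}. \<delta> s = \<gamma> s)"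
      using e(1) disj by (intro K(2)) auto
    then obtain S \<delta> where S: "open S" "{t - e..t + e} \<subseteq> S" "smooth_map (euclidean_mfd S) N \<delta>" "\<forall>s\<in>{t - e..t + e}. \<delta> s = \<gamma> s"
      by blast
    let ?S = "{t - e<..<t + e}"
    have s: "smooth_map (euclidean_mfd ?S) N \<delta>"
    proof -
      have sub: "?S \<subseteq> S" using S(2) by auto
      have "continuous_map (top_of_set ?S) (mtop N) \<delta>"
        using S(3) sub continuous_map_from_subtopology_mono unfolding smooth_path_iff[OF S(1)] by blast
      moreover have "smooth_on {t\<in>?S. \<delta> t \<in> fst c} (\<lambda>t. snd c (\<delta> t))" if "c \<in> atlas N" for c
        by (rule smooth_on_subset[of "{t\<in>S. \<delta> t \<in> fst c}"]) (use S(3) sub that in \<open>auto simp: smooth_path_iff[OF S(1)]\<close>)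
      ultimately show ?thesis unfolding smooth_path_iff[OF open_greaterThanLessThan] by blast
    qed
    show ?thesis using smooth_path_speed[OF open_greaterThanLessThan s, of t \<gamma>] e(1) S(4) by simp
  qed
  then show ?thesis using K(1) by (intro exI[of _ "K \<union> {a, b}"]) auto
qed

lemma pws_piece:
  assumes S: "open S" "{x..y} \<subseteq> S" and d: "smooth_map (euclidean_mfd S) N \<delta>" and eq: "\<And>t. t \<in> {x..y} \<Longrightarrow> \<delta> t = \<gamma> t" and xy: "x < y"
  shows "speed N f \<gamma> integrable_on {x..y}" "norm (f (\<gamma> y) - f (\<gamma> x)) \<le> len x y \<gamma>"
    "len x y \<gamma> = integral {x..y} (\<lambda>t. norm (vector_derivative (\<lambda>s. f (\<delta> s)) (at t)))"
proof -
  let ?F = "\<lambda>s. f (\<delta> s)" let ?F' = "\<lambda>t. vector_derivative (\<lambda>s. f (\<delta> s)) (at t)"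
  have smF: "smooth_on S ?F" by (rule smooth_f_path[OF S(1) d])
  have dF: "(?F has_derivative frechet_derivative ?F (at t)) (at t)" if "t \<in> S" for t
    by (rule smooth_on_has_derivative[OF smF that])
  have vF: "(?F has_vector_derivative ?F' t) (at t)" if "t \<in> S" for t
    using dF[OF that] unfolding vector_derivative_works[symmetric] by (rule differentiableI)
  have "continuous_on S ?F'"
  proof -
    have "continuous_on S (\<lambda>t. frechet_derivative ?F (at t) 1)"
      by (rule smooth_on_continuous[OF smooth_on_frechet[OF smF]])
    moreover have "frechet_derivative ?F (at t) 1 = ?F' t" if "t \<in> S" for t
      using frechet_derivative_at[OF vF[OF that, unfolded has_vector_derivative_def]] by (metis scaleR_one)
    ultimately show ?thesis by (simp cong: continuous_on_cong)
  qed
  then have c: "continuous_on {x..y} ?F'" using S(2) continuous_on_subset by blast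
  then have i: "(\<lambda>t. norm (?F' t)) integrable_on {x..y}" by (intro integrable_continuous_interval continuous_on_norm)
  \<comment> \<open>At \<open>x\<close> and \<open>y\<close> the two-sided derivative in
    \<open>speed\<close> may involve other pieces of \<gamma>; two points do not affect the
    integral.\<close>
  have sp: "speed N f \<gamma> t = norm (?F' t)" if t: "t \<in> {x..y} - {x, y}" for t
  proof -
    let ?S = "{x<..<y}"
    have s: "smooth_map (euclidean_mfd ?S) N \<delta>"
    proof -
      have sub: "?S \<subseteq> S" using S(2) by auto
      have "continuous_map (top_of_set ?S) (mtop N) \<delta>"
        using d sub continuous_map_from_subtopology_mono unfolding smooth_path_iff[OF S(1)] by blast
      moreover have "smooth_on {t\<in>?S. \<delta> t \<in> fst c} (\<lambda>t. snd c (\<delta> t))" if "c \<in> atlas N" for c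
        by (rule smooth_on_subset[of "{t\<in>S. \<delta> t \<in> fst c}"]) (use d sub that in \<open>auto simp: smooth_path_iff[OF S(1)]\<close>)
      ultimately show ?thesis unfolding smooth_path_iff[OF open_greaterThanLessThan] by blast
    qed
    have tS: "t \<in> ?S" using t by auto
    have "speed N f \<gamma> t = norm (vector_derivative (\<lambda>s. f (\<gamma> s)) (at t))"
      by (rule smooth_path_speed[OF open_greaterThanLessThan s tS]) (simp add: eq)
    also have "vector_derivative (\<lambda>s. f (\<gamma> s)) (at t) = ?F' t"
      by (rule vector_derivative_at, rule has_vector_derivative_transform_within_open[OF vF open_greaterThanLessThan tS])
        (use tS S(2) eq in auto)
    finally show ?thesis .
  qed
  have fin: "finite {x, y}" by simp
  show "speed N f \<gamma> integrable_on {x..y}" by (rule integrable_spike_finite[OF fin sp i])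
  have "((\<lambda>t. norm (?F' t)) has_integral integral {x..y} (\<lambda>t. norm (?F' t))) {x..y}" using i by (rule integrable_integral)
  then have "(speed N f \<gamma> has_integral integral {x..y} (\<lambda>t. norm (?F' t))) {x..y}"
    using has_integral_spike_finite[of "{x, y}" "{x..y}" "speed N f \<gamma>" "\<lambda>t. norm (?F' t)"] sp fin by simp
  then show l: "len x y \<gamma> = integral {x..y} (\<lambda>t. norm (?F' t))" unfolding len_def by (rule integral_unique)
  have "(?F' has_integral (?F y - ?F x)) {x..y}"
  proof (rule fundamental_theorem_of_calculus)
    show "(?F has_vector_derivative ?F' t) (at t within {x..y})" if "t \<in> {x..y}" for t
      by (rule has_vector_derivative_at_within[OF vF]) (use that S(2) in blast)
  qed (use xy in simp)
  then have "norm (?F y - ?F x) \<le> integral {x..y} (\<lambda>t. norm (?F' t))"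
    using integral_norm_bound_integral[of ?F' "{x..y}" "\<lambda>t. norm (?F' t)"] i by (metis has_integral_integrable_integral order_refl)
  then show "norm (f (\<gamma> y) - f (\<gamma> x)) \<le> len x y \<gamma>" using l eq xy by simp
qed

lemma pws_length:
  assumes p: "pws a b \<gamma>" and ab: "a < b"
  shows "speed N f \<gamma> integrable_on {a..b}" "norm (f (\<gamma> b) - f (\<gamma> a)) \<le> len a b \<gamma>"
proof -
  obtain K where K0: "finite K" "\<forall>x y. a \<le> x \<and> x < y \<and> y \<le> b \<and> {x<..<y} \<inter> K = {} \<longrightarrow>
        (\<exists>S \<delta>. open S \<and> {x..y} \<subseteq> S \<and> smooth_map (euclidean_mfd S) N \<delta> \<and> (\<forall>t\<in>{x..y}. \<delta> t = \<gamma> t))"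
    and ct: "continuous_map (top_of_set {a..b}) (mtop N) \<gamma>"
    by (rule piecewise_smoothE[OF p])
  have K: "finite K" "\<And>x y. a \<le> x \<Longrightarrow> x < y \<Longrightarrow> y \<le> b \<Longrightarrow> {x<..<y} \<inter> K = {} \<Longrightarrow>
        \<exists>S \<delta>. open S \<and> {x..y} \<subseteq> S \<and> smooth_map (euclidean_mfd S) N \<delta> \<and> (\<forall>t\<in>{x..y}. \<delta> t = \<gamma> t)" using K0 by blast+
  have "speed N f \<gamma> integrable_on {a..b} \<and> norm (f (\<gamma> b) - f (\<gamma> a)) \<le> len a b \<gamma>"
  proof (rule interval_pieces[OF K(1) ab])
    fix x y assume "a \<le> x" "x < y" "y \<le> b" "{x<..<y} \<inter> K = {}"
    then obtain S \<delta> where "open S" "{x..y} \<subseteq> S" "smooth_map (euclidean_mfd S) N \<delta>" "\<And>t. t\<in>{x..y} \<Longrightarrow> \<delta> t = \<gamma> t"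
      using K(2) by meson
    from pws_piece(1,2)[OF this \<open>x < y\<close>] show "speed N f \<gamma> integrable_on {x..y} \<and> norm (f (\<gamma> y) - f (\<gamma> x)) \<le> len x y \<gamma>" by blast
  next
    fix x y z :: real
    assume xyz: "x < y" "y < z" and 1: "speed N f \<gamma> integrable_on {x..y} \<and> norm (f (\<gamma> y) - f (\<gamma> x)) \<le> len x y \<gamma>"
      and 2: "speed N f \<gamma> integrable_on {y..z} \<and> norm (f (\<gamma> z) - f (\<gamma> y)) \<le> len y z \<gamma>"
    have i: "speed N f \<gamma> integrable_on {x..z}" by (rule Henstock_Kurzweil_Integration.integrable_combine[of x y]) (use xyz 1 2 in auto)
    have "len x z \<gamma> = len x y \<gamma> + len y z \<gamma>" unfolding len_def using Henstock_Kurzweil_Integration.integral_combine[OF _ _ i, of y] xyz by simp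
    moreover have "norm (f (\<gamma> z) - f (\<gamma> x)) \<le> norm (f (\<gamma> z) - f (\<gamma> y)) + norm (f (\<gamma> y) - f (\<gamma> x))"
      using norm_triangle_ineq[of "f (\<gamma> z) - f (\<gamma> y)" "f (\<gamma> y) - f (\<gamma> x)"] by simp
    ultimately show "speed N f \<gamma> integrable_on {x..z} \<and> norm (f (\<gamma> z) - f (\<gamma> x)) \<le> len x z \<gamma>" using i 1 2 by linarith
  qed
  then show "speed N f \<gamma> integrable_on {a..b}" "norm (f (\<gamma> b) - f (\<gamma> a)) \<le> len a b \<gamma>" by auto
qed

lemma pws_sub:
  assumes "pws a b \<gamma>" "a \<le> a'" "b' \<le> b" shows "pws a' b' \<gamma>"
proof -
  obtain K where K0: "finite K" "\<forall>x y. a \<le> x \<and> x < y \<and> y \<le> b \<and> {x<..<y} \<inter> K = {} \<longrightarrow>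
        (\<exists>S \<delta>. open S \<and> {x..y} \<subseteq> S \<and> smooth_map (euclidean_mfd S) N \<delta> \<and> (\<forall>t\<in>{x..y}. \<delta> t = \<gamma> t))"
    and c: "continuous_map (top_of_set {a..b}) (mtop N) \<gamma>"
    by (rule piecewise_smoothE[OF assms(1)])
  have K: "finite K" "\<And>x y. a \<le> x \<Longrightarrow> x < y \<Longrightarrow> y \<le> b \<Longrightarrow> {x<..<y} \<inter> K = {} \<Longrightarrow>
        \<exists>S \<delta>. open S \<and> {x..y} \<subseteq> S \<and> smooth_map (euclidean_mfd S) N \<delta> \<and> (\<forall>t\<in>{x..y}. \<delta> t = \<gamma> t)" using K0 by blast+
  have "continuous_map (top_of_set {a'..b'}) (mtop N) \<gamma>"
    by (rule continuous_map_from_subtopology_mono[OF c]) (use assms in auto)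
  moreover have "\<exists>S \<delta>. open S \<and> {x..y} \<subseteq> S \<and> smooth_map (euclidean_mfd S) N \<delta> \<and> (\<forall>t\<in>{x..y}. \<delta> t = \<gamma> t)"
    if "a' \<le> x \<and> x < y \<and> y \<le> b' \<and> {x<..<y} \<inter> K = {}" for x y
    by (rule K(2)) (use that assms(2,3) in auto)
  ultimately show ?thesis unfolding pws_def using K(1) by blast
qed

lemma pws_smooth:
  assumes S: "open S" "{a..b} \<subseteq> S" and d: "smooth_map (euclidean_mfd S) N \<delta>"
  shows "pws a b \<delta>"
proof -
  have "continuous_map (top_of_set {a..b}) (mtop N) \<delta>"
    by (rule continuous_map_from_subtopology_mono[OF _ S(2)]) (use d in \<open>simp add: smooth_path_iff[OF S(1)]\<close>)
  moreover have "\<exists>S' \<delta>'. open S' \<and> {x..y} \<subseteq> S' \<and> smooth_map (euclidean_mfd S') N \<delta>' \<and> (\<forall>t\<in>{x..y}. \<delta>' t = \<delta> t)"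
    if "a \<le> x \<and> x < y \<and> y \<le> b \<and> {x<..<y} \<inter> {} = {}" for x y
    by (intro exI[of _ S] exI[of _ \<delta>]) (use S d that in auto)
  ultimately show ?thesis unfolding pws_def using finite.emptyI by blast
qed

lemma speed_cong:
  assumes "eventually (\<lambda>s. \<gamma> s = \<gamma>' s) (nhds t)"
  shows "speed N f \<gamma> t = speed N f \<gamma>' t"
proof -
  have "vector_derivative (snd c \<circ> \<gamma>) (at t) = vector_derivative (snd c \<circ> \<gamma>') (at t)" for c :: "('p, real ^ 'n) chart"
    by (rule vector_derivative_cong_eq) (use assms in \<open>auto elim!: eventually_mono\<close>)
  then show ?thesis using eventually_nhds_x_imp_x[OF assms] by (simp add: speed_def)
qed

lemma pws_join:
  assumes p: "pws a b \<gamma>" and q: "pws b c \<gamma>'" and ab: "a < b" and bc: "b < c" and eq: "\<gamma> b = \<gamma>' b"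
  defines "h \<equiv> (\<lambda>t. if t \<le> b then \<gamma> t else \<gamma>' t)"
  shows "pws a c h" "len a c h = len a b \<gamma> + len b c \<gamma>'"
proof -
  obtain K where K0: "finite K" "\<forall>x y. a \<le> x \<and> x < y \<and> y \<le> b \<and> {x<..<y} \<inter> K = {} \<longrightarrow>
        (\<exists>S \<delta>. open S \<and> {x..y} \<subseteq> S \<and> smooth_map (euclidean_mfd S) N \<delta> \<and> (\<forall>t\<in>{x..y}. \<delta> t = \<gamma> t))"
    and ct: "continuous_map (top_of_set {a..b}) (mtop N) \<gamma>"
    by (rule piecewise_smoothE[OF p])
  have K: "finite K" "\<And>x y. a \<le> x \<Longrightarrow> x < y \<Longrightarrow> y \<le> b \<Longrightarrow> {x<..<y} \<inter> K = {} \<Longrightarrow>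
        \<exists>S \<delta>. open S \<and> {x..y} \<subseteq> S \<and> smooth_map (euclidean_mfd S) N \<delta> \<and> (\<forall>t\<in>{x..y}. \<delta> t = \<gamma> t)" using K0 by blast+
  obtain K' where K'0: "finite K'" "\<forall>x y. b \<le> x \<and> x < y \<and> y \<le> c \<and> {x<..<y} \<inter> K' = {} \<longrightarrow>
        (\<exists>S \<delta>. open S \<and> {x..y} \<subseteq> S \<and> smooth_map (euclidean_mfd S) N \<delta> \<and> (\<forall>t\<in>{x..y}. \<delta> t = \<gamma>' t))"
    and ct': "continuous_map (top_of_set {b..c}) (mtop N) \<gamma>'"
    by (rule piecewise_smoothE[OF q])
  have K': "finite K'" "\<And>x y. b \<le> x \<Longrightarrow> x < y \<Longrightarrow> y \<le> c \<Longrightarrow> {x<..<y} \<inter> K' = {} \<Longrightarrow>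
        \<exists>S \<delta>. open S \<and> {x..y} \<subseteq> S \<and> smooth_map (euclidean_mfd S) N \<delta> \<and> (\<forall>t\<in>{x..y}. \<delta> t = \<gamma>' t)" using K'0 by blast+
  have "continuous_map (top_of_set {a..c}) (mtop N) h"
    unfolding h_def
  proof (rule continuous_map_cases_le)
    have e: "{x \<in> topspace (top_of_set {a..c}). x \<le> b} = {a..b}" "{x \<in> topspace (top_of_set {a..c}). b \<le> x} = {b..c}"
      using ab bc by auto
    have s: "subtopology (top_of_set {a..c}) {a..b} = top_of_set {a..b}" "subtopology (top_of_set {a..c}) {b..c} = top_of_set {b..c}"
      using ab bc unfolding subtopology_subtopology by (auto intro!: arg_cong[of _ _ "subtopology euclidean"])
    show "continuous_map (subtopology (top_of_set {a..c}) {x \<in> topspace (top_of_set {a..c}). x \<le> b}) (mtop N) \<gamma>"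
      unfolding e s by (rule ct)
    show "continuous_map (subtopology (top_of_set {a..c}) {x \<in> topspace (top_of_set {a..c}). b \<le> x}) (mtop N) \<gamma>'"
      unfolding e s by (rule ct')
  qed (use eq in auto)
  moreover have "\<exists>S \<delta>. open S \<and> {x..y} \<subseteq> S \<and> smooth_map (euclidean_mfd S) N \<delta> \<and> (\<forall>t\<in>{x..y}. \<delta> t = h t)"
    if xy: "a \<le> x \<and> x < y \<and> y \<le> c \<and> {x<..<y} \<inter> (K \<union> K' \<union> {b}) = {}" for x y
  proof (cases "y \<le> b")
    case True
    have "\<exists>S \<delta>. open S \<and> {x..y} \<subseteq> S \<and> smooth_map (euclidean_mfd S) N \<delta> \<and> (\<forall>t\<in>{x..y}. \<delta> t = \<gamma> t)"
      using xy True by (intro K(2)) auto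
    moreover have "\<forall>t\<in>{x..y}. h t = \<gamma> t" using True by (auto simp: h_def)
    ultimately show ?thesis by simp
  next
    case False
    then have bx: "b \<le> x" using xy by (auto simp: not_le)
    have "\<exists>S \<delta>. open S \<and> {x..y} \<subseteq> S \<and> smooth_map (euclidean_mfd S) N \<delta> \<and> (\<forall>t\<in>{x..y}. \<delta> t = \<gamma>' t)"
      using xy bx by (intro K'(2)) auto
    moreover have "\<forall>t\<in>{x..y}. h t = \<gamma>' t"
    proof
      fix t assume "t \<in> {x..y}"
      then have "t = b \<or> t > b" using bx by auto
      then show "h t = \<gamma>' t" using eq by (auto simp: h_def)
    qed
    ultimately show ?thesis by simp
  qed
  ultimately show ph: "pws a c h" unfolding pws_def using K(1) K'(1) by (metis finite.emptyI finite.insertI finite_UnI)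
  have i: "speed N f h integrable_on {a..c}" using pws_length(1)[OF ph] ab bc by simp
  have "len a c h = len a b h + len b c h"
    unfolding len_def using Henstock_Kurzweil_Integration.integral_combine[OF _ _ i, of b] ab bc by simp
  moreover have "len a b h = len a b \<gamma>"
    unfolding len_def
  proof (rule integral_spike[of "{a, b}"])
    fix t assume t: "t \<in> {a..b} - {a, b}"
    have "eventually (\<lambda>s. s \<in> {..<b}) (nhds t)" by (rule eventually_nhds_in_open) (use t in auto)
    then show "speed N f \<gamma> t = speed N f h t" by (intro speed_cong) (auto simp: h_def elim!: eventually_mono)
  qed simp
  moreover have "len b c h = len b c \<gamma>'"
    unfolding len_def
  proof (rule integral_spike[of "{b, c}"])
    fix t assume t: "t \<in> {b..c} - {b, c}"
    have "eventually (\<lambda>s. s \<in> {b<..}) (nhds t)" by (rule eventually_nhds_in_open) (use t in auto)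
    then show "speed N f \<gamma>' t = speed N f h t" by (intro speed_cong) (auto simp: h_def elim!: eventually_mono)
  qed simp
  ultimately show "len a c h = len a b \<gamma> + len b c \<gamma>'" by simp
qed

text \<open>As \<open>m\<close> may be negative, this covers reversal of a path as well as
  translation and scaling.\<close>

lemma pws_affine:
  assumes p: "pws a b \<gamma>" and ab: "a < b" and m: "m \<noteq> 0" and im: "(\<lambda>t. m * t + k) ` {a'..b'} = {a..b}"
  shows "pws a' b' (\<lambda>t. \<gamma> (m * t + k))" "len a' b' (\<lambda>t. \<gamma> (m * t + k)) = len a b \<gamma>"
proof -
  let ?\<sigma> = "\<lambda>t::real. m * t + k"
  have inj: "inj ?\<sigma>" using m by (auto intro!: injI)
  obtain K where K0: "finite K" "\<forall>x y. a \<le> x \<and> x < y \<and> y \<le> b \<and> {x<..<y} \<inter> K = {} \<longrightarrow>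
        (\<exists>S \<delta>. open S \<and> {x..y} \<subseteq> S \<and> smooth_map (euclidean_mfd S) N \<delta> \<and> (\<forall>t\<in>{x..y}. \<delta> t = \<gamma> t))"
    and ct: "continuous_map (top_of_set {a..b}) (mtop N) \<gamma>"
    by (rule piecewise_smoothE[OF p])
  have K: "finite K" "\<And>x y. a \<le> x \<Longrightarrow> x < y \<Longrightarrow> y \<le> b \<Longrightarrow> {x<..<y} \<inter> K = {} \<Longrightarrow>
        \<exists>S \<delta>. open S \<and> {x..y} \<subseteq> S \<and> smooth_map (euclidean_mfd S) N \<delta> \<and> (\<forall>t\<in>{x..y}. \<delta> t = \<gamma> t)" using K0 by blast+
  have "continuous_map (top_of_set {a'..b'}) (top_of_set {a..b}) ?\<sigma>"
    unfolding im[symmetric] by (auto intro!: continuous_intros)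
  from continuous_map_compose[OF this ct] have "continuous_map (top_of_set {a'..b'}) (mtop N) (\<lambda>t. \<gamma> (?\<sigma> t))" by (simp add: o_def)
  moreover have "finite (?\<sigma> -` K)" by (rule finite_vimageI[OF K(1) inj])
  moreover have "\<exists>S \<delta>. open S \<and> {x..y} \<subseteq> S \<and> smooth_map (euclidean_mfd S) N \<delta> \<and> (\<forall>t\<in>{x..y}. \<delta> t = \<gamma> (?\<sigma> t))"
    if xy: "a' \<le> x \<and> x < y \<and> y \<le> b' \<and> {x<..<y} \<inter> (?\<sigma> -` K) = {}" for x y
  proof -
    let ?x = "min (?\<sigma> x) (?\<sigma> y)" let ?y = "max (?\<sigma> x) (?\<sigma> y)"
    have "?\<sigma> x \<in> {a..b}" "?\<sigma> y \<in> {a..b}" using xy unfolding im[symmetric] by auto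
    moreover have "?\<sigma> x \<noteq> ?\<sigma> y" using xy m by simp
    ultimately have ends: "a \<le> ?x" "?x < ?y" "?y \<le> b"
      unfolding atLeastAtMost_iff min_def max_def by (smt (verit))+
    have "{?x<..<?y} \<inter> K = {}"
    proof -
      have "s \<notin> K" if s: "s \<in> {?x<..<?y}" for s
      proof -
        define t where "t = (s - k) / m"
        have st: "s = ?\<sigma> t" using m by (simp add: t_def)
        have "x < t \<and> t < y"
        proof (cases "m > 0")
          case True
          then have "?\<sigma> x < ?\<sigma> y" using xy by simp
          then show ?thesis using s True unfolding st by simp
        next
          case False
          then have m0: "m < 0" using m by simp
          then have "?\<sigma> y < ?\<sigma> x" using xy by simp
          then show ?thesis using s m0 unfolding st by simp
        qed
        then show ?thesis using xy unfolding st by auto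
      qed
      then show ?thesis by blast
    qed
    then obtain S \<delta> where S: "open S" "{?x..?y} \<subseteq> S" "smooth_map (euclidean_mfd S) N \<delta>" "\<forall>t\<in>{?x..?y}. \<delta> t = \<gamma> t"
      using K(2)[OF ends] by blast
    have in_xy: "?\<sigma> t \<in> {?x..?y}" if "t \<in> {x..y}" for t
    proof (cases "m > 0")
      case True
      then have "?\<sigma> x \<le> ?\<sigma> t" "?\<sigma> t \<le> ?\<sigma> y" using that by (auto intro!: mult_left_mono)
      then show ?thesis by auto
    next
      case False
      then have "?\<sigma> y \<le> ?\<sigma> t" "?\<sigma> t \<le> ?\<sigma> x" using that by (auto intro!: mult_left_mono_neg)
      then show ?thesis by auto
    qed
    have "open (?\<sigma> -` S)" by (rule open_vimage[OF S(1)]) (intro continuous_intros)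
    moreover have "{x..y} \<subseteq> ?\<sigma> -` S" using in_xy S(2) by blast
    moreover have "\<forall>t\<in>{x..y}. \<delta> (?\<sigma> t) = \<gamma> (?\<sigma> t)" using in_xy S(4) by blast
    ultimately show ?thesis using smooth_path_affine[OF S(1,3)] by blast
  qed
  ultimately show ph: "pws a' b' (\<lambda>t. \<gamma> (?\<sigma> t))" unfolding pws_def by blast
  show "len a' b' (\<lambda>t. \<gamma> (?\<sigma> t)) = len a b \<gamma>"
  proof -
    let ?G = "\<lambda>t. norm (vector_derivative (\<lambda>s. f (\<gamma> s)) (at t))"
    obtain L where L: "finite L" "\<And>t. t \<in> {a..b} - L \<Longrightarrow> (\<lambda>s. f (\<gamma> s)) differentiable (at t) \<and> speed N f \<gamma> t = ?G t"
      using pws_speed[OF p] by blast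
    obtain L' where L': "finite L'" "\<And>t. t \<in> {a'..b'} - L' \<Longrightarrow> speed N f (\<lambda>t. \<gamma> (?\<sigma> t)) t = norm (vector_derivative (\<lambda>s. f (\<gamma> (?\<sigma> s))) (at t))"
      using pws_speed[OF ph] by blast
    have I: "(speed N f \<gamma> has_integral len a b \<gamma>) (cbox a b)"
      unfolding len_def using pws_length(1)[OF p ab] by (simp add: integrable_integral)
    have "((\<lambda>t. speed N f \<gamma> (m *\<^sub>R t + k)) has_integral (1 / (\<bar>m\<bar> ^ DIM(real))) *\<^sub>R len a b \<gamma>) ((\<lambda>t. (1 / m) *\<^sub>R t + - ((1 / m) *\<^sub>R k)) ` cbox a b)"
      by (rule has_integral_affinity[OF I m])
    moreover have "(\<lambda>t. (1 / m) *\<^sub>R t + - ((1 / m) *\<^sub>R k)) ` cbox a b = {a'..b'}"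
      unfolding cbox_interval im[symmetric] image_image using m by (simp add: field_simps)
    ultimately have "((\<lambda>t. speed N f \<gamma> (?\<sigma> t)) has_integral (1 / \<bar>m\<bar>) * len a b \<gamma>) {a'..b'}" by simp
    from has_integral_mult_right[OF this, of "\<bar>m\<bar>"] have "((\<lambda>t. \<bar>m\<bar> * speed N f \<gamma> (?\<sigma> t)) has_integral len a b \<gamma>) {a'..b'}" using m by simp
    then have "(speed N f (\<lambda>t. \<gamma> (?\<sigma> t)) has_integral len a b \<gamma>) {a'..b'}"
    proof (rule has_integral_spike_finite[rotated 2])
      show "finite (L' \<union> ?\<sigma> -` L)" using L'(1) finite_vimageI[OF L(1) inj] by simp
      fix t assume t: "t \<in> {a'..b'} - (L' \<union> ?\<sigma> -` L)"
      have "?\<sigma> t \<in> {a..b} - L" using t unfolding im[symmetric] by auto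
      then have d: "(\<lambda>s. f (\<gamma> s)) differentiable (at (?\<sigma> t))" "speed N f \<gamma> (?\<sigma> t) = ?G (?\<sigma> t)" using L(2) by blast+
      have "((\<lambda>s. f (\<gamma> s)) has_vector_derivative vector_derivative (\<lambda>s. f (\<gamma> s)) (at (?\<sigma> t))) (at (?\<sigma> t))"
        using d(1) vector_derivative_works by blast
      moreover have "(?\<sigma> has_vector_derivative m) (at t)"
        by (auto simp: has_vector_derivative_def intro!: derivative_eq_intros)
      ultimately have "((\<lambda>s. f (\<gamma> s)) \<circ> ?\<sigma> has_vector_derivative m *\<^sub>R vector_derivative (\<lambda>s. f (\<gamma> s)) (at (?\<sigma> t))) (at t)"
        by (intro vector_diff_chain_at)
      then have "vector_derivative (\<lambda>s. f (\<gamma> (?\<sigma> s))) (at t) = m *\<^sub>R vector_derivative (\<lambda>s. f (\<gamma> s)) (at (?\<sigma> t))"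
        by (intro vector_derivative_at) (simp add: o_def)
      then show "speed N f (\<lambda>t. \<gamma> (?\<sigma> t)) t = \<bar>m\<bar> * speed N f \<gamma> (?\<sigma> t)"
        using L'(2)[of t] t d(2) by simp
    qed
    then show ?thesis unfolding len_def by (rule integral_unique)
  qed
qed

end

section \<open>The induced distance\<close>

context hypersurface begin

lemma connected_N: "connected_space (mtop N)" and nonempty_N: "points N \<noteq> {}"
  using oriented unfolding connected_oriented_manifold_def by blast+

definition lens :: "'p \<Rightarrow> 'p \<Rightarrow> real set" where
  "lens p q = {len 0 1 \<gamma> | \<gamma>. pws 0 1 \<gamma> \<and> \<gamma> 0 = p \<and> \<gamma> 1 = q}"

abbreviation "D \<equiv> induced_dist N f"

lemma D_eq: "p \<in> points N \<Longrightarrow> q \<in> points N \<Longrightarrow> D p q = Inf (lens p q)"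
  unfolding induced_dist_def lens_def pws_unit by simp

lemma lens_nonneg: "l \<in> lens p q \<Longrightarrow> 0 \<le> l"
proof -
  assume "l \<in> lens p q"
  then obtain \<gamma> where \<gamma>: "pws 0 1 \<gamma>" "l = len 0 1 \<gamma>" by (auto simp: lens_def)
  show ?thesis using pws_length(2)[OF \<gamma>(1)] norm_ge_zero[of "f (\<gamma> 1) - f (\<gamma> 0)"] \<gamma>(2) by linarith
qed

lemma lens_trans:
  assumes "l \<in> lens p q" "l' \<in> lens q r" shows "l + l' \<in> lens p r"
proof -
  obtain \<gamma> where \<gamma>: "pws 0 1 \<gamma>" "\<gamma> 0 = p" "\<gamma> 1 = q" "l = len 0 1 \<gamma>" using assms(1) by (auto simp: lens_def)
  obtain \<gamma>' where \<gamma>': "pws 0 1 \<gamma>'" "\<gamma>' 0 = q" "\<gamma>' 1 = r" "l' = len 0 1 \<gamma>'" using assms(2) by (auto simp: lens_def)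
  \<comment> \<open>The second path is moved to [1, 2] and joined to the first, and the result on
    [0, 2] is compressed to [0, 1].\<close>
  have i1: "(\<lambda>t::real. 1 * t + - 1) ` {1..2} = {0..1}"
    using image_add_atLeastAtMost[of "- 1" 1 "2::real"] by (simp add: add.commute)
  note s = pws_affine[OF \<gamma>'(1) zero_less_one one_neq_zero i1]
  have e: "\<gamma> 1 = \<gamma>' (1 * 1 + - 1)" using \<gamma>(3) \<gamma>'(2) by simp
  have "(1::real) < 2" by simp
  note j = pws_join[OF \<gamma>(1) s(1) zero_less_one this e]
  let ?h = "\<lambda>t::real. if t \<le> 1 then \<gamma> t else \<gamma>' (1 * t + - 1)"
  have i2: "(\<lambda>t::real. 2 * t + 0) ` {0..1} = {0..2}" by simp
  have "(0::real) < 2" "(2::real) \<noteq> 0" by simp_all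
  note k = pws_affine[OF j(1) this i2]
  have "len 0 1 (\<lambda>t. ?h (2 * t + 0)) = l + l'" using k(2) j(2) s(2) \<gamma>(4) \<gamma>'(4) by simp
  moreover have "?h (2 * 0 + 0) = p" "?h (2 * 1 + 0) = r" using \<gamma> \<gamma>' by simp_all
  ultimately show ?thesis unfolding lens_def using k(1) by (intro CollectI exI[of _ "\<lambda>t. ?h (2 * t + 0)"] conjI) simp_all
qed

lemma lens_sym:
  assumes "l \<in> lens p q" shows "l \<in> lens q p"
proof -
  obtain \<gamma> where \<gamma>: "pws 0 1 \<gamma>" "\<gamma> 0 = p" "\<gamma> 1 = q" "l = len 0 1 \<gamma>" using assms by (auto simp: lens_def)
  have i: "(\<lambda>t::real. (- 1) * t + 1) ` {0..1} = {0..1}"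
    using image_diff_atLeastAtMost[of 1 0 "1::real"] by (simp add: add.commute)
  have "(-1::real) \<noteq> 0" by simp
  note k = pws_affine[OF \<gamma>(1) zero_less_one this i]
  show ?thesis unfolding lens_def using k \<gamma> by (intro CollectI exI[of _ "\<lambda>t. \<gamma> ((- 1) * t + 1)"]) simp
qed

text \<open>A straight segment in coordinates is a smooth path, and a bound on its speed bounds its
  length. This is the source of all upper bounds for the distance.\<close>

lemma lens_segment:
  assumes c: "c \<in> atlas N" and B: "convex B" "B \<subseteq> cran c" and x: "x \<in> B" and y: "y \<in> B"
    and C: "\<And>z. z \<in> B \<Longrightarrow> norm (df c f (chart_inv c z) (y - x)) \<le> C"
  shows "\<exists>l\<in>lens (chart_inv c x) (chart_inv c y). l \<le> C"
proof -
  let ?\<sigma> = "\<lambda>t::real. x + t *\<^sub>R (y - x)" let ?S = "?\<sigma> -` cran c" let ?\<gamma> = "\<lambda>t. chart_inv c (?\<sigma> t)"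
  have oS: "open (?\<sigma> -` T)" if "open T" for T by (rule open_vimage[OF that]) (intro continuous_intros)
  have S: "open ?S" by (rule oS[OF ran_open[OF c]])
  have inB: "?\<sigma> t \<in> B" if "t \<in> {0..1}" for t
  proof -
    have "(1 - t) *\<^sub>R x + t *\<^sub>R y \<in> B" using convexD_alt[OF B(1) x y] that by simp
    then show ?thesis by (simp add: algebra_simps)
  qed
  then have sub: "{0..1} \<subseteq> ?S" using B(2) by blast
  have sm\<sigma>: "smooth_on T ?\<sigma>" if "open T" for T
    by (intro smooth_on_add smooth_on_scaleR smooth_on_const smooth_on_id that)
  have d: "smooth_map (euclidean_mfd ?S) N ?\<gamma>"
    unfolding smooth_path_iff[OF S]
  proof (intro conjI ballI)
    have "continuous_map (top_of_set ?S) (top_of_set (cran c)) ?\<sigma>" by (auto intro!: continuous_intros)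
    from continuous_map_compose[OF this cont_chart_inv[OF c]] show "continuous_map (top_of_set ?S) (mtop N) ?\<gamma>" by (simp add: o_def)
    fix d assume d: "d \<in> atlas N"
    have e: "{t \<in> ?S. ?\<gamma> t \<in> fst d} = ?\<sigma> -` (snd c ` (fst c \<inter> fst d))"
    proof (intro set_eqI iffI)
      fix t assume t: "t \<in> {t \<in> ?S. ?\<gamma> t \<in> fst d}"
      then have "?\<sigma> t = snd c (?\<gamma> t)" "?\<gamma> t \<in> fst c \<inter> fst d" using chart_inv_in[OF c] c by simp_all
      then show "t \<in> ?\<sigma> -` (snd c ` (fst c \<inter> fst d))" by (intro vimageI2) (rule image_eqI)
    next
      fix t assume "t \<in> ?\<sigma> -` (snd c ` (fst c \<inter> fst d))"
      then obtain p where "?\<sigma> t = snd c p" "p \<in> fst c" "p \<in> fst d" by auto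
      then show "t \<in> {t \<in> ?S. ?\<gamma> t \<in> fst d}" using c by auto
    qed
    show "smooth_on {t \<in> ?S. ?\<gamma> t \<in> fst d} (\<lambda>t. snd d (?\<gamma> t))"
      unfolding e
    proof (rule smooth_on_compose[OF _ overlap_open[OF c d] sm\<sigma> trans_smooth[OF c d]])
      show "open (?\<sigma> -` (snd c ` (fst c \<inter> fst d)))" by (rule oS[OF overlap_open[OF c d]])
      then show "open (?\<sigma> -` (snd c ` (fst c \<inter> fst d)))" .
    qed simp
  qed
  have p: "pws 0 1 ?\<gamma>" by (rule pws_smooth[OF S sub d])
  have l: "len 0 1 ?\<gamma> = integral {0..1} (\<lambda>t. norm (vector_derivative (\<lambda>s. f (?\<gamma> s)) (at t)))"
    by (rule pws_piece(3)[OF S sub d]) auto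
  have bd: "norm (vector_derivative (\<lambda>s. f (?\<gamma> s)) (at t)) \<le> C" if t: "t \<in> {0..1}" for t
  proof -
    have zt: "?\<sigma> t \<in> cran c" using sub t by blast
    have dF: "((\<lambda>x. f (chart_inv c x)) has_derivative df c f (?\<gamma> t)) (at (?\<sigma> t))"
      by (rule df_has_derivative[OF c smooth_f[OF c] zt])
    have d\<sigma>: "(?\<sigma> has_derivative (\<lambda>h. h *\<^sub>R (y - x))) (at t)" by (auto intro!: derivative_eq_intros)
    have "((\<lambda>s. f (?\<gamma> s)) has_derivative (\<lambda>h. df c f (?\<gamma> t) (h *\<^sub>R (y - x)))) (at t)"
      by (rule has_derivative_compose[OF d\<sigma> dF])
    moreover have "linear (df c f (?\<gamma> t))"
      by (rule df_facts) (use chart_inv_in[OF c zt] c in \<open>simp add: charts_at_def\<close>)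
    ultimately have "((\<lambda>s. f (?\<gamma> s)) has_vector_derivative df c f (?\<gamma> t) (y - x)) (at t)"
      by (simp add: has_vector_derivative_def linear_cmul)
    then have "vector_derivative (\<lambda>s. f (?\<gamma> s)) (at t) = df c f (?\<gamma> t) (y - x)" by (rule vector_derivative_at)
    then show ?thesis using C[OF inB[OF t]] by simp
  qed
  have "integral {0..1} (speed N f ?\<gamma>) \<le> C"
  proof -
    have "speed N f ?\<gamma> integrable_on {0..1}" using pws_length(1)[OF p] by simp
    have "integral {0..1} (\<lambda>t. norm (vector_derivative (\<lambda>s. f (?\<gamma> s)) (at t))) \<le> C"
    proof (cases "(\<lambda>t. norm (vector_derivative (\<lambda>s. f (?\<gamma> s)) (at t))) integrable_on {0..1}")
      case True
      have "integral {0..1} (\<lambda>t. norm (vector_derivative (\<lambda>s. f (?\<gamma> s)) (at t))) \<le> integral {0..1::real} (\<lambda>t. C)"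
        by (rule integral_le[OF True]) (use bd in auto)
      then show ?thesis by simp
    next
      \<comment> \<open>Without integrability the integral is 0 by convention.\<close>
      case False
      have "0 \<le> C" using C[OF x] norm_ge_zero order_trans by blast
      then show ?thesis using False by (simp add: not_integrable_integral)
    qed
    then show ?thesis using l by (simp add: len_def)
  qed
  then have "len 0 1 ?\<gamma> \<le> C" by (simp add: len_def)
  moreover have "len 0 1 ?\<gamma> \<in> lens (chart_inv c x) (chart_inv c y)"
    unfolding lens_def using p by (intro CollectI exI[of _ ?\<gamma>]) simp
  ultimately show ?thesis by blast
qed

lemma df_continuous:
  assumes c: "c \<in> atlas N" and sm: "smooth_on (cran c) (\<lambda>x. h (chart_inv c x))"
  shows "continuous_on (cran c) (\<lambda>x. df c h (chart_inv c x) u)"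
proof -
  have "continuous_on (cran c) (\<lambda>x. frechet_derivative (\<lambda>x. h (chart_inv c x)) (at x) u)"
    by (rule smooth_on_continuous[OF smooth_on_frechet[OF sm]])
  moreover have "df c h (chart_inv c x) u = frechet_derivative (\<lambda>x. h (chart_inv c x)) (at x) u" if "x \<in> cran c" for x
    using c that by (simp add: df_def o_def)
  ultimately show ?thesis by (simp cong: continuous_on_cong)
qed

lemma lens_local:
  assumes c: "c \<in> charts_at N q"
  shows "\<exists>C\<ge>0. \<exists>r>0. ball (snd c q) r \<subseteq> cran c \<and>
    (\<forall>x\<in>ball (snd c q) r. \<forall>y\<in>ball (snd c q) r. \<exists>l\<in>lens (chart_inv c x) (chart_inv c y). l \<le> C * norm (y - x))"
proof -
  have cA: "c \<in> atlas N" "q \<in> fst c" using c charts_atD by auto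
  let ?x = "snd c q" let ?F' = "\<lambda>x. df c f (chart_inv c x)"
  have x: "?x \<in> cran c" using cA by simp
  have ch: "c \<in> charts_at N (chart_inv c z)" if "z \<in> cran c" for z
    using chart_inv_in[OF cA(1) that] cA(1) by (simp add: charts_at_def)
  obtain r where r: "r > 0" "ball ?x r \<subseteq> cran c" "\<forall>z\<in>ball ?x r. \<forall>u. norm (?F' z u - ?F' ?x u) \<le> 1 * norm u"
    using deriv_close[OF ran_open[OF cA(1)] x df_continuous[OF cA(1) smooth_f[OF cA(1)]] df_facts(1)[OF ch] zero_less_one] by blast
  obtain C where C: "C > 0" "\<And>u. norm (?F' ?x u) \<le> C * norm u" using linear_bounded_pos[OF df_facts(1)[OF ch[OF x]]] by blast
  have "\<exists>l\<in>lens (chart_inv c y) (chart_inv c z). l \<le> (C + 1) * norm (z - y)" if yz: "y \<in> ball ?x r" "z \<in> ball ?x r" for y z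
  proof (rule lens_segment[OF cA(1) convex_ball r(2) yz])
    fix w assume w: "w \<in> ball ?x r"
    have "norm (?F' w (z - y)) \<le> norm (?F' w (z - y) - ?F' ?x (z - y)) + norm (?F' ?x (z - y))" by (metis diff_add_cancel norm_triangle_ineq)
    also have "\<dots> \<le> 1 * norm (z - y) + C * norm (z - y)" using r(3) w C(2) by (intro add_mono) auto
    finally show "norm (?F' w (z - y)) \<le> (C + 1) * norm (z - y)" by (simp add: algebra_simps)
  qed
  then show ?thesis using r(1,2) C(1) by (intro exI[of _ "C + 1"] conjI exI[of _ r]) auto
qed

text \<open>The points that can be joined to \<open>p\<close> form a set that is open and closed.
  This ensures that \<open>induced_dist\<close> never takes the infimum of the empty set.\<close>

lemma lens_nonempty:
  assumes p: "p \<in> points N" and q: "q \<in> points N" shows "lens p q \<noteq> {}"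
proof -
  have nbd: "\<exists>V. openin (mtop N) V \<and> q \<in> V \<and> (\<forall>y\<in>V. lens q y \<noteq> {} \<and> lens y q \<noteq> {})" if qN: "q \<in> points N" for q
  proof -
    obtain c where c: "c \<in> charts_at N q" using covered[OF qN] by blast
    then have cA: "c \<in> atlas N" "q \<in> fst c" using charts_atD by auto
    obtain C r where r: "r > 0" "ball (snd c q) r \<subseteq> cran c"
      "\<forall>x\<in>ball (snd c q) r. \<forall>y\<in>ball (snd c q) r. \<exists>l\<in>lens (chart_inv c x) (chart_inv c y). l \<le> C * norm (y - x)"
      using lens_local[OF c] by blast
    have "openin (mtop N) (chart_inv c ` ball (snd c q) r)" by (rule open_chart_inv[OF cA(1) open_ball r(2)])
    moreover have "q \<in> chart_inv c ` ball (snd c q) r" by (rule image_eqI[of _ _ "snd c q"]) (use cA r(1) in auto)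
    moreover have "lens q y \<noteq> {} \<and> lens y q \<noteq> {}" if y: "y \<in> chart_inv c ` ball (snd c q) r" for y
    proof -
      obtain z where z: "z \<in> ball (snd c q) r" "y = chart_inv c z" using y by blast
      have "\<exists>l. l \<in> lens (chart_inv c (snd c q)) (chart_inv c z)" using r(1,3) z(1) centre_in_ball by blast
      then obtain l where "l \<in> lens q y" using z(2) cA by auto
      with lens_sym[OF this] show ?thesis by blast
    qed
    ultimately show ?thesis by blast
  qed
  have tr: "lens x z \<noteq> {}" if "lens x y \<noteq> {}" "lens y z \<noteq> {}" for x y z using lens_trans that by blast
  let ?A = "{q \<in> points N. lens p q \<noteq> {}}"
  have "openin (mtop N) ?A"
  proof (subst openin_subopen, rule ballI)
    fix q assume q: "q \<in> ?A"
    then obtain V where V: "openin (mtop N) V" "q \<in> V" "\<forall>y\<in>V. lens q y \<noteq> {} \<and> lens y q \<noteq> {}" using nbd by blast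
    have "V \<subseteq> ?A" using q V(3) tr openin_subset[OF V(1)] by blast
    then show "\<exists>T. openin (mtop N) T \<and> q \<in> T \<and> T \<subseteq> ?A" using V by blast
  qed
  moreover have "openin (mtop N) (points N - ?A)"
  proof (subst openin_subopen, rule ballI)
    fix q assume q: "q \<in> points N - ?A"
    then obtain V where V: "openin (mtop N) V" "q \<in> V" "\<forall>y\<in>V. lens q y \<noteq> {} \<and> lens y q \<noteq> {}" using nbd by blast
    have "V \<subseteq> points N - ?A" using q V(3) tr openin_subset[OF V(1)] by blast
    then show "\<exists>T. openin (mtop N) T \<and> q \<in> T \<and> T \<subseteq> points N - ?A" using V by blast
  qed
  ultimately have "?A = {} \<or> ?A = points N"
    using connected_N unfolding connected_space_clopen_in closedin_def by blast
  moreover have "p \<in> ?A" using nbd[OF p] p by blast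
  ultimately show ?thesis using q by blast
qed

lemma D_le: "p \<in> points N \<Longrightarrow> q \<in> points N \<Longrightarrow> l \<in> lens p q \<Longrightarrow> D p q \<le> l"
  unfolding D_eq by (rule cInf_lower) (auto intro: bdd_belowI lens_nonneg)

lemma D_ge: "p \<in> points N \<Longrightarrow> q \<in> points N \<Longrightarrow> (\<And>l. l \<in> lens p q \<Longrightarrow> \<rho> \<le> l) \<Longrightarrow> \<rho> \<le> D p q"
  unfolding D_eq by (rule cInf_greatest[OF lens_nonempty])

text \<open>A path that leaves a small coordinate ball at \<open>q\<close> passes its boundary.
  There \<open>f\<close> is at distance at least b r / 2 from \<open>f q\<close>, since the
  derivative of \<open>f\<close> at \<open>q\<close> is injective, and a path is at least as long as
  its chord in the ambient space. So small metric balls lie in the given neighbourhood.\<close>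

lemma exit_bound:
  assumes U: "openin (mtop N) U" "q \<in> U"
  shows "\<exists>\<rho>>0. \<forall>p\<in>points N. D q p < \<rho> \<longrightarrow> p \<in> U"
proof -
  have qN: "q \<in> points N" using openin_subset[OF U(1)] U(2) by blast
  obtain c where c: "c \<in> charts_at N q" using covered[OF qN] by blast
  then have cA: "c \<in> atlas N" "q \<in> fst c" using charts_atD by auto
  let ?x = "snd c q" let ?F = "\<lambda>x. f (chart_inv c x)" let ?O = "snd c ` (U \<inter> fst c)"
  have O: "open ?O" "?x \<in> ?O" using open_image[OF cA(1) U(1)] U(2) cA by auto
  have x: "?x \<in> cran c" using cA by simp
  obtain b where b: "b > 0" "\<And>u. b * norm u \<le> norm (df c f q u)"
    using linear_inj_bounded_below_pos[OF df_facts(1,2)[OF c]] by metis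
  have dF: "(?F has_derivative df c f q) (at ?x)" using df_has_derivative[OF cA(1) smooth_f[OF cA(1)] x] cA by simp
  obtain d where d: "d > 0" "\<And>y. norm (y - ?x) < d \<Longrightarrow> norm (?F y - ?F ?x - df c f q (y - ?x)) \<le> b / 2 * norm (y - ?x)"
    using dF b(1) unfolding has_derivative_at_alt by (metis half_gt_zero)
  obtain e where e: "e > 0" "cball ?x e \<subseteq> ?O" using O open_contains_cball by blast
  define r where "r = min e (d / 2)"
  have r: "r > 0" "r < d" "cball ?x r \<subseteq> ?O" using d e by (auto simp: r_def)
  have rc: "cball ?x r \<subseteq> cran c" using r(3) by blast
  let ?V = "chart_inv c ` ball ?x r" let ?W = "chart_inv c ` cball ?x r"
  have WU: "?W \<subseteq> U" using r(3) cA(1) by auto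
  have Vo: "openin (mtop N) ?V" by (rule open_chart_inv[OF cA(1) open_ball]) (use rc in auto)
  have "compactin (mtop N) ?W"
    by (rule image_compactin[OF _ cont_chart_inv[OF cA(1)]]) (use rc in \<open>auto simp: compactin_subtopology\<close>)
  then have Wc: "closedin (mtop N) ?W" using haus compactin_imp_closedin by blast
  have qV: "q \<in> ?V" by (rule image_eqI[of _ _ ?x]) (use cA r(1) in auto)
  have far: "b / 2 * r \<le> norm (f p - f q)" if p: "p \<in> ?W" "p \<notin> ?V" for p
  proof -
    obtain y where y: "y \<in> cball ?x r" "p = chart_inv c y" using p(1) by blast
    then have "y \<notin> ball ?x r" using p(2) by blast
    then have ny: "norm (y - ?x) = r" using y(1) by (simp add: dist_norm norm_minus_commute)
    have "b * r \<le> norm (df c f q (y - ?x))" using b(2)[of "y - ?x"] ny by simp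
    also have "\<dots> \<le> norm (?F y - ?F ?x) + norm (?F y - ?F ?x - df c f q (y - ?x))"
      using norm_triangle_ineq4[of "?F y - ?F ?x" "?F y - ?F ?x - df c f q (y - ?x)"] by simp
    also have "\<dots> \<le> norm (?F y - ?F ?x) + b / 2 * r" using d(2)[of y] ny r(2) by simp
    finally show ?thesis using y(2) cA by simp
  qed
  have "b / 2 * r \<le> l" if p: "p \<in> points N" "p \<notin> ?W" and l: "l \<in> lens q p" for p l
  proof -
    obtain \<gamma> where \<gamma>: "pws 0 1 \<gamma>" "\<gamma> 0 = q" "\<gamma> 1 = p" "l = len 0 1 \<gamma>" using l by (auto simp: lens_def)
    have ct: "continuous_map (top_of_set {0..1}) (mtop N) \<gamma>" using \<gamma>(1) by (simp add: pws_def)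
    have "\<exists>t\<in>{0..1}. \<gamma> t \<in> ?W \<and> \<gamma> t \<notin> ?V"
    proof (rule ccontr)
      assume "\<not> (\<exists>t\<in>{0..1}. \<gamma> t \<in> ?W \<and> \<gamma> t \<notin> ?V)"
      then have eq: "{t \<in> {0..1}. \<gamma> t \<in> ?V} = {t \<in> {0..1}. \<gamma> t \<in> ?W}" using ball_subset_cball by blast
      have o: "openin (top_of_set {0..1}) {t \<in> {0..1}. \<gamma> t \<in> ?V}" using openin_continuous_map_preimage[OF ct Vo] by simp
      have cl: "closedin (top_of_set {0..1}) {t \<in> {0..1}. \<gamma> t \<in> ?V}"
        unfolding eq using closedin_continuous_map_preimage[OF ct Wc] by simp
      have "connected {0..1::real}" by simp
      then have "{t \<in> {0..1}. \<gamma> t \<in> ?V} = {} \<or> {t \<in> {0..1}. \<gamma> t \<in> ?V} = {0..1}"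
        using o cl unfolding connected_clopen by blast
      moreover have "(0::real) \<in> {t \<in> {0..1}. \<gamma> t \<in> ?V}" using \<gamma>(2) qV by simp
      moreover have "(1::real) \<notin> {t \<in> {0..1}. \<gamma> t \<in> ?V}" using \<gamma>(3) p(2) ball_subset_cball by blast
      moreover have "(1::real) \<in> {0..1}" by simp
      ultimately show False by blast
    qed
    then obtain t where t: "0 \<le> t" "t \<le> 1" "\<gamma> t \<in> ?W" "\<gamma> t \<notin> ?V" by auto
    have t0: "0 < t" using t \<gamma>(2) qV by (metis less_eq_real_def)
    have "pws 0 t \<gamma>" by (rule pws_sub[OF \<gamma>(1)]) (use t in auto)
    from pws_length[OF this t0] have i: "speed N f \<gamma> integrable_on {0..t}" and n: "norm (f (\<gamma> t) - f q) \<le> len 0 t \<gamma>" using \<gamma>(2) by auto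
    have "len 0 t \<gamma> \<le> len 0 1 \<gamma>"
      unfolding len_def by (rule integral_subset_le) (use i t pws_length(1)[OF \<gamma>(1)] speed_nonneg in auto)
    then show ?thesis using n far[OF t(3,4)] \<gamma>(4) by simp
  qed
  then have "b / 2 * r \<le> D q p" if "p \<in> points N" "p \<notin> ?W" for p using D_ge[OF qN that(1)] that by blast
  then have "\<forall>p\<in>points N. D q p < b / 2 * r \<longrightarrow> p \<in> U" using WU by force
  moreover have "b / 2 * r > 0" using b(1) r(1) by simp
  ultimately show ?thesis by blast
qed

lemma D_nonneg: "0 \<le> D p q"
proof (cases "p \<in> points N \<and> q \<in> points N")
  case True then show ?thesis using D_ge[of p q 0] lens_nonneg by blast
qed (auto simp: induced_dist_def)

lemma D_sym: "D p q = D q p"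
proof -
  have "lens p q = lens q p" using lens_sym by blast
  then show ?thesis using D_eq[of p q] D_eq[of q p] by (auto simp: induced_dist_def)
qed

lemma D_local:
  assumes c: "c \<in> charts_at N q"
  shows "\<exists>C\<ge>0. \<exists>r>0. ball (snd c q) r \<subseteq> cran c \<and>
    (\<forall>x\<in>ball (snd c q) r. D q (chart_inv c x) \<le> C * norm (x - snd c q))"
proof -
  have cA: "c \<in> atlas N" "q \<in> fst c" "q \<in> points N" using c charts_atD dom_sub by blast+
  obtain C r where r: "C \<ge> 0" "r > 0" "ball (snd c q) r \<subseteq> cran c"
      "\<forall>x\<in>ball (snd c q) r. \<forall>y\<in>ball (snd c q) r. \<exists>l\<in>lens (chart_inv c x) (chart_inv c y). l \<le> C * norm (y - x)"
    using lens_local[OF c] by blast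
  have "D q (chart_inv c x) \<le> C * norm (x - snd c q)" if x: "x \<in> ball (snd c q) r" for x
  proof -
    have "chart_inv c x \<in> points N" using chart_inv_points[OF cA(1)] x r(3) by blast
    moreover obtain l where "l \<in> lens (chart_inv c (snd c q)) (chart_inv c x)" "l \<le> C * norm (x - snd c q)"
      using r(2,4) x centre_in_ball by blast
    ultimately show ?thesis using D_le[OF cA(3), of "chart_inv c x" l] cA by simp
  qed
  then show ?thesis using r by blast
qed

lemma D_metric: "Metric_space (points N) D"
proof
  fix p q r
  show "0 \<le> D p q" by (rule D_nonneg)
  show "D p q = D q p" by (rule D_sym)
  show "D p q = 0 \<longleftrightarrow> p = q" if p: "p \<in> points N" and q: "q \<in> points N"
  proof
    assume 0: "D p q = 0"
    show "p = q"
    proof (rule ccontr)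
      assume ne: "p \<noteq> q"
      have "closedin (mtop N) {q}" using haus q by (simp add: Hausdorff_imp_t1_space closedin_t1_singleton)
      then have "openin (mtop N) (points N - {q})" by (simp add: openin_diff)
      then obtain \<rho> where "\<rho> > 0" "\<forall>y\<in>points N. D p y < \<rho> \<longrightarrow> y \<in> points N - {q}" using exit_bound[of _ p] p ne by blast
      then show False using 0 q by auto
    qed
  next
    assume e: "p = q"
    obtain c where c: "c \<in> charts_at N p" using covered[OF p] by blast
    then have cA: "c \<in> atlas N" "p \<in> fst c" using charts_atD by auto
    obtain C r where "r > 0" "\<forall>x\<in>ball (snd c p) r. D p (chart_inv c x) \<le> C * norm (x - snd c p)"
      using D_local[OF c] by blast
    then have "D p (chart_inv c (snd c p)) \<le> C * norm (snd c p - snd c p)" using centre_in_ball by blast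
    then show "D p q = 0" using e cA D_nonneg[of p p] by simp
  qed
  show "D p r \<le> D p q + D q r" if p: "p \<in> points N" and q: "q \<in> points N" and r: "r \<in> points N"
  proof -
    have 1: "D p r - l' \<le> D p q" if l': "l' \<in> lens q r" for l'
    proof (rule D_ge[OF p q])
      fix l assume "l \<in> lens p q"
      then show "D p r - l' \<le> l" using D_le[OF p r lens_trans[OF _ l']] by fastforce
    qed
    have "D p r - D p q \<le> D q r"
    proof (rule D_ge[OF q r])
      fix l' assume "l' \<in> lens q r"
      then show "D p r - D p q \<le> l'" using 1 by fastforce
    qed
    then show ?thesis by simp
  qed
qed

sublocale MS: Metric_space "points N" D by (rule D_metric)

text \<open>The metric topology is that of the manifold, by \<open>exit_bound\<close> in one
  direction and \<open>D_local\<close> in the other. This brings closed manifolds under the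
  completeness assumption of the general argument.\<close>

lemma compact_complete:
  assumes "compact_space (mtop N)" shows "complete_induced N f"
proof -
  have "MS.mtopology = mtop N"
  proof (rule topology_eq[THEN iffD2], rule allI, rule iffI)
    fix U assume U: "openin MS.mtopology U"
    show "openin (mtop N) U"
    proof (subst openin_subopen, rule ballI)
      fix q assume q: "q \<in> U"
      then have qN: "q \<in> points N" using U by (auto simp: MS.openin_mtopology)
      obtain \<epsilon> where \<epsilon>: "\<epsilon> > 0" "MS.mball q \<epsilon> \<subseteq> U" using U q by (auto simp: MS.openin_mtopology)
      obtain c where c: "c \<in> charts_at N q" using covered[OF qN] by blast
      then have cA: "c \<in> atlas N" "q \<in> fst c" using charts_atD by auto
      obtain C r where r: "C \<ge> 0" "r > 0" "ball (snd c q) r \<subseteq> cran c" "\<forall>x\<in>ball (snd c q) r. D q (chart_inv c x) \<le> C * norm (x - snd c q)"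
        using D_local[OF c] by blast
      define s where "s = min r (\<epsilon> / (C + 1))"
      have s: "s > 0" using r \<epsilon> by (simp add: s_def)
      have sr: "ball (snd c q) s \<subseteq> ball (snd c q) r" by (rule subset_ball) (simp add: s_def)
      have "chart_inv c ` ball (snd c q) s \<subseteq> U"
      proof (rule image_subsetI)
        fix x assume x: "x \<in> ball (snd c q) s"
        have nx: "norm (x - snd c q) < s" using x by (simp add: dist_norm norm_minus_commute)
        have "D q (chart_inv c x) \<le> C * norm (x - snd c q)" using r(4) x sr by blast
        also have "\<dots> \<le> C * (\<epsilon> / (C + 1))" using nx r(1) by (intro mult_left_mono) (auto simp: s_def)
        also have "\<dots> < \<epsilon>" using \<epsilon>(1) r(1) by (simp add: field_simps)
        finally have "D q (chart_inv c x) < \<epsilon>" .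
        moreover have "chart_inv c x \<in> points N" by (rule chart_inv_points[OF cA(1)]) (use x sr r(3) in blast)
        ultimately have "chart_inv c x \<in> MS.mball q \<epsilon>" using qN by (simp add: MS.in_mball)
        then show "chart_inv c x \<in> U" using \<epsilon>(2) by blast
      qed
      moreover have "openin (mtop N) (chart_inv c ` ball (snd c q) s)"
        by (rule open_chart_inv[OF cA(1) open_ball]) (use sr r(3) in blast)
      moreover have "q \<in> chart_inv c ` ball (snd c q) s" by (rule image_eqI[of _ _ "snd c q"]) (use cA s in auto)
      ultimately show "\<exists>T. openin (mtop N) T \<and> q \<in> T \<and> T \<subseteq> U" by blast
    qed
  next
    fix U assume U: "openin (mtop N) U"
    show "openin MS.mtopology U"
      unfolding MS.openin_mtopology
    proof (intro conjI allI impI)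
      show "U \<subseteq> points N" using openin_subset[OF U] .
      fix q assume "q \<in> U"
      from exit_bound[OF U this] obtain \<rho> where "\<rho> > 0" "\<forall>p\<in>points N. D q p < \<rho> \<longrightarrow> p \<in> U" by blast
      then show "\<exists>r>0. MS.mball q r \<subseteq> U" by (intro exI[of _ \<rho>]) (auto simp: MS.in_mball)
    qed
  qed
  then have "compact_space MS.mtopology" using assms by simp
  then show ?thesis unfolding complete_induced_def by (rule MS.compact_space_imp_mcomplete)
qed

text \<open>By bisection the local Lipschitz bound becomes a bound on all of [0, t), so the path is
  Cauchy at \<open>t\<close>. This will supply the axiom \<open>path_complete\<close>.\<close>

lemma path_limit:
  assumes comp: "complete_induced N f" and t: "0 < (t::real)" and K: "0 \<le> K"
    and pN: "\<And>s. s \<in> {0..<t} \<Longrightarrow> p s \<in> points N"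
    and loc: "\<And>s. s \<in> {0..<t} \<Longrightarrow> \<exists>\<epsilon>>0. \<forall>s'\<in>{0..<t}. \<bar>s' - s\<bar> < \<epsilon> \<longrightarrow> D (p s) (p s') \<le> K * \<bar>s - s'\<bar>"
  shows "\<exists>q. limitin (mtop N) p q (at_left t)"
proof -
  have lip': "D (p a) (p b) \<le> K * (b - a)" if ab: "0 \<le> a" "a \<le> b" "b < t" for a b
  proof -
    have "0 \<le> a \<and> b < t \<longrightarrow> D (p a) (p b) \<le> K * (b - a)"
    proof (rule Bolzano[OF ab(2)])
      fix x y z :: real assume h: "0 \<le> x \<and> y < t \<longrightarrow> D (p x) (p y) \<le> K * (y - x)" "0 \<le> y \<and> z < t \<longrightarrow> D (p y) (p z) \<le> K * (z - y)"
        and o: "x \<le> y" "y \<le> z"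
      show "0 \<le> x \<and> z < t \<longrightarrow> D (p x) (p z) \<le> K * (z - x)"
      proof
        assume xz: "0 \<le> x \<and> z < t"
        have "D (p x) (p z) \<le> D (p x) (p y) + D (p y) (p z)" by (rule MS.triangle) (use xz o pN in auto)
        then show "D (p x) (p z) \<le> K * (z - x)" using h xz o by (simp add: algebra_simps)
      qed
    next
      fix x assume x: "a \<le> x" "x \<le> b"
      have xt: "x \<in> {0..<t}" using x ab by auto
      obtain \<epsilon> where \<epsilon>: "\<epsilon> > 0" "\<forall>s'\<in>{0..<t}. \<bar>s' - x\<bar> < \<epsilon> \<longrightarrow> D (p x) (p s') \<le> K * \<bar>x - s'\<bar>" using loc[OF xt] by blast
      have "D (p y) (p z) \<le> K * (z - y)" if yz: "y \<le> x" "x \<le> z" "z - y < \<epsilon>" "0 \<le> y" "z < t" for y z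
      proof -
        have "D (p y) (p z) \<le> D (p y) (p x) + D (p x) (p z)" by (rule MS.triangle) (use yz pN in auto)
        moreover have "D (p x) (p y) \<le> K * \<bar>x - y\<bar>" "D (p x) (p z) \<le> K * \<bar>x - z\<bar>"
          using \<epsilon>(2)[rule_format, of y] \<epsilon>(2)[rule_format, of z] yz by (simp_all add: abs_if)
        ultimately show ?thesis using D_sym[of "p x" "p y"] yz by (simp add: algebra_simps)
      qed
      then show "\<exists>d>0. \<forall>y z. y \<le> x \<and> x \<le> z \<and> z - y < d \<longrightarrow> 0 \<le> y \<and> z < t \<longrightarrow> D (p y) (p z) \<le> K * (z - y)" using \<epsilon>(1) by blast
    qed
    then show ?thesis using ab by simp
  qed
  have lip: "D (p a) (p b) \<le> K * \<bar>a - b\<bar>" if "a \<in> {0..<t}" "b \<in> {0..<t}" for a b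
    using lip'[of a b] lip'[of b a] that D_sym[of "p a" "p b"] by (cases "a \<le> b") auto
  define u where "u n = t - t / (real n + 1)" for n :: nat
  have u: "u n \<in> {0..<t}" for n using t by (auto simp: u_def field_simps)
  have ut: "u \<longlonglongrightarrow> t"
  proof -
    have "(\<lambda>n. t - t * (1 / real (Suc n))) \<longlonglongrightarrow> t - t * 0" by (intro tendsto_intros LIMSEQ_inverse_real_of_nat[unfolded inverse_eq_divide])
    then show ?thesis by (simp add: u_def[abs_def] add.commute)
  qed
  have "MS.MCauchy (\<lambda>n. p (u n))"
    unfolding MS.MCauchy_def
  proof (intro conjI allI impI)
    show "range (\<lambda>n. p (u n)) \<subseteq> points N" using u pN by blast
    fix \<epsilon> :: real assume \<epsilon>: "\<epsilon> > 0"
    have "Cauchy u" using ut LIMSEQ_imp_Cauchy by blast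
    moreover have "\<epsilon> / (K + 1) > 0" using \<epsilon> K by simp
    ultimately obtain M where M: "\<And>m n. m \<ge> M \<Longrightarrow> n \<ge> M \<Longrightarrow> \<bar>u m - u n\<bar> < \<epsilon> / (K + 1)" unfolding Cauchy_def dist_real_def by blast
    have "D (p (u m)) (p (u n)) < \<epsilon>" if "M \<le> m" "M \<le> n" for m n
    proof -
      have "D (p (u m)) (p (u n)) \<le> K * \<bar>u m - u n\<bar>" by (rule lip[OF u u])
      also have "\<dots> \<le> K * (\<epsilon> / (K + 1))" using M[OF that] K by (intro mult_left_mono) auto
      also have "\<dots> < \<epsilon>" using \<epsilon> K by (simp add: field_simps)
      finally show ?thesis .
    qed
    then show "\<exists>M. \<forall>m n. M \<le> m \<longrightarrow> M \<le> n \<longrightarrow> D (p (u m)) (p (u n)) < \<epsilon>" by blast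
  qed
  then obtain q where q: "limitin MS.mtopology (\<lambda>n. p (u n)) q sequentially"
    using comp unfolding complete_induced_def MS.mcomplete_def by blast
  then have qN: "q \<in> points N" and lim: "\<And>\<epsilon>. \<epsilon> > 0 \<Longrightarrow> \<exists>M. \<forall>n\<ge>M. p (u n) \<in> points N \<and> D (p (u n)) q < \<epsilon>"
    by (auto simp: MS.limit_metric_sequentially)
  have "limitin (mtop N) p q (at_left t)"
    unfolding limitin_def
  proof (intro conjI allI impI)
    show "q \<in> points N" by (rule qN)
    fix U assume "openin (mtop N) U \<and> q \<in> U"
    then obtain \<rho> where \<rho>: "\<rho> > 0" "\<forall>p\<in>points N. D q p < \<rho> \<longrightarrow> p \<in> U" using exit_bound by blast
    \<comment> \<open>Points within \<delta> of \<open>t\<close> are at most 2 \<delta> apart, so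
      the path moves by at most \<rho> / 2 between them; the other half is left for the distance of
      the sequence to \<open>q\<close>.\<close>
    define \<delta> where "\<delta> = \<rho> / (4 * (K + 1))"
    have \<delta>: "\<delta> > 0" "K * (2 * \<delta>) < \<rho> / 2 + 0 * K \<or> K * (2 * \<delta>) \<le> \<rho> / 2" using \<rho> K by (auto simp: \<delta>_def field_simps)
    obtain M where M: "\<forall>n\<ge>M. p (u n) \<in> points N \<and> D (p (u n)) q < \<rho> / 2" using lim[of "\<rho> / 2"] \<rho>(1) by auto
    have "\<forall>\<^sub>F n in sequentially. \<bar>u n - t\<bar> < \<delta>" using tendstoD[OF ut \<delta>(1)] by (simp add: dist_real_def)
    then obtain n where n: "n \<ge> M" "\<bar>u n - t\<bar> < \<delta>"
      using eventually_happens'[OF sequentially_bot eventually_conj[OF _ eventually_ge_at_top[of M]]] by blast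
    have "p s \<in> U" if s: "s \<in> {max 0 (t - \<delta>)<..<t}" for s
    proof -
      have sI: "s \<in> {0..<t}" using s by auto
      have "D q (p s) \<le> D q (p (u n)) + D (p (u n)) (p s)" by (rule MS.triangle) (use qN pN u sI in auto)
      moreover have "D (p (u n)) (p s) \<le> K * \<bar>u n - s\<bar>" by (rule lip[OF u sI])
      moreover have "K * \<bar>u n - s\<bar> \<le> K * (2 * \<delta>)" using n(2) s K by (intro mult_left_mono) auto
      moreover have "D q (p (u n)) < \<rho> / 2" using M n(1) D_sym[of q "p (u n)"] by simp
      ultimately have "D q (p s) < \<rho>" using \<delta>(2) by linarith
      then show ?thesis using \<rho>(2) pN[OF sI] by blast
    qed
    moreover have "\<forall>\<^sub>F s in at_left t. s \<in> {max 0 (t - \<delta>)<..<t}" by (rule eventually_at_left_real) (use t \<delta>(1) in auto)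
    ultimately show "\<forall>\<^sub>F s in at_left t. p s \<in> U" by (auto elim: eventually_mono)
  qed
  then show ?thesis by blast
qed

end

section \<open>The parallel pair\<close>

lemma (in smooth_mfd) continuous_map_charts:
  fixes h :: "'p \<Rightarrow> 'b::topological_space"
  assumes "\<And>c. c \<in> atlas M \<Longrightarrow> continuous_on (cran c) (\<lambda>x. h (chart_inv c x))"
  shows "continuous_map (mtop M) euclidean h"
  unfolding continuous_map_def
proof (intro conjI allI impI)
  fix U :: "'b set" assume U: "openin euclidean U"
  show "openin (mtop M) {p \<in> points M. h p \<in> U}"
  proof (subst openin_subopen, rule ballI)
    fix p assume p: "p \<in> {p \<in> points M. h p \<in> U}"
    then obtain c where "c \<in> charts_at M p" using covered by blast
    then have c: "c \<in> atlas M" "p \<in> fst c" using charts_atD by auto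
    let ?W = "cran c \<inter> (\<lambda>x. h (chart_inv c x)) -` U"
    have "open ?W" by (rule continuous_open_preimage[OF assms[OF c(1)] ran_open[OF c(1)]]) (use U in simp)
    then have "openin (mtop M) (chart_inv c ` ?W)" by (rule open_chart_inv[OF c(1)]) blast
    moreover have "p \<in> chart_inv c ` ?W" by (rule image_eqI[of _ _ "snd c p"]) (use c p in auto)
    moreover have "chart_inv c ` ?W \<subseteq> {p \<in> points M. h p \<in> U}" using chart_inv_points[OF c(1)] by auto
    ultimately show "\<exists>T. openin (mtop M) T \<and> p \<in> T \<and> T \<subseteq> {p \<in> points M. h p \<in> U}" by blast
  qed
qed simp

text \<open>The hypothesis \<open>radii\<close> says that every principal radius lies in (a, a +
  pi/2) modulo pi, with a uniform margin. The function sin (2 x) expresses this without choosing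
  representatives, as it has period pi.\<close>

locale pinched = hypersurface N f for N :: "('p, real ^ 'n::finite) manifold" and f +
  fixes a k :: real
  assumes k: "k > 0"
    and radii: "\<And>p c u \<rho>. c \<in> charts_at N p \<Longrightarrow> u \<noteq> 0 \<Longrightarrow> cos \<rho> *\<^sub>R df c f p u + sin \<rho> *\<^sub>R df c \<nu> p u = 0 \<Longrightarrow> k \<le> sin (2 * (\<rho> - a))"
    and card: "CARD('n) \<ge> 2" and comp: "complete_induced N f"
begin

definition g where "g p = cos a *\<^sub>R f p + sin a *\<^sub>R \<nu> p"
definition v where "v p = cos a *\<^sub>R \<nu> p - sin a *\<^sub>R f p"

definition dg where "dg c p u = cos a *\<^sub>R df c f p u + sin a *\<^sub>R df c \<nu> p u"
definition dv where "dv c p u = cos a *\<^sub>R df c \<nu> p u - sin a *\<^sub>R df c f p u"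

lemma smooth_g: "c \<in> atlas N \<Longrightarrow> smooth_on (cran c) (\<lambda>x. g (chart_inv c x))"
  unfolding g_def by (intro smooth_on_add smooth_on_scaleR smooth_on_const smooth_f smooth_nu ran_open)

lemma smooth_v: "c \<in> atlas N \<Longrightarrow> smooth_on (cran c) (\<lambda>x. v (chart_inv c x))"
  unfolding v_def by (intro smooth_on_diff smooth_on_scaleR smooth_on_const smooth_f smooth_nu ran_open)

lemma f_eq: "f p = cos a *\<^sub>R g p - sin a *\<^sub>R v p" and nu_eq: "\<nu> p = sin a *\<^sub>R g p + cos a *\<^sub>R v p"
proof -
  have s: "sin a * sin a + cos a * cos a = 1" using sin_cos_squared_add[of a] by (simp add: power2_eq_square)
  have "cos a *\<^sub>R g p - sin a *\<^sub>R v p = (sin a * sin a) *\<^sub>R f p + (cos a * cos a) *\<^sub>R f p"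
    by (simp add: g_def v_def algebra_simps)
  then show "f p = cos a *\<^sub>R g p - sin a *\<^sub>R v p" unfolding scaleR_add_left[symmetric] s by simp
  have "sin a *\<^sub>R g p + cos a *\<^sub>R v p = (sin a * sin a) *\<^sub>R \<nu> p + (cos a * cos a) *\<^sub>R \<nu> p"
    by (simp add: g_def v_def algebra_simps)
  then show "\<nu> p = sin a *\<^sub>R g p + cos a *\<^sub>R v p" unfolding scaleR_add_left[symmetric] s by simp
qed

lemma gv_unit:
  assumes p: "p \<in> points N"
  shows "norm (g p) = 1" "norm (v p) = 1" "g p \<bullet> v p = 0"
proof -
  have i: "f p \<bullet> f p = 1" "\<nu> p \<bullet> \<nu> p = 1" "\<nu> p \<bullet> f p = 0" "f p \<bullet> \<nu> p = 0"
    using norm_f[OF p] nu_facts(1,2)[OF p] by (simp_all add: norm_eq_1 inner_commute)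
  have s: "cos a * cos a + sin a * sin a = 1" using sin_cos_squared_add2[of a] by (simp add: power2_eq_square)
  show "norm (g p) = 1" "norm (v p) = 1" "g p \<bullet> v p = 0"
    using s by (simp_all add: norm_eq_1 g_def v_def inner_add_left inner_add_right inner_diff_left inner_diff_right i add.commute)
qed

lemma pair:
  assumes c: "c \<in> atlas N"
  shows "pair_chart (cran c) (\<lambda>x. g (chart_inv c x)) (\<lambda>x. v (chart_inv c x)) (\<lambda>x. dg c (chart_inv c x)) (\<lambda>x. dv c (chart_inv c x)) (k / 2)"
    "\<And>x u. x \<in> cran c \<Longrightarrow> df c f (chart_inv c x) u \<bullet> df c f (chart_inv c x) u \<le> dg c (chart_inv c x) u \<bullet> dg c (chart_inv c x) u + dv c (chart_inv c x) u \<bullet> dv c (chart_inv c x) u"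
proof -
  have ch: "c \<in> charts_at N (chart_inv c x)" "chart_inv c x \<in> points N" if "x \<in> cran c" for x
    using chart_inv_in[OF c that] chart_inv_points[OF c that] c by (simp_all add: charts_at_def)
  have s: "cos a * cos a + sin a * sin a = 1" using sin_cos_squared_add2[of a] by (simp add: power2_eq_square)
  have sq: "dg c p u \<bullet> dg c p u + dv c p u \<bullet> dv c p u = df c f p u \<bullet> df c f p u + df c \<nu> p u \<bullet> df c \<nu> p u" for p u
  proof -
    let ?X = "df c f p u \<bullet> df c f p u + df c \<nu> p u \<bullet> df c \<nu> p u"
    have "dg c p u \<bullet> dg c p u + dv c p u \<bullet> dv c p u = (cos a * cos a) * ?X + (sin a * sin a) * ?X"
      by (simp add: dg_def dv_def inner_add_left inner_add_right inner_diff_left inner_diff_right algebra_simps)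
    then show ?thesis unfolding distrib_right[symmetric] s by simp
  qed
  show "df c f (chart_inv c x) u \<bullet> df c f (chart_inv c x) u \<le> dg c (chart_inv c x) u \<bullet> dg c (chart_inv c x) u + dv c (chart_inv c x) u \<bullet> dv c (chart_inv c x) u"
    if "x \<in> cran c" for x u unfolding sq by simp
  show "pair_chart (cran c) (\<lambda>x. g (chart_inv c x)) (\<lambda>x. v (chart_inv c x)) (\<lambda>x. dg c (chart_inv c x)) (\<lambda>x. dv c (chart_inv c x)) (k / 2)"
  proof
    show "open (cran c)" by (rule ran_open[OF c])
    fix x assume x: "x \<in> cran c"
    let ?p = "chart_inv c x"
    note F = df_has_derivative[OF c smooth_f[OF c] x] and M = df_has_derivative[OF c smooth_nu[OF c] x]
    show "((\<lambda>x. g (chart_inv c x)) has_derivative dg c ?p) (at x)"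
      unfolding g_def dg_def[abs_def] by (intro has_derivative_add has_derivative_scaleR_right F M)
    show "((\<lambda>x. v (chart_inv c x)) has_derivative dv c ?p) (at x)"
      unfolding v_def dv_def[abs_def] by (intro has_derivative_diff has_derivative_scaleR_right F M)
    show "norm (g ?p) = 1" "norm (v ?p) = 1" "g ?p \<bullet> v ?p = 0" using gv_unit[OF ch(2)[OF x]] .
    note D = df_facts[OF ch(1)[OF x]] and E = dnu_facts[OF ch(1)[OF x]] and nu = nu_facts(3)[OF ch(2)[OF x] ch(1)[OF x]]
    show "dg c ?p u \<bullet> v ?p = 0" for u
      using D(4)[of u] E(2,3)[of u] nu[of u]
      by (simp add: dg_def v_def inner_add_left inner_add_right inner_diff_left inner_diff_right inner_commute)
    have lin: "linear (dg c ?p)"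
      unfolding dg_def[abs_def] by (intro linear_compose_add linear_compose_scale_right D E)
    have "u = 0" if "dg c ?p u = 0" for u
    proof (rule ccontr)
      assume "u \<noteq> 0"
      from radii[OF ch(1)[OF x] this, of a] that k show False by (simp add: dg_def)
    qed
    then show "inj (dg c ?p)" using linear_injective_0[OF lin] by blast
    show "k / 2 * (dg c ?p u \<bullet> dg c ?p u + dv c ?p u \<bullet> dv c ?p u) \<le> - (dg c ?p u \<bullet> dv c ?p u)" for u
      unfolding sq unfolding dg_def dv_def
      by (rule pinching[OF D(1,2) E(1) E(4,5)]) (use radii[OF ch(1)[OF x]] in blast)
  next
    show "continuous_on (cran c) (\<lambda>x. dg c (chart_inv c x) u)" for u
      unfolding dg_def by (intro continuous_intros df_continuous[OF c] smooth_f smooth_nu c)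
    show "continuous_on (cran c) (\<lambda>x. dv c (chart_inv c x) u)" for u
      unfolding dv_def by (intro continuous_intros df_continuous[OF c] smooth_f smooth_nu c)
    show "k / 2 > 0" using k by simp
    show "DIM(real ^ 'n option option) = DIM(real ^ 'n) + 2" by (rule dim_option)
  qed
qed

text \<open>By \<open>local_length\<close>, with constant k / 2, the coordinate segment to a nearby
  point is no longer than a fixed multiple of the displacement of \<open>v\<close>. So a path along
  which \<open>v\<close> is Lipschitz is locally Lipschitz for the induced distance.\<close>

lemma D_v:
  assumes q: "q \<in> points N"
  shows "\<exists>V. openin (mtop N) V \<and> q \<in> V \<and> (\<forall>p\<in>V. D q p \<le> 2 * (1 / (k / 2) + 1) * norm (v q - v p))"
proof -
  obtain c where c: "c \<in> charts_at N q" using covered[OF q] by blast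
  then have cA: "c \<in> atlas N" "q \<in> fst c" using charts_atD by auto
  let ?x = "snd c q"
  have x: "?x \<in> cran c" using cA by simp
  interpret pair_chart "cran c" "\<lambda>x. g (chart_inv c x)" "\<lambda>x. v (chart_inv c x)" "\<lambda>x. dg c (chart_inv c x)" "\<lambda>x. dv c (chart_inv c x)" "k / 2"
    by (rule pair[OF cA(1)])
  have lin: "linear (df c f (chart_inv c x))" if "x \<in> cran c" for x
    by (rule df_facts) (use chart_inv_in[OF cA(1) that] cA(1) in \<open>simp add: charts_at_def\<close>)
  obtain r where r: "r > 0" "ball ?x r \<subseteq> cran c"
    "\<forall>x\<in>ball ?x r. \<forall>y\<in>ball ?x r. \<forall>z\<in>ball ?x r. norm (df c f (chart_inv c z) (x - y)) \<le> 2 * (1 / (k / 2) + 1) * norm (v (chart_inv c x) - v (chart_inv c y))"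
    using local_length[OF x df_continuous[OF cA(1) smooth_f[OF cA(1)]] lin pair(2)[OF cA(1)]] by blast
  have "D q p \<le> 2 * (1 / (k / 2) + 1) * norm (v q - v p)" if p: "p \<in> chart_inv c ` ball ?x r" for p
  proof -
    obtain y where y: "y \<in> ball ?x r" "p = chart_inv c y" using p by blast
    have xb: "?x \<in> ball ?x r" using r(1) by simp
    have bd: "norm (df c f (chart_inv c z) (?x - y)) \<le> 2 * (1 / (k / 2) + 1) * norm (v p - v q)" if z: "z \<in> ball ?x r" for z
      using r(3)[rule_format, OF xb y(1) z] y(2) cA by (simp add: norm_minus_commute)
    obtain l where l: "l \<in> lens (chart_inv c y) (chart_inv c ?x)" "l \<le> 2 * (1 / (k / 2) + 1) * norm (v p - v q)"
      using lens_segment[OF cA(1) convex_ball r(2) y(1) xb bd] by blast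
    have pN: "p \<in> points N" using chart_inv_points[OF cA(1)] y r(2) by blast
    have "D p q \<le> l" by (rule D_le[OF pN q]) (use l(1) y(2) cA in simp)
    then show ?thesis using l(2) D_sym[of p q] by (simp add: norm_minus_commute)
  qed
  moreover have "openin (mtop N) (chart_inv c ` ball ?x r)" by (rule open_chart_inv[OF cA(1) open_ball r(2)])
  moreover have "q \<in> chart_inv c ` ball ?x r" by (rule image_eqI[of _ _ ?x]) (use cA r(1) in auto)
  ultimately show ?thesis by blast
qed

lemma convex_pair_gv: "convex_pair TYPE(real ^ 'n) (mtop N) g v"
proof
  show "Hausdorff_space (mtop N)" by (rule haus)
  show "connected_space (mtop N)" by (rule connected_N)
  show "\<exists>\<psi>::real ^ 'n \<Rightarrow> 'p. \<psi> 0 = p \<and> \<psi> ` cball 0 1 \<subseteq> U \<and> openin (mtop N) (\<psi> ` ball 0 1) \<and>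
         inj_on \<psi> (cball 0 1) \<and> continuous_map (top_of_set (cball 0 1)) (mtop N) \<psi>"
    if U: "openin (mtop N) U" and p: "p \<in> U" for p U
  proof -
    have pN: "p \<in> points N" using openin_subset[OF U] p by blast
    obtain c where c: "c \<in> charts_at N p" using covered[OF pN] by blast
    then have cA: "c \<in> atlas N" "p \<in> fst c" using charts_atD by auto
    let ?O = "snd c ` (U \<inter> fst c)"
    have O: "open ?O" "snd c p \<in> ?O" using open_image[OF cA(1) U] cA p by auto
    then obtain e where e: "e > 0" "cball (snd c p) e \<subseteq> ?O" using open_contains_cball by blast
    have sub: "cball (snd c p) e \<subseteq> cran c" using e(2) by blast
    let ?\<sigma> = "\<lambda>y. snd c p + e *\<^sub>R y" let ?\<psi> = "\<lambda>y. chart_inv c (?\<sigma> y)"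
    have in_cball: "?\<sigma> y \<in> cball (snd c p) e" if "y \<in> cball 0 1" for y
      using that e(1) by (simp add: dist_norm)
    have "?\<sigma> ` ball 0 1 = ball (snd c p) e"
      using e(1) ball_translation[of "snd c p" 0 e] ball_scale[of e "0 :: real ^ 'n" 1] by (simp add: image_image[symmetric])
    then have "openin (mtop N) (chart_inv c ` ?\<sigma> ` ball 0 1)"
      using open_chart_inv[OF cA(1) open_ball subset_trans[OF ball_subset_cball sub]] by simp
    then have o: "openin (mtop N) (?\<psi> ` ball 0 1)" by (simp add: image_image)
    have inj: "inj_on ?\<psi> (cball 0 1)"
    proof (rule inj_onI)
      fix y z assume y: "y \<in> cball 0 1" and z: "z \<in> cball 0 1" and eq: "?\<psi> y = ?\<psi> z"
      have "?\<sigma> y \<in> cran c" "?\<sigma> z \<in> cran c" using in_cball[OF y] in_cball[OF z] sub by blast+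
      then have "?\<sigma> y = ?\<sigma> z" using arg_cong[OF eq, of "snd c"] cA(1) by simp
      then show "y = z" using e(1) by simp
    qed
    have "continuous_map (top_of_set (cball 0 1)) (top_of_set (cran c)) ?\<sigma>"
      using in_cball sub by (auto intro!: continuous_intros)
    from continuous_map_compose[OF this cont_chart_inv[OF cA(1)]]
    have ct: "continuous_map (top_of_set (cball 0 1)) (mtop N) ?\<psi>" by (simp add: o_def)
    have "?\<psi> ` cball 0 1 \<subseteq> U"
    proof (rule image_subsetI)
      fix y :: "real ^ 'n" assume "y \<in> cball 0 1"
      then have "?\<sigma> y \<in> ?O" using in_cball e(2) by blast
      then obtain q where "?\<sigma> y = snd c q" "q \<in> U" "q \<in> fst c" by blast
      then show "?\<psi> y \<in> U" using cA(1) by simp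
    qed
    then show ?thesis using o inj ct cA by (intro exI[of _ ?\<psi>]) simp
  qed
  show "continuous_map (mtop N) euclidean g" "continuous_map (mtop N) euclidean v"
    by (rule continuous_map_charts, rule smooth_on_continuous, erule smooth_g smooth_v)+
  show "norm (g p) = 1" "norm (v p) = 1" "g p \<bullet> v p = 0" if "p \<in> points N" for p using gv_unit[OF that] .
  show "\<exists>V. openin (mtop N) V \<and> p \<in> V \<and> (\<forall>x\<in>V. \<forall>y\<in>V. x \<noteq> y \<longrightarrow> 0 < g x \<bullet> v y)" if p: "p \<in> points N" for p
  proof -
    obtain c where "c \<in> charts_at N p" using covered[OF p] by blast
    then have cA: "c \<in> atlas N" "p \<in> fst c" using charts_atD by auto
    have x: "snd c p \<in> cran c" using cA by simp
    obtain d where d: "d > 0" "ball (snd c p) d \<subseteq> cran c"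
      "\<forall>x\<in>ball (snd c p) d. \<forall>y\<in>ball (snd c p) d. x \<noteq> y \<longrightarrow> 0 < g (chart_inv c x) \<bullet> v (chart_inv c y)"
      using pair_chart.local_strict[OF pair(1)[OF cA(1)] x] by blast
    have "openin (mtop N) (chart_inv c ` ball (snd c p) d)" by (rule open_chart_inv[OF cA(1) open_ball d(2)])
    moreover have "p \<in> chart_inv c ` ball (snd c p) d" by (rule image_eqI[of _ _ "snd c p"]) (use cA d(1) in auto)
    moreover have "\<forall>x\<in>chart_inv c ` ball (snd c p) d. \<forall>y\<in>chart_inv c ` ball (snd c p) d. x \<noteq> y \<longrightarrow> 0 < g x \<bullet> v y"
      using d(3) by auto
    ultimately show ?thesis by blast
  qed
  have trans: "open (snd c ` (V \<inter> fst c)) \<and> snd c p \<in> snd c ` (V \<inter> fst c) \<and> (\<forall>y\<in>snd c ` (V \<inter> fst c). chart_inv c y \<in> V)"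
    if "openin (mtop N) V" "p \<in> V" "c \<in> atlas N" "p \<in> fst c" for V p c
    using open_image[OF that(3,1)] that by auto
  show "\<exists>c. w = c *\<^sub>R g p" if V: "openin (mtop N) V" "p \<in> V" and pos: "\<And>x. x \<in> V \<Longrightarrow> 0 \<le> w \<bullet> v x" and 0: "w \<bullet> v p = 0" for p w V
  proof -
    have pN: "p \<in> points N" using openin_subset[OF V(1)] V(2) by blast
    obtain c where "c \<in> charts_at N p" using covered[OF pN] by blast
    then have cA: "c \<in> atlas N" "p \<in> fst c" using charts_atD by auto
    note T = trans[OF V cA]
    have "\<exists>c'. w = c' *\<^sub>R g (chart_inv c (snd c p))"
      by (rule pair_chart.tangM[OF pair(1)[OF cA(1)], of _ "snd c ` (V \<inter> fst c)"]) (use T cA pos 0 in auto)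
    then show ?thesis using cA by simp
  qed
  show "\<exists>c. w = c *\<^sub>R v p" if V: "openin (mtop N) V" "p \<in> V" and pos: "\<And>x. x \<in> V \<Longrightarrow> 0 \<le> w \<bullet> g x" and 0: "w \<bullet> g p = 0" for p w V
  proof -
    have pN: "p \<in> points N" using openin_subset[OF V(1)] V(2) by blast
    obtain c where "c \<in> charts_at N p" using covered[OF pN] by blast
    then have cA: "c \<in> atlas N" "p \<in> fst c" using charts_atD by auto
    note T = trans[OF V cA]
    have "\<exists>c'. w = c' *\<^sub>R v (chart_inv c (snd c p))"
      by (rule pair_chart.tangF[OF pair(1)[OF cA(1)], of _ "snd c ` (V \<inter> fst c)"]) (use T cA pos 0 in auto)
    then show ?thesis using cA by simp
  qed
  show "\<exists>q. limitin (mtop N) p q (at_left t)"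
    if t: "0 < t" and ct: "continuous_map (top_of_set {0..<t}) (mtop N) p"
      and lip: "\<And>s s'. s \<in> {0..<t} \<Longrightarrow> s' \<in> {0..<t} \<Longrightarrow> norm (v (p s) - v (p s')) \<le> L * \<bar>s - s'\<bar>" for p t L
  proof -
    define C where "C = 2 * (1 / (k / 2) + 1)"
    have C: "C \<ge> 0" using k by (simp add: C_def)
    have pN: "p s \<in> points N" if "s \<in> {0..<t}" for s using ct that by (auto simp: continuous_map_def)
    show ?thesis
    proof (rule path_limit[OF comp t _ pN])
      show "0 \<le> C * \<bar>L\<bar>" using C by simp
      fix s assume s: "s \<in> {0..<t}"
      obtain V where V: "openin (mtop N) V" "p s \<in> V" "\<forall>q\<in>V. D (p s) q \<le> C * norm (v (p s) - v q)"
        using D_v[OF pN[OF s]] unfolding C_def by blast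
      have "openin (top_of_set {0..<t}) {s' \<in> {0..<t}. p s' \<in> V}" using openin_continuous_map_preimage[OF ct V(1)] by simp
      then obtain \<epsilon> where \<epsilon>: "\<epsilon> > 0" "ball s \<epsilon> \<inter> {0..<t} \<subseteq> {s' \<in> {0..<t}. p s' \<in> V}"
        using s V(2) unfolding openin_contains_ball by blast
      have "D (p s) (p s') \<le> C * \<bar>L\<bar> * \<bar>s - s'\<bar>" if s': "s' \<in> {0..<t}" "\<bar>s' - s\<bar> < \<epsilon>" for s'
      proof -
        have "s' \<in> ball s \<epsilon>" using s'(2) by (simp add: dist_real_def abs_minus_commute)
        then have "p s' \<in> V" using \<epsilon>(2) s'(1) by blast
        then have "D (p s) (p s') \<le> C * norm (v (p s) - v (p s'))" using V(3) by blast
        also have "\<dots> \<le> C * (L * \<bar>s - s'\<bar>)" by (rule mult_left_mono[OF lip[OF s s'(1)] C])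
        also have "\<dots> \<le> C * (\<bar>L\<bar> * \<bar>s - s'\<bar>)" by (intro mult_left_mono mult_right_mono C) auto
        finally show ?thesis by (simp add: mult.assoc)
      qed
      then show "\<exists>\<epsilon>>0. \<forall>s'\<in>{0..<t}. \<bar>s' - s\<bar> < \<epsilon> \<longrightarrow> D (p s) (p s') \<le> C * \<bar>L\<bar> * \<bar>s - s'\<bar>" using \<epsilon>(1) by blast
    qed
  qed
  show "2 \<le> DIM(real ^ 'n)" using card by simp
  show "DIM(real ^ 'n option option) = DIM(real ^ 'n) + 2" by (rule dim_option)
qed

sublocale CP: convex_pair "mtop N" "TYPE(real ^ 'n)" g v by (rule convex_pair_gv)

end

section \<open>The spherical image\<close>

context pinched begin

lemma convex_gv: "p \<in> points N \<Longrightarrow> q \<in> points N \<Longrightarrow> 0 \<le> g p \<bullet> v q"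
  using CP.global_convex by blast

lemma spherical_image:
  obtains b where "norm b = 1" "\<forall>q\<in>points N. g q \<bullet> b > 0" "inj_on (CP.hh b) (points N)"
    "CP.hh b ` points N = {z. norm z = 1 \<and> z \<bullet> b = 0}"
    "continuous_map (top_of_set {z. norm z = 1 \<and> z \<bullet> b = 0}) (mtop N) (inv_into (points N) (CP.hh b))"
proof (rule CP.sphere_structure[OF nonempty_N])
  fix b assume b: "norm b = 1" "\<And>q. q \<in> points N \<Longrightarrow> g q \<bullet> b > 0" "inj_on (CP.hh b) (points N)"
    "CP.hh b ` points N = {z. norm z = 1 \<and> z \<bullet> b = 0}"
    "continuous_map (top_of_set {z. norm z = 1 \<and> z \<bullet> b = 0}) (mtop N) (inv_into (points N) (CP.hh b))"
  have "\<forall>q\<in>points N. g q \<bullet> b > 0" using b(2) by blast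
  from that[OF b(1) this b(3-5)] show thesis .
qed

lemma compact_N: "compact_space (mtop N)"
  by (rule CP.sphere_structure[OF nonempty_N])

lemma inj_v: "inj_on v (points N)"
proof (rule inj_onI)
  fix p q assume pq: "p \<in> points N" "q \<in> points N" and "v p = v q"
  then have "CP.hh b p = CP.hh b q" for b by (simp add: CP.hh_def)
  moreover obtain b where "inj_on (CP.hh b) (points N)" by (rule spherical_image)
  ultimately show "p = q" using pq by (blast dest: inj_onD)
qed

lemma embedding_of_immersion:
  fixes h :: "'p \<Rightarrow> real ^ 'n option option"
  assumes "immersion N sphere_mfd h" "inj_on h (points N)"
  shows "embedding N sphere_mfd h"
proof -
  have "continuous_map (mtop N) (mtop sphere_mfd) h" using assms(1) by (simp add: immersion_def smooth_map_def)
  moreover have "Hausdorff_space (mtop sphere_mfd :: (real ^ 'n option option) topology)"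
    by (simp add: Hausdorff_space_subtopology)
  ultimately have "embedding_map (mtop N) (mtop sphere_mfd) h"
    by (rule continuous_imp_embedding_map[OF _ compact_N _ assms(2)])
  then show ?thesis using assms(1) by (simp add: embedding_def)
qed

text \<open>If the combinations agree at \<open>p\<close> and \<open>q\<close>, then \<delta> is at
  once a multiple of v p - v q and of g p - g q. Its squared norm is \<alpha> \<beta> times g p
  \<bullet> v q + g q \<bullet> v p, a negative times a nonnegative number.\<close>

lemma inj_combination:
  assumes \<alpha>\<beta>: "\<alpha> * \<beta> < 0"
  shows "inj_on (\<lambda>p. \<alpha> *\<^sub>R g p + \<beta> *\<^sub>R v p) (points N)"
proof (rule inj_onI)
  fix p q assume p: "p \<in> points N" and q: "q \<in> points N" and eq: "\<alpha> *\<^sub>R g p + \<beta> *\<^sub>R v p = \<alpha> *\<^sub>R g q + \<beta> *\<^sub>R v q"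
  define \<delta> where "\<delta> = \<beta> *\<^sub>R (v p - v q)"
  have \<delta>: "\<delta> = - \<alpha> *\<^sub>R (g p - g q)" using eq by (simp add: \<delta>_def algebra_simps)
  have "\<delta> \<bullet> \<delta> = (- \<alpha> *\<^sub>R (g p - g q)) \<bullet> (\<beta> *\<^sub>R (v p - v q))" using \<delta> \<delta>_def by metis
  also have "\<dots> = (\<alpha> * \<beta>) * (g p \<bullet> v q + g q \<bullet> v p)"
    using gv_unit(3)[OF p] gv_unit(3)[OF q] by (simp add: inner_diff_left inner_diff_right algebra_simps)
  also have "\<dots> \<le> 0" using \<alpha>\<beta> convex_gv[OF p q] convex_gv[OF q p] by (simp add: mult_nonpos_nonneg)
  finally have "\<delta> = 0" by (metis inner_eq_zero_iff inner_ge_zero order_antisym)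
  then have "v p = v q" using \<alpha>\<beta> by (auto simp: \<delta>_def)
  then show "p = q" using inj_v p q by (auto dest: inj_onD)
qed

lemma embedding_f:
  assumes "0 < a" "a < pi / 2" shows "embedding N sphere_mfd f"
proof (rule embedding_of_immersion[OF imm])
  have "cos a > 0" "sin a > 0" using assms by (auto intro: cos_gt_zero_pi sin_gt_zero)
  then have "inj_on (\<lambda>p. cos a *\<^sub>R g p + (- sin a) *\<^sub>R v p) (points N)" by (intro inj_combination) simp
  then show "inj_on f (points N)" using f_eq by (simp add: inj_on_def)
qed

lemma smooth_dual: "c \<in> atlas N \<Longrightarrow> smooth_on (cran c) (\<lambda>x. dual N f (chart_inv c x))"
  using smooth_on_cong[OF ran_open, of c "\<lambda>x. dual N f (chart_inv c x)" "\<lambda>x. \<nu> (chart_inv c x)"]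
    smooth_nu dual_eq chart_inv_points by simp

lemma embedding_dual:
  assumes "- (pi / 2) < a" "a < 0" shows "embedding N sphere_mfd (dual N f)"
proof (rule embedding_of_immersion)
  show "immersion N sphere_mfd (dual N f)"
    unfolding immersion_sphere_iff smooth_map_sphere_iff
  proof (intro conjI ballI allI)
    show "norm (dual N f p) = 1" if "p \<in> points N" for p using nu_facts(1)[OF that] dual_eq[OF that] by simp
    show "smooth_on (cran c) (\<lambda>x. dual N f (chart_inv c x))" if "c \<in> atlas N" for c by (rule smooth_dual[OF that])
    fix p c assume c: "c \<in> charts_at N p"
    have cA: "c \<in> atlas N" "p \<in> fst c" using c charts_atD by auto
    have x: "snd c p \<in> cran c" using cA by simp
    have "((\<lambda>x. \<nu> (chart_inv c x)) has_derivative df c \<nu> p) (at (snd c p))"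
      using df_has_derivative[OF cA(1) smooth_nu[OF cA(1)] x] cA by simp
    then have "((\<lambda>x. dual N f (chart_inv c x)) has_derivative df c \<nu> p) (at (snd c p))"
      by (rule has_derivative_transform_within_open[OF _ ran_open[OF cA(1)] x]) (use dual_eq chart_inv_points[OF cA(1)] in simp)
    from frechet_derivative_at[OF this] have e: "df c (dual N f) p = df c \<nu> p" by (simp add: df_def o_def)
    have "u = 0" if "df c \<nu> p u = 0" for u
    proof (rule ccontr)
      assume "u \<noteq> 0"
      \<comment> \<open>A vector in the kernel of the differential of \<nu> makes pi/2 a principal
        radius, but sin (2 (pi/2 - a)) = sin (2 a) is negative.\<close>
      moreover have "cos (pi / 2) *\<^sub>R df c f p u + sin (pi / 2) *\<^sub>R df c \<nu> p u = 0" using that by simp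
      ultimately have "k \<le> sin (2 * (pi / 2 - a))" using radii[OF c] by blast
      also have "\<dots> = sin (2 * a)" by (simp add: right_diff_distrib)
      also have "\<dots> < 0" unfolding sin_double
        using assms sin_less_zero[of a] cos_gt_zero_pi[of a] by (simp add: mult_neg_pos)
      finally show False using k by simp
    qed
    then show "inj (df c (dual N f) p)" unfolding e using linear_injective_0[OF dnu_facts(1)[OF c]] by blast
  qed
  have "cos a > 0" "sin a < 0" using assms by (auto intro: cos_gt_zero_pi sin_less_zero)
  then have "inj_on (\<lambda>p. sin a *\<^sub>R g p + cos a *\<^sub>R v p) (points N)" by (intro inj_combination) (simp add: mult_neg_pos)
  then show "inj_on (dual N f) (points N)" using nu_eq dual_eq by (simp add: inj_on_def)
qed

lemma diffeomorphic_sphere: "diffeomorphic N (sphere_mfd :: (real ^ 'n option, real ^ 'n) manifold)"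
proof -
  obtain b where b: "norm b = 1" "\<forall>q\<in>points N. g q \<bullet> b > 0" and inj: "inj_on (CP.hh b) (points N)"
    and im: "CP.hh b ` points N = {z. norm z = 1 \<and> z \<bullet> b = 0}"
    and ci: "continuous_map (top_of_set {z. norm z = 1 \<and> z \<bullet> b = 0}) (mtop N) (inv_into (points N) (CP.hh b))"
    by (rule spherical_image)
  have b0: "b \<noteq> 0" using b(1) by auto
  let ?B = "{z. b \<bullet> z = 0}"
  \<comment> \<open>The hyperplane orthogonal to \<open>b\<close> has the dimension of the model
    space of the sphere; \<iota> and \<kappa> identify the two isometrically.\<close>
  have "dim ?B = dim (UNIV :: (real ^ 'n option) set)" using dim_hyperplane[OF b0] by simp
  then obtain \<iota> :: "real ^ 'n option option \<Rightarrow> real ^ 'n option" and \<kappa> where lin: "linear \<iota>" "linear \<kappa>" and \<kappa>B: "\<kappa> ` UNIV = ?B"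
    and *: "\<forall>z\<in>?B. norm (\<iota> z) = norm z \<and> \<kappa> (\<iota> z) = z" "\<forall>y. norm (\<kappa> y) = norm y \<and> \<iota> (\<kappa> y) = y"
    by (rule isometries_subspaces[OF subspace_hyperplane subspace_UNIV]) blast
  have n\<iota>: "\<And>z. z \<in> ?B \<Longrightarrow> norm (\<iota> z) = norm z" and n\<kappa>: "\<And>y. norm (\<kappa> y) = norm y"
    and \<kappa>\<iota>: "\<And>z. z \<in> ?B \<Longrightarrow> \<kappa> (\<iota> z) = z" and \<iota>\<kappa>: "\<And>y. \<iota> (\<kappa> y) = y"
    using * by blast+
  have bl: "bounded_linear \<iota>" "bounded_linear \<kappa>" using lin linear_conv_bounded_linear by blast+
  define h where "h = CP.hh b"
  define H where "H p = \<iota> (h p)" for p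
  define G where "G y = inv_into (points N) h (\<kappa> y)" for y
  have nz: "pr b (v p) \<noteq> 0" if "p \<in> points N" for p
    by (rule CP.pr_v_nz) (use b that in \<open>auto simp: CP.Pos_def\<close>)
  have hB: "norm (h p) = 1" "b \<bullet> h p = 0" if "p \<in> points N" for p
    using im that by (auto simp: h_def inner_commute)
  have \<kappa>S: "\<kappa> y \<in> h ` points N" if "norm y = 1" for y
    using that n\<kappa>[of y] \<kappa>B im by (auto simp: h_def inner_commute)
  have GH: "G (H p) = p" if "p \<in> points N" for p
    using inj hB(2)[OF that] \<kappa>\<iota> that by (simp add: G_def H_def h_def)
  have hG: "h (G y) = \<kappa> y" if "norm y = 1" for y unfolding G_def by (rule f_inv_into_f[OF \<kappa>S[OF that]])
  then have HG: "H (G y) = y" if "norm y = 1" for y using that \<iota>\<kappa> by (simp add: H_def)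
  have GN: "G y \<in> points N" if "norm y = 1" for y unfolding G_def by (rule inv_into_into[OF \<kappa>S[OF that]])
  have nH: "norm (H p) = 1" if "p \<in> points N" for p using hB[OF that] n\<iota> by (simp add: H_def)
  have smh: "smooth_on (cran c) (\<lambda>x. h (chart_inv c x))" if c: "c \<in> atlas N" for c
    unfolding h_def CP.hh_def
    by (rule smooth_on_sgn[OF ran_open[OF c]])
      (use nz chart_inv_points[OF c] smooth_on_linear[OF ran_open[OF c] smooth_v[OF c] linear_pr[THEN linear_conv_bounded_linear[THEN iffD1]]] in auto)
  have smH: "smooth_on (cran c) (\<lambda>x. H (chart_inv c x))" if c: "c \<in> atlas N" for c
    unfolding H_def by (rule smooth_on_linear[OF ran_open[OF c] smh[OF c] bl(1)])
  have H: "smooth_map N sphere_mfd H" unfolding smooth_map_sphere_iff using nH smH by blast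
  \<comment> \<open>The derivative of \<open>h\<close> has trivial kernel: if \<open>h\<close> is
    stationary along \<open>u\<close>, the projection of \<open>v\<close> changes only along itself,
    so the derivative of \<open>v\<close> is a combination of \<open>v\<close> and \<open>b\<close>.
    Pairing it with \<open>g\<close> and then with \<open>v\<close> removes both terms.\<close>
  have dh0: "u = 0" if c: "c \<in> atlas N" and x: "x \<in> cran c" and dh: "((\<lambda>x. h (chart_inv c x)) has_derivative h') (at x)" and h0: "h' u = 0" for c x h' u
  proof -
    let ?p = "chart_inv c x"
    have pN: "?p \<in> points N" by (rule chart_inv_points[OF c x])
    let ?V = "\<lambda>x. pr b (v (chart_inv c x))" let ?h = "\<lambda>x. h (chart_inv c x)"
    interpret PC: pair_chart "cran c" "\<lambda>x. g (chart_inv c x)" "\<lambda>x. v (chart_inv c x)" "\<lambda>x. dg c (chart_inv c x)" "\<lambda>x. dv c (chart_inv c x)" "k / 2"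
      by (rule pair[OF c])
    have dV: "(?V has_derivative (\<lambda>u. pr b (dv c ?p u))) (at x)"
      by (rule bounded_linear.has_derivative[OF linear_pr[THEN linear_conv_bounded_linear[THEN iffD1]] PC.dM[OF x]])
    have nV: "?V y = norm (?V y) *\<^sub>R ?h y" for y
      by (cases "?V y = 0") (simp_all add: h_def CP.hh_def sgn_div_norm)
    \<comment> \<open>States that \<open>h\<close> is parallel to the projection of \<open>v\<close>
      without mentioning a norm. Its derivative at a stationary direction of \<open>h\<close> gives
      the parallelism of the derivative, with no need to differentiate the normalization.\<close>
    have sym: "(?h y \<bullet> w) * (?V y \<bullet> z) - (?h y \<bullet> z) * (?V y \<bullet> w) = 0" for y w z
      by (subst (1 2) nV) simp
    have key: "(?h x \<bullet> w) * (pr b (dv c ?p u) \<bullet> z) = (?h x \<bullet> z) * (pr b (dv c ?p u) \<bullet> w)" for w z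
    proof -
      have "((\<lambda>y. (?h y \<bullet> w) * (?V y \<bullet> z) - (?h y \<bullet> z) * (?V y \<bullet> w)) has_derivative
        (\<lambda>u. (?h x \<bullet> w) * (pr b (dv c ?p u) \<bullet> z) + (h' u \<bullet> w) * (?V x \<bullet> z) - ((?h x \<bullet> z) * (pr b (dv c ?p u) \<bullet> w) + (h' u \<bullet> z) * (?V x \<bullet> w)))) (at x)"
        by (intro has_derivative_diff has_derivative_mult has_derivative_inner_left dh dV)
      then have "((\<lambda>y. 0) has_derivative
        (\<lambda>u. (?h x \<bullet> w) * (pr b (dv c ?p u) \<bullet> z) + (h' u \<bullet> w) * (?V x \<bullet> z) - ((?h x \<bullet> z) * (pr b (dv c ?p u) \<bullet> w) + (h' u \<bullet> z) * (?V x \<bullet> w)))) (at x)"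
        unfolding sym .
      from has_derivative_unique[OF this has_derivative_const]
      have "(?h x \<bullet> w) * (pr b (dv c ?p u) \<bullet> z) + (h' u \<bullet> w) * (?V x \<bullet> z) - ((?h x \<bullet> z) * (pr b (dv c ?p u) \<bullet> w) + (h' u \<bullet> z) * (?V x \<bullet> w)) = 0"
        by (rule fun_cong)
      then show ?thesis using h0 by simp
    qed
    have hh1: "?h x \<bullet> ?h x = 1" using hB(1)[OF pN] by (simp add: norm_eq_1)
    define s where "s = pr b (dv c ?p u) \<bullet> ?h x"
    have "pr b (dv c ?p u) \<bullet> w = (s *\<^sub>R ?h x) \<bullet> w" for w
      using key[of w "?h x"] hh1 by (simp add: s_def mult.commute)
    then have "pr b (dv c ?p u) = s *\<^sub>R ?h x" by (metis vector_eq_rdot)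
    then have "dv c ?p u = s *\<^sub>R ?h x + (dv c ?p u \<bullet> b) *\<^sub>R b" using pr_decomp[of "dv c ?p u" b] by simp
    moreover have "?h x = (1 / norm (?V x)) *\<^sub>R ?V x" by (simp add: h_def CP.hh_def sgn_div_norm divide_inverse)
    moreover have "?V x = v ?p - (v ?p \<bullet> b) *\<^sub>R b" by (simp add: pr_def)
    ultimately obtain \<alpha> \<beta> where e: "dv c ?p u = \<alpha> *\<^sub>R v ?p + \<beta> *\<^sub>R b"
    proof -
      assume d: "dv c ?p u = s *\<^sub>R ?h x + (dv c ?p u \<bullet> b) *\<^sub>R b" and hx: "?h x = (1 / norm (?V x)) *\<^sub>R ?V x"
        and Vx: "?V x = v ?p - (v ?p \<bullet> b) *\<^sub>R b" and "\<And>\<alpha> \<beta>. dv c ?p u = \<alpha> *\<^sub>R v ?p + \<beta> *\<^sub>R b \<Longrightarrow> thesis"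
      note th = this(4)
      define r where "r = s * (1 / norm (?V x))"
      have "s *\<^sub>R ?h x = r *\<^sub>R ?V x" by (subst hx) (simp add: r_def)
      then have "dv c ?p u = r *\<^sub>R (v ?p - (v ?p \<bullet> b) *\<^sub>R b) + (dv c ?p u \<bullet> b) *\<^sub>R b" using d Vx by simp
      also have "\<dots> = r *\<^sub>R v ?p + (dv c ?p u \<bullet> b - r * (v ?p \<bullet> b)) *\<^sub>R b" by (simp add: algebra_simps)
      finally show thesis by (rule th)
    qed
    have "\<beta> * (g ?p \<bullet> b) = 0"
      using arg_cong[OF e, of "\<lambda>z. g ?p \<bullet> z"] PC.perps(3)[OF x, of u] gv_unit(3)[OF pN] by (simp add: inner_add_right inner_commute)
    then have "\<beta> = 0" using b(2) pN by force
    then have "\<alpha> = 0"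
      using arg_cong[OF e, of "\<lambda>z. v ?p \<bullet> z"] PC.perps(2)[OF x, of u] gv_unit(2)[OF pN] by (auto simp: inner_add_right inner_commute norm_eq_1)
    then have "dv c ?p u = 0" using e \<open>\<beta> = 0\<close> by simp
    then show "u = 0" using PC.injM[OF x] linear_injective_0[OF PC.linM[OF x]] by blast
  qed
  have contG: "continuous_map (top_of_set (sphere 0 1)) (mtop N) G"
  proof -
    have "continuous_on (sphere 0 1) \<kappa>" by (rule linear_continuous_on[OF bl(2)])
    then have "continuous_map (top_of_set (sphere 0 1)) (top_of_set {z. norm z = 1 \<and> z \<bullet> b = 0}) \<kappa>"
      using \<kappa>S im by (auto simp: h_def)
    from continuous_map_compose[OF this ci] show ?thesis unfolding G_def[abs_def] h_def by (simp add: o_def)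
  qed
  have "smooth_map sphere_mfd N G"
    unfolding smooth_map_def
  proof (intro conjI ballI)
    show "continuous_map (mtop sphere_mfd) (mtop N) G" using contG by simp
    fix s :: "(real ^ 'n option, real ^ 'n) chart" and d assume s: "s \<in> atlas sphere_mfd" and d: "d \<in> atlas N"
    obtain \<sigma> :: real where \<sigma>: "\<sigma> = 1 \<or> \<sigma> = - 1" and s\<sigma>: "s = sch \<sigma>" using s by (auto simp: atlas_sphere)
    have ist1: "norm (ist \<sigma> y) = 1" for y :: "real ^ 'n" by (rule st_ist(2)[OF \<sigma>])
    have O2e: "snd s ` {p \<in> fst s. G p \<in> fst d} = {y. G (ist \<sigma> y) \<in> fst d}" (is "?S = ?O2")
    proof (intro set_eqI iffI)
      fix y assume "y \<in> ?S"
      then obtain p where p: "y = st \<sigma> p" "norm p = 1" "p \<noteq> pole \<sigma>" "G p \<in> fst d" by (auto simp: s\<sigma> sch_def)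
      then show "y \<in> ?O2" using ist_st_aux(2)[OF \<sigma> p(2,3)] by simp
    next
      fix y assume "y \<in> ?O2"
      then show "y \<in> ?S" using st_ist[OF \<sigma>, of y] by (intro image_eqI[of _ _ "ist \<sigma> y"]) (auto simp: s\<sigma> sch_def)
    qed
    have cist: "continuous_map euclidean (top_of_set (sphere 0 1)) (ist \<sigma> :: real ^ 'n \<Rightarrow> _)"
      using smooth_on_continuous[OF smooth_ist[of \<sigma>]] ist1 by (auto simp: continuous_map_in_subtopology)
    have cGi: "continuous_map euclidean (mtop N) (\<lambda>y. G (ist \<sigma> y))"
      using continuous_map_compose[OF cist contG] by (simp add: o_def)
    have oO2: "open ?O2" using openin_continuous_map_preimage[OF cGi dom_open[OF d]] by simp
    \<comment> \<open>In coordinates \<theta> is the map \<open>G\<close> and \<Psi> is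
      \<open>H\<close>. As \<open>H\<close> is smooth with injective derivative and \<open>G\<close>
      is a continuous inverse, \<open>smooth_on_inverse_function\<close> makes \<open>G\<close>
      smooth.\<close>
    define \<theta> where "\<theta> y = snd d (G (ist \<sigma> y))" for y
    define \<Psi> where "\<Psi> x = st \<sigma> (H (chart_inv d x))" for x
    let ?O1 = "cran d \<inter> (\<lambda>x. H (chart_inv d x)) -` {x. 1 - \<sigma> * x $ None > 0}"
    have oO1: "open ?O1"
      by (rule continuous_open_preimage[OF smooth_on_continuous[OF smH[OF d]] ran_open[OF d] open_st])
    have sm\<Psi>: "smooth_on ?O1 \<Psi>"
      unfolding \<Psi>_def[abs_def]
      by (rule smooth_on_compose[OF oO1 open_st smooth_on_subset[OF smH[OF d]] smooth_st]) auto
    have i\<Psi>: "ist \<sigma> (\<Psi> x) = H (chart_inv d x)" if x: "x \<in> ?O1" for x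
    proof -
      have n: "norm (H (chart_inv d x)) = 1" using nH chart_inv_points[OF d] x by blast
      have "H (chart_inv d x) \<noteq> pole \<sigma>"
      proof
        assume "H (chart_inv d x) = pole \<sigma>"
        then have "H (chart_inv d x) $ None = \<sigma>" by (simp add: pole_def axis_def)
        then show False using x \<sigma> by auto
      qed
      then show ?thesis unfolding \<Psi>_def by (rule ist_st_aux(2)[OF \<sigma> n])
    qed
    have "smooth_on ?O2 \<theta>"
    proof (rule smooth_on_inverse_function[OF oO1 sm\<Psi> oO2])
      have "continuous_map (top_of_set ?O2) (subtopology (mtop N) (fst d)) (\<lambda>y. G (ist \<sigma> y))"
        using continuous_map_from_subtopology[OF cGi, of ?O2] by (auto simp: continuous_map_in_subtopology)
      from continuous_map_compose[OF this cont_chart[OF d]] show "continuous_on ?O2 \<theta>" by (simp add: \<theta>_def[abs_def] o_def)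
      fix y assume y: "y \<in> ?O2"
      then have e: "chart_inv d (\<theta> y) = G (ist \<sigma> y)" "\<theta> y \<in> cran d" using d by (simp_all add: \<theta>_def)
      have He: "H (chart_inv d (\<theta> y)) = ist \<sigma> y" using e(1) HG ist1 by simp
      show "\<theta> y \<in> ?O1" using e(2) He ist_st_aux(1)[OF \<sigma> ist1 st_ist(3)[OF \<sigma>]] by simp
      show "\<Psi> (\<theta> y) = y" unfolding \<Psi>_def He by (rule st_ist(1)[OF \<sigma>])
    next
      fix x assume x: "x \<in> ?O1"
      have d\<Psi>: "(\<Psi> has_derivative frechet_derivative \<Psi> (at x)) (at x)" by (rule smooth_on_has_derivative[OF sm\<Psi> x])
      have di: "(ist \<sigma> has_derivative frechet_derivative (ist \<sigma>) (at (\<Psi> x))) (at (\<Psi> x))" by (rule smooth_on_has_derivative[OF smooth_ist]) simp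
      have "((\<lambda>x. \<kappa> (ist \<sigma> (\<Psi> x))) has_derivative (\<lambda>u. \<kappa> (frechet_derivative (ist \<sigma>) (at (\<Psi> x)) (frechet_derivative \<Psi> (at x) u)))) (at x)"
        by (rule bounded_linear.has_derivative[OF bl(2) has_derivative_compose[OF d\<Psi> di]])
      then have dh: "((\<lambda>x. h (chart_inv d x)) has_derivative (\<lambda>u. \<kappa> (frechet_derivative (ist \<sigma>) (at (\<Psi> x)) (frechet_derivative \<Psi> (at x) u)))) (at x)"
      proof (rule has_derivative_transform_within_open[OF _ oO1 x])
        fix z assume z: "z \<in> ?O1"
        have "b \<bullet> h (chart_inv d z) = 0" using hB(2) chart_inv_points[OF d] z by blast
        then show "\<kappa> (ist \<sigma> (\<Psi> z)) = h (chart_inv d z)" unfolding i\<Psi>[OF z] H_def using \<kappa>\<iota> by blast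
      qed
      have "u = 0" if "frechet_derivative \<Psi> (at x) u = 0" for u
        by (rule dh0[OF d _ dh]) (use x that linear_0[OF has_derivative_linear[OF di]] linear_0[OF lin(2)] in auto)
      then show "inj (frechet_derivative \<Psi> (at x))" using linear_injective_0[OF has_derivative_linear[OF d\<Psi>]] by blast
    qed
    moreover have "snd d \<circ> G \<circ> chart_inv s = \<theta>" by (rule ext) (simp add: \<theta>_def s\<sigma> sch_inv[OF \<sigma>])
    ultimately show "smooth_on (snd s ` {p \<in> fst s. G p \<in> fst d}) (snd d \<circ> G \<circ> chart_inv s)" unfolding O2e by simp
  qed
  moreover have "\<forall>p\<in>points N. G (H p) = p" using GH by blast
  moreover have "\<forall>q\<in>points sphere_mfd. H (G q) = q" using HG by simp
  ultimately show ?thesis unfolding diffeomorphic_def using H by blast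
qed

end

section \<open>Arcs of the circle\<close>

lemma mod_pi_eq: "mod_pi x = mod_pi y \<longleftrightarrow> (\<exists>n::int. y = x + real_of_int n * pi)"
  by (simp add: real_mod_pi.abs_eq_iff rcong_altdef)

lemma mod_pi_shift [simp]: "mod_pi (x + real_of_int n * pi) = mod_pi x"
  using mod_pi_eq by metis

lemma mod_pi_rep: obtains n :: int where "z \<le> x + real_of_int n * pi" "x + real_of_int n * pi < z + pi"
proof -
  define m where "m = \<lfloor>(x - z) / pi\<rfloor>"
  have "real_of_int m \<le> (x - z) / pi" "(x - z) / pi < real_of_int m + 1" by (simp_all add: m_def)
  then have "real_of_int m * pi \<le> x - z" "x - z < (real_of_int m + 1) * pi" by (simp_all add: field_simps)
  then show thesis by (intro that[of "- m"]) (simp_all add: algebra_simps)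
qed

lemma mod_pi_inj:
  assumes "mod_pi s = mod_pi t" "z \<le> s" "s < z + pi" "z \<le> t" "t < z + pi" shows "s = t"
proof -
  obtain n :: int where n: "t = s + real_of_int n * pi" using assms(1) mod_pi_eq by blast
  have "s + real_of_int n * pi < s + pi" "s < s + real_of_int n * pi + pi" using n assms(2-5) by linarith+
  then have "real_of_int n * pi < 1 * pi" "(- 1) * pi < real_of_int n * pi" by simp_all
  then have "real_of_int n < 1" "- 1 < real_of_int n" unfolding mult_less_cancel_right_pos[OF pi_gt_zero] .
  then have "n = 0" by linarith
  then show ?thesis using n by simp
qed

lemma open_mod_pi_image: assumes "open U" shows "open (mod_pi ` U)"
proof -
  have "mod_pi -` mod_pi ` U = (\<Union>n::int. (+) (real_of_int n * pi) ` U)"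
  proof (intro set_eqI iffI)
    fix y assume "y \<in> mod_pi -` mod_pi ` U"
    then obtain x where x: "x \<in> U" "mod_pi x = mod_pi y" by auto
    then obtain n :: int where "y = x + real_of_int n * pi" using mod_pi_eq by blast
    then have "y \<in> (+) (real_of_int n * pi) ` U" using x(1) by (intro image_eqI[of _ _ x]) simp_all
    then show "y \<in> (\<Union>n::int. (+) (real_of_int n * pi) ` U)" by blast
  next
    fix y assume "y \<in> (\<Union>n::int. (+) (real_of_int n * pi) ` U)"
    then obtain n :: int and x where "x \<in> U" "y = x + real_of_int n * pi" by (auto simp: add.commute)
    then show "y \<in> mod_pi -` mod_pi ` U" by simp
  qed
  moreover have "open (\<Union>n::int. (+) (real_of_int n * pi) ` U)" using assms by (intro open_UN ballI open_translation)
  ultimately show ?thesis by (simp add: open_real_mod_pi_def)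
qed

context
  fixes J :: "real_mod_pi set" and z :: real
  assumes conn: "connected J" and z: "mod_pi z \<notin> J"
begin

text \<open>Cut at the missing point \<open>z\<close>, the circle becomes the window (z, z + pi). If
  \<open>y\<close> were missing as well, the images of (z, y) and (y, z + pi) would separate
  \<open>J\<close>.\<close>

lemma arc_between:
  assumes x: "z < x" "mod_pi x \<in> J" and w: "w < z + pi" "mod_pi w \<in> J" and y: "x \<le> y" "y \<le> w"
  shows "mod_pi y \<in> J"
proof (rule ccontr)
  assume nJ: "mod_pi y \<notin> J"
  let ?U = "mod_pi ` {z<..<y}" and ?V = "mod_pi ` {y<..<z + pi}"
  have "x \<noteq> y" "w \<noteq> y" using nJ x w by auto
  then have "mod_pi x \<in> ?U \<inter> J" "mod_pi w \<in> ?V \<inter> J" using x w y by auto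
  moreover have "J \<subseteq> ?U \<union> ?V"
  proof
    fix q assume q: "q \<in> J"
    obtain t where t: "q = mod_pi t" by (rule real_mod_pi.abs_induct[of "\<lambda>q. (\<exists>t. q = mod_pi t)", THEN exE]) auto
    obtain n :: int where n: "z \<le> t + real_of_int n * pi" "t + real_of_int n * pi < z + pi" by (rule mod_pi_rep)
    have "t + real_of_int n * pi \<noteq> z" "t + real_of_int n * pi \<noteq> y" using q t z nJ by (metis mod_pi_shift)+
    then have "t + real_of_int n * pi \<in> {z<..<y} \<union> {y<..<z + pi}" using n by auto
    then have "mod_pi (t + real_of_int n * pi) \<in> ?U \<union> ?V" by blast
    then show "q \<in> ?U \<union> ?V" using t by simp
  qed
  moreover have "?U \<inter> ?V \<inter> J = {}"
  proof -
    have "q \<notin> ?V" if q: "q \<in> ?U" for q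
    proof
      assume "q \<in> ?V"
      then obtain t where t: "q = mod_pi t" "y < t" "t < z + pi" by auto
      obtain s where s: "q = mod_pi s" "z < s" "s < y" using q by auto
      have "s = t" by (rule mod_pi_inj[of _ _ z]) (use s t x y in auto)
      then show False using s t by simp
    qed
    then show ?thesis by blast
  qed
  ultimately show False
    using connectedD[OF conn open_mod_pi_image[OF open_greaterThanLessThan] open_mod_pi_image[OF open_greaterThanLessThan], of z y y "z + pi"]
    by blast
qed

lemma arc_measurable: "{t. mod_pi t \<in> J} \<in> sets borel"
proof -
  define A where "A = {t \<in> {z<..<z + pi}. mod_pi t \<in> J}"
  have "is_interval A"
    unfolding is_interval_1 A_def
  proof (intro ballI allI impI)
    fix a b x assume a: "a \<in> {t \<in> {z<..<z + pi}. mod_pi t \<in> J}" and b: "b \<in> {t \<in> {z<..<z + pi}. mod_pi t \<in> J}" and x: "a \<le> x \<and> x \<le> b"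
    have "mod_pi x \<in> J" by (rule arc_between[of a b]) (use a b x in auto)
    then show "x \<in> {t \<in> {z<..<z + pi}. mod_pi t \<in> J}" using a b x by auto
  qed
  then have A: "A \<in> sets borel" by (rule real_interval_borel_measurable)
  have "{t. mod_pi t \<in> J} = (\<Union>n::int. (\<lambda>t. t + real_of_int n * pi) -` A)"
  proof (intro set_eqI iffI)
    fix t assume t: "t \<in> {t. mod_pi t \<in> J}"
    obtain n :: int where n: "z \<le> t + real_of_int n * pi" "t + real_of_int n * pi < z + pi" by (rule mod_pi_rep)
    have "t + real_of_int n * pi \<noteq> z" using t z by (metis mem_Collect_eq mod_pi_shift)
    then have "t \<in> (\<lambda>t. t + real_of_int n * pi) -` A" using n t by (auto simp: A_def)
    then show "t \<in> (\<Union>n::int. (\<lambda>t. t + real_of_int n * pi) -` A)" by blast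
  qed (auto simp: A_def)
  moreover have "(\<lambda>t. t + real_of_int n * pi) -` A \<in> sets borel" for n :: int
    using measurable_sets[of "\<lambda>t. t + real_of_int n * pi" borel borel A] A by simp
  ultimately show ?thesis by auto
qed

text \<open>The length is measured in the window [0, pi), whereas the segment lies in (z, z + pi).
  The three cases are segments before, after and across \<open>pi\<close>.\<close>

lemma arc_len_ge:
  assumes z0: "0 \<le> z" "z < pi" and x: "z < x" "mod_pi x \<in> J" and w: "w < z + pi" "mod_pi w \<in> J" and xw: "x \<le> w"
  shows "w - x \<le> arc_len J"
proof -
  let ?A = "{t \<in> {0..<pi}. mod_pi t \<in> J}"
  have eq: "?A = {0..<pi} \<inter> {t. mod_pi t \<in> J}" by blast
  have A: "?A \<in> sets lborel" unfolding eq using arc_measurable by simp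
  have "emeasure lborel ?A \<le> emeasure lborel {0..<pi}" by (rule emeasure_mono) auto
  then have fin: "emeasure lborel ?A \<noteq> \<infinity>" by (auto simp: top_unique)
  have mono: "measure lborel B \<le> arc_len J" if "B \<subseteq> ?A" "B \<in> sets lborel" for B
    unfolding arc_len_def using that A fin by (intro measure_mono_fmeasurable) (auto simp: fmeasurable_def top.not_eq_extremum)
  have J: "mod_pi y \<in> J" if "x \<le> y" "y \<le> w" for y using arc_between[OF x w that] .
  have J': "mod_pi y \<in> J" if "x \<le> y + pi" "y + pi \<le> w" for y using J[OF that] mod_pi_shift[of y 1] by simp
  consider "w < pi" | "pi \<le> x" | "x < pi" "pi \<le> w" by linarith
  then show ?thesis
  proof cases
    case 1
    have "measure lborel {x..w} \<le> arc_len J" by (rule mono) (use 1 z0 x J in auto)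
    then show ?thesis using xw by simp
  next
    case 2
    have "measure lborel {x - pi..w - pi} \<le> arc_len J" by (rule mono) (use 2 z0 w J' in auto)
    then show ?thesis using xw by simp
  next
    case 3
    have "measure lborel ({x..<pi} \<union> {0..w - pi}) \<le> arc_len J" by (rule mono) (use 3 z0 x w J J' in auto)
    moreover have "measure lborel ({x..<pi} \<union> {0..w - pi}) = measure lborel {x..<pi} + measure lborel {0..w - pi}"
      by (rule measure_Union) (use z0 x w 3 in \<open>auto simp: emeasure_lborel_Icc_eq\<close>)
    ultimately show ?thesis using 3 by simp
  qed
qed

end

lemma exists_missing_point:
  assumes "arc_len J < pi / 2 \<or> J \<inter> shift (pi / 2) J = {}"
  obtains z where "0 \<le> z" "z < pi" "mod_pi z \<notin> J"
proof -
  have "\<exists>z. 0 \<le> z \<and> z < pi \<and> mod_pi z \<notin> J"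
  proof (rule ccontr)
    assume "\<not> ?thesis"
    then have all: "mod_pi t \<in> J" if "0 \<le> t" "t < pi" for t using that by blast
    then have "{t \<in> {0..<pi}. mod_pi t \<in> J} = {0..<pi}" by auto
    then have "arc_len J = pi" by (simp add: arc_len_def)
    moreover have "mod_pi (0 + pi / 2) \<in> shift (pi / 2) J" unfolding shift_def using all[of 0] pi_gt_zero by blast
    then have "mod_pi (pi / 2) \<in> J \<inter> shift (pi / 2) J" using all[of "pi / 2"] by simp
    ultimately show False using assms pi_gt_zero by auto
  qed
  then show thesis using that by blast
qed

text \<open>If \<open>J\<close> is disjoint from its translate, a segment of length pi/2 over
  \<open>J\<close> is impossible, since it would contain \<open>x + pi / 2\<close> along with
  \<open>x\<close>.\<close>

lemma arc_short:
  assumes J: "connected J" and z: "0 \<le> z" "z < pi" "mod_pi z \<notin> J"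
    and short: "arc_len J < pi / 2 \<or> J \<inter> shift (pi / 2) J = {}"
    and x: "z < x" "mod_pi x \<in> J" and w: "w < z + pi" "mod_pi w \<in> J" and xw: "x \<le> w"
  shows "w - x < pi / 2"
  using short
proof
  assume "arc_len J < pi / 2"
  then show ?thesis using arc_len_ge[OF J z(3,1,2) x w xw] by simp
next
  assume disj: "J \<inter> shift (pi / 2) J = {}"
  show ?thesis
  proof (rule ccontr)
    assume "\<not> ?thesis"
    then have "mod_pi (x + pi / 2) \<in> J" by (intro arc_between[OF J z(3) x w]) auto
    moreover have "mod_pi (x + pi / 2) \<in> shift (pi / 2) J" using x(2) by (auto simp: shift_def)
    ultimately show False using disj by blast
  qed
qed

section \<open>Principal radii\<close>

context hypersurface begin

text \<open>
  This homogeneous form of the equation for a principal radius is defined for all \<open>\<rho>\<close>, and is a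
  closed condition if \<open>N\<close> is compact.
\<close>

definition lifted_radii :: "real set" where
  "lifted_radii = {\<rho>. \<exists>p c u. c \<in> charts_at N p \<and> u \<noteq> 0 \<and> cos \<rho> *\<^sub>R df c f p u + sin \<rho> *\<^sub>R df c \<nu> p u = 0}"

lemma lifted_radiiI: "c \<in> charts_at N p \<Longrightarrow> u \<noteq> 0 \<Longrightarrow> cos \<rho> *\<^sub>R df c f p u + sin \<rho> *\<^sub>R df c \<nu> p u = 0 \<Longrightarrow> \<rho> \<in> lifted_radii"
  unfolding lifted_radii_def by blast

lemma lifted_radii_mod_pi:
  assumes "\<rho> \<in> lifted_radii" shows "mod_pi \<rho> \<in> principal_radii N f"
proof -
  obtain p c u where c: "c \<in> charts_at N p" and u: "u \<noteq> 0" "cos \<rho> *\<^sub>R df c f p u + sin \<rho> *\<^sub>R df c \<nu> p u = 0"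
    using assms by (auto simp: lifted_radii_def)
  have pN: "p \<in> points N" using c charts_atD dom_sub by blast
  \<comment> \<open>A zero sine would leave a kernel vector of the differential of \<open>f\<close>,
    which is excluded for an immersion.\<close>
  have s: "sin \<rho> \<noteq> 0"
  proof
    assume s0: "sin \<rho> = 0"
    then have "cos \<rho> \<noteq> 0" using sin_cos_squared_add[of \<rho>] by auto
    then have "df c f p u = 0" using u(2) s0 by simp
    then show False using df_facts(1,2)[OF c] u(1) linear_injective_0 by blast
  qed
  have "sin \<rho> *\<^sub>R df c \<nu> p u = - (cos \<rho> *\<^sub>R df c f p u)" using u(2) by (simp add: add_eq_0_iff)
  then have "(1 / sin \<rho>) *\<^sub>R sin \<rho> *\<^sub>R df c \<nu> p u = (1 / sin \<rho>) *\<^sub>R - (cos \<rho> *\<^sub>R df c f p u)" by simp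
  then have "df c \<nu> p u = - cot \<rho> *\<^sub>R df c f p u" using s by (simp add: cot_def)
  then have "principal_curvature N f p (cot \<rho>)"
    unfolding principal_curvature_def \<nu>_def[symmetric] using c u(1) by blast
  then show ?thesis unfolding principal_radii_def using s pN by blast
qed

lemma lifted_radii_shift: assumes "\<rho> \<in> lifted_radii" shows "\<rho> + real_of_int n * pi \<in> lifted_radii"
proof -
  obtain p c u where c: "c \<in> charts_at N p" and u: "u \<noteq> 0" "cos \<rho> *\<^sub>R df c f p u + sin \<rho> *\<^sub>R df c \<nu> p u = 0"
    using assms by (auto simp: lifted_radii_def)
  have sn: "sin (real_of_int n * pi) = 0" by (simp add: sin_zero_iff_int2)
  have "cos (\<rho> + real_of_int n * pi) = cos (real_of_int n * pi) * cos \<rho>" "sin (\<rho> + real_of_int n * pi) = cos (real_of_int n * pi) * sin \<rho>"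
    by (simp_all add: cos_add sin_add sn)
  then have "cos (\<rho> + real_of_int n * pi) *\<^sub>R df c f p u + sin (\<rho> + real_of_int n * pi) *\<^sub>R df c \<nu> p u
    = cos (real_of_int n * pi) *\<^sub>R (cos \<rho> *\<^sub>R df c f p u + sin \<rho> *\<^sub>R df c \<nu> p u)"
    by (simp add: scaleR_add_right)
  then show ?thesis using u(2) by (intro lifted_radiiI[OF c u(1)]) simp
qed

lemma sin_double_periodic: "sin (2 * (\<rho> + real_of_int n * pi - a)) = sin (2 * (\<rho> - a))"
proof -
  have e: "2 * (\<rho> + real_of_int n * pi - a) = 2 * (\<rho> - a) + real_of_int n * (2 * pi)" by (simp add: algebra_simps)
  have "sin (real_of_int n * (2 * pi)) = 0" "cos (real_of_int n * (2 * pi)) = 1"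
    by (auto simp: sin_zero_iff_int2 cos_one_2pi_int intro: exI[of _ "2 * n"])
  then show ?thesis unfolding e sin_add by simp
qed

text \<open>Both the equation for \<rho> and sin (2 (\<rho> - a)) are invariant under adding
  multiples of pi, so one window of length pi is representative.\<close>

lemma radii_window:
  assumes "\<And>\<rho>. \<rho> \<in> lifted_radii \<Longrightarrow> z \<le> \<rho> \<Longrightarrow> \<rho> < z + pi \<Longrightarrow> k \<le> sin (2 * (\<rho> - a))"
    and c: "c \<in> charts_at N p" "u \<noteq> 0" "cos \<rho> *\<^sub>R df c f p u + sin \<rho> *\<^sub>R df c \<nu> p u = 0"
  shows "k \<le> sin (2 * (\<rho> - a))"
proof -
  have \<rho>: "\<rho> \<in> lifted_radii" by (rule lifted_radiiI[OF c])
  obtain n :: int where n: "z \<le> \<rho> + real_of_int n * pi" "\<rho> + real_of_int n * pi < z + pi" by (rule mod_pi_rep)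
  show ?thesis using assms(1)[OF lifted_radii_shift[OF \<rho>] n] sin_double_periodic by simp
qed

text \<open>For such \<rho> the combination cos \<rho> df + sin \<rho> d\<nu> is injective at
  \<open>p\<close>, and injectivity of a linear map is stable under small changes of the point and
  of the angle.\<close>

lemma not_lifted_radii_local:
  assumes \<rho>: "\<rho> \<notin> lifted_radii" and p: "p \<in> points N"
  shows "\<exists>V. openin (mtop N) V \<and> p \<in> V \<and> (\<exists>\<epsilon>>0. \<forall>q\<in>V. \<forall>\<rho>'. \<bar>\<rho>' - \<rho>\<bar> < \<epsilon> \<longrightarrow>
    (\<forall>c\<in>charts_at N q. \<forall>u. cos \<rho>' *\<^sub>R df c f q u + sin \<rho>' *\<^sub>R df c \<nu> q u = 0 \<longrightarrow> u = 0))"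
proof -
  obtain c where c: "c \<in> charts_at N p" using covered[OF p] by blast
  then have cA: "c \<in> atlas N" "p \<in> fst c" using charts_atD by auto
  let ?x = "snd c p" let ?A = "\<lambda>x. df c f (chart_inv c x)" let ?B = "\<lambda>x. df c \<nu> (chart_inv c x)"
  have x: "?x \<in> cran c" using cA by simp
  have ch: "c \<in> charts_at N (chart_inv c y)" if "y \<in> cran c" for y
    using chart_inv_in[OF cA(1) that] cA by (simp add: charts_at_def)
  let ?Q = "\<lambda>u. cos \<rho> *\<^sub>R ?A ?x u + sin \<rho> *\<^sub>R ?B ?x u"
  have linQ: "linear ?Q"
    by (intro linear_compose_add linear_compose_scale_right df_facts(1)[OF ch[OF x]] dnu_facts(1)[OF ch[OF x]])
  have "inj ?Q" unfolding linear_injective_0[OF linQ] using \<rho> lifted_radiiI[OF ch[OF x]] by blast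
  then obtain b where b: "b > 0" "\<And>u. b * norm u \<le> norm (?Q u)" using linear_inj_bounded_below_pos[OF linQ] by metis
  obtain C1 where C1: "C1 > 0" "\<And>u. norm (?A ?x u) \<le> C1 * norm u" using linear_bounded_pos[OF df_facts(1)[OF ch[OF x]]] by blast
  obtain C2 where C2: "C2 > 0" "\<And>u. norm (?B ?x u) \<le> C2 * norm u" using linear_bounded_pos[OF dnu_facts(1)[OF ch[OF x]]] by blast
  define C where "C = max C1 C2"
  have C: "C > 0" "\<And>u. norm (?A ?x u) \<le> C * norm u" "\<And>u. norm (?B ?x u) \<le> C * norm u"
  proof -
    show "C > 0" using C1(1) by (simp add: C_def)
    show "norm (?A ?x u) \<le> C * norm u" for u by (rule order_trans[OF C1(2)]) (simp add: C_def mult_right_mono)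
    show "norm (?B ?x u) \<le> C * norm u" for u by (rule order_trans[OF C2(2)]) (simp add: C_def mult_right_mono)
  qed
  \<comment> \<open>Each of the two summands is disturbed by at most 2 \<eta> = b / 4 times |u|, so
    together they stay below the lower bound b |u|.\<close>
  define \<eta> where "\<eta> = b / 8"
  have \<eta>: "\<eta> > 0" using b(1) by (simp add: \<eta>_def)
  obtain d1 where d1: "d1 > 0" "ball ?x d1 \<subseteq> cran c" "\<forall>y\<in>ball ?x d1. \<forall>u. norm (?A y u - ?A ?x u) \<le> \<eta> * norm u"
    using deriv_close[OF ran_open[OF cA(1)] x df_continuous[OF cA(1) smooth_f[OF cA(1)]] df_facts(1)[OF ch] \<eta>] by blast
  obtain d2 where d2: "d2 > 0" "ball ?x d2 \<subseteq> cran c" "\<forall>y\<in>ball ?x d2. \<forall>u. norm (?B y u - ?B ?x u) \<le> \<eta> * norm u"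
    using deriv_close[OF ran_open[OF cA(1)] x df_continuous[OF cA(1) smooth_nu[OF cA(1)]] dnu_facts(1)[OF ch] \<eta>] by blast
  have "\<forall>\<^sub>F \<rho>' in nhds \<rho>. dist (cos \<rho>') (cos \<rho>) < \<eta> / C \<and> dist (sin \<rho>') (sin \<rho>) < \<eta> / C"
    using C(1) \<eta> isCont_cos[of \<rho>] isCont_sin[of \<rho>]
    by (intro eventually_conj tendstoD) (simp_all add: isCont_def tendsto_at_iff_tendsto_nhds)
  then obtain \<epsilon> where \<epsilon>: "\<epsilon> > 0" "\<And>\<rho>'. \<bar>\<rho>' - \<rho>\<bar> < \<epsilon> \<Longrightarrow> \<bar>cos \<rho>' - cos \<rho>\<bar> < \<eta> / C \<and> \<bar>sin \<rho>' - sin \<rho>\<bar> < \<eta> / C"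
    unfolding eventually_nhds_metric dist_real_def by blast
  define d where "d = min d1 d2"
  have d: "d > 0" "ball ?x d \<subseteq> cran c" "\<And>y u. y \<in> ball ?x d \<Longrightarrow> norm (?A y u - ?A ?x u) \<le> \<eta> * norm u"
    "\<And>y u. y \<in> ball ?x d \<Longrightarrow> norm (?B y u - ?B ?x u) \<le> \<eta> * norm u"
    using d1 d2 by (auto simp: d_def)
  have small: "norm (s *\<^sub>R X - s0 *\<^sub>R X0) \<le> b / 4 * m"
    if "\<bar>s\<bar> \<le> 1" "\<bar>s - s0\<bar> < \<eta> / C" "norm (X - X0) \<le> \<eta> * m" "norm X0 \<le> C * m" "0 \<le> m" for s s0 m and X X0 :: "real ^ 'n option option"
  proof -
    have "s *\<^sub>R X - s0 *\<^sub>R X0 = s *\<^sub>R (X - X0) + (s - s0) *\<^sub>R X0" by (simp add: algebra_simps)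
    then have "norm (s *\<^sub>R X - s0 *\<^sub>R X0) \<le> \<bar>s\<bar> * norm (X - X0) + \<bar>s - s0\<bar> * norm X0"
      using norm_triangle_ineq[of "s *\<^sub>R (X - X0)" "(s - s0) *\<^sub>R X0"] by simp
    also have "\<dots> \<le> 1 * (\<eta> * m) + (\<eta> / C) * (C * m)" using that C(1) by (intro add_mono mult_mono) auto
    also have "\<dots> = b / 4 * m" using C(1) by (simp add: \<eta>_def)
    finally show ?thesis .
  qed
  have key: "u = 0" if y: "y \<in> ball ?x d" and \<rho>': "\<bar>\<rho>' - \<rho>\<bar> < \<epsilon>" and 0: "cos \<rho>' *\<^sub>R ?A y u + sin \<rho>' *\<^sub>R ?B y u = 0" for y \<rho>' u
  proof (rule ccontr)
    assume u: "u \<noteq> 0"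
    have "?Q u = - ((cos \<rho>' *\<^sub>R ?A y u - cos \<rho> *\<^sub>R ?A ?x u) + (sin \<rho>' *\<^sub>R ?B y u - sin \<rho> *\<^sub>R ?B ?x u))"
      using 0 by (simp add: algebra_simps)
    then have "norm (?Q u) = norm ((cos \<rho>' *\<^sub>R ?A y u - cos \<rho> *\<^sub>R ?A ?x u) + (sin \<rho>' *\<^sub>R ?B y u - sin \<rho> *\<^sub>R ?B ?x u))"
      by (simp only: norm_minus_cancel)
    also have "\<dots> \<le> norm (cos \<rho>' *\<^sub>R ?A y u - cos \<rho> *\<^sub>R ?A ?x u) + norm (sin \<rho>' *\<^sub>R ?B y u - sin \<rho> *\<^sub>R ?B ?x u)"
      by (rule norm_triangle_ineq)
    also have "\<dots> \<le> b / 4 * norm u + b / 4 * norm u"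
      using d(3,4)[OF y, of u] C(2,3)[of u] \<epsilon>(2)[OF \<rho>'] by (intro add_mono small) auto
    finally have "b * norm u \<le> b / 2 * norm u" using b(2)[of u] by simp
    then show False using b(1) u by simp
  qed
  let ?V = "chart_inv c ` ball ?x d"
  have V: "openin (mtop N) ?V" by (rule open_chart_inv[OF cA(1) open_ball d(2)])
  have pV: "p \<in> ?V" by (rule image_eqI[of _ _ ?x]) (use cA d(1) in auto)
  have "u = 0"
    if q: "q \<in> ?V" and \<rho>': "\<bar>\<rho>' - \<rho>\<bar> < \<epsilon>" and e: "e \<in> charts_at N q" and 0: "cos \<rho>' *\<^sub>R df e f q u + sin \<rho>' *\<^sub>R df e \<nu> q u = 0" for q \<rho>' e u
  proof -
    obtain y where y: "y \<in> ball ?x d" "q = chart_inv c y" using q by blast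
    have cq: "c \<in> charts_at N q" using ch y d(2) by blast
    let ?T = "frechet_derivative (\<lambda>x. snd c (chart_inv e x)) (at (snd e q))"
    have T: "df e f q u = df c f q (?T u)" "df e \<nu> q u = df c \<nu> q (?T u)"
      by (rule fun_cong[OF df_change[OF cq e smooth_f[OF cA(1)]]], rule fun_cong[OF df_change[OF cq e smooth_nu[OF cA(1)]]])
    have "?T u = 0" by (rule key[OF y(1) \<rho>'], unfold y(2)[symmetric] T[symmetric], rule 0)
    then have "df e f q u = 0" unfolding T(1) using linear_0[OF df_facts(1)[OF cq]] by (simp only:)
    then show "u = 0" using df_facts(1,2)[OF e] linear_injective_0 by blast
  qed
  then show ?thesis
    by (intro exI[of _ ?V] conjI V pV exI[of _ \<epsilon>] \<epsilon>(1) ballI allI impI) assumption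
qed

lemma closed_lifted_radii:
  assumes comp: "compact_space (mtop N)" shows "closed lifted_radii"
proof -
  have "\<exists>\<epsilon>>0. ball \<rho> \<epsilon> \<subseteq> - lifted_radii" if \<rho>: "\<rho> \<notin> lifted_radii" for \<rho>
  proof -
    let ?good = "\<lambda>V \<epsilon>. \<forall>q\<in>V. \<forall>\<rho>'. \<bar>\<rho>' - \<rho>\<bar> < \<epsilon> \<longrightarrow>
      (\<forall>c\<in>charts_at N q. \<forall>u. cos \<rho>' *\<^sub>R df c f q u + sin \<rho>' *\<^sub>R df c \<nu> q u = 0 \<longrightarrow> u = 0)"
    let ?\<U> = "{V. openin (mtop N) V \<and> (\<exists>\<epsilon>>0. ?good V \<epsilon>)}"
    have "(\<forall>U\<in>?\<U>. openin (mtop N) U) \<and> points N \<subseteq> \<Union> ?\<U>" using not_lifted_radii_local[OF \<rho>] by fast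
    then obtain \<F> where \<F>: "finite \<F>" "\<F> \<subseteq> ?\<U>" "points N \<subseteq> \<Union> \<F>"
      using comp unfolding compact_space_alt by meson
    have "\<exists>\<epsilon>>0. \<forall>V\<in>\<F>. ?good V \<epsilon>"
      using \<F>(1,2)
    proof (induction \<F> rule: finite_induct)
      case empty show ?case by (intro exI[of _ 1]) simp
    next
      case (insert V \<F>)
      then obtain \<epsilon>1 where e1: "\<epsilon>1 > 0" "\<forall>V\<in>\<F>. ?good V \<epsilon>1" by auto
      obtain \<epsilon>2 where e2: "\<epsilon>2 > 0" "?good V \<epsilon>2" using insert.prems by auto
      show ?case using e1 e2 by (intro exI[of _ "min \<epsilon>1 \<epsilon>2"]) auto
    qed
    then obtain \<epsilon> where \<epsilon>: "\<epsilon> > 0" "\<forall>V\<in>\<F>. ?good V \<epsilon>" by blast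
    have "\<rho>' \<notin> lifted_radii" if "\<rho>' \<in> ball \<rho> \<epsilon>" for \<rho>'
    proof
      assume "\<rho>' \<in> lifted_radii"
      then obtain p c u where c: "c \<in> charts_at N p" and u: "u \<noteq> 0" "cos \<rho>' *\<^sub>R df c f p u + sin \<rho>' *\<^sub>R df c \<nu> p u = 0"
        by (auto simp: lifted_radii_def)
      have "p \<in> points N" using c charts_atD dom_sub by blast
      then obtain V where V: "V \<in> \<F>" "p \<in> V" using \<F>(3) by blast
      have "\<bar>\<rho>' - \<rho>\<bar> < \<epsilon>" using that by (simp add: dist_real_def abs_minus_commute)
      then show False using \<epsilon>(2) V c u by blast
    qed
    then show ?thesis using \<epsilon>(1) by blast
  qed
  then have "open (- lifted_radii)" by (auto simp: open_contains_ball)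
  then show ?thesis by (simp add: closed_def)
qed

text \<open>The extreme radii need not be attained here. So \<open>a\<close> is placed at distance
  \<eta> before the infimum \<open>x\<close> of the window, where \<eta> is half of the slack pi/2 -
  arc_len J. Then \<rho> - a lies in [\<eta>, pi/2 - \<eta>] for every radius in the window, which
  gives k = sin (2 \<eta>).\<close>

lemma angle_exists:
  assumes J: "connected J" "principal_radii N f \<subseteq> J" and short: "arc_len J < pi / 2"
  shows "\<exists>a k. k > 0 \<and> (\<forall>p c u \<rho>. c \<in> charts_at N p \<longrightarrow> u \<noteq> 0 \<longrightarrow> cos \<rho> *\<^sub>R df c f p u + sin \<rho> *\<^sub>R df c \<nu> p u = 0 \<longrightarrow> k \<le> sin (2 * (\<rho> - a)))"
proof -
  obtain z where z: "0 \<le> z" "z < pi" "mod_pi z \<notin> J" using exists_missing_point short by metis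
  define W where "W = lifted_radii \<inter> {z..<z + pi}"
  have W: "z < \<rho>" "\<rho> < z + pi" "mod_pi \<rho> \<in> J" if "\<rho> \<in> W" for \<rho>
    using that z(3) J(2) lifted_radii_mod_pi by (auto simp: W_def order_le_less)
  have "\<exists>a k. k > 0 \<and> (\<forall>\<rho>\<in>W. k \<le> sin (2 * (\<rho> - a)))"
  proof (cases "W = {}")
    case True then show ?thesis by (intro exI[of _ 0] exI[of _ 1]) simp
  next
    case False
    define x where "x = Inf W"
    define \<eta> where "\<eta> = (pi / 2 - arc_len J) / 2"
    have al: "arc_len J \<ge> 0" by (simp add: arc_len_def)
    have \<eta>: "\<eta> > 0" "2 * \<eta> \<le> pi / 2" using short al by (simp_all add: \<eta>_def)
    have bd: "bdd_below W" using W(1) by (intro bdd_belowI[of _ z]) (simp add: less_imp_le)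
    have lo: "x \<le> \<rho>" if "\<rho> \<in> W" for \<rho> unfolding x_def by (rule cInf_lower[OF that bd])
    have hi: "\<rho> - x \<le> arc_len J" if \<rho>: "\<rho> \<in> W" for \<rho>
    proof -
      have "\<rho> - arc_len J \<le> s" if s: "s \<in> W" for s
      proof (cases "s \<le> \<rho>")
        case True
        have "\<rho> - s \<le> arc_len J" by (rule arc_len_ge[OF J(1) z(3,1,2) W(1)[OF s] W(3)[OF s] W(2)[OF \<rho>] W(3)[OF \<rho>] True])
        then show ?thesis by simp
      qed (use al in simp)
      then have "\<rho> - arc_len J \<le> x" unfolding x_def by (rule cInf_greatest[OF False])
      then show ?thesis by simp
    qed
    have "sin (2 * \<eta>) \<le> sin (2 * (\<rho> - (x - \<eta>)))" if \<rho>: "\<rho> \<in> W" for \<rho>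
    proof -
      define t where "t = 2 * (\<rho> - (x - \<eta>))"
      have t: "2 * \<eta> \<le> t" "t \<le> pi - 2 * \<eta>" using lo[OF \<rho>] hi[OF \<rho>] by (simp_all add: t_def \<eta>_def field_simps)
      show ?thesis
      proof (cases "t \<le> pi / 2")
        case True
        then show ?thesis unfolding t_def[symmetric] using t \<eta> by (intro sin_monotone_2pi_le) auto
      next
        case False
        have "sin (2 * \<eta>) \<le> sin (pi - t)" using t \<eta> False by (intro sin_monotone_2pi_le) auto
        then show ?thesis unfolding t_def[symmetric] by simp
      qed
    qed
    moreover have "sin (2 * \<eta>) > 0" using \<eta> by (intro sin_gt_zero) auto
    ultimately show ?thesis by blast
  qed
  then obtain a k where k: "k > 0" "\<forall>\<rho>\<in>W. k \<le> sin (2 * (\<rho> - a))" by blast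
  have kW: "k \<le> sin (2 * (\<rho> - a))" if "\<rho> \<in> lifted_radii" "z \<le> \<rho>" "\<rho> < z + pi" for \<rho> using k(2) that by (simp add: W_def)
  show ?thesis
    by (intro exI[of _ a] exI[of _ k] conjI k(1) allI impI) (rule radii_window[OF kW])
qed

text \<open>The position of \<open>a\<close> relative to the missing point \<open>z\<close> matters
  for embeddedness. For compact \<open>N\<close> the radii in the window have a least element
  \<open>x\<close> and a greatest element \<open>w\<close>, at distance less than pi/2, and every
  \<open>a\<close> between max z (w - pi/2) and min (z + pi/2) x is admissible.\<close>

lemma angle_exists_compact:
  assumes comp: "compact_space (mtop N)" and J: "connected J" "principal_radii N f \<subseteq> J"
    and z: "0 \<le> z" "z < pi" "mod_pi z \<notin> J" and short: "arc_len J < pi / 2 \<or> J \<inter> shift (pi / 2) J = {}"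
  shows "\<exists>a k. z < a \<and> a < z + pi / 2 \<and> k > 0 \<and>
    (\<forall>p c u \<rho>. c \<in> charts_at N p \<longrightarrow> u \<noteq> 0 \<longrightarrow> cos \<rho> *\<^sub>R df c f p u + sin \<rho> *\<^sub>R df c \<nu> p u = 0 \<longrightarrow> k \<le> sin (2 * (\<rho> - a)))"
proof -
  \<comment> \<open>The window is closed at both ends to be compact; neither end is a radius, since
    both represent the missing point.\<close>
  define W where "W = lifted_radii \<inter> {z..z + pi}"
  have W: "z < \<rho>" "\<rho> < z + pi" "mod_pi \<rho> \<in> J" if "\<rho> \<in> W" for \<rho>
  proof -
    show J\<rho>: "mod_pi \<rho> \<in> J" using that J(2) lifted_radii_mod_pi by (auto simp: W_def)
    then have "\<rho> \<noteq> z" "\<rho> \<noteq> z + pi" using z(3) mod_pi_shift[of z 1] by auto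
    then show "z < \<rho>" "\<rho> < z + pi" using that by (auto simp: W_def)
  qed
  have cW: "compact W" unfolding W_def using closed_lifted_radii[OF comp] by (intro closed_Int_compact) auto
  have "\<exists>a k. z < a \<and> a < z + pi / 2 \<and> k > 0 \<and> (\<forall>\<rho>\<in>W. k \<le> sin (2 * (\<rho> - a)))"
  proof (cases "W = {}")
    case True then show ?thesis by (intro exI[of _ "z + pi / 4"] exI[of _ 1]) simp
  next
    case False
    obtain x where x: "x \<in> W" "\<And>\<rho>. \<rho> \<in> W \<Longrightarrow> x \<le> \<rho>" using compact_attains_inf[OF cW False] by blast
    obtain w where w: "w \<in> W" "\<And>\<rho>. \<rho> \<in> W \<Longrightarrow> \<rho> \<le> w" using compact_attains_sup[OF cW False] by blast
    have "w - x < pi / 2"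
      by (rule arc_short[OF J(1) z short W(1)[OF x(1)] W(3)[OF x(1)] W(2)[OF w(1)] W(3)[OF w(1)] x(2)[OF w(1)]])
    then have "max z (w - pi / 2) < min (z + pi / 2) x" using W(1)[OF x(1)] W(2)[OF w(1)] by auto
    then obtain a where a: "max z (w - pi / 2) < a" "a < min (z + pi / 2) x" using dense by blast
    have pos: "sin (2 * (\<rho> - a)) > 0" if "\<rho> \<in> W" for \<rho>
      using x(2)[OF that] w(2)[OF that] a by (intro sin_gt_zero) auto
    have "continuous_on W (\<lambda>\<rho>. sin (2 * (\<rho> - a)))" by (intro continuous_intros)
    then obtain \<rho>0 where "\<rho>0 \<in> W" "\<forall>\<rho>\<in>W. sin (2 * (\<rho>0 - a)) \<le> sin (2 * (\<rho> - a))"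
      using continuous_attains_inf[OF cW False] by blast
    then show ?thesis using a pos by (intro exI[of _ a] exI[of _ "sin (2 * (\<rho>0 - a))"]) auto
  qed
  then obtain a k where k: "z < a" "a < z + pi / 2" "k > 0" "\<forall>\<rho>\<in>W. k \<le> sin (2 * (\<rho> - a))" by blast
  have kW: "k \<le> sin (2 * (\<rho> - a))" if "\<rho> \<in> lifted_radii" "z \<le> \<rho>" "\<rho> < z + pi" for \<rho> using k(4) that by (simp add: W_def)
  show ?thesis
    by (intro exI[of _ a] exI[of _ k] conjI k(1-3) allI impI) (rule radii_window[OF kW])
qed

end

text \<open>Both cases of the theorem arrive here, the complete one after compactness has been
  derived. Each conclusion takes its own angle: one for an arbitrary missing point, one for the
  missing point 0 and one for pi/2.\<close>

lemma (in hypersurface) conclusion_compact: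
  assumes comp: "compact_space (mtop N)" and card: "CARD('n) \<ge> 2" and J: "connected J" "principal_radii N f \<subseteq> J"
    and short: "arc_len J < pi / 2 \<or> J \<inter> shift (pi / 2) J = {}"
  shows "diffeomorphic N (sphere_mfd :: (real ^ 'n option, real ^ 'n) manifold)"
    "mod_pi 0 \<notin> J \<Longrightarrow> embedding N sphere_mfd f"
    "mod_pi (pi / 2) \<notin> J \<Longrightarrow> embedding N sphere_mfd (dual N f)"
proof -
  have pinchedI: "pinched N f a k"
    if "k > 0" "\<forall>p c u \<rho>. c \<in> charts_at N p \<longrightarrow> u \<noteq> 0 \<longrightarrow> cos \<rho> *\<^sub>R df c f p u + sin \<rho> *\<^sub>R df c \<nu> p u = 0 \<longrightarrow> k \<le> sin (2 * (\<rho> - a))" for a k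
    by unfold_locales (use that card compact_complete[OF comp] in auto)
  obtain z where z: "0 \<le> z" "z < pi" "mod_pi z \<notin> J" using exists_missing_point[OF short] .
  obtain a k where "k > 0" "\<forall>p c u \<rho>. c \<in> charts_at N p \<longrightarrow> u \<noteq> 0 \<longrightarrow> cos \<rho> *\<^sub>R df c f p u + sin \<rho> *\<^sub>R df c \<nu> p u = 0 \<longrightarrow> k \<le> sin (2 * (\<rho> - a))"
    using angle_exists_compact[OF comp J z short] by (elim exE conjE)
  from pinched.diffeomorphic_sphere[OF pinchedI[OF this]]
  show "diffeomorphic N (sphere_mfd :: (real ^ 'n option, real ^ 'n) manifold)" .
  show "embedding N sphere_mfd f" if 0: "mod_pi 0 \<notin> J"
  proof -
    obtain a k where a: "0 < a" "a < 0 + pi / 2" and k: "k > 0" "\<forall>p c u \<rho>. c \<in> charts_at N p \<longrightarrow> u \<noteq> 0 \<longrightarrow> cos \<rho> *\<^sub>R df c f p u + sin \<rho> *\<^sub>R df c \<nu> p u = 0 \<longrightarrow> k \<le> sin (2 * (\<rho> - a))"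
      using angle_exists_compact[OF comp J order_refl pi_gt_zero 0 short] by (elim exE conjE)
    show ?thesis by (rule pinched.embedding_f[OF pinchedI[OF k]]) (use a in simp_all)
  qed
  show "embedding N sphere_mfd (dual N f)" if h: "mod_pi (pi / 2) \<notin> J"
  proof -
    have h0: "0 \<le> pi / 2" "pi / 2 < pi" by simp_all
    obtain a k where a: "pi / 2 < a" "a < pi / 2 + pi / 2" and k: "k > 0" "\<forall>p c u \<rho>. c \<in> charts_at N p \<longrightarrow> u \<noteq> 0 \<longrightarrow> cos \<rho> *\<^sub>R df c f p u + sin \<rho> *\<^sub>R df c \<nu> p u = 0 \<longrightarrow> k \<le> sin (2 * (\<rho> - a))"
      using angle_exists_compact[OF comp J h0 h short] by (elim exE conjE)
    \<comment> \<open>The missing point pi/2 puts \<open>a\<close> into (pi/2, pi); subtracting the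
      period moves it to (- pi/2, 0), the range in \<open>embedding_dual\<close>.\<close>
    have "sin (2 * (\<rho> - (a - pi))) = sin (2 * (\<rho> - a))" for \<rho>
      using sin_double_periodic[of \<rho> 1 a] by (simp add: algebra_simps)
    then have k': "\<forall>p c u \<rho>. c \<in> charts_at N p \<longrightarrow> u \<noteq> 0 \<longrightarrow> cos \<rho> *\<^sub>R df c f p u + sin \<rho> *\<^sub>R df c \<nu> p u = 0 \<longrightarrow> k \<le> sin (2 * (\<rho> - (a - pi)))"
      using k(2) by (simp only:)
    show ?thesis by (rule pinched.embedding_dual[OF pinchedI[OF k(1) k']]) (use a in simp_all)
  qed
qed

lemma (in hypersurface) complete_imp_compact:
  assumes comp: "complete_induced N f" and card: "CARD('n) \<ge> 2" and J: "connected J" "principal_radii N f \<subseteq> J"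
    and short: "arc_len J < pi / 2"
  shows "compact_space (mtop N)"
proof -
  obtain a k where k: "k > 0" "\<forall>p c u \<rho>. c \<in> charts_at N p \<longrightarrow> u \<noteq> 0 \<longrightarrow> cos \<rho> *\<^sub>R df c f p u + sin \<rho> *\<^sub>R df c \<nu> p u = 0 \<longrightarrow> k \<le> sin (2 * (\<rho> - a))"
    using angle_exists[OF J short] by (elim exE conjE)
  have "pinched N f a k" by unfold_locales (use k card comp in auto)
  then show ?thesis by (rule pinched.compact_N)
qed

theorem theorem0p4:
  fixes N :: "('p, real ^ 'n::finite) manifold"
    and f :: "'p \<Rightarrow> real ^ 'n option option"
    and J :: "real_mod_pi set"
  assumes "CARD('n) \<ge> 2"
    and "connected_oriented_manifold N"
    and "immersion N sphere_mfd f"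
    and "smallest_interval (principal_radii N f) J"
  shows
    "(complete_induced N f \<and> arc_len J < pi / 2 \<longrightarrow>
        diffeomorphic N (sphere_mfd :: (real ^ 'n option, real ^ 'n) manifold) \<and>
        (mod_pi 0 \<notin> J \<longrightarrow> embedding N sphere_mfd f) \<and>
        (mod_pi (pi / 2) \<notin> J \<longrightarrow> embedding N sphere_mfd (dual N f))) \<and>
     (compact_space (mtop N) \<and> J \<inter> shift (pi / 2) J = {} \<longrightarrow>
        diffeomorphic N (sphere_mfd :: (real ^ 'n option, real ^ 'n) manifold) \<and>
        (mod_pi 0 \<notin> J \<longrightarrow> embedding N sphere_mfd f) \<and>
        (mod_pi (pi / 2) \<notin> J \<longrightarrow> embedding N sphere_mfd (dual N f)))"
proof -
  have J: "connected J" "principal_radii N f \<subseteq> J"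
    using assms(4) by (auto simp: smallest_interval_def arc_interval_def)
  interpret hypersurface N f
    by unfold_locales (use assms(2,3) in \<open>auto simp: connected_oriented_manifold_def\<close>)
  note c = conclusion_compact[OF _ assms(1) J]
  show ?thesis
  proof (intro conjI impI)
    assume h: "complete_induced N f \<and> arc_len J < pi / 2"
    then have "compact_space (mtop N)" using complete_imp_compact[OF _ assms(1) J] by blast
    note c = c[OF this disjI1[OF conjunct2[OF h]]]
    show "diffeomorphic N (sphere_mfd :: (real ^ 'n option, real ^ 'n) manifold)" by (rule c)
    show "embedding N sphere_mfd f" if "mod_pi 0 \<notin> J" by (rule c(2)[OF that])
    show "embedding N sphere_mfd (dual N f)" if "mod_pi (pi / 2) \<notin> J" by (rule c(3)[OF that])
  next
    assume h: "compact_space (mtop N) \<and> J \<inter> shift (pi / 2) J = {}"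
    note c = c[OF conjunct1[OF h] disjI2[OF conjunct2[OF h]]]
    show "diffeomorphic N (sphere_mfd :: (real ^ 'n option, real ^ 'n) manifold)" by (rule c)
    show "embedding N sphere_mfd f" if "mod_pi 0 \<notin> J" by (rule c(2)[OF that])
    show "embedding N sphere_mfd (dual N f)" if "mod_pi (pi / 2) \<notin> J" by (rule c(3)[OF that])
  qed
qed

end
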